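(* Let $n_0=\max\{2.67\times 9^{17},\ 10.2\times 2^{(t-1)(l-1)+l-3}+2\}$. \begin{description} \item[(i)] If $t=1$, $l\ge 6$ and $n\ge \max\{n_0,\ \tfrac{625}{32}\lfloor \tfrac{l-3}{3}\rfloor^2+2\}$, then the extremal graph to $\mathrm{spex}_{\mathcal{P}}(n,P_{t\cdot l})$ is $K_2\vee H_{\mathcal{P}}(l-3-2\lfloor \tfrac{l-3}{3}\rfloor,\lfloor \tfrac{l-3}{3}\rfloor)$. \item[(ii)] If $t=2$, $l\ge 4$ and $n\ge \max\{n_0,\ \tfrac{625}{32}\lfloor \tfrac{2l-4}{3}\rfloor^2+2\}$, then the extremal graph to $\mathrm{spex}_{\mathcal{P}}(n,P_{t\cdot l})$ is $K_2\vee H_{\mathcal{P}}(2l-4-2\lfloor \tfrac{2l-4}{3}\rfloor,\lfloor \tfrac{2l-4}{3}\rfloor)$. \item[(iii)] If $t\ge 5$, $l\ge 3$ and $n\ge \max\{n_0,\ \tfrac{625}{32}\lfloor \tfrac{l-3}{2}\rfloor^2+2\}$, then the extremal graph to $\mathrm{spex}_{\mathcal{P}}(n,P_{t\cdot l})$ is $K_2\vee H_{\mathcal{P}}(tl-t-l,\,l-2)$. \end{description} Here "the extremal graph to $\mathrm{spex}_{\mathcal{P}}(n,F)$ is $X$" means that $X$ is an $n$-vertex $F$-free planar graph and every $n$-vertex $F$-free planar graph of maximum spectral radius is isomorphic to $X$.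
   Context: All graphs are finite and simple. The spectral radius of a graph is the largest eigenvalue of its adjacency matrix. A graph is $F$-free if it contains no subgraph isomorphic to $F$. $\mathrm{spex}_{\mathcal{P}}(n,F)$ denotes the maximum spectral radius over all $n$-vertex $F$-free planar graphs. $P_l$ denotes the path on $l$ vertices, $K_2$ a single edge, and $G_1\vee G_2$ the join (disjoint union plus all edges between $G_1$ and $G_2$). $P_{t\cdot l}$ denotes the starlike tree obtained from a central vertex $v$ and $t$ vertex-disjoint copies of $P_{l-1}$ by joining $v$ to one endpoint of each copy (so $P_{t\cdot l}$ has $t(l-1)+1$ vertices, $P_{1\cdot l}=P_l$, $P_{2\cdot l}=P_{2l-1}$). For positive integers $n,n_1,n_2$ with $n\ge n_1\ge n_2\ge 1$, $H_{\mathcal{P}}(n_1,n_2)$ (depending on $n$) is the disjoint union of paths on $n-2$ vertices defined by: $H_{\mathcal{P}}(n_1,n_2)=P_{n_1}\cup \frac{n-2-n_1}{n_2}P_{n_2}$ if $n_2\mid (n-2-n_1)$, and otherwise $H_{\mathcal{P}}(n_1,n_2)=P_{n_1}\cup \lfloor \frac{n-2-n_1}{n_2}\rfloor P_{n_2}\cup P_{\,n-2-n_1-\lfloor \frac{n-2-n_1}{n_2}\rfloor n_2}$, where $kP_m$ denotes $k$ vertex-disjoint copies of $P_m$. *)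

theory Defs
  imports "HOL-Analysis.Analysis"
begin

type_synonym 'a ugraph = "'a set \<times> 'a set set"

definition verts :: "'a ugraph \<Rightarrow> 'a set" where "verts G = fst G"
definition edges :: "'a ugraph \<Rightarrow> 'a set set" where "edges G = snd G"

definition simple_graph :: "'a ugraph \<Rightarrow> bool" where
  "simple_graph G \<longleftrightarrow> finite (verts G) \<and>
     (\<forall>e\<in>edges G. \<exists>u v. u \<in> verts G \<and> v \<in> verts G \<and> u \<noteq> v \<and> e = {u, v})"

definition contains_subgraph :: "'a ugraph \<Rightarrow> 'b ugraph \<Rightarrow> bool" where
  "contains_subgraph G F \<longleftrightarrow> (\<exists>\<phi>. inj_on \<phi> (verts F) \<and> \<phi> ` verts F \<subseteq> verts G \<and>
      (\<forall>e\<in>edges F. \<phi> ` e \<in> edges G))"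

definition F_free :: "'a ugraph \<Rightarrow> 'b ugraph \<Rightarrow> bool" where
  "F_free G F \<longleftrightarrow> \<not> contains_subgraph G F"

definition graph_iso :: "'a ugraph \<Rightarrow> 'b ugraph \<Rightarrow> bool" where
  "graph_iso G H \<longleftrightarrow> (\<exists>f. bij_betw f (verts G) (verts H) \<and>
      (\<forall>u\<in>verts G. \<forall>v\<in>verts G. {u, v} \<in> edges G \<longleftrightarrow> {f u, f v} \<in> edges H))"

definition planar :: "'a ugraph \<Rightarrow> bool" where
  "planar G \<longleftrightarrow> (\<exists>(f :: 'a \<Rightarrow> complex) (\<gamma> :: 'a set \<Rightarrow> real \<Rightarrow> complex).
      inj_on f (verts G) \<and>
      (\<forall>e\<in>edges G. \<exists>u v. e = {u, v} \<and> arc (\<gamma> e) \<and>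
          pathstart (\<gamma> e) = f u \<and> pathfinish (\<gamma> e) = f v) \<and>
      (\<forall>e\<in>edges G. \<forall>w\<in>verts G. f w \<in> path_image (\<gamma> e) \<longrightarrow> w \<in> e) \<and>
      (\<forall>e\<in>edges G. \<forall>e'\<in>edges G. e \<noteq> e' \<longrightarrow>
          path_image (\<gamma> e) \<inter> path_image (\<gamma> e') \<subseteq> f ` (e \<inter> e')))"

definition adj_matrix :: "'a ugraph \<Rightarrow> 'a \<Rightarrow> 'a \<Rightarrow> real" where
  "adj_matrix G u v = (if {u, v} \<in> edges G then 1 else 0)"

definition is_eigenvalue :: "'a ugraph \<Rightarrow> real \<Rightarrow> bool" where
  "is_eigenvalue G mu \<longleftrightarrow> (\<exists>x :: 'a \<Rightarrow> real. (\<exists>v\<in>verts G. x v \<noteq> 0) \<and>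
      (\<forall>u\<in>verts G. (\<Sum>v\<in>verts G. adj_matrix G u v * x v) = mu * x u))"

definition spectral_radius :: "'a ugraph \<Rightarrow> real" where
  "spectral_radius G = Max {mu. is_eigenvalue G mu}"

text \<open>The class of n-vertex F-free planar graphs, and spex_P(n,F) (computed over graphs
  with vertices in nat, which represent all finite graphs up to isomorphism).\<close>
definition planar_F_free_class :: "nat \<Rightarrow> 'b ugraph \<Rightarrow> 'a ugraph \<Rightarrow> bool" where
  "planar_F_free_class n F G \<longleftrightarrow> simple_graph G \<and> card (verts G) = n \<and> planar G \<and> F_free G F"

definition spex_planar :: "nat \<Rightarrow> 'b ugraph \<Rightarrow> real" where
  "spex_planar n F = Sup (spectral_radius ` {H :: nat ugraph. planar_F_free_class n F H})"

definition path_graph :: "nat \<Rightarrow> nat ugraph" where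
  "path_graph m = ({0..<m}, {{k, Suc k} | k. Suc k < m})"

definition K2 :: "nat ugraph" where "K2 = path_graph 2"

definition join :: "'a ugraph \<Rightarrow> 'b ugraph \<Rightarrow> ('a + 'b) ugraph" where
  "join G H = (Inl ` verts G \<union> Inr ` verts H,
      ((\<lambda>e. Inl ` e) ` edges G) \<union> ((\<lambda>e. Inr ` e) ` edges H) \<union>
      {{Inl u, Inr v} | u v. u \<in> verts G \<and> v \<in> verts H})"

definition disj_union_list :: "'a ugraph list \<Rightarrow> (nat \<times> 'a) ugraph" where
  "disj_union_list Gs = ({(i, v) | i v. i < length Gs \<and> v \<in> verts (Gs ! i)},
      {(\<lambda>v. (i, v)) ` e | i e. i < length Gs \<and> e \<in> edges (Gs ! i)})"

definition H_P_lengths :: "nat \<Rightarrow> nat \<Rightarrow> nat \<Rightarrow> nat list" where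
  "H_P_lengths n n1 n2 =
     (let m = n - 2 - n1 in
      if n2 dvd m then n1 # replicate (m div n2) n2
      else n1 # replicate (m div n2) n2 @ [m - (m div n2) * n2])"

definition H_P :: "nat \<Rightarrow> nat \<Rightarrow> nat \<Rightarrow> (nat \<times> nat) ugraph" where
  "H_P n n1 n2 = disj_union_list (map path_graph (H_P_lengths n n1 n2))"

text \<open>Starlike tree P_{t.l}: centre 0, copy i (i<t) has vertices i*(l-1)+1 .. i*(l-1)+(l-1),
  joined consecutively, with the centre adjacent to i*(l-1)+1.\<close>
definition starlike :: "nat \<Rightarrow> nat \<Rightarrow> nat ugraph" where
  "starlike t l = ({0..t * (l - 1)},
      {{0, i * (l - 1) + 1} | i. i < t \<and> 1 \<le> l - 1} \<union>
      {{i * (l - 1) + j, i * (l - 1) + j + 1} | i j. i < t \<and> 1 \<le> j \<and> j < l - 1})"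

end

theory Submission
  imports Defs "HOL-Complex_Analysis.Complex_Analysis"
begin

text \<open>
  A planar graph has no \<open>K\<^sub>3\<^sub>,\<^sub>3\<close> minor, which already bounds the number of its edges linearly. Applied to
  the square of the adjacency matrix of an extremal graph \<open>G\<close>, whose spectral radius is at least
  \<open>sqrt (2 (n - 2))\<close>, these bounds produce two vertices \<open>u\<close>, \<open>v\<close> with almost maximal Perron entries
  and almost all vertices as common neighbours; every other vertex has a small entry. Joining all
  vertices to \<open>u\<close> and \<open>v\<close> and deleting the edges that leave the common neighbourhood does not
  decrease the Rayleigh quotient and creates no new starlike tree. Hence \<open>u\<close> and \<open>v\<close> are adjacent and
  dominating. Planarity excludes cycles and vertices of degree 3 in the rest: a vertex of degree 3
  gives \<open>K\<^sub>3\<^sub>,\<^sub>3\<close>, and a cycle together with one further vertex cannot be placed around \<open>u\<close> and \<open>v\<close>. So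
  \<open>G\<close> is the join of \<open>K\<^sub>2\<close> with a linear forest.

  With \<open>x u = x v = 1\<close>, the eigenvalue equation along a path on \<open>a\<close> vertices is a linear recurrence
  with explicit solution, and the sum \<open>weight r a\<close> of its entries determines the comparison of two
  linear forests: the one with the larger total weight has the larger spectral radius. The weight is
  strictly convex in \<open>a\<close>, so vertices are moved from shorter to longer paths whenever the forbidden
  tree permits it, and a larger number of paths costs more than any redistribution gains.
\<close>

section \<open>Connected vertex sets\<close>

text \<open>\<open>planar\<close> speaks of arcs in the complex plane, so no faces are at hand for
  Euler's formula. Both obstructions come from theta curves instead: an open arc has a winding
  number around each point off it, and differences of these numbers tell on which side of a closed
  curve the point lies. The resulting bound of 6 edges per vertex is twice Euler's; n >= 44 * 10^15,
  just below 2.67 * 9^17, leaves room for it. The constant 625/32 gives 6.25 k <= sqrt (2 (n - 2)),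
  so k times the decay rate is at most about 1/6, where k is the common length of the short paths
  for t <= 2; the count of paths relies on this. The power of 2 keeps n above small multiples of the
  tree size. Which trees fit into the join splits the theorem. A path visits each dominating vertex
  at most once and so meets at most three inner paths; for t <= 2 the three largest lengths decide.
  An inner vertex has degree at most 4, so for t >= 5 the centre is dominating, at most one leg uses
  the other dominating vertex, and the sum of all length div (l - 1) decides.\<close>

definition adj :: "'a ugraph \<Rightarrow> 'a \<Rightarrow> 'a \<Rightarrow> bool" where
  "adj G u v \<longleftrightarrow> {u, v} \<in> edges G"

lemma adj_sym: "adj G u v \<Longrightarrow> adj G v u"
  by (simp add: adj_def insert_commute)

lemma adj_in_verts:
  assumes "simple_graph G" "adj G u v"
  shows "u \<in> verts G" "v \<in> verts G" "u \<noteq> v"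
  using assms unfolding simple_graph_def adj_def by (fastforce simp: doubleton_eq_iff)+

definition gpath :: "('a \<Rightarrow> 'a \<Rightarrow> bool) \<Rightarrow> 'a list \<Rightarrow> bool" where
  "gpath E p \<longleftrightarrow> p \<noteq> [] \<and> distinct p \<and> successively E p"

lemma gpath_rev: "symp E \<Longrightarrow> gpath E p \<Longrightarrow> gpath E (rev p)"
  by (auto simp: gpath_def successively_rev elim!: successively_mono dest: sympD)

lemma gpath_append:
  "\<lbrakk>gpath E p; gpath E q; E (last p) (hd q); set p \<inter> set q = {}\<rbrakk> \<Longrightarrow> gpath E (p @ q)"
  by (auto simp: gpath_def successively_append_iff)

lemma gpath_split: "gpath E (p @ c # q) \<Longrightarrow> gpath E (p @ [c]) \<and> gpath E (c # q)"
  by (auto simp: gpath_def successively_append_iff)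

text \<open>The closure is reflexive outside \<open>S\<close> too, so extracting a path inside
  \<open>S\<close> needs \<open>x \<in> S\<close> as a separate assumption.\<close>

definition reach :: "('a \<Rightarrow> 'a \<Rightarrow> bool) \<Rightarrow> 'a set \<Rightarrow> ('a \<times> 'a) set" where
  "reach E S = {(x, y). x \<in> S \<and> y \<in> S \<and> E x y}\<^sup>*"

definition conn :: "('a \<Rightarrow> 'a \<Rightarrow> bool) \<Rightarrow> 'a set \<Rightarrow> bool" where
  "conn E S \<longleftrightarrow> S \<noteq> {} \<and> (\<forall>x\<in>S. \<forall>y\<in>S. (x, y) \<in> reach E S)"

lemma reach_mono: "S \<subseteq> T \<Longrightarrow> reach E S \<subseteq> reach E T"
  unfolding reach_def by (intro rtrancl_mono) auto

lemma reach_sym: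
  assumes "symp E" "(x, y) \<in> reach E S"
  shows "(y, x) \<in> reach E S"
proof -
  have "sym {(x, y). x \<in> S \<and> y \<in> S \<and> E x y}" using assms(1) by (auto intro!: symI dest: sympD)
  then show ?thesis using assms(2) unfolding reach_def by (meson sym_rtrancl symE)
qed

lemma reach_trans: "(x, y) \<in> reach E S \<Longrightarrow> (y, z) \<in> reach E S \<Longrightarrow> (x, z) \<in> reach E S"
  unfolding reach_def by (rule rtrancl_trans)

lemma reach_step: "x \<in> S \<Longrightarrow> y \<in> S \<Longrightarrow> E x y \<Longrightarrow> (x, y) \<in> reach E S"
  unfolding reach_def by auto

lemma conn_singleton: "conn E {x}"
  by (simp add: conn_def reach_def)

lemma conn_union:
  assumes "symp E" "conn E S" "conn E T" "x \<in> S" "y \<in> T" "E x y"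
  shows "conn E (S \<union> T)"
proof -
  have S: "(u, v) \<in> reach E (S \<union> T)" if "u \<in> S" "v \<in> S" for u v
    using assms(2) that reach_mono[of S "S \<union> T" E] unfolding conn_def by blast
  have T: "(u, v) \<in> reach E (S \<union> T)" if "u \<in> T" "v \<in> T" for u v
    using assms(3) that reach_mono[of T "S \<union> T" E] unfolding conn_def by blast
  have ST: "(u, v) \<in> reach E (S \<union> T)" if "u \<in> S" "v \<in> T" for u v
    using S[OF that(1) assms(4)] T[OF assms(5) that(2)] reach_step[of x "S \<union> T" y E] assms(4-6)
    by (meson UnI1 UnI2 reach_trans)
  show ?thesis
    using S T ST reach_sym[OF assms(1)] assms(2) unfolding conn_def by blast
qed

lemma reach_gpath:
  assumes "(x, y) \<in> reach E S" "x \<in> S"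
  obtains p where "gpath E p" "set p \<subseteq> S" "hd p = x" "last p = y"
proof -
  have "\<exists>p. gpath E p \<and> set p \<subseteq> S \<and> hd p = x \<and> last p = y"
    using assms(1) unfolding reach_def
  proof (induction rule: rtrancl_induct)
    case base
    then show ?case using assms(2) by (intro exI[of _ "[x]"]) (auto simp: gpath_def)
  next
    case (step y z)
    then obtain p where p: "gpath E p" "set p \<subseteq> S" "hd p = x" "last p = y" by blast
    show ?case
    \<comment> \<open>If \<open>z\<close> was visited before, cutting back to that visit keeps the
      list distinct.\<close>
    proof (cases "z \<in> set p")
      case True
      then obtain q r where "p = q @ z # r" by (meson split_list)
      then show ?thesis using gpath_split[of E q z r] p
        by (intro exI[of _ "q @ [z]"]) (auto simp: hd_append)
    next
      case False
      then show ?thesis using p step(2) gpath_append[of E p "[z]"]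
        by (intro exI[of _ "p @ [z]"]) (auto simp: gpath_def)
    qed
  qed
  then show ?thesis using that by blast
qed

lemma conn_gpath_ex:
  assumes "conn E S" "x \<in> S" "y \<in> S"
  shows "\<exists>p. gpath E p \<and> set p \<subseteq> S \<and> hd p = x \<and> last p = y"
proof -
  have "(x, y) \<in> reach E S" using assms by (simp add: conn_def)
  from reach_gpath[OF this assms(2)] show ?thesis by blast
qed

lemma conn_gpath:
  assumes "conn E S" "x \<in> S" "y \<in> S"
  obtains p where "gpath E p" "set p \<subseteq> S" "hd p = x" "last p = y"
  using conn_gpath_ex[OF assms] by blast

text \<open>Take a path \<open>q\<close> from \<open>x 0\<close> to \<open>x 1\<close> and walk from
  \<open>x 2\<close> towards \<open>x 0\<close>; the first vertex on \<open>q\<close> is the centre.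
  A leg may consist of the centre alone. This turns a branch set with three outgoing edges into a
  subdivided claw.\<close>

lemma tripod:
  fixes x :: "nat \<Rightarrow> 'a"
  assumes "symp E" "conn E S" "\<And>i. i < 3 \<Longrightarrow> x i \<in> S"
  shows "\<exists>c p. (\<forall>i<3::nat. gpath E (p i) \<and> set (p i) \<subseteq> S \<and> hd (p i) = c \<and> last (p i) = x i) \<and>
    (\<forall>i<3. \<forall>j<3. i \<noteq> j \<longrightarrow> set (p i) \<inter> set (p j) = {c})"
proof -
  obtain q where q: "gpath E q" "set q \<subseteq> S" "hd q = x 0" "last q = x 1"
    using conn_gpath[OF assms(2), of "x 0" "x 1"] assms(3) by auto
  obtain r where r: "gpath E r" "set r \<subseteq> S" "hd r = x 2" "last r = x 0"
    using conn_gpath[OF assms(2), of "x 2" "x 0"] assms(3) by auto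
  have "x 0 \<in> set r" "x 0 \<in> set q"
    using r q by (metis gpath_def last_in_set, metis gpath_def hd_in_set)
  then obtain rs c ts where r': "r = rs @ c # ts" "c \<in> set q" "\<forall>z\<in>set rs. z \<notin> set q"
    using split_list_first_prop[of r "\<lambda>z. z \<in> set q"] by blast
  obtain q1 q2 where q': "q = q1 @ c # q2" using r'(2) by (meson split_list)
  have gp: "gpath E (rev (q1 @ [c]))" "gpath E (c # q2)" "gpath E (rev (rs @ [c]))"
    using gpath_split[of E q1 c q2] gpath_split[of E rs c ts] q r q' r' gpath_rev[OF assms(1)] by blast+
  define p where "p i = (if i = 0 then rev (q1 @ [c]) else if i = 1 then c # q2 else rev (rs @ [c]))" for i :: nat
  have hds: "hd (q1 @ [c]) = x 0" "last (c # q2) = x 1" "hd (rs @ [c]) = x 2"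
    using q q' r r' by (auto simp: hd_append)
  have dist: "set q1 \<inter> set (c # q2) = {}" "c \<notin> set q1" "c \<notin> set q2" using q(1) q' by (auto simp: gpath_def)
  show ?thesis
  proof (rule exI[of _ c], rule exI[of _ p], intro conjI allI impI)
    fix i :: nat assume "i < 3"
    then consider "i = 0" | "i = 1" | "i = 2" by linarith
    then have "gpath E (p i) \<and> set (p i) \<subseteq> S \<and> hd (p i) = c \<and> last (p i) = x i"
    proof cases
      case 1 then show ?thesis using gp hds q q' by (auto simp: p_def last_rev hd_rev)
    next
      case 2 then show ?thesis using gp hds q q' by (auto simp: p_def)
    next
      case 3 then show ?thesis using gp hds r r' by (auto simp: p_def last_rev hd_rev)
    qed
    then show "gpath E (p i)" "set (p i) \<subseteq> S" "hd (p i) = c" "last (p i) = x i" by blast+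
  next
    fix i j :: nat assume "i < 3" "j < 3" "i \<noteq> j"
    then have "(i = 0 \<or> i = 1 \<or> i = 2) \<and> (j = 0 \<or> j = 1 \<or> j = 2)" by linarith
    then show "set (p i) \<inter> set (p j) = {c}"
      using \<open>i \<noteq> j\<close> dist r' q' unfolding p_def by auto
  qed
qed

text \<open>\<open>bip_minor s V E\<close>: the graph on \<open>V\<close> with edge relation \<open>E\<close> has the complete bipartite graph
  \<open>K\<^bsub>s,3\<^esub>\<close> as a minor, with branch sets \<open>D 0, \<dots>, D (s + 2)\<close>.\<close>

definition bip_minor :: "nat \<Rightarrow> 'a set \<Rightarrow> ('a \<Rightarrow> 'a \<Rightarrow> bool) \<Rightarrow> bool" where
  "bip_minor s V E \<longleftrightarrow> (\<exists>D :: nat \<Rightarrow> 'a set.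
     (\<forall>i<s+3. conn E (D i) \<and> D i \<subseteq> V) \<and>
     (\<forall>i<s+3. \<forall>j<s+3. i \<noteq> j \<longrightarrow> D i \<inter> D j = {}) \<and>
     (\<forall>i<s. \<forall>j\<in>{s..<s+3}. \<exists>x\<in>D i. \<exists>y\<in>D j. E x y))"

section \<open>Arcs with common endpoints in the plane\<close>

text \<open>A generalised theta curve. The marked point \<open>y i\<close> stands for the open arc
  \<open>i\<close>, which lies on one side of every closed curve formed by two other arcs.\<close>

locale arc_bundle =
  fixes a b :: complex and P :: "nat \<Rightarrow> real \<Rightarrow> complex" and m :: nat and y :: "nat \<Rightarrow> complex"
  assumes arc: "i < m \<Longrightarrow> arc (P i)"
    and start: "i < m \<Longrightarrow> pathstart (P i) = a"
    and finish: "i < m \<Longrightarrow> pathfinish (P i) = b"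
    and meet: "\<lbrakk>i < m; j < m; i \<noteq> j\<rbrakk> \<Longrightarrow> path_image (P i) \<inter> path_image (P j) = {a, b}"
    and mid: "i < m \<Longrightarrow> y i \<in> path_image (P i) - {a, b}"
begin

definition J :: "nat \<Rightarrow> nat \<Rightarrow> complex set" where
  "J i j = path_image (P i) \<union> path_image (P j)"

definition loop :: "nat \<Rightarrow> nat \<Rightarrow> real \<Rightarrow> complex" where
  "loop i j = P i +++ reversepath (P j)"

lemma J_commute: "J i j = J j i"
  by (auto simp: J_def)

lemma loop:
  assumes "i < m" "j < m" "i \<noteq> j"
  shows "simple_path (loop i j)" "pathfinish (loop i j) = pathstart (loop i j)"
    "path_image (loop i j) = J i j"
proof -
  show "simple_path (loop i j)"
    unfolding loop_def using assms arc start finish meet[of i j]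
    by (subst simple_path_join_loop_eq) (auto simp: arc_reversepath)
  show "pathfinish (loop i j) = pathstart (loop i j)"
    unfolding loop_def using assms start by simp
  show "path_image (loop i j) = J i j"
    unfolding loop_def J_def using assms finish by (simp add: path_image_join)
qed

lemma jordan:
  assumes "i < m" "j < m" "i \<noteq> j"
  shows "inside (J i j) \<noteq> {}" "open (inside (J i j))" "connected (inside (J i j))"
    "open (outside (J i j))" "connected (outside (J i j))"
    "inside (J i j) \<inter> outside (J i j) = {}" "inside (J i j) \<union> outside (J i j) = - J i j"
    "frontier (inside (J i j)) = J i j" "frontier (outside (J i j)) = J i j"
    "\<not> bounded (outside (J i j))"
  using Jordan_inside_outside[OF loop(1,2)[OF assms]] loop(3)[OF assms] by auto

lemma connected_same_side:
  assumes "i < m" "j < m" "i \<noteq> j" "connected C" "C \<inter> J i j = {}"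
  shows "C \<subseteq> inside (J i j) \<or> C \<subseteq> outside (J i j)"
proof -
  note jd = jordan[OF assms(1-3)]
  have "C \<subseteq> inside (J i j) \<union> outside (J i j)" using jd(7) assms(5) by auto
  then show ?thesis
    using connectedD[OF assms(4) jd(2) jd(4)] jd(6) by blast
qed

lemma component_same_side:
  assumes "i < m" "j < m" "i \<noteq> j" "connected_component (- J i j) p q"
  shows "p \<in> inside (J i j) \<longleftrightarrow> q \<in> inside (J i j)" "p \<in> outside (J i j) \<longleftrightarrow> q \<in> outside (J i j)"
proof -
  obtain C where C: "connected C" "C \<subseteq> - J i j" "p \<in> C" "q \<in> C"
    using assms(4) unfolding connected_component_def by blast
  have "C \<subseteq> inside (J i j) \<or> C \<subseteq> outside (J i j)"
    using connected_same_side[OF assms(1-3) C(1)] C(2) by blast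
  moreover have "inside (J i j) \<inter> outside (J i j) = {}" using jordan(6)[OF assms(1-3)] .
  ultimately show "p \<in> inside (J i j) \<longleftrightarrow> q \<in> inside (J i j)" "p \<in> outside (J i j) \<longleftrightarrow> q \<in> outside (J i j)"
    using C(3,4) by blast+
qed

lemma open_arc_subset:
  assumes "k < m" "i < m" "j < m" "i \<noteq> j" "k \<noteq> i" "k \<noteq> j"
  shows "y k \<in> inside (J i j) \<Longrightarrow> path_image (P k) - {a, b} \<subseteq> inside (J i j)"
    "y k \<in> outside (J i j) \<Longrightarrow> path_image (P k) - {a, b} \<subseteq> outside (J i j)"
    "y k \<in> inside (J i j) \<or> y k \<in> outside (J i j)"
proof -
  let ?C = "path_image (P k) - {a, b}"
  have "connected ?C"
    using connected_simple_path_endless[OF arc_imp_simple_path[OF arc[OF assms(1)]]] start[OF assms(1)] finish[OF assms(1)]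
    by simp
  moreover have "?C \<inter> J i j = {}"
    using meet[of k i] meet[of k j] assms by (auto simp: J_def)
  ultimately have "?C \<subseteq> inside (J i j) \<or> ?C \<subseteq> outside (J i j)"
    using connected_same_side[OF assms(2-4)] by blast
  moreover have "inside (J i j) \<inter> outside (J i j) = {}" using jordan(6)[OF assms(2-4)] .
  ultimately show "y k \<in> inside (J i j) \<Longrightarrow> ?C \<subseteq> inside (J i j)"
    "y k \<in> outside (J i j) \<Longrightarrow> ?C \<subseteq> outside (J i j)"
    "y k \<in> inside (J i j) \<or> y k \<in> outside (J i j)"
    using mid[OF assms(1)] by blast+
qed

lemma ends_in_J: "i < m \<Longrightarrow> {a, b} \<subseteq> J i j"
  using start finish pathstart_in_path_image[of "P i"] pathfinish_in_path_image[of "P i"]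
  by (auto simp: J_def)

text \<open>The outside of \<open>J i j\<close> is connected, unbounded and misses
  \<open>J i k\<close>, so it lies in the outside of \<open>J i k\<close>. Every point of
  \<open>J i j\<close> is a limit of that outside and hence cannot lie in the open inside of
  \<open>J i k\<close>.\<close>

lemma inside_mono:
  assumes "i < m" "j < m" "k < m" "i \<noteq> j" "k \<noteq> i" "k \<noteq> j" "y k \<in> inside (J i j)"
  shows "inside (J i k) \<subseteq> inside (J i j)"
proof -
  note ij = jordan[OF assms(1,2,4)]
  note ik = jordan[OF assms(1,3) assms(5)[symmetric]]
  have Pk: "path_image (P k) \<subseteq> inside (J i j) \<union> J i j"
    using open_arc_subset(1)[OF assms(3,1,2,4,5,6,7)] ends_in_J[OF assms(1), of j] by blast
  have "outside (J i j) \<inter> J i k = {}"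
  proof -
    have "J i k \<subseteq> inside (J i j) \<union> J i j" using Pk by (auto simp: J_def)
    then show ?thesis using ij(6,7) by blast
  qed
  then have "outside (J i j) \<subseteq> inside (J i k) \<or> outside (J i j) \<subseteq> outside (J i k)"
    using connected_same_side[OF assms(1,3) assms(5)[symmetric] ij(5)] by blast
  moreover have "\<not> outside (J i j) \<subseteq> inside (J i k)"
  proof
    assume *: "outside (J i j) \<subseteq> inside (J i k)"
    have "bounded (inside (J i k))"
      using Jordan_inside_outside[OF loop(1,2)[OF assms(1,3) assms(5)[symmetric]]]
        loop(3)[OF assms(1,3) assms(5)[symmetric]] by auto
    then show False using * ij(10) bounded_subset by blast
  qed
  ultimately have sub: "outside (J i j) \<subseteq> outside (J i k)" by blast
  have "inside (J i k) \<inter> J i j = {}"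
  proof (rule ccontr)
    assume "inside (J i k) \<inter> J i j \<noteq> {}"
    then obtain z where z: "z \<in> inside (J i k)" "z \<in> J i j" by blast
    then have "z \<in> closure (outside (J i j))" using ij(9) by (auto simp: frontier_def)
    then have "inside (J i k) \<inter> outside (J i j) \<noteq> {}"
      using z(1) ik(2) open_Int_closure_eq_empty by blast
    then show False using sub ik(6) by blast
  qed
  then show ?thesis using ij(7) sub ik(6) by blast
qed

text \<open>If arcs \<open>k\<close> and \<open>i\<close> were both enclosed by the respective other
  two, monotonicity would put \<open>y i\<close> strictly inside a curve that passes through
  it.\<close>

lemma inside_at_most_one:
  assumes "i < m" "j < m" "k < m" "i \<noteq> j" "k \<noteq> i" "k \<noteq> j" "y k \<in> inside (J i j)"
  shows "y i \<in> outside (J j k)"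
proof (rule ccontr)
  assume "y i \<notin> outside (J j k)"
  then have "y i \<in> inside (J j k)" using open_arc_subset(3)[of i j k] assms by blast
  moreover have "inside (J j k) \<subseteq> inside (J j i)"
    using inside_mono[of j i k] assms by (simp add: J_commute)
  ultimately have "y i \<in> inside (J i j)" by (auto simp: J_commute)
  moreover have "y i \<in> J i j" using mid[OF assms(1)] by (auto simp: J_def)
  ultimately show False using jordan(7)[OF assms(1,2,4)] by blast
qed

text \<open>A closed simple curve winds 0 times around points outside and with absolute value 1
  around points inside. Splitting this into the contributions of the two open arcs makes equality of
  winding numbers a transitive test for sides.\<close>

lemma winding_loop:
  assumes "i < m" "j < m" "i \<noteq> j" "z \<notin> J i j"
  shows "winding_number (loop i j) z = winding_number (P i) z - winding_number (P j) z"
    "z \<in> outside (J i j) \<Longrightarrow> winding_number (P i) z = winding_number (P j) z"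
    "z \<in> inside (J i j) \<Longrightarrow> winding_number (P i) z \<noteq> winding_number (P j) z"
proof -
  have p: "path (P i)" "path (P j)" using assms arc arc_imp_path by blast+
  have "z \<notin> path_image (P i)" "z \<notin> path_image (P j)" using assms(4) by (auto simp: J_def)
  then show *: "winding_number (loop i j) z = winding_number (P i) z - winding_number (P j) z"
    unfolding loop_def using assms p finish
    by (subst winding_number_join) (auto simp: winding_number_reversepath)
  note l = loop[OF assms(1-3)]
  show "winding_number (P i) z = winding_number (P j) z" if "z \<in> outside (J i j)"
    using winding_number_zero_in_outside[OF simple_path_imp_path[OF l(1)] l(2)] that l(3) * by simp
  show "winding_number (P i) z \<noteq> winding_number (P j) z" if "z \<in> inside (J i j)"
  proof -
    have "cmod (winding_number (loop i j) z) = 1"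
      using simple_closed_path_norm_winding_number_inside[OF l(1)] that l(3) by simp
    then show ?thesis using * by auto
  qed
qed

text \<open>A point inside the curve formed by arcs \<open>i\<close> and \<open>j\<close> would lie outside the other two curves, so the
  three winding numbers around it would agree pairwise, except for the pair \<open>i\<close>, \<open>j\<close>.\<close>

lemma not_all_outside:
  assumes "i < m" "j < m" "k < m" "i \<noteq> j" "k \<noteq> i" "k \<noteq> j"
    and "y k \<in> outside (J i j)" "y j \<in> outside (J i k)" "y i \<in> outside (J j k)"
  shows False
proof -
  have disj: "inside (J r s) \<inter> J r t = {}"
    if "r < m" "s < m" "t < m" "r \<noteq> s" "t \<noteq> r" "t \<noteq> s" "y t \<in> outside (J r s)" for r s t
  proof -
    have "path_image (P t) \<subseteq> outside (J r s) \<union> J r s"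
      using open_arc_subset(2)[of t r s] that ends_in_J[of r s] by blast
    then have "J r t \<subseteq> outside (J r s) \<union> J r s" by (auto simp: J_def)
    then show ?thesis using jordan(6,7)[of r s] that by blast
  qed
  \<comment> \<open>Two insides that share a point would coincide, since neither meets the other's
    curve. Then their frontiers, the two curves, would be equal as well, although \<open>y s\<close>
    lies on only one of them.\<close>
  have neq: False
    if *: "r < m" "s < m" "t < m" "r \<noteq> s" "t \<noteq> r" "t \<noteq> s" "y t \<in> outside (J r s)" "y s \<in> outside (J r t)"
      and z: "z \<in> inside (J r s)" "z \<in> inside (J r t)" for r s t z
  proof -
    have "inside (J r s) \<subseteq> inside (J r t)"
      using connected_same_side[of r t "inside (J r s)"] disj[of r s t] * z jordan(3)[of r s] jordan(6)[of r t] by blast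
    moreover have "inside (J r t) \<subseteq> inside (J r s)"
      using connected_same_side[of r s "inside (J r t)"] disj[of r t s] * z jordan(3)[of r t] jordan(6)[of r s] by blast
    ultimately have "J r s = J r t"
      using jordan(8)[of r s] jordan(8)[of r t] * by (metis subset_antisym)
    then have "y s \<in> J r t" using mid[of s] * by (auto simp: J_def)
    then show False using *(8) jordan(7)[of r t] * by blast
  qed
  obtain z where z: "z \<in> inside (J i j)" using jordan(1)[OF assms(1,2,4)] by blast
  have zn: "z \<notin> J i j" using z jordan(7)[OF assms(1,2,4)] by blast
  have zk: "z \<notin> J i k" using z disj[of i j k] assms by blast
  have zjk: "z \<notin> J j k" using zn zk by (auto simp: J_def)
  have "z \<notin> inside (J i k)" using neq[of i j k z] assms z by blast
  then have "z \<in> outside (J i k)" using zk jordan(7)[of i k] assms by blast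
  then have 1: "winding_number (P i) z = winding_number (P k) z"
    using winding_loop(2)[of i k z] assms zk by simp
  have "z \<notin> inside (J j k)" using neq[of j i k z] assms z by (auto simp: J_commute)
  then have "z \<in> outside (J j k)" using zjk jordan(7)[of j k] assms by blast
  then have 2: "winding_number (P j) z = winding_number (P k) z"
    using winding_loop(2)[of j k z] assms zjk by simp
  show False using winding_loop(3)[of i j z] assms zn z 1 2 by simp
qed

lemma exists_inner_arc:
  assumes "i < m" "j < m" "k < m" "i \<noteq> j" "k \<noteq> i" "k \<noteq> j"
  shows "y k \<in> inside (J i j) \<or> y j \<in> inside (J i k) \<or> y i \<in> inside (J j k)"
  using not_all_outside[OF assms] open_arc_subset(3)[of k i j] open_arc_subset(3)[of j i k]
    open_arc_subset(3)[of i j k] assms by blast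

text \<open>The topological core of the nonplanarity of K_{3,3}: no point is accessible from all
  three open arcs of a theta curve. One arc is enclosed by the other two; \<open>p\<close> would lie
  inside that pair and outside both other pairs, which makes all three winding numbers around
  \<open>p\<close> equal, against the first fact.\<close>

lemma separated:
  assumes "i < m" "j < m" "k < m" "i \<noteq> j" "k \<noteq> i" "k \<noteq> j"
    and c: "connected_component (- J i j) p (y k)" "connected_component (- J i k) p (y j)"
      "connected_component (- J j k) p (y i)"
  shows False
proof -
  have False
    if *: "r < m" "s < m" "t < m" "r \<noteq> s" "t \<noteq> r" "t \<noteq> s" "y t \<in> inside (J r s)"
      and c: "connected_component (- J r s) p (y t)" "connected_component (- J r t) p (y s)"
      "connected_component (- J s t) p (y r)" for r s t
  proof -
    have "y r \<in> outside (J s t)" using inside_at_most_one[of r s t] * by blast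
    moreover have "y s \<in> outside (J r t)" using inside_at_most_one[of s r t] * by (simp add: J_commute)
    ultimately have p: "p \<in> inside (J r s)" "p \<in> outside (J r t)" "p \<in> outside (J s t)"
      using component_same_side[OF _ _ _ c(1)] component_same_side[OF _ _ _ c(2)] component_same_side[OF _ _ _ c(3)] * by auto
    have n: "p \<notin> J r s" "p \<notin> J r t" "p \<notin> J s t" using p jordan(7) * by blast+
    show False
      using winding_loop(3)[of r s p] winding_loop(2)[of r t p] winding_loop(2)[of s t p] n p * by simp
  qed
  note F = this
  consider "y k \<in> inside (J i j)" | "y j \<in> inside (J i k)" | "y i \<in> inside (J j k)"
    using exists_inner_arc[OF assms(1-6)] by blast
  then show False
  proof cases
    case 1 then show ?thesis using F[of i j k] assms by blast
  next
    case 2 then show ?thesis using F[of i k j] assms by (simp add: J_commute)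
  next
    case 3 then show ?thesis using F[of j k i] assms by (simp add: J_commute)
  qed
qed

text \<open>By \<open>separated\<close>, each of \<open>y i\<close>, \<open>y j\<close>,
  \<open>y k\<close> lies on another side than \<open>y z\<close> of the curve formed by the
  remaining two. If arc \<open>t\<close> is the enclosed one, \<open>y z\<close> must lie inside
  \<open>J r t\<close>, hence inside \<open>J r s\<close> together with \<open>y t\<close>: a
  contradiction.\<close>

lemma four_arcs:
  assumes "i < m" "j < m" "k < m" "z < m" "i \<noteq> j" "k \<noteq> i" "k \<noteq> j" "z \<noteq> i" "z \<noteq> j" "z \<noteq> k"
    and c: "connected_component (- J z i) (y j) (y k)" "connected_component (- J z j) (y i) (y k)"
      "connected_component (- J z k) (y i) (y j)"
  shows False
proof -
  have sepz: "\<not> connected_component (- J r s) (y t) (y z)"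
    if "r < m" "s < m" "t < m" "r \<noteq> s" "t \<noteq> r" "t \<noteq> s" "z \<noteq> r" "z \<noteq> s" "z \<noteq> t"
      "connected_component (- J z r) (y t) (y s)" "connected_component (- J z s) (y t) (y r)" for r s t
    using separated[of z r s "y t"] that assms(4) by blast
  have False
    if *: "r < m" "s < m" "t < m" "r \<noteq> s" "t \<noteq> r" "t \<noteq> s" "z \<noteq> r" "z \<noteq> s" "z \<noteq> t"
      and c: "connected_component (- J z r) (y t) (y s)" "connected_component (- J z s) (y t) (y r)"
        "connected_component (- J z t) (y s) (y r)"
      and ins: "y t \<in> inside (J r s)" for r s t
  proof -
    have sym: "connected_component (- J z r) (y s) (y t)" "connected_component (- J z t) (y r) (y s)"
        "connected_component (- J z s) (y r) (y t)"
      using c connected_component_sym by blast+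
    have ys: "y s \<in> outside (J r t)" using inside_at_most_one[of s r t] * ins by (simp add: J_commute)
    have "\<not> connected_component (- J r t) (y s) (y z)"
      using sepz[of r t s] * sym c connected_component_sym by blast
    moreover have "connected_component (- J r t) u v" if "u \<in> outside (J r t)" "v \<in> outside (J r t)" for u v
      using jordan(5,7)[of r t] that * unfolding connected_component_def by blast
    ultimately have "y z \<notin> outside (J r t)" using ys by blast
    then have "y z \<in> inside (J r t)" using open_arc_subset(3)[of z r t] * assms(4) by blast
    then have "y z \<in> inside (J r s)" using inside_mono[of r s t] * ins by blast
    moreover have "connected_component (- J r s) u v" if "u \<in> inside (J r s)" "v \<in> inside (J r s)" for u v
      using jordan(3,7)[of r s] that * unfolding connected_component_def by blast
    ultimately have "connected_component (- J r s) (y t) (y z)" using ins by blast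
    then show False using sepz[of r s t] * c by blast
  qed
  note F = this
  have sym: "connected_component (- J z i) (y k) (y j)" "connected_component (- J z j) (y k) (y i)"
      "connected_component (- J z k) (y j) (y i)"
    using c connected_component_sym by blast+
  consider "y k \<in> inside (J i j)" | "y j \<in> inside (J i k)" | "y i \<in> inside (J j k)"
    using exists_inner_arc[of i j k] assms by blast
  then show False
  proof cases
    case 1 then show ?thesis using F[of i j k] assms sym by blast
  next
    case 2 then show ?thesis using F[of i k j] assms sym by blast
  next
    case 3 then show ?thesis using F[of j k i] assms sym by blast
  qed
qed

end

section \<open>Obstructions to planarity\<close>

fun pedges :: "'a list \<Rightarrow> 'a set set" where
  "pedges (x # y # p) = insert {x, y} (pedges (y # p))"
| "pedges _ = {}"

lemma pedges_subset: "e \<in> pedges p \<Longrightarrow> e \<subseteq> set p"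
  by (induction p rule: pedges.induct) auto

lemma Union_pedges: "length p \<ge> 2 \<Longrightarrow> \<Union>(pedges p) = set p"
proof (induction p rule: pedges.induct)
  case (1 x y p)
  then show ?case by (cases p) auto
qed auto

lemma pedges_edges: "successively (adj G) p \<Longrightarrow> pedges p \<subseteq> edges G"
  by (induction p rule: pedges.induct) (auto simp: adj_def)

text \<open>Excludes the edge between the common ends, the only edge that two internally disjoint
  paths could share.\<close>

lemma hd_last_pedges:
  assumes "distinct p" "length p \<ge> 3"
  shows "{hd p, last p} \<notin> pedges p"
proof -
  obtain x y r where p: "p = x # y # r" "r \<noteq> []"
    using assms(2) by (cases p; cases "tl p"; cases "tl (tl p)") auto
  have "e \<in> pedges (y # r) \<Longrightarrow> x \<notin> e" for e using pedges_subset[of e "y # r"] assms(1) p by auto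
  then show ?thesis using p assms(1) last_in_set[of r] by (auto simp: doubleton_eq_iff)
qed

locale embedded_graph =
  fixes G :: "'a ugraph" and f :: "'a \<Rightarrow> complex" and \<gamma> :: "'a set \<Rightarrow> real \<Rightarrow> complex"
  assumes simple: "simple_graph G"
    and inj: "inj_on f (verts G)"
    and edge: "e \<in> edges G \<Longrightarrow> \<exists>u v. e = {u, v} \<and> arc (\<gamma> e) \<and> pathstart (\<gamma> e) = f u \<and> pathfinish (\<gamma> e) = f v"
    and vertex: "\<lbrakk>e \<in> edges G; w \<in> verts G; f w \<in> path_image (\<gamma> e)\<rbrakk> \<Longrightarrow> w \<in> e"
    and cross: "\<lbrakk>e \<in> edges G; e' \<in> edges G; e \<noteq> e'\<rbrakk> \<Longrightarrow> path_image (\<gamma> e) \<inter> path_image (\<gamma> e') \<subseteq> f ` (e \<inter> e')"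
begin

text \<open>The point set covered by the drawing of the edges in \<open>D\<close>.\<close>

definition TI :: "'a set set \<Rightarrow> complex set" where
  "TI D = (\<Union>e\<in>D. path_image (\<gamma> e))"

lemma edge_verts: "e \<in> edges G \<Longrightarrow> e \<subseteq> verts G"
  using simple unfolding simple_graph_def by fastforce

lemma TI_inter:
  assumes "D \<subseteq> edges G" "D' \<subseteq> edges G" "D \<inter> D' = {}"
  shows "TI D \<inter> TI D' \<subseteq> f ` (\<Union>D \<inter> \<Union>D')"
proof
  fix z assume "z \<in> TI D \<inter> TI D'"
  then obtain e e' where e: "e \<in> D" "e' \<in> D'" "z \<in> path_image (\<gamma> e) \<inter> path_image (\<gamma> e')"
    by (auto simp: TI_def)
  then have "e \<noteq> e'" using assms(3) by blast
  then have "z \<in> f ` (e \<inter> e')" using cross[of e e'] e assms by blast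
  then show "z \<in> f ` (\<Union>D \<inter> \<Union>D')" using e by blast
qed

lemma f_in_TI:
  assumes "D \<subseteq> edges G" "w \<in> verts G" "f w \<in> TI D"
  shows "w \<in> \<Union>D"
  using assms vertex unfolding TI_def by blast

lemma TI_f:
  assumes "D \<subseteq> edges G" "w \<in> \<Union>D"
  shows "f w \<in> TI D"
proof -
  obtain e where e: "e \<in> D" "w \<in> e" using assms by blast
  then obtain u v where uv: "e = {u, v}" "pathstart (\<gamma> e) = f u" "pathfinish (\<gamma> e) = f v"
    using edge[of e] assms(1) by blast
  then have "f w \<in> path_image (\<gamma> e)"
    using e(2) pathstart_in_path_image[of "\<gamma> e"] pathfinish_in_path_image[of "\<gamma> e"] by auto
  then show ?thesis using e by (auto simp: TI_def)
qed

lemma edge_arc: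
  assumes "adj G u v"
  obtains g where "arc g" "pathstart g = f u" "pathfinish g = f v" "path_image g = path_image (\<gamma> {u, v})"
proof -
  have "{u, v} \<in> edges G" using assms by (simp add: adj_def)
  then obtain u' v' where *: "{u, v} = {u', v'}" "arc (\<gamma> {u, v})" "pathstart (\<gamma> {u, v}) = f u'"
      "pathfinish (\<gamma> {u, v}) = f v'"
    using edge[of "{u, v}"] by blast
  then consider "u = u'" "v = v'" | "u = v'" "v = u'" by (auto simp: doubleton_eq_iff)
  then show ?thesis
  proof cases
    case 1 then show ?thesis using that[of "\<gamma> {u, v}"] * by auto
  next
    case 2 then show ?thesis using that[of "reversepath (\<gamma> {u, v})"] * by (auto simp: arc_reversepath)
  qed
qed

text \<open>Edge arcs are concatenated; the new arc meets the old one only in the shared vertex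
  because drawings of disjoint edge sets meet only in common vertices.\<close>

lemma gpath_arc:
  assumes "gpath (adj G) p" "length p \<ge> 2"
  shows "\<exists>g. arc g \<and> pathstart g = f (hd p) \<and> pathfinish g = f (last p) \<and> path_image g = TI (pedges p)"
  using assms
proof (induction p rule: pedges.induct)
  case (1 x y p)
  have xy: "adj G x y" using 1(2) by (auto simp: gpath_def)
  obtain g where g: "arc g" "pathstart g = f x" "pathfinish g = f y" "path_image g = path_image (\<gamma> {x, y})"
    using edge_arc[OF xy] by blast
  show ?case
  proof (cases "p = []")
    case True
    then show ?thesis using g by (intro exI[of _ g]) (auto simp: TI_def)
  next
    case False
    have gp: "gpath (adj G) (y # p)" "x \<notin> set (y # p)" using 1(2) by (auto simp: gpath_def)
    moreover have "length (y # p) \<ge> 2" using False by (cases p) auto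
    ultimately obtain h where h: "arc h" "pathstart h = f y" "pathfinish h = f (last (y # p))"
        "path_image h = TI (pedges (y # p))"
      using 1(1) by auto
    have "TI {{x, y}} \<inter> TI (pedges (y # p)) \<subseteq> f ` (\<Union>{{x, y}} \<inter> \<Union>(pedges (y # p)))"
    proof (rule TI_inter)
      show "{{x, y}} \<subseteq> edges G" using xy by (simp add: adj_def)
      show "pedges (y # p) \<subseteq> edges G" using gp by (intro pedges_edges) (auto simp: gpath_def)
      show "{{x, y}} \<inter> pedges (y # p) = {}" using gp(2) pedges_subset[of "{x, y}" "y # p"] by auto
    qed
    moreover have "\<Union>{{x, y}} \<inter> \<Union>(pedges (y # p)) \<subseteq> {y}"
      using gp(2) pedges_subset[of _ "y # p"] by auto
    ultimately have "path_image g \<inter> path_image h \<subseteq> {f y}"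
      using g(4) h(4) by (auto simp: TI_def)
    then have "arc (g +++ h)" using g h by (intro arc_join) auto
    then show ?thesis using g h False
      by (intro exI[of _ "g +++ h"]) (auto simp: path_image_join TI_def)
  qed
qed auto

text \<open>The inner vertex \<open>w i\<close> forces every path to have at least three vertices.
  So none of them is the edge \<open>a b\<close>, their edge sets are disjoint, and the drawn arcs
  meet only in \<open>f a\<close> and \<open>f b\<close>.\<close>

lemma theta_bundle:
  assumes L: "\<And>i. i < m \<Longrightarrow> gpath (adj G) (L i) \<and> hd (L i) = a \<and> last (L i) = b \<and> w i \<in> set (L i) - {a, b}"
    and meet: "\<And>i j. \<lbrakk>i < m; j < m; i \<noteq> j\<rbrakk> \<Longrightarrow> set (L i) \<inter> set (L j) = {a, b}"
    and "a \<noteq> b"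
  obtains P where "arc_bundle (f a) (f b) P m (f \<circ> w)" "\<And>i. i < m \<Longrightarrow> path_image (P i) = TI (pedges (L i))"
proof -
  have len: "length (L i) \<ge> 3" if "i < m" for i
  proof -
    have "card {a, b, w i} = 3" using L[OF that] \<open>a \<noteq> b\<close> by auto
    moreover have "{a, b, w i} \<subseteq> set (L i)" using L[OF that] by (auto simp: gpath_def)
    ultimately have "3 \<le> card (set (L i))" by (metis List.finite_set card_mono)
    then show ?thesis using card_length le_trans by blast
  qed
  have "\<exists>g. arc g \<and> pathstart g = f a \<and> pathfinish g = f b \<and> path_image g = TI (pedges (L i))" if "i < m" for i
    using gpath_arc[of "L i"] L[OF that] len[OF that] by auto
  then obtain P where P: "\<And>i. i < m \<Longrightarrow> arc (P i) \<and> pathstart (P i) = f a \<and> pathfinish (P i) = f b \<and>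
      path_image (P i) = TI (pedges (L i))"
    by metis
  have pe: "pedges (L i) \<subseteq> edges G" "\<Union>(pedges (L i)) = set (L i)" if "i < m" for i
    using L[OF that] len[OF that] by (auto intro!: pedges_edges Union_pedges[THEN equalityD1, THEN subsetD] simp: gpath_def Union_pedges)
  have V: "set (L i) \<subseteq> verts G" if "i < m" for i
    using pe[OF that] edge_verts by blast
  have "arc_bundle (f a) (f b) P m (f \<circ> w)"
  proof
    fix i assume i: "i < m"
    show "arc (P i)" "pathstart (P i) = f a" "pathfinish (P i) = f b" using P[OF i] by auto
    have "f (w i) \<in> path_image (P i)" using P[OF i] TI_f[OF pe(1)[OF i]] pe(2)[OF i] L[OF i] by auto
    moreover have "w i \<in> verts G" "a \<in> verts G" "b \<in> verts G" "w i \<noteq> a" "w i \<noteq> b"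
      using L[OF i] V[OF i] by (auto simp: gpath_def)
    ultimately show "(f \<circ> w) i \<in> path_image (P i) - {f a, f b}"
      using inj by (auto dest: inj_onD)
  next
    fix i j assume ij: "i < m" "j < m" "i \<noteq> j"
    have "pedges (L i) \<inter> pedges (L j) = {}"
    proof (rule ccontr)
      assume "pedges (L i) \<inter> pedges (L j) \<noteq> {}"
      then obtain e where e: "e \<in> pedges (L i)" "e \<in> pedges (L j)" by blast
      then have "e \<subseteq> {a, b}" using pedges_subset[of e] meet[OF ij] by blast
      moreover obtain u v where "e = {u, v}" "u \<noteq> v"
        using e pe[OF ij(1)] simple unfolding simple_graph_def by blast
      ultimately have "e = {a, b}" by auto
      then show False using hd_last_pedges[of "L i"] L[OF ij(1)] len[OF ij(1)] e by (auto simp: gpath_def)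
    qed
    then have "TI (pedges (L i)) \<inter> TI (pedges (L j)) \<subseteq> f ` {a, b}"
      using TI_inter[OF pe(1)[OF ij(1)] pe(1)[OF ij(2)]] pe(2)[OF ij(1)] pe(2)[OF ij(2)] meet[OF ij] by simp
    moreover have "f ` {a, b} \<subseteq> TI (pedges (L k))" if "k < m" for k
      using TI_f[OF pe(1)] pe(2) that L[OF that] by (auto simp: gpath_def)
    ultimately show "path_image (P i) \<inter> path_image (P j) = {f a, f b}"
      using P[OF ij(1)] P[OF ij(2)] ij by blast
  qed
  then show ?thesis using that P by blast
qed

lemma gpath_connected_component:
  assumes "gpath (adj G) p" "set p \<subseteq> verts G"
    and D: "D \<subseteq> edges G" "\<Union>D \<inter> set p = {}"
  shows "connected_component (- TI D) (f (hd p)) (f (last p))"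
proof (cases "length p \<ge> 2")
  case True
  then obtain g where g: "arc g" "pathstart g = f (hd p)" "pathfinish g = f (last p)" "path_image g = TI (pedges p)"
    using gpath_arc[OF assms(1)] by blast
  have pe: "pedges p \<subseteq> edges G" "\<Union>(pedges p) = set p"
    using True assms(1) by (auto intro!: pedges_edges[THEN subsetD] simp: Union_pedges gpath_def)
  have "D \<inter> pedges p = {}"
  proof (rule ccontr)
    assume "D \<inter> pedges p \<noteq> {}"
    then obtain e where "e \<in> D" "e \<in> pedges p" by blast
    then have "e = {}" using D pe by blast
    then show False using edge \<open>e \<in> D\<close> D(1) by blast
  qed
  then have "TI D \<inter> path_image g = {}" using TI_inter[OF D(1) pe(1)] pe(2) D(2) g(4) by auto
  moreover have "connected (path_image g)" using g(1) by (simp add: arc_imp_path connected_path_image)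
  moreover have "f (hd p) \<in> path_image g" "f (last p) \<in> path_image g"
    using g pathstart_in_path_image[of g] pathfinish_in_path_image[of g] by auto
  ultimately show ?thesis unfolding connected_component_def by blast
next
  case False
  then obtain x where x: "p = [x]" using assms(1) by (cases p) (auto simp: gpath_def Suc_le_eq)
  then have "f x \<notin> TI D" using f_in_TI[OF D(1), of x] assms by auto
  then show ?thesis using x by simp
qed

text \<open>Tripods in \<open>D 0\<close> and \<open>D 1\<close>, linked through \<open>D 3\<close>,
  \<open>D 4\<close>, \<open>D 5\<close>, form a theta curve. The connected set \<open>D 2\<close>
  reaches each of its three arcs without touching the other two, which \<open>separated\<close>
  forbids.\<close>

lemma no_K33_minor: "\<not> bip_minor 3 (verts G) (adj G)"
proof
  have symp: "symp (adj G)" by (auto intro: sympI adj_sym)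
  assume "bip_minor 3 (verts G) (adj G)"
  then obtain D :: "nat \<Rightarrow> 'a set" where D0: "\<forall>i<3+3. conn (adj G) (D i) \<and> D i \<subseteq> verts G"
      "\<forall>i<3+3. \<forall>j<3+3. i \<noteq> j \<longrightarrow> D i \<inter> D j = {}"
      "\<forall>i<3. \<forall>j\<in>{3..<3+3}. \<exists>x\<in>D i. \<exists>y\<in>D j. adj G x y"
    unfolding bip_minor_def by blast
  have D: "\<And>i. i < 6 \<Longrightarrow> conn (adj G) (D i) \<and> D i \<subseteq> verts G"
      "\<And>i j. \<lbrakk>i < 6; j < 6; i \<noteq> j\<rbrakk> \<Longrightarrow> D i \<inter> D j = {}"
      "\<And>i j. \<lbrakk>i < 3; j \<in> {3..<6}\<rbrakk> \<Longrightarrow> \<exists>x\<in>D i. \<exists>y\<in>D j. adj G x y"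
    using D0 by simp_all
  have "\<exists>x y. x \<in> D i \<and> y \<in> D (k + 3) \<and> adj G x y" if "i < 3" "k < 3" for i k
    using D(3)[of i "k + 3"] that by auto
  then obtain xx yy where xy: "\<And>i k. \<lbrakk>i < 3; k < 3\<rbrakk> \<Longrightarrow> xx i k \<in> D i \<and> yy i k \<in> D (k + 3) \<and> adj G (xx i k) (yy i k)"
    by metis
  have D3: "conn (adj G) (D 0)" "conn (adj G) (D 1)" "conn (adj G) (D 2)" using D(1) by auto
  have x01: "\<And>i. i < 3 \<Longrightarrow> xx 0 i \<in> D 0" "\<And>i. i < 3 \<Longrightarrow> xx 1 i \<in> D 1" using xy by simp_all
  have D3k: "conn (adj G) (D (k + 3))" if "k < 3" for k using D(1)[of "k + 3"] that by auto
  obtain a p where p0: "\<forall>i<3. gpath (adj G) (p i) \<and> set (p i) \<subseteq> D 0 \<and> hd (p i) = a \<and> last (p i) = xx 0 i"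
    "\<forall>i<3. \<forall>j<3. i \<noteq> j \<longrightarrow> set (p i) \<inter> set (p j) = {a}"
    using tripod[of "adj G" "D 0" "xx 0", OF symp D3(1) x01(1)] by blast
  note p = p0[rule_format]
  obtain b q where q0: "\<forall>i<3. gpath (adj G) (q i) \<and> set (q i) \<subseteq> D 1 \<and> hd (q i) = b \<and> last (q i) = xx 1 i"
    "\<forall>i<3. \<forall>j<3. i \<noteq> j \<longrightarrow> set (q i) \<inter> set (q j) = {b}"
    using tripod[of "adj G" "D 1" "xx 1", OF symp D3(2) x01(2)] by blast
  note q = q0[rule_format]
  have "\<exists>r. gpath (adj G) r \<and> set r \<subseteq> D (k + 3) \<and> hd r = yy 0 k \<and> last r = yy 1 k" if "k < 3" for k
    using conn_gpath_ex[OF D3k[OF that], of "yy 0 k" "yy 1 k"] xy[of 0 k] xy[of 1 k] that by simp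
  then obtain r where r: "\<And>k. k < 3 \<Longrightarrow> gpath (adj G) (r k) \<and> set (r k) \<subseteq> D (k + 3) \<and> hd (r k) = yy 0 k \<and> last (r k) = yy 1 k"
    by metis
  \<comment> \<open>From the centre \<open>a\<close> of the first tripod through
    \<open>D (k + 3)\<close> to the centre \<open>b\<close> of the second; the marked vertex of this
    path will be \<open>yy 0 k\<close> in \<open>D (k + 3)\<close>.\<close>
  define L where "L k = p k @ r k @ rev (q k)" for k
  have disj: "D 0 \<inter> D (k + 3) = {}" "D 1 \<inter> D (k + 3) = {}" "D 2 \<inter> D (k + 3) = {}" "D 0 \<inter> D 1 = {}"
      "D 2 \<inter> D 0 = {}" "D 2 \<inter> D 1 = {}" if "k < 3" for k
    using that D(2)[of 0 "k + 3"] D(2)[of 1 "k + 3"] D(2)[of 2 "k + 3"] D(2)[of 0 1] D(2)[of 2 0] D(2)[of 2 1] by auto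
  have disj2: "D (k + 3) \<inter> D (l + 3) = {}" if "k < 3" "l < 3" "k \<noteq> l" for k l
    using that D(2)[of "k + 3" "l + 3"] by auto
  have setL: "set (L k) \<subseteq> D 0 \<union> D 1 \<union> D (k + 3)" if "k < 3" for k
    using p(1)[OF that] q(1)[OF that] r[OF that] by (auto simp: L_def)
  have ab: "a \<in> D 0" "b \<in> D 1" using p(1)[of 0] q(1)[of 0] by (auto simp: gpath_def dest: hd_in_set)
  then have "a \<noteq> b" using disj[of 0] by auto
  define w where "w k = yy 0 k" for k
  have Lk: "gpath (adj G) (L k) \<and> hd (L k) = a \<and> last (L k) = b \<and> w k \<in> set (L k) - {a, b}" if k: "k < 3" for k
  proof -
    note P = p(1)[OF k] and Q = q(1)[OF k] and R = r[OF k]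
    have 1: "gpath (adj G) (r k @ rev (q k))"
    proof (rule gpath_append)
      show "gpath (adj G) (r k)" using R by simp
      show "gpath (adj G) (rev (q k))" using gpath_rev[OF symp] Q by simp
      show "adj G (last (r k)) (hd (rev (q k)))" using R Q xy[of 1 k] k by (simp add: hd_rev adj_sym)
      show "set (r k) \<inter> set (rev (q k)) = {}" using R Q disj[OF k] by auto
    qed
    have "gpath (adj G) (p k @ r k @ rev (q k))"
    proof (rule gpath_append)
      show "gpath (adj G) (p k)" using P by simp
      show "gpath (adj G) (r k @ rev (q k))" by (rule 1)
      show "adj G (last (p k)) (hd (r k @ rev (q k)))" using P R xy[of 0 k] k by (auto simp: gpath_def)
      show "set (p k) \<inter> set (r k @ rev (q k)) = {}" using P R Q disj[OF k] by auto
    qed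
    moreover have "hd (L k) = a" "last (L k) = b" using P Q by (auto simp: L_def gpath_def last_rev)
    moreover have "w k \<in> set (L k)" using R by (auto simp: L_def w_def gpath_def dest: hd_in_set)
    moreover have "w k \<in> D (k + 3)" using xy[of 0 k] k by (simp add: w_def)
    ultimately show ?thesis using disj[OF k] ab by (auto simp: L_def)
  qed
  have meet: "set (L k) \<inter> set (L l) = {a, b}" if kl: "k < 3" "l < 3" "k \<noteq> l" for k l
  proof -
    have "a \<in> set (p k)" "a \<in> set (p l)" "b \<in> set (q k)" "b \<in> set (q l)"
      using p(2)[OF kl] q(2)[OF kl] by blast+
    moreover have "set (L k) \<inter> set (L l) \<subseteq> (set (p k) \<inter> set (p l)) \<union> (set (q k) \<inter> set (q l))"
    proof -
      have sub: "set (p k) \<subseteq> D 0" "set (p l) \<subseteq> D 0" "set (q k) \<subseteq> D 1" "set (q l) \<subseteq> D 1"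
          "set (r k) \<subseteq> D (k + 3)" "set (r l) \<subseteq> D (l + 3)"
        using p(1)[OF kl(1)] p(1)[OF kl(2)] q(1)[OF kl(1)] q(1)[OF kl(2)] r[OF kl(1)] r[OF kl(2)] by simp_all
      note d = disj[OF kl(1)] disj[OF kl(2)]
      have "set (p k) \<inter> set (q l) = {}" using sub(1,4) d(4) by blast
      moreover have "set (q k) \<inter> set (p l) = {}" using sub(3,2) d(4) by blast
      moreover have "set (p k) \<inter> set (r l) = {}" using sub(1,6) d(7) by blast
      moreover have "set (r k) \<inter> set (p l) = {}" using sub(5,2) d(1) by blast
      moreover have "set (q k) \<inter> set (r l) = {}" using sub(3,6) d(8) by blast
      moreover have "set (r k) \<inter> set (q l) = {}" using sub(5,4) d(2) by blast
      moreover have "set (r k) \<inter> set (r l) = {}" using sub(5,6) disj2[OF kl] by blast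
      ultimately show ?thesis unfolding L_def set_append set_rev by blast
    qed
    moreover have "set (p i) \<union> set (q i) \<subseteq> set (L i)" for i by (auto simp: L_def)
    ultimately show ?thesis using p(2)[OF kl] q(2)[OF kl] by blast
  qed
  obtain P where P: "arc_bundle (f a) (f b) P 3 (f \<circ> w)" "\<And>i. i < 3 \<Longrightarrow> path_image (P i) = TI (pedges (L i))"
    using theta_bundle[of 3 L a b w] Lk meet \<open>a \<noteq> b\<close> by blast
  interpret arc_bundle "f a" "f b" P 3 "f \<circ> w" by (rule P(1))
  obtain c where c: "c \<in> D 2" using D3(3) by (auto simp: conn_def)
  \<comment> \<open>A path inside \<open>D 2 \<union> D (k + 3)\<close> avoids the arcs
    \<open>i\<close> and \<open>j\<close>, whose vertices lie in the other branch sets.\<close>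
  have cc: "connected_component (- J i j) (f c) ((f \<circ> w) k)"
    if ijk: "i < 3" "j < 3" "k < 3" "k \<noteq> i" "k \<noteq> j" for i j k
  proof -
    have "conn (adj G) (D 2 \<union> D (k + 3))"
      using conn_union[OF symp D3(3) D3k[OF ijk(3)], of "xx 2 k" "yy 2 k"] xy[of 2 k] ijk by simp
    moreover have "w k \<in> D (k + 3)" using xy[of 0 k] ijk by (simp add: w_def)
    ultimately have "\<exists>s. gpath (adj G) s \<and> set s \<subseteq> D 2 \<union> D (k + 3) \<and> hd s = c \<and> last s = w k"
      using c by (intro conn_gpath_ex) simp_all
    then obtain s where s: "gpath (adj G) s" "set s \<subseteq> D 2 \<union> D (k + 3)" "hd s = c" "last s = w k"
      by blast
    let ?D = "pedges (L i) \<union> pedges (L j)"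
    have "?D \<subseteq> edges G" using pedges_edges[of G "L i"] pedges_edges[of G "L j"] Lk[OF ijk(1)] Lk[OF ijk(2)]
      unfolding gpath_def by blast
    moreover have "\<Union>?D \<inter> set s = {}"
    proof -
      have sep: "set (L l) \<inter> set s = {}" if l: "l < 3" "k \<noteq> l" for l
      proof -
        have "D 0 \<inter> D 2 = {}" "D 1 \<inter> D 2 = {}" using D(2)[of 0 2] D(2)[of 1 2] by simp_all
        moreover have "D 0 \<inter> D (k + 3) = {}" "D 1 \<inter> D (k + 3) = {}" "D 2 \<inter> D (l + 3) = {}"
            "D (k + 3) \<inter> D (l + 3) = {}"
          using disj(1,2)[OF ijk(3)] disj(3)[OF l(1)] disj2[OF ijk(3) l] by blast+
        ultimately have "(D 0 \<union> D 1 \<union> D (l + 3)) \<inter> (D 2 \<union> D (k + 3)) = {}"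
          unfolding Int_Un_distrib Int_Un_distrib2 by (metis Int_commute Un_empty)
        then show ?thesis using setL[OF l(1)] s(2) by blast
      qed
      have "\<Union>?D \<subseteq> set (L i) \<union> set (L j)" using pedges_subset by fastforce
      then show ?thesis using sep[OF ijk(1,4)] sep[OF ijk(2,5)] by blast
    qed
    moreover have "set s \<subseteq> verts G" using s(2) D(1)[of 2] D(1)[of "k + 3"] ijk by auto
    ultimately have "connected_component (- TI ?D) (f (hd s)) (f (last s))"
      by (intro gpath_connected_component[OF s(1)])
    moreover have "TI ?D = J i j" using P(2) ijk by (auto simp: J_def TI_def)
    ultimately show ?thesis using s by simp
  qed
  show False using separated[of 0 1 2 "f c"] cc by simp
qed

text \<open>Three vertices of the cycle and \<open>z\<close> are the midpoints of four arcs from \<open>u\<close> to \<open>v\<close>; the cycle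
  provides the connections that \<open>four_arcs\<close> excludes.\<close>

lemma no_wheel_pair:
  assumes "u \<noteq> v" "gpath (adj G) c" "length c \<ge> 3" "adj G (last c) (hd c)"
    and "z \<notin> set c" "\<And>x. x \<in> insert z (set c) \<Longrightarrow> adj G u x \<and> adj G v x"
  shows False
proof -
  have symp: "symp (adj G)" by (auto intro: sympI adj_sym)
  obtain c0 c1 c' where c: "c = c0 # c1 # c'" "c' \<noteq> []"
    using assms(3) by (cases c; cases "tl c"; cases "tl (tl c)") auto
  define c2 where "c2 = hd c'"
  have c2: "c2 \<in> set c'" using c(2) by (simp add: c2_def)
  have dist: "distinct c" using assms(2) by (simp add: gpath_def)
  define w where "w i = (if i = 0 then c0 else if i = 1 then c1 else if i = 2 then c2 else z)" for i :: nat
  define L where "L i = [u, w i, v]" for i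
  have w: "w i \<in> insert z (set c)" for i using c c2 by (auto simp: w_def)
  have uv: "u \<notin> insert z (set c)" "v \<notin> insert z (set c)"
    using assms(6) adj_in_verts(3)[OF simple] by blast+
  have wn: "w i \<noteq> u" "w i \<noteq> v" for i using w uv by metis+
  have winj: "w i \<noteq> w j" if "i < 4" "j < 4" "i \<noteq> j" for i j
    using that dist c c2 assms(5) by (auto simp: w_def)
  have au: "adj G u (w i)" "adj G (w i) v" for i
    using assms(6)[OF w[of i]] adj_sym[of G v "w i"] by auto
  have Lk: "gpath (adj G) (L i) \<and> hd (L i) = u \<and> last (L i) = v \<and> w i \<in> set (L i) - {u, v}" if "i < 4" for i
    using wn[of i] au[of i] assms(1) by (auto simp: L_def gpath_def)
  have meet: "set (L i) \<inter> set (L j) = {u, v}" if "i < 4" "j < 4" "i \<noteq> j" for i j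
    using winj[OF that] by (auto simp: L_def)
  obtain P where P: "arc_bundle (f u) (f v) P 4 (f \<circ> w)" "\<And>i. i < 4 \<Longrightarrow> path_image (P i) = TI (pedges (L i))"
    using theta_bundle[of 4 L u v w] Lk meet assms(1) by blast
  interpret arc_bundle "f u" "f v" P 4 "f \<circ> w" by (rule P(1))
  have cc: "connected_component (- J 3 i) (f (hd s)) (f (last s))"
    if "i < 3" "gpath (adj G) s" "set s \<subseteq> set c - {w i}" for i s
  proof -
    let ?D = "pedges (L 3) \<union> pedges (L i)"
    have "?D \<subseteq> edges G" using pedges_edges[of G "L i"] pedges_edges[of G "L 3"] Lk that unfolding gpath_def by auto
    moreover have "\<Union>?D \<inter> set s = {}" using that(3) uv assms(5) by (auto simp: L_def w_def)
    moreover have "set s \<subseteq> verts G" using that(3) assms(6) adj_in_verts(2)[OF simple] by fast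
    ultimately have "connected_component (- TI ?D) (f (hd s)) (f (last s))"
      by (intro gpath_connected_component[OF that(2)])
    moreover have "TI ?D = J 3 i" using P(2) that by (auto simp: J_def TI_def)
    ultimately show ?thesis by simp
  qed
  have gc: "adj G c0 c1" "adj G c1 c2" "gpath (adj G) c'"
    using assms(2) c by (auto simp: gpath_def c2_def successively_Cons)
  have "gpath (adj G) [c1, c2]" using gc dist c c2 by (auto simp: gpath_def)
  from cc[of 0, OF _ this] have 1: "connected_component (- J 3 0) (f c1) (f c2)"
    using dist c c2 by (auto simp: w_def)
  \<comment> \<open>The way around the cycle that avoids \<open>c1\<close>; the other two
    connections are single edges.\<close>
  have "gpath (adj G) (c0 # rev c')"
    using gpath_append[of "adj G" "[c0]" "rev c'"] gpath_rev[OF symp gc(3)] assms(4) c dist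
    by (auto simp: gpath_def hd_rev adj_sym)
  from cc[of 1, OF _ this] have 2: "connected_component (- J 3 1) (f c0) (f c2)"
    using dist c by (auto simp: w_def c2_def last_rev)
  have "gpath (adj G) [c0, c1]" using gc dist c by (auto simp: gpath_def)
  from cc[of 2, OF _ this] have 3: "connected_component (- J 3 2) (f c0) (f c1)"
    using dist c c2 by (auto simp: w_def)
  show False using four_arcs[of 0 1 2 3] 1 2 3 by (simp add: w_def)
qed

end

lemma planar_embedded:
  assumes "simple_graph G" "planar G"
  obtains f \<gamma> where "embedded_graph G f \<gamma>"
  using assms unfolding planar_def embedded_graph_def by metis

lemma planar_no_K33_minor:
  assumes "simple_graph G" "planar G"
  shows "\<not> bip_minor 3 (verts G) (adj G)"
  using planar_embedded[OF assms] embedded_graph.no_K33_minor by metis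

lemma planar_no_wheel_pair:
  assumes "simple_graph G" "planar G" "u \<noteq> v" "gpath (adj G) c" "length c \<ge> 3" "adj G (last c) (hd c)"
    and "z \<notin> set c" "\<And>x. x \<in> insert z (set c) \<Longrightarrow> adj G u x \<and> adj G v x"
  shows False
  using planar_embedded[OF assms(1,2)] embedded_graph.no_wheel_pair[OF _ assms(3-8)] by metis

section \<open>Edge bounds for graphs without \<open>K\<^bsub>s,3\<^esub>\<close> minor\<close>

definition nbr :: "('a \<Rightarrow> 'a \<Rightarrow> bool) \<Rightarrow> 'a set \<Rightarrow> 'a \<Rightarrow> 'a set" where
  "nbr E V x = {y \<in> V. E x y}"

text \<open>For symmetric irreflexive \<open>E\<close> this is twice the number of edges on
  \<open>V\<close>.\<close>

definition degsum :: "('a \<Rightarrow> 'a \<Rightarrow> bool) \<Rightarrow> 'a set \<Rightarrow> nat" where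
  "degsum E V = (\<Sum>x\<in>V. card (nbr E V x))"

text \<open>Merges \<open>v\<close> into \<open>u\<close>. The relation still mentions
  \<open>v\<close>; it becomes the contraction only when restricted to \<open>V - {v}\<close>, as in
  all uses. The condition \<open>x \<noteq> y\<close> removes the loop.\<close>

definition contract :: "('a \<Rightarrow> 'a \<Rightarrow> bool) \<Rightarrow> 'a \<Rightarrow> 'a \<Rightarrow> 'a \<Rightarrow> 'a \<Rightarrow> bool" where
  "contract E u v x y \<longleftrightarrow> x \<noteq> y \<and> (E x y \<or> (x = u \<and> E v y) \<or> (y = u \<and> E x v))"

lemma finite_nbr [simp]: "finite V \<Longrightarrow> finite (nbr E V x)"
  by (simp add: nbr_def)

lemma contract_props:
  assumes "symp E" "irreflp E"
  shows "symp (contract E u v)" "irreflp (contract E u v)"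
  using assms by (auto intro!: sympI irreflpI simp: contract_def dest: sympD)

lemma bip_minor_mono:
  assumes "bip_minor s V E" "V \<subseteq> W"
  shows "bip_minor s W E"
proof -
  obtain D where D: "\<forall>i<s+3. conn E (D i) \<and> D i \<subseteq> V"
     "(\<forall>i<s+3. \<forall>j<s+3. i \<noteq> j \<longrightarrow> D i \<inter> D j = {}) \<and>
     (\<forall>i<s. \<forall>j\<in>{s..<s+3}. \<exists>x\<in>D i. \<exists>y\<in>D j. E x y)"
    using assms(1) unfolding bip_minor_def by blast
  then have "\<forall>i<s+3. conn E (D i) \<and> D i \<subseteq> W" using assms(2) by blast
  then show ?thesis unfolding bip_minor_def using D(2) by blast
qed

text \<open>An edge that exists only after the contraction lifts to the two steps through
  \<open>v\<close>, which is attached to \<open>u\<close>.\<close>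

lemma conn_contract:
  assumes "symp E" "E u v" "conn (contract E u v) S" "v \<notin> S"
  shows "conn E (if u \<in> S then insert v S else S)"
proof -
  let ?T = "if u \<in> S then insert v S else S"
  have edge: "(x, y) \<in> reach E ?T" if xy: "x \<in> S" "y \<in> S" "contract E u v x y" for x y
  proof -
    consider "E x y" | "x = u" "E v y" | "y = u" "E x v" using xy(3) by (auto simp: contract_def)
    then show ?thesis
    proof cases
      case 1 then show ?thesis using xy reach_step[of x ?T y E] by auto
    next
      case 2
      then have "(u, v) \<in> reach E ?T" "(v, y) \<in> reach E ?T"
        using xy assms(2) reach_step[of u ?T v E] reach_step[of v ?T y E] by auto
      then show ?thesis using 2 reach_trans by metis
    next
      case 3
      then have "(x, v) \<in> reach E ?T" "(v, u) \<in> reach E ?T"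
        using xy assms(1,2) reach_step[of v ?T u E] reach_step[of x ?T v E] by (auto dest: sympD)
      then show ?thesis using 3 reach_trans by metis
    qed
  qed
  have lift: "(x, y) \<in> reach E ?T" if "(x, y) \<in> reach (contract E u v) S" for x y
    using that unfolding reach_def[of "contract E u v"]
  proof (induction rule: rtrancl_induct)
    case base then show ?case by (simp add: reach_def)
  next
    case (step y z)
    then show ?case using edge[of y z] reach_trans by fast
  qed
  have SS: "(x, y) \<in> reach E ?T" if "x \<in> S" "y \<in> S" for x y
    using assms(3) lift that by (auto simp: conn_def)
  show ?thesis
  proof (cases "u \<in> S")
    case True
    then have vS: "(v, y) \<in> reach E ?T" if "y \<in> S" for y
      using reach_step[of v ?T u E] assms(1,2) SS[OF True that] reach_trans by (metis insertI1 insertI2 sympD)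
    have "(x, y) \<in> reach E ?T" if "x \<in> ?T" "y \<in> ?T" for x y
    proof -
      consider "x \<in> S" "y \<in> S" | "x = v" "y \<in> S" | "x \<in> S" "y = v" | "x = v" "y = v"
        using \<open>x \<in> ?T\<close> \<open>y \<in> ?T\<close> True by auto
      then show ?thesis
        using SS vS reach_sym[OF assms(1)] by cases (auto simp: reach_def)
    qed
    then show ?thesis unfolding conn_def using True by auto
  next
    case False
    then show ?thesis using SS assms(3) by (simp add: conn_def)
  qed
qed

text \<open>The branch set that contains \<open>u\<close>, if any, absorbs \<open>v\<close>; the
  others stay unchanged.\<close>

lemma bip_minor_contract:
  assumes "symp E" "E u v" "u \<in> V" "v \<in> V" "u \<noteq> v" "bip_minor s (V - {v}) (contract E u v)"
  shows "bip_minor s V E"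
proof -
  obtain D where D: "\<And>i. i<s+3 \<Longrightarrow> conn (contract E u v) (D i) \<and> D i \<subseteq> V - {v}"
     "\<And>i j. \<lbrakk>i<s+3; j<s+3; i \<noteq> j\<rbrakk> \<Longrightarrow> D i \<inter> D j = {}"
     "\<And>i j. \<lbrakk>i<s; j\<in>{s..<s+3}\<rbrakk> \<Longrightarrow> \<exists>x\<in>D i. \<exists>y\<in>D j. contract E u v x y"
    using assms(6) unfolding bip_minor_def by metis
  define D' where "D' i = (if u \<in> D i then insert v (D i) else D i)" for i
  have "conn E (D' i) \<and> D' i \<subseteq> V" if "i < s + 3" for i
    using conn_contract[OF assms(1,2), of "D i"] D(1)[OF that] assms(4)
    by (cases "v \<in> D i"; cases "u \<in> D i") (auto simp: D'_def)
  moreover have "D' i \<inter> D' j = {}" if "i < s + 3" "j < s + 3" "i \<noteq> j" for i j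
    using D(2)[OF that] D(1)[OF that(1)] D(1)[OF that(2)] by (auto simp: D'_def)
  moreover have "\<exists>x\<in>D' i. \<exists>y\<in>D' j. E x y" if ij: "i < s" "j \<in> {s..<s+3}" for i j
  proof -
    obtain x y where xy: "x \<in> D i" "y \<in> D j" "contract E u v x y" using D(3)[OF ij] by blast
    then consider "E x y" | "x = u" "E v y" | "y = u" "E x v" by (auto simp: contract_def)
    then show ?thesis
    proof cases
      case 1 then show ?thesis using xy by (auto simp: D'_def)
    next
      case 2 then show ?thesis using xy by (intro bexI[of _ v] bexI[of _ y]) (auto simp: D'_def)
    next
      case 3 then show ?thesis using xy by (intro bexI[of _ x] bexI[of _ v]) (auto simp: D'_def)
    qed
  qed
  ultimately show ?thesis unfolding bip_minor_def by (intro exI[of _ D']) blast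
qed

lemma degsum_remove:
  assumes "finite V" "symp E" "irreflp E" "v \<in> V"
  shows "degsum E V = degsum E (V - {v}) + 2 * card (nbr E V v)"
proof -
  have "card (nbr E V x) = card (nbr E (V - {v}) x) + (if E x v then 1 else 0)" for x
  proof (cases "E x v")
    case True
    then have "nbr E V x = insert v (nbr E (V - {v}) x)" "v \<notin> nbr E (V - {v}) x"
      using assms(4) by (auto simp: nbr_def)
    then show ?thesis using True assms(1) by simp
  next
    case False
    then have "nbr E V x = nbr E (V - {v}) x" by (auto simp: nbr_def)
    then show ?thesis using False by simp
  qed
  then have "(\<Sum>x\<in>V - {v}. card (nbr E V x)) = degsum E (V - {v}) + (\<Sum>x\<in>V - {v}. if E x v then 1 else 0)"
    by (simp add: degsum_def sum.distrib)
  moreover have "(\<Sum>x\<in>V - {v}. if E x v then 1 else 0) = card (nbr E V v)"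
  proof -
    have "(V - {v}) \<inter> {x. E x v} = nbr E V v"
      using assms(2,3) by (auto simp: nbr_def irreflp_def dest: sympD)
    then show ?thesis using assms(1) by (simp add: sum.If_cases)
  qed
  moreover have "degsum E V = card (nbr E V v) + (\<Sum>x\<in>V - {v}. card (nbr E V x))"
    unfolding degsum_def using assms by (simp add: sum.remove)
  ultimately show ?thesis by simp
qed

text \<open>Contracting \<open>u v\<close> destroys this edge and identifies two edges for every
  common neighbour; \<open>degsum\<close> counts each lost edge twice.\<close>

lemma degsum_contract:
  assumes "finite V" "symp E" "irreflp E" "E u v" "u \<in> V" "v \<in> V"
  shows "degsum E V \<le> degsum (contract E u v) (V - {v}) + 2 * (card (nbr E V u \<inter> nbr E V v) + 1)"
proof -
  let ?W = "V - {v}" and ?C = "contract E u v"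
  have uv: "u \<noteq> v" using assms(3,4) by (auto simp: irreflp_def)
  then have uW: "u \<in> ?W" using assms by simp
  have finW: "finite ?W" using assms(1) by simp
  have irr: "\<not> E x x" for x using assms(3) by (simp add: irreflp_def)
  have sym: "E x y \<Longrightarrow> E y x" for x y using assms(2) by (rule sympD)
  have rest: "degsum E (?W - {u}) = degsum ?C (?W - {u})"
  proof -
    have "nbr E (?W - {u}) x = nbr ?C (?W - {u}) x" if "x \<in> ?W - {u}" for x
      using that irr by (auto simp: nbr_def contract_def)
    then show ?thesis by (simp add: degsum_def)
  qed
  have "nbr ?C ?W u = (nbr E V u \<union> nbr E V v) - {u, v}"
    using irr sym uv by (auto simp: nbr_def contract_def)
  also have "card \<dots> + 2 = card (nbr E V u \<union> nbr E V v)"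
  proof -
    have "{u, v} \<subseteq> nbr E V u \<union> nbr E V v" using assms(4-6) sym by (auto simp: nbr_def)
    moreover have "finite (nbr E V u \<union> nbr E V v)" using assms(1) by simp
    moreover have "card {u, v} = 2" using uv by simp
    ultimately show ?thesis using card_Diff_subset[of "{u, v}" "nbr E V u \<union> nbr E V v"] card_mono
      by (metis finite.emptyI finite_insert le_add_diff_inverse2)
  qed
  finally have "card (nbr ?C ?W u) + 2 + card (nbr E V u \<inter> nbr E V v) = card (nbr E V u) + card (nbr E V v)"
    using card_Un_Int[of "nbr E V u" "nbr E V v"] assms(1) by simp
  moreover have "card (nbr E V u) = card (nbr E ?W u) + 1"
  proof -
    have "nbr E V u = insert v (nbr E ?W u)" "v \<notin> nbr E ?W u" using assms by (auto simp: nbr_def)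
    then show ?thesis using assms(1) by simp
  qed
  moreover have "degsum E V = degsum E (?W - {u}) + 2 * card (nbr E ?W u) + 2 * card (nbr E V v)"
    using degsum_remove[OF assms(1-3,6)] degsum_remove[OF finW assms(2,3) uW] by simp
  moreover have "degsum ?C ?W = degsum ?C (?W - {u}) + 2 * card (nbr ?C ?W u)"
    using degsum_remove[OF finW contract_props[OF assms(2,3)] uW] .
  ultimately show ?thesis using rest by simp
qed

lemma card_ge_3E:
  assumes "finite S" "card S \<ge> 3"
  obtains f :: "nat \<Rightarrow> 'a" where "\<And>i. i < 3 \<Longrightarrow> f i \<in> S" "inj_on f {..<3}"
proof -
  obtain T where T: "T \<subseteq> S" "card T = 3" using assms obtain_subset_with_card_n by metis
  then have "finite T" using assms(1) finite_subset by blast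
  then obtain f :: "nat \<Rightarrow> 'a" where "bij_betw f {0..<3} T" using ex_bij_betw_nat_finite[of T] T by auto
  then have "\<And>i. i < 3 \<Longrightarrow> f i \<in> T" "inj_on f {..<3}"
    by (auto simp: bij_betw_def lessThan_atLeast0)
  then show ?thesis using that[of f] T(1) by blast
qed

text \<open>A complete bipartite subgraph is a minor with singleton branch sets: \<open>S\<close>
  against three of its common neighbours.\<close>

lemma bip_minor_singletons:
  assumes "finite V" "S \<subseteq> V" "S \<noteq> {}" "finite S" "card (V \<inter> {y. \<forall>x\<in>S. E x y} - S) \<ge> 3"
  shows "bip_minor (card S) V E"
proof -
  let ?s = "card S"
  obtain f where f: "\<And>i. i < 3 \<Longrightarrow> f i \<in> V \<inter> {y. \<forall>x\<in>S. E x y} - S" "inj_on f {..<3::nat}"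
    using card_ge_3E[OF _ assms(5)] assms(1) by auto
  obtain g where g: "bij_betw g {0..<?s} S" using ex_bij_betw_nat_finite[OF assms(4)] by blast
  define D where "D i = {if i < ?s then g i else f (i - ?s)}" for i
  have gS: "g i \<in> S" if "i < ?s" for i using g that by (auto simp: bij_betw_def)
  have "conn E (D i) \<and> D i \<subseteq> V" if "i < ?s + 3" for i
    using gS[of i] f(1)[of "i - ?s"] that assms(2) by (auto simp: D_def conn_singleton)
  moreover have "D i \<inter> D j = {}" if "i < ?s + 3" "j < ?s + 3" "i \<noteq> j" for i j
  proof -
    have "g i \<noteq> g j" if "i < ?s" "j < ?s"
      using g that \<open>i \<noteq> j\<close> by (auto simp: bij_betw_def inj_on_def)
    moreover have "f (i - ?s) \<noteq> f (j - ?s)" if "\<not> i < ?s" "\<not> j < ?s"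
    proof -
      have "i - ?s < 3" "j - ?s < 3" "i - ?s \<noteq> j - ?s"
        using that \<open>i < ?s + 3\<close> \<open>j < ?s + 3\<close> \<open>i \<noteq> j\<close> by linarith+
      then show ?thesis using inj_onD[OF f(2), of "i - ?s" "j - ?s"] by auto
    qed
    moreover have "g i \<noteq> f (j - ?s)" if "i < ?s" "\<not> j < ?s"
      using gS[of i] f(1)[of "j - ?s"] that \<open>j < ?s + 3\<close> by auto
    moreover have "g j \<noteq> f (i - ?s)" if "j < ?s" "\<not> i < ?s"
      using gS[of j] f(1)[of "i - ?s"] that \<open>i < ?s + 3\<close> by auto
    ultimately show ?thesis by (auto simp: D_def)
  qed
  moreover have "\<exists>x\<in>D i. \<exists>y\<in>D j. E x y" if "i < ?s" "j \<in> {?s..<?s+3}" for i j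
    using gS[of i] f(1)[of "j - ?s"] that by (auto simp: D_def)
  ultimately show ?thesis unfolding bip_minor_def by (intro exI[of _ D]) blast
qed

text \<open>Adjacent vertices have at most two common neighbours, since three would give K_{2,3}. So
  contracting an edge loses at most three edges and one vertex, which yields at most 3 (|V| - 1)
  edges by induction.\<close>

lemma K23_minor_free_degsum:
  assumes "finite V" "V \<noteq> {}" "symp E" "irreflp E" "\<not> bip_minor 2 V E"
  shows "degsum E V + 6 \<le> 6 * card V"
  using assms
proof (induction "card V" arbitrary: V E rule: less_induct)
  case less
  show ?case
  proof (cases "\<exists>u\<in>V. \<exists>v\<in>V. E u v")
    case False
    then have "nbr E V x = {}" if "x \<in> V" for x using that by (auto simp: nbr_def)
    then have "degsum E V = 0" by (simp add: degsum_def)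
    moreover have "card V > 0" using less by (simp add: card_gt_0_iff)
    ultimately show ?thesis by simp
  next
    case True
    then obtain u v where uv: "u \<in> V" "v \<in> V" "E u v" by blast
    have ne: "u \<noteq> v" using uv less.prems(4) by (auto simp: irreflp_def)
    have irr: "\<not> E x x" for x using less.prems(4) by (simp add: irreflp_def)
    have "V \<inter> {y. \<forall>x\<in>{u, v}. E x y} - {u, v} = nbr E V u \<inter> nbr E V v"
      using irr by (auto simp: nbr_def)
    moreover have "card {u, v} = 2" using ne by simp
    ultimately have "\<not> 3 \<le> card (nbr E V u \<inter> nbr E V v)"
      using bip_minor_singletons[of V "{u, v}" E] less.prems(1,5) uv by auto
    then have "card (nbr E V u \<inter> nbr E V v) \<le> 2" by simp
    moreover have "degsum (contract E u v) (V - {v}) + 6 \<le> 6 * card (V - {v})"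
    proof (rule less.hyps)
      show "card (V - {v}) < card V" using less.prems uv by (meson card_Diff1_less)
      show "V - {v} \<noteq> {}" using uv ne by auto
      show "\<not> bip_minor 2 (V - {v}) (contract E u v)"
        using bip_minor_contract[OF less.prems(3) uv(3,1,2) ne] less.prems(5) by blast
    qed (use less.prems contract_props[OF less.prems(3,4)] in auto)
    moreover have "card V = card (V - {v}) + 1" using card_Suc_Diff1[OF less.prems(1) uv(2)] by simp
    ultimately show ?thesis using degsum_contract[OF less.prems(1,3,4) uv(3,1,2)] by simp
  qed
qed

text \<open>The apex \<open>v\<close> becomes one more branch set on the side of size
  \<open>s\<close>.\<close>

lemma bip_minor_cone:
  assumes "v \<in> V" "v \<notin> W" "W \<subseteq> V" "\<And>x. x \<in> W \<Longrightarrow> E v x" "bip_minor s W E"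
  shows "bip_minor (Suc s) V E"
proof -
  obtain D where D: "\<And>i. i<s+3 \<Longrightarrow> conn E (D i) \<and> D i \<subseteq> W"
     "\<And>i j. \<lbrakk>i<s+3; j<s+3; i \<noteq> j\<rbrakk> \<Longrightarrow> D i \<inter> D j = {}"
     "\<And>i j. \<lbrakk>i<s; j\<in>{s..<s+3}\<rbrakk> \<Longrightarrow> \<exists>x\<in>D i. \<exists>y\<in>D j. E x y"
    using assms(5) unfolding bip_minor_def by metis
  define D' where "D' i = (case i of 0 \<Rightarrow> {v} | Suc k \<Rightarrow> D k)" for i
  have "conn E (D' i) \<and> D' i \<subseteq> V" if "i < Suc s + 3" for i
    using D(1)[of "i - 1"] that assms(1,3) by (cases i) (auto simp: D'_def conn_singleton)
  moreover have "D' i \<inter> D' j = {}" if "i < Suc s + 3" "j < Suc s + 3" "i \<noteq> j" for i j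
    using D(2)[of "i - 1" "j - 1"] D(1)[of "i - 1"] D(1)[of "j - 1"] that assms(2)
    by (cases i; cases j) (auto simp: D'_def)
  moreover have "\<exists>x\<in>D' i. \<exists>y\<in>D' j. E x y" if "i < Suc s" "j \<in> {Suc s..<Suc s+3}" for i j
  proof (cases i)
    case 0
    have "j - 1 < s + 3" using that by auto
    then have "conn E (D (j - 1))" "D (j - 1) \<subseteq> W" using D(1)[of "j - 1"] by blast+
    then obtain y where "y \<in> D (j - 1)" "E v y" using assms(4) by (auto simp: conn_def)
    then show ?thesis using 0 that by (cases j) (auto simp: D'_def)
  next
    case (Suc k)
    then show ?thesis using D(3)[of k "j - 1"] that by (cases j) (auto simp: D'_def)
  qed
  ultimately show ?thesis unfolding bip_minor_def by (intro exI[of _ D']) blast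
qed

text \<open>The neighbourhood of a vertex has no K_{2,3} minor, as the vertex would complete it to
  K_{3,3}. Hence its average degree is below 6 and some neighbour shares at most 5 neighbours with
  the vertex. Contracting that edge loses at most 6 edges.\<close>

lemma K33_minor_free_degsum:
  assumes "finite V" "symp E" "irreflp E" "\<not> bip_minor 3 V E"
  shows "degsum E V \<le> 12 * card V"
  using assms
proof (induction "card V" arbitrary: V E rule: less_induct)
  case less
  have irr: "\<not> E x x" for x using less.prems(3) by (simp add: irreflp_def)
  have sym: "E x y \<Longrightarrow> E y x" for x y using less.prems(2) by (rule sympD)
  show ?case
  proof (cases "\<exists>u\<in>V. \<exists>v\<in>V. E u v")
    case False
    then have "nbr E V x = {}" if "x \<in> V" for x using that by (auto simp: nbr_def)
    then have "degsum E V = 0" by (simp add: degsum_def)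
    then show ?thesis by simp
  next
    case True
    then obtain v0 w0 where v0: "v0 \<in> V" "w0 \<in> V" "E v0 w0" by blast
    have "\<exists>u\<in>V. E v0 u \<and> card (nbr E V u \<inter> nbr E V v0) \<le> 5"
    proof (rule ccontr)
      let ?H = "nbr E V v0"
      assume neg: "\<not> ?thesis"
      have "6 \<le> card (nbr E ?H u)" if "u \<in> ?H" for u
      proof -
        have "nbr E ?H u = nbr E V u \<inter> nbr E V v0" by (auto simp: nbr_def)
        then show ?thesis using neg that by (auto simp: nbr_def)
      qed
      then have "6 * card ?H \<le> degsum E ?H"
        unfolding degsum_def using sum_bounded_below[of ?H 6 "\<lambda>u. card (nbr E ?H u)"] by (simp add: mult.commute)
      moreover have "degsum E ?H + 6 \<le> 6 * card ?H"
      proof (rule K23_minor_free_degsum)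
        show "\<not> bip_minor 2 ?H E"
        proof
          assume "bip_minor 2 ?H E"
          then have "bip_minor (Suc 2) V E"
            using v0(1) irr by (intro bip_minor_cone[of v0 V ?H]) (auto simp: nbr_def)
          then show False using less.prems(4) by simp
        qed
        show "?H \<noteq> {}" using v0 by (auto simp: nbr_def)
      qed (use less.prems in auto)
      ultimately show False by simp
    qed
    then obtain u where u: "u \<in> V" "E v0 u" "card (nbr E V u \<inter> nbr E V v0) \<le> 5" by blast
    have ne: "v0 \<noteq> u" using u irr by auto
    have "degsum (contract E v0 u) (V - {u}) \<le> 12 * card (V - {u})"
    proof (rule less.hyps)
      show "card (V - {u}) < card V" using less.prems u by (meson card_Diff1_less)
      show "\<not> bip_minor 3 (V - {u}) (contract E v0 u)"
        using bip_minor_contract[OF less.prems(2) u(2) v0(1) u(1) ne] less.prems(4) by blast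
    qed (use less.prems contract_props[OF less.prems(2,3)] in auto)
    moreover have "card V = card (V - {u}) + 1" using card_Suc_Diff1[OF less.prems(1) u(1)] by simp
    ultimately show ?thesis
      using degsum_contract[OF less.prems(1-3) u(2) v0(1) u(1)] u(3) by (simp add: Int_commute)
  qed
qed

lemma K33_minor_free_common_nbrs:
  assumes "finite V" "irreflp E" "symp E" "\<not> bip_minor 3 V E" "S \<subseteq> V" "card S = 3"
  shows "card (V \<inter> {y. \<forall>x\<in>S. E x y}) \<le> 2"
proof -
  have "V \<inter> {y. \<forall>x\<in>S. E x y} - S = V \<inter> {y. \<forall>x\<in>S. E x y}"
    using assms(2) by (auto simp: irreflp_def)
  moreover have "finite S" "S \<noteq> {}" using assms(6) by (auto intro: card_ge_0_finite)
  ultimately show ?thesis using bip_minor_singletons[of V S E] assms by fastforce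
qed

section \<open>The spectral radius\<close>

definition mv :: "'a ugraph \<Rightarrow> ('a \<Rightarrow> real) \<Rightarrow> 'a \<Rightarrow> real" where
  "mv G x u = (\<Sum>v\<in>verts G. adj_matrix G u v * x v)"

definition ip :: "'a ugraph \<Rightarrow> ('a \<Rightarrow> real) \<Rightarrow> ('a \<Rightarrow> real) \<Rightarrow> real" where
  "ip G x y = (\<Sum>v\<in>verts G. x v * y v)"

lemma ip_commute: "ip G x y = ip G y x"
  by (simp add: ip_def mult.commute)

lemma ip_add: "ip G (\<lambda>v. x v + t * y v) z = ip G x z + t * ip G y z"
  by (simp add: ip_def algebra_simps sum.distrib sum_distrib_left)

lemma mv_add: "mv G (\<lambda>v. x v + t * y v) = (\<lambda>u. mv G x u + t * mv G y u)"
  by (auto simp: mv_def algebra_simps sum.distrib sum_distrib_left)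

lemma mv_sym: "ip G (mv G x) y = ip G x (mv G y)"
proof -
  have "ip G (mv G x) y = (\<Sum>u\<in>verts G. \<Sum>v\<in>verts G. adj_matrix G u v * x v * y u)"
    by (simp add: ip_def mv_def sum_distrib_right)
  also have "\<dots> = (\<Sum>v\<in>verts G. \<Sum>u\<in>verts G. adj_matrix G u v * x v * y u)"
    by (rule sum.swap)
  also have "\<dots> = ip G x (mv G y)"
    by (simp add: ip_def mv_def sum_distrib_left adj_matrix_def insert_commute mult_ac)
  finally show ?thesis .
qed

lemma ip_self_pos: "finite (verts G) \<Longrightarrow> v \<in> verts G \<Longrightarrow> x v \<noteq> 0 \<Longrightarrow> ip G x x > 0"
  unfolding ip_def by (rule sum_pos2[of _ v]) (auto simp: zero_less_mult_iff)

lemma ip_self_nonneg: "ip G x x \<ge> 0"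
  unfolding ip_def by (rule sum_nonneg) auto

lemma ip_self_zero: "finite (verts G) \<Longrightarrow> ip G x x = 0 \<Longrightarrow> v \<in> verts G \<Longrightarrow> x v = 0"
  using ip_self_pos[of G v x] by fastforce

lemma is_eigenvalue_mv:
  "is_eigenvalue G mu \<longleftrightarrow> (\<exists>x. (\<exists>v\<in>verts G. x v \<noteq> 0) \<and> (\<forall>u\<in>verts G. mv G x u = mu * x u))"
  by (simp add: is_eigenvalue_def mv_def)

text \<open>Moving from \<open>x\<close> by \<open>t\<close> times the residual \<open>d\<close>
  changes the nonpositive form by 2 t |d|^2 + O(t^2), so small positive \<open>t\<close> forces
  \<open>d = 0\<close>.\<close>

lemma rayleigh_maximizer_eigen:
  assumes "finite (verts G)" "\<And>y. ip G y (mv G y) \<le> \<mu> * ip G y y" "ip G x (mv G x) = \<mu> * ip G x x" "u \<in> verts G"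
  shows "mv G x u = \<mu> * x u"
proof -
  define d where "d v = mv G x v + (- \<mu>) * x v" for v
  define C where "C = ip G d (mv G d) - \<mu> * ip G d d"
  have xd: "ip G x (mv G d) = ip G d (mv G x)" by (metis mv_sym ip_commute)
  have *: "2 * t * ip G d d + t\<^sup>2 * C \<le> 0" for t
  proof -
    let ?y = "\<lambda>v. x v + t * d v"
    have A: "ip G ?y (mv G ?y) = ip G x (mv G x) + 2 * t * ip G d (mv G x) + t\<^sup>2 * ip G d (mv G d)"
      by (simp add: mv_add ip_add ip_commute[of G x "\<lambda>u. mv G x u + t * mv G d u"] ip_commute[of G d "\<lambda>u. mv G x u + t * mv G d u"])
        (simp add: mv_sym ip_commute[of G "mv G d" x] ip_commute[of G "mv G x" d] ip_commute[of G "mv G x" x] ip_commute[of G "mv G d" d] power2_eq_square algebra_simps xd)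
    have B: "ip G ?y ?y = ip G x x + 2 * t * ip G d x + t\<^sup>2 * ip G d d"
      by (simp add: ip_add ip_commute[of G x "\<lambda>v. x v + t * d v"] ip_commute[of G d "\<lambda>v. x v + t * d v"])
        (simp add: ip_commute[of G x d] power2_eq_square algebra_simps)
    have D: "ip G d d = ip G d (mv G x) - \<mu> * ip G d x"
    proof -
      have "d = (\<lambda>v. mv G x v + (- \<mu>) * x v)" by (rule ext) (simp add: d_def)
      then have "ip G d d = ip G (mv G x) d + (- \<mu>) * ip G x d" using ip_add by metis
      then show ?thesis by (simp add: ip_commute)
    qed
    have "2 * t * ip G d d = 2 * t * ip G d (mv G x) - \<mu> * (2 * t * ip G d x)"
      by (simp add: D algebra_simps)
    then have "2 * t * ip G d d + t\<^sup>2 * C = ip G ?y (mv G ?y) - \<mu> * ip G ?y ?y"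
      unfolding A B C_def assms(3) by (simp add: algebra_simps)
    then show ?thesis using assms(2)[of ?y] by simp
  qed
  have "ip G d d = 0"
  proof (rule ccontr)
    assume "ip G d d \<noteq> 0"
    then have pos: "ip G d d > 0" using ip_self_nonneg[of G d] by simp
    \<comment> \<open>Small enough for the quadratic term to stay below the linear one whatever the
      sign of \<open>C\<close>; the 1 covers \<open>C = 0\<close>.\<close>
    define t where "t = ip G d d / (\<bar>C\<bar> + 1)"
    have t: "t > 0" using pos by (simp add: t_def)
    have "t * \<bar>C\<bar> < ip G d d" using pos by (simp add: t_def field_simps)
    then have "t * (t * \<bar>C\<bar>) < t * ip G d d" using t by (simp only: mult_less_cancel_left_pos)
    moreover have "- (t\<^sup>2 * C) \<le> t * (t * \<bar>C\<bar>)"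
      using t by (simp add: power2_eq_square abs_if mult.assoc)
    ultimately show False using *[of t] mult_pos_pos[OF t pos] by linarith
  qed
  then have "d u = 0" using ip_self_zero[OF assms(1) _ assms(4)] by blast
  then show ?thesis by (simp add: d_def)
qed

lemma exists_rayleigh_maximizer:
  assumes "finite (verts G)" "verts G \<noteq> {}"
  obtains \<mu> x where "ip G x x = 1" "ip G x (mv G x) = \<mu>" "\<And>y. ip G y (mv G y) \<le> \<mu> * ip G y y"
proof -
  let ?V = "verts G"
  \<comment> \<open>Vectors are functions on the whole type. Fixing them to 0 off the vertex set
    gives a compact product of intervals.\<close>
  define K where "K = PiE UNIV (\<lambda>v. if v \<in> ?V then {-1..1::real} else {0})"
  define S where "S = {x \<in> K. ip G x x = 1}"
  have "compactin (product_topology (\<lambda>i. euclidean) UNIV) K"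
    unfolding K_def by (subst compactin_PiE) auto
  then have "compact K" by (simp add: euclidean_product_topology)
  have cont: "continuous_on A (\<lambda>x :: 'a \<Rightarrow> real. x v)" for A v
    by (rule continuous_on_product_then_coordinatewise) (rule continuous_on_id)
  have cip: "continuous_on A (\<lambda>x. ip G x x)" for A
    unfolding ip_def by (intro continuous_intros cont)
  have cq: "continuous_on A (\<lambda>x. ip G x (mv G x))" for A
    unfolding ip_def mv_def by (intro continuous_intros cont)
  have "S = K \<inter> (\<lambda>x. ip G x x) -` {1}" by (auto simp: S_def)
  moreover have "closed ((\<lambda>x. ip G x x) -` {1})"
    by (rule closed_vimage[OF _ cip]) simp
  ultimately have "compact S" using \<open>compact K\<close> by (simp add: compact_Int_closed)
  have normalize: "\<exists>x\<in>S. ip G x (mv G x) = ip G y (mv G y) / ip G y y" if "ip G y y > 0" for y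
  proof -
    define c where "c = 1 / sqrt (ip G y y)"
    define x where "x v = (if v \<in> ?V then c * y v else 0)" for v
    have c2: "c * c = 1 / ip G y y" using that by (simp add: c_def)
    have "ip G x x = (c * c) * ip G y y"
      by (simp add: ip_def x_def sum_distrib_left mult_ac)
    then have 1: "ip G x x = 1" using c2 that by simp
    have "\<bar>x v\<bar> \<le> 1" if "v \<in> ?V" for v
    proof -
      have "x v * x v \<le> ip G x x" unfolding ip_def using that assms(1) by (intro member_le_sum) auto
      then show ?thesis using 1 using abs_square_le_1[of "x v"] by (simp add: power2_eq_square)
    qed
    then have "x \<in> K" by (auto simp: K_def PiE_def Pi_def x_def abs_le_iff)
    moreover have "ip G x (mv G x) = (c * c) * ip G y (mv G y)"
      by (simp add: ip_def mv_def x_def sum_distrib_left mult_ac)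
    ultimately show ?thesis using 1 c2 by (intro bexI[of _ x]) (auto simp: S_def)
  qed
  obtain v where "v \<in> ?V" using assms by blast
  then have "ip G (\<lambda>_. 1) (\<lambda>_. 1) > 0" using ip_self_pos[OF assms(1), of v "\<lambda>_. 1"] by simp
  then have "S \<noteq> {}" using normalize by blast
  then obtain x where x: "x \<in> S" "\<And>y. y \<in> S \<Longrightarrow> ip G y (mv G y) \<le> ip G x (mv G x)"
    using continuous_attains_sup[OF \<open>compact S\<close> _ cq] by blast
  have "ip G y (mv G y) \<le> ip G x (mv G x) * ip G y y" for y
  proof (cases "ip G y y > 0")
    case True
    then show ?thesis using normalize[OF True] x(2) by (metis divide_le_eq)
  next
    case False
    then have 0: "ip G y y = 0" using ip_self_nonneg[of G y] by simp
    then have "ip G y (mv G y) = 0"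
      using ip_self_zero[OF assms(1) 0] by (simp add: ip_def)
    then show ?thesis using 0 by simp
  qed
  then show ?thesis using that[of x "ip G x (mv G x)"] x(1) by (simp add: S_def)
qed

text \<open>\<open>spectral_radius\<close> is a \<open>Max\<close> and carries information only for
  a finite set. More than |V| eigenvalues would give more than |V| orthonormal eigenvectors; summing
  Bessel's inequality over the unit vectors refutes this.\<close>

lemma finite_eigenvalues:
  assumes "finite (verts G)"
  shows "finite {mu. is_eigenvalue G mu}"
proof (rule ccontr)
  let ?V = "verts G"
  assume "infinite {mu. is_eigenvalue G mu}"
  then obtain T where T: "finite T" "T \<subseteq> {mu. is_eigenvalue G mu}" "card T = Suc (card ?V)"
    using infinite_arbitrarily_large by metis
  have "\<exists>z. ip G z z = 1 \<and> (\<forall>u\<in>?V. mv G z u = l * z u)" if l: "l \<in> T" for l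
  proof -
    obtain x v where x: "v \<in> ?V" "x v \<noteq> 0" "\<forall>u\<in>?V. mv G x u = l * x u"
      using l T(2) unfolding is_eigenvalue_mv by blast
    define c where "c = 1 / sqrt (ip G x x)"
    have pos: "ip G x x > 0" using ip_self_pos[of G v x, OF assms x(1,2)] .
    have "ip G (\<lambda>v. c * x v) (\<lambda>v. c * x v) = c * c * ip G x x"
      by (simp add: ip_def sum_distrib_left mult_ac)
    then have "ip G (\<lambda>v. c * x v) (\<lambda>v. c * x v) = 1" using pos by (simp add: c_def)
    moreover have "mv G (\<lambda>v. c * x v) u = c * mv G x u" for u
      by (simp add: mv_def sum_distrib_left mult_ac)
    ultimately show ?thesis using x(3) by (intro exI[of _ "\<lambda>v. c * x v"]) auto
  qed
  then obtain z where z: "\<And>l. l \<in> T \<Longrightarrow> ip G (z l) (z l) = 1" "\<And>l u. l \<in> T \<Longrightarrow> u \<in> ?V \<Longrightarrow> mv G (z l) u = l * z l u"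
    by metis
  have orth: "ip G (z l) (z m) = (if l = m then 1 else 0)" if "l \<in> T" "m \<in> T" for l m
  proof (cases "l = m")
    case False
    have "ip G (mv G (z l)) (z m) = l * ip G (z l) (z m)" "ip G (z l) (mv G (z m)) = m * ip G (z l) (z m)"
      using z(2) that by (simp_all add: ip_def sum_distrib_left mult_ac)
    then show ?thesis using False mv_sym[of G "z l" "z m"] by simp
  qed (use z that in simp)
  \<comment> \<open>Here \<open>d\<close> is the unit vector at \<open>v\<close> and
    \<open>s\<close> its projection onto the span of the \<open>z l\<close>; the squared distance
    equals \<open>1 - s v\<close>.\<close>
  have bessel: "(\<Sum>l\<in>T. (z l v)\<^sup>2) \<le> 1" if v: "v \<in> ?V" for v
  proof -
    define s where "s u = (\<Sum>l\<in>T. z l v * z l u)" for u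
    define d where "d u = (if u = v then 1 else 0 :: real)" for u
    have "0 \<le> (\<Sum>u\<in>?V. (d u - s u)\<^sup>2)" by (rule sum_nonneg) auto
    also have "\<dots> = (\<Sum>u\<in>?V. d u) - 2 * (\<Sum>u\<in>?V. d u * s u) + (\<Sum>u\<in>?V. s u * s u)"
    proof -
      have "(d u - s u)\<^sup>2 = d u - 2 * (d u * s u) + s u * s u" for u
        by (simp add: d_def power2_eq_square algebra_simps)
      then show ?thesis by (simp add: sum.distrib sum_subtractf sum_distrib_left)
    qed
    also have "(\<Sum>u\<in>?V. d u) = 1" using assms v by (simp add: d_def)
    also have "(\<Sum>u\<in>?V. d u * s u) = s v"
      using assms v by (simp add: d_def if_distrib[of "\<lambda>x. x * _"] cong: if_cong)
    also have "(\<Sum>u\<in>?V. s u * s u) = (\<Sum>u\<in>?V. \<Sum>l\<in>T. \<Sum>m\<in>T. z l v * z m v * (z l u * z m u))"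
      by (simp add: s_def sum_product mult_ac)
    also have "\<dots> = (\<Sum>l\<in>T. \<Sum>m\<in>T. \<Sum>u\<in>?V. z l v * z m v * (z l u * z m u))"
      by (subst sum.swap) (simp add: sum.swap[of _ ?V])
    also have "\<dots> = (\<Sum>l\<in>T. \<Sum>m\<in>T. z l v * z m v * ip G (z l) (z m))"
      by (simp add: ip_def sum_distrib_left)
    also have "\<dots> = (\<Sum>l\<in>T. \<Sum>m\<in>T. if l = m then z l v * z m v else 0)"
      by (intro sum.cong refl) (simp add: orth)
    also have "\<dots> = s v" using T(1) by (simp add: s_def)
    finally show ?thesis by (simp add: s_def power2_eq_square)
  qed
  have "(\<Sum>l\<in>T. ip G (z l) (z l)) = (\<Sum>v\<in>?V. \<Sum>l\<in>T. (z l v)\<^sup>2)"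
    by (simp add: ip_def power2_eq_square) (rule sum.swap)
  also have "\<dots> \<le> (\<Sum>v\<in>?V. 1)" by (intro sum_mono bessel)
  finally show False using T z(1) by simp
qed

context
  fixes G :: "'a ugraph"
  assumes fin: "finite (verts G)" and ne: "verts G \<noteq> {}"
begin

lemma spectral_radius_rayleigh:
  shows "ip G y (mv G y) \<le> spectral_radius G * ip G y y"
    and "\<exists>x. ip G x x = 1 \<and> ip G x (mv G x) = spectral_radius G"
proof -
  obtain \<mu> x where *: "ip G x x = 1" "ip G x (mv G x) = \<mu>" "\<And>y. ip G y (mv G y) \<le> \<mu> * ip G y y"
    using exists_rayleigh_maximizer[OF fin ne] by blast
  have ev: "\<forall>u\<in>verts G. mv G x u = \<mu> * x u"
    using rayleigh_maximizer_eigen[OF fin *(3)] * by simp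
  have "\<exists>v\<in>verts G. x v \<noteq> 0"
  proof (rule ccontr)
    assume "\<not> ?thesis" then have "ip G x x = 0" by (simp add: ip_def)
    then show False using *(1) by simp
  qed
  then have "is_eigenvalue G \<mu>" using ev unfolding is_eigenvalue_mv by blast
  moreover have "l \<le> \<mu>" if "is_eigenvalue G l" for l
  proof -
    obtain z v where z: "v \<in> verts G" "z v \<noteq> 0" "\<forall>u\<in>verts G. mv G z u = l * z u"
      using \<open>is_eigenvalue G l\<close> unfolding is_eigenvalue_mv by blast
    have "ip G z (mv G z) = l * ip G z z" using z(3) by (simp add: ip_def sum_distrib_left mult_ac)
    then have "l * ip G z z \<le> \<mu> * ip G z z" using *(3)[of z] by simp
    then show ?thesis using ip_self_pos[of G v z, OF fin z(1,2)] by simp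
  qed
  ultimately have "spectral_radius G = \<mu>"
    unfolding spectral_radius_def using finite_eigenvalues[OF fin] by (intro Max_eqI) auto
  then show "ip G y (mv G y) \<le> spectral_radius G * ip G y y"
    "\<exists>x. ip G x x = 1 \<and> ip G x (mv G x) = spectral_radius G" using * by auto
qed

lemma spectral_radius_eigen:
  assumes "ip G x (mv G x) \<ge> spectral_radius G * ip G x x" "u \<in> verts G"
  shows "mv G x u = spectral_radius G * x u"
  using rayleigh_maximizer_eigen[OF fin spectral_radius_rayleigh(1) _ assms(2)] assms(1)
    spectral_radius_rayleigh(1)[of x] by fastforce

text \<open>Taking absolute values in a maximizer keeps the norm and does not lower the quadratic
  form, since the matrix has no negative entries. The result is again a maximizer, so an
  eigenvector.\<close>

lemma perron_vector:
  obtains x where "\<And>v. x v \<ge> 0" "\<exists>v\<in>verts G. x v > 0" "\<And>u. u \<in> verts G \<Longrightarrow> mv G x u = spectral_radius G * x u"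
proof -
  obtain x where x: "ip G x x = 1" "ip G x (mv G x) = spectral_radius G"
    using spectral_radius_rayleigh(2) by blast
  define y where "y v = \<bar>x v\<bar>" for v
  have "ip G y y = 1" using x(1) by (simp add: y_def ip_def)
  moreover have "ip G x (mv G x) \<le> ip G y (mv G y)"
    unfolding ip_def mv_def sum_distrib_left
    by (intro sum_mono) (auto simp: y_def adj_matrix_def abs_mult[symmetric])
  ultimately have "\<And>u. u \<in> verts G \<Longrightarrow> mv G y u = spectral_radius G * y u"
    using spectral_radius_eigen[of y] x by simp
  moreover have "\<exists>v\<in>verts G. y v > 0"
  proof (rule ccontr)
    assume "\<not> ?thesis"
    then have "ip G x x = 0" by (auto simp: y_def ip_def intro!: sum.neutral)
    then show False using x(1) by simp
  qed
  ultimately show ?thesis using that[of y] by (simp add: y_def)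
qed

text \<open>Serves to bound the set whose supremum defines \<open>spex_planar\<close>; the estimate
  is 2 a b <= a^2 + b^2 on each entry.\<close>

lemma spectral_radius_le_card: "spectral_radius G \<le> card (verts G)"
proof -
  obtain x where x: "ip G x x = 1" "ip G x (mv G x) = spectral_radius G"
    using spectral_radius_rayleigh(2) by blast
  have "ip G x (mv G x) \<le> (\<Sum>u\<in>verts G. \<Sum>v\<in>verts G. (x u * x u + x v * x v) / 2)"
    unfolding ip_def mv_def sum_distrib_left
  proof (intro sum_mono)
    fix u v
    have "0 \<le> (x u - x v)\<^sup>2" by simp
    then have "x u * x v \<le> (x u * x u + x v * x v) / 2" by (simp add: power2_eq_square algebra_simps)
    then show "x u * (adj_matrix G u v * x v) \<le> (x u * x u + x v * x v) / 2"
      by (auto simp: adj_matrix_def)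
  qed
  also have "\<dots> = card (verts G) * ip G x x"
    by (simp add: ip_def add_divide_distrib sum.distrib flip: sum_divide_distrib sum_distrib_left)
  finally show ?thesis using x by simp
qed

end

section \<open>Invariance under relabelling of the vertices\<close>

lemma is_eigenvalue_bij:
  assumes "bij_betw f (verts G) (verts H)"
    and "\<And>u v. \<lbrakk>u \<in> verts G; v \<in> verts G\<rbrakk> \<Longrightarrow> {u, v} \<in> edges G \<longleftrightarrow> {f u, f v} \<in> edges H"
    and "is_eigenvalue H mu"
  shows "is_eigenvalue G mu"
proof -
  obtain x v where x: "v \<in> verts H" "x v \<noteq> 0" "\<And>u. u \<in> verts H \<Longrightarrow> mv H x u = mu * x u"
    using assms(3) unfolding is_eigenvalue_mv by blast
  have "mv G (x \<circ> f) u = mu * (x \<circ> f) u" if "u \<in> verts G" for u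
  proof -
    have "mv G (x \<circ> f) u = (\<Sum>v\<in>verts G. adj_matrix H (f u) (f v) * x (f v))"
      unfolding mv_def using assms(2) that by (intro sum.cong) (auto simp: adj_matrix_def)
    also have "\<dots> = mv H x (f u)"
      unfolding mv_def using assms(1) by (rule sum.reindex_bij_betw)
    finally show ?thesis using x(3)[of "f u"] assms(1) that by (auto simp: bij_betw_def)
  qed
  moreover obtain w where "w \<in> verts G" "f w = v" using x(1) assms(1) by (metis bij_betw_imp_surj_on imageE)
  ultimately show ?thesis using x(2) unfolding is_eigenvalue_mv by (intro exI[of _ "x \<circ> f"]) auto
qed

lemma spectral_radius_iso:
  assumes "graph_iso G H"
  shows "spectral_radius G = spectral_radius H"
proof -
  obtain f where f: "bij_betw f (verts G) (verts H)"
    "\<And>u v. \<lbrakk>u \<in> verts G; v \<in> verts G\<rbrakk> \<Longrightarrow> {u, v} \<in> edges G \<longleftrightarrow> {f u, f v} \<in> edges H"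
    using assms unfolding graph_iso_def by blast
  let ?g = "inv_into (verts G) f"
  have g: "bij_betw ?g (verts H) (verts G)" using f(1) by (rule bij_betw_inv_into)
  have gv: "?g u \<in> verts G" "f (?g u) = u" if "u \<in> verts H" for u
    using bij_betw_inv_into_right[OF f(1) that] bij_betwE[OF g] that by auto
  have "is_eigenvalue G mu \<longleftrightarrow> is_eigenvalue H mu" for mu
  proof
    show "is_eigenvalue H mu \<Longrightarrow> is_eigenvalue G mu" using is_eigenvalue_bij[OF f] .
    show "is_eigenvalue G mu \<Longrightarrow> is_eigenvalue H mu"
      by (rule is_eigenvalue_bij[OF g]) (use f(2)[OF gv(1) gv(1)] gv in auto)
  qed
  then show ?thesis by (simp add: spectral_radius_def)
qed

definition relabel :: "('a \<Rightarrow> 'b) \<Rightarrow> 'a ugraph \<Rightarrow> 'b ugraph" where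
  "relabel h G = (h ` verts G, (`) h ` edges G)"

lemma relabel_sel: "verts (relabel h G) = h ` verts G" "edges (relabel h G) = (`) h ` edges G"
  by (simp_all add: relabel_def verts_def edges_def)

text \<open>\<open>spex_planar\<close> ranges over graphs on natural numbers only; an injection into
  \<open>nat\<close> carries a graph on any vertex type there. The drawing is reused by pulling
  edges back along the inverse.\<close>

lemma planar_F_free_class_relabel:
  assumes "planar_F_free_class n F G" and hinj: "inj_on h (verts G)"
  shows "planar_F_free_class n F (relabel h G)" "graph_iso G (relabel h G)"
proof -
  let ?H = "relabel h G" and ?g = "inv_into (verts G) h"
  have G: "simple_graph G" "card (verts G) = n" "planar G" "F_free G F"
    using assms(1) by (auto simp: planar_F_free_class_def)
  have edgeV: "e \<subseteq> verts G" if "e \<in> edges G" for e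
    using G(1) that unfolding simple_graph_def by fastforce
  have ginv: "?g ` h ` e = e" if "e \<subseteq> verts G" for e
    using that hinj by (force simp: image_image)
  have g1: "?g (h u) = u" if "u \<in> verts G" for u using that hinj by simp
  have simpleH: "simple_graph ?H"
    unfolding simple_graph_def relabel_sel
  proof (intro conjI ballI)
    show "finite (h ` verts G)" using G(1) by (simp add: simple_graph_def)
    fix e assume "e \<in> (`) h ` edges G"
    then obtain u v where uv: "u \<in> verts G" "v \<in> verts G" "u \<noteq> v" "e = h ` {u, v}"
      using G(1) unfolding simple_graph_def by fastforce
    then have "h u \<noteq> h v" using hinj by (auto dest: inj_onD)
    then show "\<exists>u v. u \<in> h ` verts G \<and> v \<in> h ` verts G \<and> u \<noteq> v \<and> e = {u, v}" using uv by auto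
  qed
  have "\<exists>f \<gamma>. embedded_graph G f \<gamma>" using planar_embedded[OF G(1,3)] by blast
  then obtain f \<gamma> where "embedded_graph G f \<gamma>" by blast
  then interpret embedded_graph G f \<gamma> .
  note f = inj edge vertex cross
  have planar: "planar ?H"
    unfolding planar_def relabel_sel
  proof (intro exI[of _ "f \<circ> ?g"] exI[of _ "\<lambda>e. \<gamma> (?g ` e)"] conjI ballI impI)
    show "inj_on (f \<circ> ?g) (h ` verts G)"
      by (rule comp_inj_on) (use f(1) ginv[of "verts G"] in \<open>simp_all add: inj_on_inv_into\<close>)
  next
    fix e assume "e \<in> (`) h ` edges G"
    then obtain d where d: "d \<in> edges G" "e = h ` d" by blast
    obtain u v where uv: "d = {u, v}" "arc (\<gamma> d)" "pathstart (\<gamma> d) = f u" "pathfinish (\<gamma> d) = f v"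
      using f(2)[OF d(1)] by blast
    then have "u \<in> verts G" "v \<in> verts G" using edgeV[OF d(1)] by auto
    then show "\<exists>u v. e = {u, v} \<and> arc (\<gamma> (?g ` e)) \<and> pathstart (\<gamma> (?g ` e)) = (f \<circ> ?g) u \<and>
        pathfinish (\<gamma> (?g ` e)) = (f \<circ> ?g) v"
      using uv d ginv[OF edgeV[OF d(1)]] g1 by (intro exI[of _ "h u"] exI[of _ "h v"]) auto
  next
    fix e w assume "e \<in> (`) h ` edges G" "w \<in> h ` verts G" and w: "(f \<circ> ?g) w \<in> path_image (\<gamma> (?g ` e))"
    then obtain d x where d: "d \<in> edges G" "e = h ` d" "x \<in> verts G" "w = h x" by blast
    then show "w \<in> e" using f(3)[of d x] w ginv[OF edgeV[OF d(1)]] g1 by auto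
  next
    fix e e' assume "e \<in> (`) h ` edges G" "e' \<in> (`) h ` edges G" "e \<noteq> e'"
    then obtain d d' where d: "d \<in> edges G" "e = h ` d" "d' \<in> edges G" "e' = h ` d'" "d \<noteq> d'" by blast
    then have "path_image (\<gamma> d) \<inter> path_image (\<gamma> d') \<subseteq> f ` (d \<inter> d')" using f(4) by blast
    also have "d \<inter> d' = ?g ` h ` (d \<inter> d')" using ginv[of "d \<inter> d'"] edgeV[OF d(1)] by blast
    also have "h ` (d \<inter> d') = e \<inter> e'"
      using d inj_on_image_Int[OF hinj edgeV[OF d(1)] edgeV[OF d(3)]] by simp
    finally show "path_image (\<gamma> (?g ` e)) \<inter> path_image (\<gamma> (?g ` e')) \<subseteq> (f \<circ> ?g) ` (e \<inter> e')"
      using d ginv[OF edgeV[OF d(1)]] ginv[OF edgeV[OF d(3)]] by (simp add: image_comp)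
  qed
  have "F_free ?H F"
    unfolding F_free_def contains_subgraph_def relabel_sel
  proof
    assume "\<exists>\<phi>. inj_on \<phi> (verts F) \<and> \<phi> ` verts F \<subseteq> h ` verts G \<and> (\<forall>e\<in>edges F. \<phi> ` e \<in> (`) h ` edges G)"
    then obtain \<phi> where \<phi>: "inj_on \<phi> (verts F)" "\<phi> ` verts F \<subseteq> h ` verts G" "\<forall>e\<in>edges F. \<phi> ` e \<in> (`) h ` edges G"
      by blast
    have "inj_on (?g \<circ> \<phi>) (verts F)"
      using \<phi>(1,2) inj_on_inv_into[of "h ` verts G" h "verts G"] by (intro comp_inj_on) (auto intro: inj_on_subset)
    moreover have "(?g \<circ> \<phi>) ` verts F \<subseteq> verts G" using \<phi>(2) g1 by (force simp: image_subset_iff)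
    moreover have "(?g \<circ> \<phi>) ` e \<in> edges G" if e: "e \<in> edges F" for e
    proof -
      have "\<phi> ` e \<in> (`) h ` edges G" using \<phi>(3) e by simp
      then obtain d where "d \<in> edges G" "\<phi> ` e = h ` d" by (elim imageE) simp
      then show ?thesis using ginv[OF edgeV[of d]] unfolding image_comp[symmetric] by simp
    qed
    ultimately have "contains_subgraph G F" unfolding contains_subgraph_def by blast
    then show False using G(4) by (simp add: F_free_def)
  qed
  then show "planar_F_free_class n F ?H"
    using simpleH planar G(2) hinj by (simp add: planar_F_free_class_def relabel_sel card_image)
  have "{u, v} \<in> edges G \<longleftrightarrow> h ` {u, v} \<in> (`) h ` edges G" if uv: "u \<in> verts G" "v \<in> verts G" for u v
  proof
    assume "h ` {u, v} \<in> (`) h ` edges G"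
    then obtain d where "d \<in> edges G" "h ` {u, v} = h ` d" by blast
    then show "{u, v} \<in> edges G" using ginv[of d] ginv[of "{u, v}"] edgeV uv by auto
  qed (rule imageI)
  then show "graph_iso G ?H"
    unfolding graph_iso_def relabel_sel using hinj by (intro exI[of _ h]) (auto simp: bij_betw_def)
qed

lemma spectral_radius_le_spex:
  assumes "planar_F_free_class n F (G :: 'a ugraph)" "n > 0"
  shows "spectral_radius G \<le> spex_planar n F"
proof -
  have "finite (verts G)" using assms by (auto simp: planar_F_free_class_def simple_graph_def)
  then obtain h :: "'a \<Rightarrow> nat" where h: "inj_on h (verts G)"
    using finite_imp_inj_to_nat_seg by metis
  have "bdd_above (spectral_radius ` {H :: nat ugraph. planar_F_free_class n F H})"
  proof (rule bdd_aboveI2)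
    fix H :: "nat ugraph" assume "H \<in> {H. planar_F_free_class n F H}"
    then have H: "finite (verts H)" "card (verts H) = n"
      by (auto simp: planar_F_free_class_def simple_graph_def)
    then have "verts H \<noteq> {}" using assms(2) by auto
    then show "spectral_radius H \<le> real n" using spectral_radius_le_card[OF H(1)] H(2) by simp
  qed
  then show ?thesis
    unfolding spex_planar_def spectral_radius_iso[OF planar_F_free_class_relabel(2)[OF assms(1) h]]
    by (rule cSUP_upper[rotated]) (simp add: planar_F_free_class_relabel(1)[OF assms(1) h])
qed

text \<open>A crude Bonferroni bound: each new set overlaps the union of the earlier ones in at most
  \<open>c\<close> elements per earlier set.\<close>

lemma sum_card_le_card_Union:
  assumes "finite I" "\<And>i. i \<in> I \<Longrightarrow> finite (A i)"
    and "\<And>i j. \<lbrakk>i \<in> I; j \<in> I; i \<noteq> j\<rbrakk> \<Longrightarrow> card (A i \<inter> A j) \<le> c"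
  shows "(\<Sum>i\<in>I. card (A i)) \<le> card (\<Union>(A ` I)) + c * (card I)\<^sup>2"
  using assms
proof (induction I rule: finite_induct)
  case (insert j I)
  let ?U = "\<Union>(A ` I)"
  have "(\<Sum>i\<in>I. card (A i)) \<le> card ?U + c * (card I)\<^sup>2" using insert by simp
  moreover have "card ?U + card (A j) = card (?U \<union> A j) + card (?U \<inter> A j)"
    using insert by (intro card_Un_Int) auto
  moreover have "card (?U \<inter> A j) \<le> c * card I"
  proof -
    have "?U \<inter> A j = (\<Union>i\<in>I. A i \<inter> A j)" by auto
    also have "card \<dots> \<le> (\<Sum>i\<in>I. card (A i \<inter> A j))" using insert(1) by (rule card_UN_le)
    also have "\<dots> \<le> (\<Sum>i\<in>I. c)" using insert by (intro sum_mono) auto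
    finally show ?thesis by (simp add: mult.commute)
  qed
  moreover have "c * (card I)\<^sup>2 + c * card I \<le> c * (card (insert j I))\<^sup>2"
    using insert(1,2) by (simp add: power2_eq_square algebra_simps)
  moreover have U: "\<Union>(A ` insert j I) = ?U \<union> A j" by auto
  moreover have S: "(\<Sum>i\<in>insert j I. card (A i)) = card (A j) + (\<Sum>i\<in>I. card (A i))" using insert(1,2) by simp
  ultimately show ?case unfolding U S by linarith
qed simp

lemma sum_Un_le:
  fixes f :: "'a \<Rightarrow> real"
  assumes "finite A" "finite B" "\<And>b. b \<in> A \<union> B \<Longrightarrow> 0 \<le> f b"
  shows "sum f (A \<union> B) \<le> sum f A + sum f B"
  using sum_Un[OF assms(1,2), of f] sum_nonneg[of "A \<inter> B" f] assms(3) by simp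

section \<open>The two dominating vertices\<close>

text \<open>The eigenvector is scaled to have maximum 1, attained at \<open>u\<close>. The lower
  bound on \<open>\<rho>\<close> comes from comparison with the join of an edge and
  \<open>n - 2\<close> isolated vertices. \<open>n\<close> is real for the sake of the
  estimates.\<close>

locale eigen_graph =
  fixes V :: "'a set" and E :: "'a \<Rightarrow> 'a \<Rightarrow> bool" and x :: "'a \<Rightarrow> real" and \<rho> n :: real and u :: 'a
  assumes fin: "finite V" and n: "n = card V" and sym: "symp E" and irr: "irreflp E"
    and free: "\<not> bip_minor 3 V E"
    and x0: "a \<in> V \<Longrightarrow> 0 \<le> x a" and x1: "a \<in> V \<Longrightarrow> x a \<le> 1" and u: "u \<in> V" "x u = 1"
    and eigen: "a \<in> V \<Longrightarrow> (\<Sum>b\<in>nbr E V a. x b) = \<rho> * x a"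
    and \<rho>0: "\<rho> > 0" and \<rho>: "\<rho>\<^sup>2 \<ge> 2 * n - 4" and large: "n \<ge> 44 * 10 ^ 15"
begin

abbreviation "N \<equiv> nbr E V"
abbreviation "d a \<equiv> real (card (N a))"
abbreviation "codeg a w \<equiv> real (card (N a \<inter> N w))"

lemma irrE: "\<not> E a a" using irr by (simp add: irreflp_def)
lemma symE': "E a b \<Longrightarrow> E b a" using sym by (rule sympD)
lemma N_sub: "N a \<subseteq> V" by (auto simp: nbr_def)
lemma finN: "finite (N a)" using fin by simp

lemma degsum_le: "W \<subseteq> V \<Longrightarrow> real (degsum E W) \<le> 12 * real (card W)"
  using K33_minor_free_degsum[of W E] bip_minor_mono[of 3 W E V] fin sym irr free finite_subset
  by (metis of_nat_le_iff of_nat_mult of_nat_numeral)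

lemma degsum_V: "(\<Sum>a\<in>V. d a) \<le> 12 * n"
  using degsum_le[of V] by (simp add: degsum_def n)

lemma common_nbrs_le_2:
  assumes "a \<in> V" "b \<in> V" "c \<in> V" "a \<noteq> b" "b \<noteq> c" "a \<noteq> c"
  shows "card (N a \<inter> N b \<inter> N c) \<le> 2"
proof -
  have "V \<inter> {y. \<forall>z\<in>{a, b, c}. E z y} = N a \<inter> N b \<inter> N c" by (auto simp: nbr_def)
  moreover have "card {a, b, c} = 3" using assms by simp
  ultimately show ?thesis
    using K33_minor_free_common_nbrs[OF fin irr sym free, of "{a, b, c}"] assms by auto
qed

lemma two_step:
  assumes "a \<in> V"
  shows "\<rho>\<^sup>2 * x a = (\<Sum>y\<in>N a. \<Sum>w\<in>N y. x w)"
proof -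
  have "\<rho>\<^sup>2 * x a = \<rho> * (\<Sum>y\<in>N a. x y)" using eigen[OF assms] by (simp add: power2_eq_square)
  also have "\<dots> = (\<Sum>y\<in>N a. \<rho> * x y)" by (simp add: sum_distrib_left)
  also have "\<dots> = (\<Sum>y\<in>N a. \<Sum>w\<in>N y. x w)"
    using eigen N_sub by (intro sum.cong refl) (metis subsetD)
  finally show ?thesis .
qed

text \<open>Walks of length two from \<open>a\<close>, grouped by their end.\<close>

lemma two_step_codeg:
  assumes "a \<in> V"
  shows "(\<Sum>y\<in>N a. \<Sum>w\<in>N y. f w) = (\<Sum>w\<in>V. codeg a w * f w)"
proof -
  have "(\<Sum>y\<in>N a. \<Sum>w\<in>N y. f w) = (\<Sum>y\<in>N a. \<Sum>w\<in>V. if E y w then f w else 0)"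
  proof (rule sum.cong[OF refl])
    fix y show "(\<Sum>w\<in>N y. f w) = (\<Sum>w\<in>V. if E y w then f w else 0)"
      unfolding nbr_def by (rule sum.inter_filter[OF fin])
  qed
  also have "\<dots> = (\<Sum>w\<in>V. \<Sum>y\<in>N a. if E y w then f w else 0)" by (rule sum.swap)
  also have "\<dots> = (\<Sum>w\<in>V. codeg a w * f w)"
  proof (intro sum.cong refl)
    fix w
    have "{y \<in> N a. E y w} = N a \<inter> N w" using symE' by (auto simp: nbr_def)
    then show "(\<Sum>y\<in>N a. if E y w then f w else 0) = codeg a w * f w"
      using finN by (simp add: sum.inter_filter[symmetric])
  qed
  finally show ?thesis .
qed

lemma sum_deg_nbrs: "(\<Sum>y\<in>N a. d y) \<le> 12 * n"
  using sum_mono2[OF fin N_sub, of a d] degsum_V by simp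

text \<open>(296 * 10^6)^2 is slightly below 2 * 44 * 10^15 - 4.\<close>

lemma rho_ge: "\<rho> \<ge> 296 * 10 ^ 6"
proof (rule ccontr)
  assume "\<not> ?thesis"
  then have "\<rho>\<^sup>2 < (296 * 10 ^ 6)\<^sup>2" using \<rho>0 by (intro power_strict_mono) auto
  then show False using \<rho> large by simp
qed

text \<open>The two thresholds are needed in succession: \<open>card_L'\<close> makes vertices of \<open>L\<close> have degree linear in
  \<open>n\<close>, hence \<open>L\<close> has bounded size.\<close>

definition "L' = {v \<in> V. x v \<ge> 1 / 3000}"
definition "L = {v \<in> V. x v \<ge> 1 / 250}"

lemma L_sub: "L' \<subseteq> V" "L \<subseteq> V" "finite L'" "finite L"
  using fin by (auto simp: L'_def L_def)

text \<open>Summing the eigenvalue equation over all vertices gives \<open>\<rho>\<close> times the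
  sum of the entries, at most 12 n. So \<open>L'\<close> has at most 36000 n / \<open>\<rho>\<close>
  elements, and 12 * 36000 / 296000000 is below 0.00146.\<close>

lemma card_L': "real (card L') * 12 \<le> 1.46 / 1000 * n"
proof -
  have "real (card L') * (\<rho> / 3000) = (\<Sum>v\<in>L'. \<rho> / 3000)" by simp
  also have "\<dots> \<le> (\<Sum>v\<in>L'. \<rho> * x v)"
    using \<rho>0 by (intro sum_mono) (auto simp: L'_def mult_left_mono[of "1/3000" _ \<rho>, simplified])
  also have "\<dots> \<le> (\<Sum>v\<in>V. \<rho> * x v)" using fin L_sub(1) x0 \<rho>0 by (intro sum_mono2) auto
  also have "\<dots> = (\<Sum>v\<in>V. \<Sum>b\<in>N v. x b)" using eigen by simp
  also have "\<dots> \<le> (\<Sum>v\<in>V. \<Sum>b\<in>N v. 1)" using x1 N_sub by (intro sum_mono) (metis subsetD)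
  also have "\<dots> \<le> 12 * n" using degsum_V by simp
  finally have "real (card L') * \<rho> \<le> 36000 * n" by simp
  moreover have "real (card L') * (296 * 10 ^ 6) \<le> real (card L') * \<rho>"
    using rho_ge by (intro mult_left_mono) auto
  ultimately show ?thesis by simp
qed

text \<open>In the two-step sum, entries below 1/3000 contribute at most 12 n / 3000, and the rest
  is counted by edges inside \<open>N v \<union> L'\<close>. The left side is about 0.008 n, so 12
  times the degree is at least about 0.008 n - 0.004 n - 0.00146 n.\<close>

lemma deg_ge:
  assumes "v \<in> L"
  shows "d v \<ge> n / 5000"
proof -
  have v: "v \<in> V" "x v \<ge> 1 / 250" using assms by (auto simp: L_def)
  have "\<rho>\<^sup>2 / 250 \<le> \<rho>\<^sup>2 * x v" using mult_left_mono[OF v(2), of "\<rho>\<^sup>2"] by simp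
  also have "\<dots> = (\<Sum>y\<in>N v. \<Sum>w\<in>N y. x w)" by (rule two_step[OF v(1)])
  also have "\<dots> \<le> (\<Sum>y\<in>N v. d y / 3000 + real (card (nbr E (N v \<union> L') y)))"
  proof (intro sum_mono)
    fix y
    have "(\<Sum>w\<in>N y. x w) \<le> (\<Sum>w\<in>N y. 1 / 3000 + (if w \<in> L' then 1 else 0))"
    proof (intro sum_mono)
      fix w assume "w \<in> N y"
      then have "w \<in> V" using N_sub by blast
      then show "x w \<le> 1 / 3000 + (if w \<in> L' then 1 else 0)" using x1[of w] by (auto simp: L'_def)
    qed
    also have "\<dots> = d y / 3000 + real (card (N y \<inter> L'))"
      using finN by (simp add: sum.distrib sum.If_cases)
    also have "card (N y \<inter> L') \<le> card (nbr E (N v \<union> L') y)"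
      using finN L_sub by (intro card_mono) (auto simp: nbr_def)
    finally show "(\<Sum>w\<in>N y. x w) \<le> d y / 3000 + real (card (nbr E (N v \<union> L') y))" by simp
  qed
  also have "\<dots> = (\<Sum>y\<in>N v. d y) / 3000 + (\<Sum>y\<in>N v. real (card (nbr E (N v \<union> L') y)))"
    by (simp add: sum.distrib sum_divide_distrib)
  also have "(\<Sum>y\<in>N v. real (card (nbr E (N v \<union> L') y))) \<le> (\<Sum>y\<in>N v \<union> L'. real (card (nbr E (N v \<union> L') y)))"
    using finN L_sub by (intro sum_mono2) auto
  also have "\<dots> = real (degsum E (N v \<union> L'))" by (simp add: degsum_def)
  also have "\<dots> \<le> 12 * real (card (N v \<union> L'))" using N_sub L_sub by (intro degsum_le) auto
  also have "real (card (N v \<union> L')) \<le> d v + real (card L')" using card_Un_le[of "N v" L'] by linarith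
  finally have "\<rho>\<^sup>2 / 250 \<le> (\<Sum>y\<in>N v. d y) / 3000 + 12 * (d v + real (card L'))" by simp
  then show ?thesis using sum_deg_nbrs[of v] card_L' \<rho> large by simp
qed

lemma card_L: "real (card L) \<le> 60000"
proof -
  have "real (card L) * (n / 5000) \<le> (\<Sum>v\<in>L. d v)"
    using deg_ge sum_mono[of L "\<lambda>_. n / 5000" d] by simp
  also have "\<dots> \<le> (\<Sum>v\<in>V. d v)" using fin L_sub by (intro sum_mono2) auto
  also have "\<dots> \<le> 12 * n" by (rule degsum_V)
  finally show ?thesis using large by simp
qed

text \<open>Codegrees of \<open>a\<close> with the large vertices add up to little more than the
  degree of \<open>a\<close>: the sets \<open>N a \<inter> N w\<close> pairwise share at most two
  elements by the absence of K_{3,3}, and 2 * 60000^2 is below n / 10^6. Vertices outside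
  \<open>L\<close> have entries below 1/250 and total codegree at most 12 n.\<close>

lemma two_step_le:
  assumes a: "a \<in> V" and m: "\<And>w. w \<in> L - {a} \<Longrightarrow> x w \<le> m" "0 \<le> m"
  shows "\<rho>\<^sup>2 * x a \<le> d a * x a + m * (d a + n / 10 ^ 6) + 12 / 250 * n"
proof -
  have "\<rho>\<^sup>2 * x a = (\<Sum>w\<in>V. codeg a w * x w)" using two_step[OF a] two_step_codeg[OF a] by simp
  also have "\<dots> = d a * x a + (\<Sum>w\<in>V - {a}. codeg a w * x w)"
    using fin a by (simp add: sum.remove)
  also have "(\<Sum>w\<in>V - {a}. codeg a w * x w) = (\<Sum>w\<in>L - {a}. codeg a w * x w) + (\<Sum>w\<in>V - {a} - (L - {a}). codeg a w * x w)"
    using fin L_sub by (intro sum.subset_diff[THEN trans]) (auto simp: add.commute)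
  also have "(\<Sum>w\<in>L - {a}. codeg a w * x w) \<le> (\<Sum>w\<in>L - {a}. codeg a w * m)"
    using m by (intro sum_mono mult_left_mono) auto
  also have "\<dots> = m * real (\<Sum>w\<in>L - {a}. card (N a \<inter> N w))"
    by (simp add: sum_distrib_left mult.commute)
  also have "\<dots> \<le> m * (d a + n / 10 ^ 6)"
  proof (intro mult_left_mono m(2))
    have "(\<Sum>w\<in>L - {a}. card (N a \<inter> N w)) \<le> card (\<Union>w\<in>L - {a}. N a \<inter> N w) + 2 * (card (L - {a}))\<^sup>2"
    proof (rule sum_card_le_card_Union)
      fix i j assume ij: "i \<in> L - {a}" "j \<in> L - {a}" "i \<noteq> j"
      have "N a \<inter> N i \<inter> (N a \<inter> N j) = N a \<inter> N i \<inter> N j" by blast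
      then show "card (N a \<inter> N i \<inter> (N a \<inter> N j)) \<le> 2"
        using common_nbrs_le_2[of a i j] ij L_sub(2) a by auto
    qed (use L_sub finN in auto)
    moreover have "card (\<Union>w\<in>L - {a}. N a \<inter> N w) \<le> card (N a)" using finN by (intro card_mono) auto
    ultimately have "(\<Sum>w\<in>L - {a}. card (N a \<inter> N w)) \<le> card (N a) + 2 * (card (L - {a}))\<^sup>2" by linarith
    then have "real (\<Sum>w\<in>L - {a}. card (N a \<inter> N w)) \<le> real (card (N a) + 2 * (card (L - {a}))\<^sup>2)"
      by (simp only: of_nat_le_iff)
    then have "real (\<Sum>w\<in>L - {a}. card (N a \<inter> N w)) \<le> d a + 2 * (real (card (L - {a})))\<^sup>2"
      by simp
    moreover have "real (card (L - {a})) \<le> 60000"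
      using card_L card_mono[of L "L - {a}"] L_sub by (meson Diff_subset le_trans of_nat_le_iff order_trans)
    then have "(real (card (L - {a})))\<^sup>2 \<le> 60000\<^sup>2" by (intro power_mono) auto
    ultimately show "real (\<Sum>w\<in>L - {a}. card (N a \<inter> N w)) \<le> d a + n / 10 ^ 6" using large by simp
  qed
  also have "(\<Sum>w\<in>V - {a} - (L - {a}). codeg a w * x w) \<le> (\<Sum>w\<in>V - {a} - (L - {a}). codeg a w * (1 / 250))"
    by (intro sum_mono mult_left_mono) (auto simp: L_def)
  also have "\<dots> \<le> (\<Sum>w\<in>V. codeg a w * (1 / 250))" using fin by (intro sum_mono2) auto
  also have "\<dots> = (\<Sum>y\<in>N a. d y) / 250"
    using two_step_codeg[OF a, of "\<lambda>_. 1"] by (simp add: sum_divide_distrib[symmetric])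
  finally show ?thesis using sum_deg_nbrs[of a] by simp
qed

lemma d_le: "a \<in> V \<Longrightarrow> d a \<le> n"
  using card_mono[OF fin N_sub] by (simp add: n)

definition "A v = N u \<inter> N v"
definition "R v = V - {u, v} - A v"

text \<open>Let \<open>v\<close> have the largest entry \<open>m\<close> in \<open>L - {u}\<close>.
  The two-step bound at \<open>u\<close> reads roughly 2 n <= n + m n + 0.048 n and forces
  \<open>m\<close> near 1. Adding the bounds at \<open>u\<close> and \<open>v\<close> makes the two
  degrees sum to almost 2 n, so few vertices miss one of them.\<close>

lemma second_vertex:
  obtains v where "v \<in> V" "v \<noteq> u" "x v \<ge> 95 / 100" "card (R v) \<le> n / 20"
proof -
  have ne: "L - {u} \<noteq> {}"
  proof
    assume "L - {u} = {}"
    then have "\<And>w. w \<in> L - {u} \<Longrightarrow> x w \<le> 0" by blast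
    from two_step_le[OF u(1) this] have "\<rho>\<^sup>2 * x u \<le> d u * x u + 12 / 250 * n" by simp
    then show False using u d_le[OF u(1)] \<rho> large by simp
  qed
  obtain v where v: "v \<in> L - {u}" "\<And>w. w \<in> L - {u} \<Longrightarrow> x w \<le> x v"
  proof -
    have "finite (x ` (L - {u}))" "x ` (L - {u}) \<noteq> {}" using L_sub ne by auto
    then have "Max (x ` (L - {u})) \<in> x ` (L - {u})" "\<And>w. w \<in> L - {u} \<Longrightarrow> x w \<le> Max (x ` (L - {u}))" by auto
    then show ?thesis using that by (metis imageE)
  qed
  define m where "m = x v"
  have vV: "v \<in> V" "v \<noteq> u" using v L_sub by auto
  have m: "0 \<le> m" "m \<le> 1" using x0 x1 vV by (auto simp: m_def)
  have 1: "\<rho>\<^sup>2 \<le> d u + m * (d u + n / 10 ^ 6) + 12 / 250 * n"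
    using two_step_le[OF u(1), of m] v(2) m u(2) by (simp add: m_def)
  have 2: "\<rho>\<^sup>2 * m \<le> d v * m + (d v + n / 10 ^ 6) + 12 / 250 * n"
    using two_step_le[OF vV(1), of 1] x1 L_sub by (simp add: m_def subset_iff)
  have "m * (d u + n / 10 ^ 6) \<le> m * (n + n / 10 ^ 6)" using d_le[OF u(1)] m by (intro mult_left_mono) auto
  then have "2 * n - 4 \<le> n + m * (n + n / 10 ^ 6) + 12 / 250 * n" using 1 \<rho> d_le[OF u(1)] by linarith
  moreover have e: "m * (n + n / 10 ^ 6) = m * n + m * n / 1000000" by (simp add: algebra_simps)
  ultimately have "2 * n - 4 \<le> n + (m * n + m * n / 1000000) + 12 / 250 * n" by (simp only: e)
  moreover have "m * n \<le> n" using m large by (simp add: mult_left_le_one_le)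
  moreover have "n \<ge> 44000000000000000" using large by simp
  ultimately have "9519 / 10000 * n \<le> m * n" by linarith
  then have mge: "m \<ge> 9519 / 10000" using large by (subst (asm) mult_le_cancel_right_pos) auto
  have "(2 * n - 4) * m \<le> \<rho>\<^sup>2 * m" using \<rho> m by (intro mult_right_mono) auto
  then have "(2 * n - 4) * (1 + m) \<le> (d u + d v + n / 10 ^ 6) * (1 + m) + 24 / 250 * n"
  proof -
    define K where "K = n / 10 ^ 6"
    have "\<rho>\<^sup>2 \<le> d u + (m * d u + m * K) + 12 / 250 * n" using 1 by (simp add: K_def distrib_left)
    moreover have "\<rho>\<^sup>2 * m \<le> m * d v + (d v + K) + 12 / 250 * n" using 2 by (simp add: K_def mult.commute)
    moreover have "(d u + d v + K) * (1 + m) = d u + d v + K + m * d u + m * d v + m * K"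
      by (simp add: algebra_simps)
    moreover have "(2 * n - 4) * (1 + m) = (2 * n - 4) + (2 * n - 4) * m" by (simp add: algebra_simps)
    ultimately have "(2 * n - 4) * (1 + m) \<le> (d u + d v + K) * (1 + m) + 24 / 250 * n"
      using \<open>(2 * n - 4) * m \<le> \<rho>\<^sup>2 * m\<close> \<rho> by linarith
    then show ?thesis by (simp add: K_def)
  qed
  \<comment> \<open>0.0492 * 1.9519 exceeds 0.096, so after division by \<open>1 + m\<close> the
    error term costs less than \<open>n / 20\<close>.\<close>
  moreover have "24 / 250 * n \<le> (492 / 10000 * n) * (1 + m)"
  proof -
    have "(492 / 10000 * n) * (19519 / 10000) \<le> (492 / 10000 * n) * (1 + m)"
      using mge large by (intro mult_left_mono) auto
    then show ?thesis using large by simp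
  qed
  ultimately have "(2 * n - 4) * (1 + m) \<le> (d u + d v + n / 10 ^ 6 + 492 / 10000 * n) * (1 + m)"
    unfolding distrib_right[of "d u + d v + n / 10 ^ 6"] by linarith
  then have "2 * n - 4 \<le> d u + d v + n / 10 ^ 6 + 492 / 10000 * n"
    using m by (simp add: mult_le_cancel_right)
  moreover have "real (card (R v)) \<le> (n - d u) + (n - d v)"
  proof -
    have "R v \<subseteq> (V - N u) \<union> (V - N v)" by (auto simp: R_def A_def)
    then have "card (R v) \<le> card ((V - N u) \<union> (V - N v))" using fin by (intro card_mono) auto
    also have "\<dots> \<le> card (V - N u) + card (V - N v)" by (rule card_Un_le)
    finally have "real (card (R v)) \<le> real (card (V - N u)) + real (card (V - N v))" by linarith
    moreover have "real (card (V - N a)) = n - d a" for a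
      using card_Diff_subset[OF finN N_sub, of a] card_mono[OF fin N_sub, of a] by (simp add: n of_nat_diff)
    ultimately show ?thesis by simp
  qed
  ultimately have "card (R v) \<le> n / 20" using large by simp
  then show ?thesis using that[of v] vV mge by (simp add: m_def)
qed

lemma finite_R: "finite (R v)" "R v \<subseteq> V" "finite (A v)" "A v \<subseteq> V"
  using fin finN N_sub by (auto simp: R_def A_def)

lemma nbr_split:
  assumes "v \<in> V" "v \<noteq> u" "w \<in> V" "w \<notin> {u, v}"
  shows "N w = (N w \<inter> {u, v}) \<union> (N w \<inter> A v) \<union> nbr E (R v) w" "card (N w \<inter> A v) \<le> 2"
    "w \<in> R v \<Longrightarrow> \<not> (E w u \<and> E w v)"
proof -
  show "N w = (N w \<inter> {u, v}) \<union> (N w \<inter> A v) \<union> nbr E (R v) w"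
    by (auto simp: nbr_def R_def A_def)
  have "N w \<inter> A v = N u \<inter> N v \<inter> N w" by (auto simp: A_def)
  then show "card (N w \<inter> A v) \<le> 2" using common_nbrs_le_2[of u v w] assms u by auto
  show "w \<in> R v \<Longrightarrow> \<not> (E w u \<and> E w v)"
    using symE' by (auto simp: R_def A_def nbr_def)
qed

lemma sum_const_le:
  assumes "finite S" "card S \<le> k" "\<And>b. b \<in> S \<Longrightarrow> x b \<le> c" "0 \<le> c"
  shows "(\<Sum>b\<in>S. x b) \<le> real k * c"
proof -
  have "(\<Sum>b\<in>S. x b) \<le> (\<Sum>b\<in>S. c)" using assms by (intro sum_mono) auto
  also have "\<dots> \<le> real k * c" using assms by (simp add: mult_right_mono)
  finally show ?thesis .
qed

text \<open>Let \<open>\<eta>\<close> be the largest entry besides \<open>u\<close> and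
  \<open>v\<close>. Its vertex sees the two dominating vertices, at most two vertices of
  \<open>A v\<close>, and part of \<open>R v\<close>. The entries on \<open>R v\<close> are bounded
  by another application of the eigenvalue equation, and \<open>R v\<close> has at most
  \<open>n / 20\<close> elements.\<close>

lemma others_small:
  assumes v: "v \<in> V" "v \<noteq> u" "card (R v) \<le> n / 20" and w: "w \<in> V - {u, v}"
  shows "x w \<le> 1 / 25"
proof -
  let ?O = "V - {u, v}"
  obtain w0 where w0: "w0 \<in> ?O" "\<And>w. w \<in> ?O \<Longrightarrow> x w \<le> x w0"
  proof -
    have "finite (x ` ?O)" "x ` ?O \<noteq> {}" using fin w by auto
    then have "Max (x ` ?O) \<in> x ` ?O" "\<And>w. w \<in> ?O \<Longrightarrow> x w \<le> Max (x ` ?O)" by auto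
    then show ?thesis using that by (metis imageE)
  qed
  define \<eta> where "\<eta> = x w0"
  have \<eta>: "0 \<le> \<eta>" "\<eta> \<le> 1" using w0 x0 x1 by (auto simp: \<eta>_def)
  have small: "x b \<le> \<eta>" if "b \<in> A v \<union> R v" for b
  proof -
    have "b \<in> V" "b \<noteq> u" "b \<noteq> v" using that irrE by (auto simp: R_def A_def nbr_def)
    then show ?thesis using w0(2)[of b] by (simp add: \<eta>_def)
  qed
  have split: "(\<Sum>b\<in>N a. x b) \<le> (\<Sum>b\<in>N a \<inter> {u, v}. x b) + 2 * \<eta> + (\<Sum>b\<in>nbr E (R v) a. x b)"
    if a: "a \<in> ?O" for a
  proof -
    have av: "a \<in> V" "a \<notin> {u, v}" using a by auto
    note ns = nbr_split[OF v(1,2) av]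
    have xp: "\<And>b. b \<in> N a \<union> nbr E (R v) a \<Longrightarrow> 0 \<le> x b"
      using x0 N_sub finite_R by (auto simp: nbr_def)
    have "(\<Sum>b\<in>N a. x b) = (\<Sum>b\<in>(N a \<inter> {u, v}) \<union> (N a \<inter> A v) \<union> nbr E (R v) a. x b)" using ns(1) by simp
    also have "\<dots> \<le> (\<Sum>b\<in>(N a \<inter> {u, v}) \<union> (N a \<inter> A v). x b) + (\<Sum>b\<in>nbr E (R v) a. x b)"
      using finN finite_R xp by (intro sum_Un_le) auto
    also have "(\<Sum>b\<in>(N a \<inter> {u, v}) \<union> (N a \<inter> A v). x b) \<le> (\<Sum>b\<in>N a \<inter> {u, v}. x b) + (\<Sum>b\<in>N a \<inter> A v. x b)"
      using finN xp by (intro sum_Un_le) auto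
    also have "(\<Sum>b\<in>N a \<inter> A v. x b) \<le> real 2 * \<eta>"
      using ns(2) small \<eta> finN by (intro sum_const_le) auto
    finally show ?thesis by simp
  qed
  let ?r = "real (card (R v))"
  \<comment> \<open>A vertex of \<open>R v\<close> misses \<open>u\<close> or \<open>v\<close>,
    which accounts for the 1. At most two neighbours in \<open>A v\<close> give
    \<open>2 * \<eta>\<close>, and the edge bound inside \<open>R v\<close> gives the remaining 12
    on average.\<close>
  have SR: "\<rho> * (\<Sum>r\<in>R v. x r) \<le> ?r * (1 + 14 * \<eta>)"
  proof -
    have "\<rho> * (\<Sum>r\<in>R v. x r) = (\<Sum>r\<in>R v. \<Sum>b\<in>N r. x b)"
      using eigen finite_R by (simp add: sum_distrib_left subset_iff)
    also have "\<dots> \<le> (\<Sum>r\<in>R v. 1 + 2 * \<eta> + \<eta> * real (card (nbr E (R v) r)))"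
    proof (intro sum_mono)
      fix r assume r: "r \<in> R v"
      then have rO: "r \<in> ?O" by (auto simp: R_def)
      have "card (N r \<inter> {u, v}) \<le> 1"
      proof -
        have "\<not> (E r u \<and> E r v)" using nbr_split(3)[OF v(1,2)] r rO by blast
        then have "N r \<inter> {u, v} \<subseteq> {u} \<or> N r \<inter> {u, v} \<subseteq> {v}" by (auto simp: nbr_def)
        then show ?thesis by (metis card.empty card_mono finite.emptyI finite.insertI is_singletonI is_singleton_altdef)
      qed
      then have "(\<Sum>b\<in>N r \<inter> {u, v}. x b) \<le> real 1 * 1"
        using finN x1 N_sub by (intro sum_const_le) auto
      moreover have "(\<Sum>b\<in>nbr E (R v) r. x b) \<le> real (card (nbr E (R v) r)) * \<eta>"
        using finite_R small \<eta> by (intro sum_const_le) (auto simp: nbr_def)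
      ultimately show "(\<Sum>b\<in>N r. x b) \<le> 1 + 2 * \<eta> + \<eta> * real (card (nbr E (R v) r))"
        using split[OF rO] by (simp add: mult.commute)
    qed
    also have "\<dots> = ?r * (1 + 2 * \<eta>) + \<eta> * real (degsum E (R v))"
      by (simp add: sum.distrib degsum_def sum_distrib_left algebra_simps)
    also have "\<eta> * real (degsum E (R v)) \<le> \<eta> * (12 * ?r)"
      using degsum_le[OF finite_R(2)] \<eta> by (intro mult_left_mono) auto
    finally show ?thesis by (simp add: algebra_simps)
  qed
  have "\<rho> * \<eta> \<le> 2 + 2 * \<eta> + (\<Sum>r\<in>R v. x r)"
  proof -
    have "card (N w0 \<inter> {u, v}) \<le> 2"
      using card_mono[of "{u, v}" "N w0 \<inter> {u, v}"] v(2) by (auto simp: numeral_2_eq_2)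
    then have "(\<Sum>b\<in>N w0 \<inter> {u, v}. x b) \<le> real 2 * 1"
      using finN x1 N_sub by (intro sum_const_le) auto
    moreover have "(\<Sum>b\<in>nbr E (R v) w0. x b) \<le> (\<Sum>r\<in>R v. x r)"
      using finite_R(1) x0[OF subsetD[OF finite_R(2)]] by (intro sum_mono2) (auto simp: nbr_def)
    ultimately show ?thesis using split[OF w0(1)] eigen[of w0] w0 by (simp add: \<eta>_def)
  qed
  then have "\<rho> * (\<rho> * \<eta>) \<le> \<rho> * (2 + 2 * \<eta> + (\<Sum>r\<in>R v. x r))" using \<rho>0 by (intro mult_left_mono) auto
  also have "\<dots> = \<rho> * (2 + 2 * \<eta>) + \<rho> * (\<Sum>r\<in>R v. x r)" by (simp add: algebra_simps)
  also have "\<rho> * (2 + 2 * \<eta>) \<le> \<rho> * 4" using \<rho>0 \<eta> by (intro mult_left_mono) auto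
  also note SR
  also have "?r * (1 + 14 * \<eta>) \<le> n / 20 * (1 + 14 * \<eta>)" using v(3) \<eta> by (intro mult_right_mono) auto
  finally have "\<rho>\<^sup>2 * \<eta> \<le> \<rho> * 4 + n / 20 * (1 + 14 * \<eta>)" by (simp add: power2_eq_square algebra_simps)
  moreover have "(2 * n - 4) * \<eta> \<le> \<rho>\<^sup>2 * \<eta>" using \<rho> \<eta> by (intro mult_right_mono) auto
  moreover have "\<rho> \<le> n / 10 ^ 6"
  proof -
    have "\<rho>\<^sup>2 = (\<Sum>y\<in>N u. \<Sum>w\<in>N y. x w)" using two_step[OF u(1)] u by simp
    also have "\<dots> \<le> (\<Sum>y\<in>N u. \<Sum>w\<in>N y. 1)" using x1 N_sub by (intro sum_mono) (metis subsetD)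
    also have "\<dots> \<le> 12 * n" using sum_deg_nbrs[of u] by simp
    finally have "\<rho> * \<rho> \<le> 12 * n" by (simp add: power2_eq_square)
    moreover have "(296 * 10 ^ 6) * \<rho> \<le> \<rho> * \<rho>" using rho_ge \<rho>0 by (intro mult_right_mono) auto
    ultimately show ?thesis using large by simp
  qed
  ultimately have "(2 * n - 4) * \<eta> \<le> n / 10 ^ 6 * 4 + n / 20 * (1 + 14 * \<eta>)" by linarith
  \<comment> \<open>13/10 is 2 - 14/20: the terms in \<open>\<eta>\<close> from \<open>R v\<close>
    are absorbed on the left.\<close>
  then have "n * (13 / 10 * \<eta>) \<le> n * (5 / 100 + 4 / 10 ^ 6) + 4 * \<eta>" by (simp add: algebra_simps)
  moreover have "4 * \<eta> \<le> n * (1 / 10 ^ 6)" using \<eta> large by simp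
  ultimately have "n * (13 / 10 * \<eta>) \<le> n * (5 / 100 + 5 / 10 ^ 6)" by (simp add: algebra_simps)
  then have "13 / 10 * \<eta> \<le> 5 / 100 + 5 / 10 ^ 6" using large by (subst (asm) mult_le_cancel_left_pos) auto
  then have "\<eta> \<le> 1 / 25" by simp
  then show ?thesis using w0(2)[OF w] by (simp add: \<eta>_def)
qed

abbreviation "e a b \<equiv> (of_bool (E a b) :: real)"

text \<open>\<open>E' v\<close> makes \<open>u\<close> and \<open>v\<close> dominating and deletes all other edges that meet \<open>R v\<close>.\<close>

definition E' :: "'a \<Rightarrow> 'a \<Rightarrow> 'a \<Rightarrow> bool" where
  "E' v a b \<longleftrightarrow> a \<in> V \<and> b \<in> V \<and> a \<noteq> b \<and> (a \<in> {u, v} \<or> b \<in> {u, v} \<or> (a \<in> A v \<and> b \<in> A v \<and> E a b))"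

lemma sum_e: "finite W \<Longrightarrow> (\<Sum>b\<in>W. e a b * f b) = (\<Sum>b\<in>nbr E W a. f b)"
  unfolding nbr_def by (subst sum.inter_filter) (auto intro!: sum.cong simp: of_bool_def)

text \<open>By the edge bound every subset has a vertex with at most 12 neighbours in it. Removing
  such a vertex \<open>w\<close> removes a row and a column that contribute at most
  \<open>12 * c * x w\<close> each. The bound is linear in the entries, which the comparison with
  linear gains requires.\<close>

lemma degenerate_quadratic_form:
  assumes "W \<subseteq> V" "\<And>b. b \<in> W \<Longrightarrow> x b \<le> c" "0 \<le> c"
  shows "(\<Sum>a\<in>W. \<Sum>b\<in>W. e a b * x a * x b) \<le> 24 * c * (\<Sum>a\<in>W. x a)"
  using assms(1,2)
proof (induction "card W" arbitrary: W rule: less_induct)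
  case less
  have finW: "finite W" using less.prems(1) fin finite_subset by blast
  show ?case
  proof (cases "W = {}")
    case False
    have "\<exists>w\<in>W. card (nbr E W w) \<le> 12"
    proof (rule ccontr)
      assume "\<not> ?thesis"
      then have "(\<Sum>w\<in>W. 13) \<le> (\<Sum>w\<in>W. card (nbr E W w))" by (intro sum_mono) force
      then have "13 * card W \<le> degsum E W" by (simp add: degsum_def mult.commute)
      then have "real (13 * card W) \<le> 12 * real (card W)"
        using degsum_le[OF less.prems(1)] by linarith
      then show False using False finW by (simp add: card_gt_0_iff)
    qed
    then obtain w where w: "w \<in> W" "card (nbr E W w) \<le> 12" by blast
    let ?W = "W - {w}"
    let ?q = "\<lambda>a b. e a b * x a * x b"
    have "card ?W < card W" using finW w(1) by (rule card_Diff1_less)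
    then have IH: "(\<Sum>a\<in>?W. \<Sum>b\<in>?W. ?q a b) \<le> 24 * c * (\<Sum>a\<in>?W. x a)"
      using less.prems by (intro less.hyps) auto
    have row: "(\<Sum>b\<in>W. ?q w b) \<le> x w * (12 * c)"
    proof -
      have "(\<Sum>b\<in>W. ?q w b) = x w * (\<Sum>b\<in>W. e w b * x b)" by (simp add: sum_distrib_left mult_ac)
      also have "\<dots> = x w * (\<Sum>b\<in>nbr E W w. x b)" using sum_e[OF finW] by simp
      also have "(\<Sum>b\<in>nbr E W w. x b) \<le> real 12 * c"
        using w(2) less.prems finW assms(3) by (intro sum_const_le) (auto simp: nbr_def)
      finally show ?thesis using x0[of w] w(1) less.prems(1) by (simp add: mult_left_mono subset_iff)
    qed
    have "?q w w = 0" using irrE by simp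
    then have row': "(\<Sum>b\<in>W. ?q w b) = (\<Sum>b\<in>?W. ?q w b)" using finW w(1) by (simp add: sum.remove)
    have col: "(\<Sum>a\<in>?W. ?q a w) = (\<Sum>b\<in>?W. ?q w b)"
      using symE' by (intro sum.cong) (auto simp: of_bool_def)
    have "(\<Sum>a\<in>W. \<Sum>b\<in>W. ?q a b) = (\<Sum>b\<in>W. ?q w b) + (\<Sum>a\<in>?W. \<Sum>b\<in>W. ?q a b)"
      using finW w(1) by (rule sum.remove)
    also have "(\<Sum>a\<in>?W. \<Sum>b\<in>W. ?q a b) = (\<Sum>a\<in>?W. ?q a w + (\<Sum>b\<in>?W. ?q a b))"
      using finW w(1) by (intro sum.cong refl sum.remove)
    also have "\<dots> = (\<Sum>b\<in>W. ?q w b) + (\<Sum>a\<in>?W. \<Sum>b\<in>?W. ?q a b)"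
      by (simp add: sum.distrib col row')
    finally have "(\<Sum>a\<in>W. \<Sum>b\<in>W. ?q a b) \<le> 2 * (x w * (12 * c)) + 24 * c * (\<Sum>a\<in>?W. x a)"
      using IH row by linarith
    moreover have "(\<Sum>a\<in>W. x a) = x w + (\<Sum>a\<in>?W. x a)" using finW w(1) by (rule sum.remove)
    ultimately show ?thesis by (simp add: algebra_simps)
  qed simp
qed

text \<open>Each vertex of \<open>R v\<close> gains an edge to a dominating vertex, of entry at
  least 0.95, and loses at most two edges into \<open>A v\<close>, of entries at most 1/25. Edges
  inside \<open>R v\<close> are controlled by degeneracy. The net gain is proportional to the
  entries on \<open>R v\<close>.\<close>

lemma join_gain:
  assumes v: "v \<in> V" "v \<noteq> u" "x v \<ge> 95 / 100" "card (R v) \<le> n / 20"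
  shows "(\<Sum>a\<in>V. \<Sum>b\<in>V. e a b * x a * x b) + (\<Sum>r\<in>R v. x r) / 2 + (if E u v then 0 else 9 / 10)
    \<le> (\<Sum>a\<in>V. \<Sum>b\<in>V. of_bool (E' v a b) * x a * x b)"
proof -
  let ?A = "A v" and ?R = "R v"
  have V: "V = {u, v} \<union> ?A \<union> ?R" "{u, v} \<inter> ?A = {}" "({u, v} \<union> ?A) \<inter> ?R = {}"
    using v u N_sub irrE by (auto simp: R_def A_def nbr_def)
  have Aadj: "E u b" "E v b" "E b u" "E b v" if "b \<in> ?A" for b
    using that symE' by (auto simp: A_def nbr_def)
  \<comment> \<open>The change on ordered pairs is split up: \<open>g\<close> from
    \<open>R v\<close> to the rest (its transpose covers the other order), \<open>h\<close> inside
    \<open>R v\<close>, and \<open>k\<close> for the pair \<open>u\<close>,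
    \<open>v\<close>.\<close>
  define g where "g a b = (if a \<in> ?R then (if b \<in> {u, v} then 1 - e a b else if b \<in> ?A then - e a b else 0) else 0)" for a b
  define h where "h a b = (if a \<in> ?R \<and> b \<in> ?R then e a b else 0)" for a b
  define k where "k a b = (if (a = u \<and> b = v) \<or> (a = v \<and> b = u) then 1 - e a b else 0)" for a b
  have pt: "of_bool (E' v a b) = e a b + g a b + g b a - h a b + k a b" if ab: "a \<in> V" "b \<in> V" for a b
  proof -
    have ee: "e a b = e b a" using symE' by auto
    have cls: "(a \<in> {u, v} \<and> a \<notin> ?A \<and> a \<notin> ?R) \<or> (a \<in> ?A \<and> a \<notin> {u, v} \<and> a \<notin> ?R) \<or> (a \<in> ?R \<and> a \<notin> {u, v} \<and> a \<notin> ?A)"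
      "(b \<in> {u, v} \<and> b \<notin> ?A \<and> b \<notin> ?R) \<or> (b \<in> ?A \<and> b \<notin> {u, v} \<and> b \<notin> ?R) \<or> (b \<in> ?R \<and> b \<notin> {u, v} \<and> b \<notin> ?A)"
      using ab V by blast+
    from cls show ?thesis
    proof (elim disjE conjE)
    qed (insert ab v(1,2) u(1) irrE Aadj[of a] Aadj[of b] ee, auto simp: E'_def g_def h_def k_def)
  qed
  let ?S = "\<lambda>f. \<Sum>a\<in>V. \<Sum>b\<in>V. f a b * x a * x b"
  have swap: "?S (\<lambda>a b. g b a) = ?S g"
    by (subst sum.swap) (simp add: mult_ac)
  have "?S (\<lambda>a b. of_bool (E' v a b)) = ?S (\<lambda>a b. e a b + g a b + g b a - h a b + k a b)"
    using pt by (intro sum.cong refl) simp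
  also have "\<dots> = ?S e + ?S g + ?S (\<lambda>a b. g b a) - ?S h + ?S k"
    by (simp add: algebra_simps sum.distrib sum_subtractf)
  finally have eq: "?S (\<lambda>a b. of_bool (E' v a b)) = ?S e + 2 * ?S g - ?S h + ?S k" using swap by simp
  have small: "x b \<le> 1 / 25" if "b \<in> ?A \<union> ?R" for b
    using others_small[OF v(1,2,4), of b] that V by blast
  have Rs: "0 \<le> (\<Sum>r\<in>?R. x r)" using x0 V(1) by (intro sum_nonneg) blast
  have Sh: "?S h \<le> 24 / 25 * (\<Sum>r\<in>?R. x r)"
  proof -
    have "?S h = (\<Sum>a\<in>V. if a \<in> ?R then \<Sum>b\<in>V. if b \<in> ?R then e a b * x a * x b else 0 else 0)"
      by (intro sum.cong refl) (auto simp: h_def intro: sum.cong)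
    also have "\<dots> = (\<Sum>a\<in>?R. \<Sum>b\<in>?R. e a b * x a * x b)"
      using fin finite_R(2)[of v] by (simp add: sum.inter_restrict[symmetric] Int_absorb1)
    also have "\<dots> \<le> 24 * (1 / 25) * (\<Sum>r\<in>?R. x r)"
      using finite_R small by (intro degenerate_quadratic_form) auto
    finally show ?thesis by simp
  qed
  have Sg: "?S g \<ge> (95 / 100 - 2 / 25) * (\<Sum>r\<in>?R. x r)"
  proof -
    have row: "(\<Sum>b\<in>V. g a b * x a * x b) \<ge> (if a \<in> ?R then (95 / 100 - 2 / 25) * x a else 0)" if a: "a \<in> V" for a
    proof (cases "a \<in> ?R")
      case True
      have aV: "a \<in> V" "a \<notin> {u, v}" using True V by auto
      note ns = nbr_split[OF v(1,2) aV]
      have "(\<Sum>b\<in>V. g a b * x b) = (\<Sum>b\<in>{u, v}. g a b * x b) + (\<Sum>b\<in>?A. g a b * x b) + (\<Sum>b\<in>?R. g a b * x b)"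
      proof -
        have "(\<Sum>b\<in>V. g a b * x b) = (\<Sum>b\<in>({u, v} \<union> ?A) \<union> ?R. g a b * x b)" using V(1) by simp
        also have "\<dots> = (\<Sum>b\<in>{u, v} \<union> ?A. g a b * x b) + (\<Sum>b\<in>?R. g a b * x b)"
          using finite_R V(3) by (intro sum.union_disjoint) auto
        also have "(\<Sum>b\<in>{u, v} \<union> ?A. g a b * x b) = (\<Sum>b\<in>{u, v}. g a b * x b) + (\<Sum>b\<in>?A. g a b * x b)"
          using finite_R V(2) by (intro sum.union_disjoint) auto
        finally show ?thesis .
      qed
      also have "(\<Sum>b\<in>?R. g a b * x b) = 0" using V by (intro sum.neutral) (auto simp: g_def)
      also have "(\<Sum>b\<in>?A. g a b * x b) = - (\<Sum>b\<in>?A. e a b * x b)"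
        unfolding sum_negf[symmetric] using V True by (intro sum.cong) (auto simp: g_def)
      also have "(\<Sum>b\<in>?A. e a b * x b) = (\<Sum>b\<in>nbr E ?A a. x b)" using sum_e finite_R by simp
      also have "(\<Sum>b\<in>{u, v}. g a b * x b) = (1 - e a u) * x u + (1 - e a v) * x v"
        using v(2) True by (simp add: g_def)
      finally have eq: "(\<Sum>b\<in>V. g a b * x b) = (1 - e a u) * x u + (1 - e a v) * x v - (\<Sum>b\<in>nbr E ?A a. x b)" by simp
      have "nbr E ?A a = N a \<inter> ?A" using finite_R(4)[of v] by (auto simp: nbr_def)
      then have "(\<Sum>b\<in>nbr E ?A a. x b) \<le> real 2 * (1 / 25)"
        using ns(2) small finN by (intro sum_const_le) auto
      moreover have "(1 - e a u) * x u + (1 - e a v) * x v \<ge> 95 / 100"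
        using ns(3)[OF True] v(3) u(2) by auto
      ultimately have "(\<Sum>b\<in>V. g a b * x b) \<ge> 95 / 100 - 2 / 25" using eq by simp
      then have "x a * (95 / 100 - 2 / 25) \<le> x a * (\<Sum>b\<in>V. g a b * x b)"
        using x0[OF aV(1)] by (rule mult_left_mono)
      also have "\<dots> = (\<Sum>b\<in>V. g a b * x a * x b)" by (simp add: sum_distrib_left mult_ac)
      finally show ?thesis using True by (simp add: mult.commute)
    next
      case False
      then show ?thesis by (simp add: g_def)
    qed
    have "(95 / 100 - 2 / 25) * (\<Sum>r\<in>?R. x r) = (\<Sum>a\<in>V. if a \<in> ?R then (95 / 100 - 2 / 25) * x a else 0)"
      using fin finite_R(2)[of v] by (simp add: sum.inter_restrict[symmetric] Int_absorb1 sum_distrib_left)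
    also have "\<dots> \<le> ?S g" by (intro sum_mono row)
    finally show ?thesis .
  qed
  have Sk: "?S k \<ge> (if E u v then 0 else 9 / 10)"
  proof -
    have nn: "0 \<le> k a b * x a * x b" if "a \<in> V" "b \<in> V" for a b
      using x0[OF that(1)] x0[OF that(2)] by (simp add: k_def)
    have "k u v * x u * x v \<le> (\<Sum>b\<in>V. k u b * x u * x b)"
      using nn u(1) v(1) fin by (intro member_le_sum) auto
    also have "\<dots> \<le> ?S k"
      using nn u(1) fin by (intro member_le_sum[of u V "\<lambda>a. \<Sum>b\<in>V. k a b * x a * x b"] sum_nonneg) auto
    finally show ?thesis using u(2) v(3) by (auto simp: k_def)
  qed
  \<comment> \<open>2 * 0.87 - 0.96 = 0.78 exceeds 1/2.\<close>
  have "E0 + r / 2 + c \<le> T"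
    if "T = E0 + 2 * G - H + K" "H \<le> 24 / 25 * r" "(95 / 100 - 2 / 25) * r \<le> G" "c \<le> K" "0 \<le> r"
    for T E0 G H K c r :: real
    using that by (simp add: field_simps)
  from this[OF eq Sh Sg Sk Rs] show ?thesis .
qed

end

section \<open>The join of \<open>K\<^sub>2\<close> with disjoint paths\<close>

text \<open>Indexed by the list of path lengths, so that arbitrary linear forests can be compared
  with \<open>H_P\<close>. Zero lengths are allowed and contribute no vertex.\<close>

definition JP :: "nat list \<Rightarrow> (nat + nat \<times> nat) ugraph" where
  "JP ls = join K2 (disj_union_list (map path_graph ls))"

definition slots :: "nat list \<Rightarrow> (nat \<times> nat) set" where
  "slots ls = {(i, j). i < length ls \<and> j < ls ! i}"

lemma verts_JP: "verts (JP ls) = {Inl 0, Inl 1} \<union> Inr ` slots ls"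
proof -
  have "{0..<2::nat} = {0, 1}" by auto
  moreover have "verts (disj_union_list (map path_graph ls)) = slots ls"
    by (auto simp: disj_union_list_def verts_def slots_def path_graph_def)
  ultimately show ?thesis
    by (auto simp: JP_def join_def verts_def K2_def path_graph_def)
qed

lemma edges_K2: "edges K2 = {{0, 1}}"
  by (auto simp: K2_def path_graph_def edges_def)

lemma verts_K2: "verts K2 = {0, 1}"
  by (auto simp: K2_def path_graph_def verts_def)

lemma edges_slots:
  "edges (disj_union_list (map path_graph ls)) = {{(i, j), (i, Suc j)} |i j. i < length ls \<and> Suc j < ls ! i}"
  (is "?l = ?r")
proof
  show "?l \<subseteq> ?r"
  proof
    fix e assume "e \<in> ?l"
    then obtain i k where "i < length ls" "Suc k < ls ! i" "e = {(i, k), (i, Suc k)}"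
      by (auto simp: disj_union_list_def edges_def path_graph_def)
    then show "e \<in> ?r" by blast
  qed
  show "?r \<subseteq> ?l"
  proof
    fix e assume "e \<in> ?r"
    then obtain i j where ij: "e = {(i, j), (i, Suc j)}" "i < length ls" "Suc j < ls ! i" by blast
    then have "e = Pair i ` {j, Suc j}" "{j, Suc j} \<in> edges (map path_graph ls ! i)"
      by (auto simp: path_graph_def edges_def)
    then show "e \<in> ?l"
      using ij(2) unfolding disj_union_list_def edges_def[of "(_, _)"] by auto
  qed
qed

lemma image_Collect2: "g ` {f i j |i j. P i j} = {g (f i j) |i j. P i j}"
  by blast

lemma edges_JP: "edges (JP ls) = {{Inl 0, Inl 1}} \<union> {{Inr (i, j), Inr (i, Suc j)} |i j. i < length ls \<and> Suc j < ls ! i}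
    \<union> {{Inl a, Inr w} |a w. a \<in> {0, 1} \<and> w \<in> slots ls}"
proof -
  have "verts (disj_union_list (map path_graph ls)) = slots ls"
    by (auto simp: disj_union_list_def verts_def slots_def path_graph_def)
  then have "edges (JP ls) = ((\<lambda>e. Inl ` e) ` {{0, 1}}) \<union>
      ((\<lambda>e. Inr ` e) ` {{(i, j), (i, Suc j)} |i j. i < length ls \<and> Suc j < ls ! i}) \<union>
      {{Inl u, Inr v} | u v. u \<in> {0, 1} \<and> v \<in> slots ls}"
    unfolding JP_def join_def by (simp add: edges_def[of "(_, _)"] edges_K2 verts_K2 edges_slots)
  then show ?thesis unfolding image_Collect2 by simp
qed

lemma adj_JP [simp]:
  "adj (JP ls) (Inl a) (Inl b) \<longleftrightarrow> (a = 0 \<and> b = 1) \<or> (a = 1 \<and> b = 0)"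
  "adj (JP ls) (Inl a) (Inr w) \<longleftrightarrow> a \<in> {0, 1} \<and> w \<in> slots ls"
  "adj (JP ls) (Inr w) (Inl a) \<longleftrightarrow> a \<in> {0, 1} \<and> w \<in> slots ls"
  "adj (JP ls) (Inr (i, j)) (Inr (i', j')) \<longleftrightarrow>
    i = i' \<and> i < length ls \<and> ((j' = Suc j \<and> j' < ls ! i) \<or> (j = Suc j' \<and> j < ls ! i))"
  unfolding adj_def edges_JP by (cases w, auto simp: doubleton_eq_iff)+

lemma slots_Sigma: "slots ls = (SIGMA i:{..<length ls}. {..<ls ! i})"
  by (auto simp: slots_def)

lemma finite_slots: "finite (slots ls)"
  by (simp add: slots_Sigma)

lemma simple_JP: "simple_graph (JP ls)"
  unfolding simple_graph_def
proof (intro conjI ballI)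
  show "finite (verts (JP ls))" by (simp add: verts_JP finite_slots)
  fix e assume "e \<in> edges (JP ls)"
  then consider "e = {Inl 0, Inl 1}"
    | i j where "e = {Inr (i, j), Inr (i, Suc j)}" "i < length ls" "Suc j < ls ! i"
    | a w where "e = {Inl a, Inr w}" "a \<in> {0, 1}" "w \<in> slots ls"
    unfolding edges_JP by blast
  then show "\<exists>u v. u \<in> verts (JP ls) \<and> v \<in> verts (JP ls) \<and> u \<noteq> v \<and> e = {u, v}"
  proof cases
    case 1
    then show ?thesis by (intro exI[of _ "Inl 0"] exI[of _ "Inl 1"]) (simp add: verts_JP)
  next
    case (2 i j)
    then show ?thesis by (intro exI[of _ "Inr (i, j)"] exI[of _ "Inr (i, Suc j)"]) (auto simp: verts_JP slots_def)
  next
    case (3 a w)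
    then show ?thesis by (intro exI[of _ "Inl a"] exI[of _ "Inr w"]) (auto simp: verts_JP)
  qed
qed

lemma card_JP: "card (verts (JP ls)) = sum_list ls + 2"
proof -
  have "card (slots ls) = (\<Sum>i<length ls. ls ! i)" by (simp add: slots_Sigma)
  then have "card (slots ls) = sum_list ls" by (simp add: sum_list_sum_nth lessThan_atLeast0)
  moreover have "card ({Inl 0, Inl 1} \<union> Inr ` slots ls :: (nat + nat \<times> nat) set) = card {Inl 0 :: nat + nat \<times> nat, Inl 1} + card (Inr ` slots ls :: (nat + nat \<times> nat) set)"
    by (rule card_Un_disjoint) (auto simp: finite_slots)
  ultimately show ?thesis by (simp add: verts_JP card_image)
qed

text \<open>The join is drawn with its inner vertices on the real axis at positive integers and the two
  dominating vertices at \<open>\<i>\<close> and \<open>-\<i>\<close>; then all edges can be straight.\<close>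

definition pos :: "nat list \<Rightarrow> nat \<times> nat \<Rightarrow> nat" where
  "pos ls w = Suc (sum_list (take (fst w) ls) + snd w)"

definition place :: "nat list \<Rightarrow> nat + nat \<times> nat \<Rightarrow> complex" where
  "place ls z = (case z of Inl a \<Rightarrow> (if a = 0 then \<i> else - \<i>) | Inr w \<Rightarrow> of_nat (pos ls w))"

lemma pos_less:
  assumes "(i, j) \<in> slots ls" "(i', j') \<in> slots ls" "i < i'"
  shows "pos ls (i, j) < pos ls (i', j')"
proof -
  have "take i' ls = take i ls @ take (i' - i) (drop i ls)" using assms(3) by (metis le_add_diff_inverse less_imp_le_nat take_add)
  moreover have "take (i' - i) (drop i ls) = ls ! i # take (i' - i - 1) (drop (Suc i) ls)"
    using assms by (cases "i' - i") (auto simp: slots_def take_Suc_conv_app_nth Cons_nth_drop_Suc[symmetric])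
  ultimately show ?thesis using assms by (auto simp: pos_def slots_def)
qed

lemma pos_inj: "inj_on (pos ls) (slots ls)"
proof (rule inj_onI)
  fix w w' assume w: "w \<in> slots ls" "w' \<in> slots ls" "pos ls w = pos ls w'"
  obtain i j i' j' where ij: "w = (i, j)" "w' = (i', j')" by fastforce
  then have "i = i'" using w pos_less[of i j ls i' j'] pos_less[of i' j' ls i j] by (metis less_irrefl nat_neq_iff)
  then show "w = w'" using w ij by (simp add: pos_def)
qed

lemma closed_segment_poles: "z \<in> closed_segment \<i> (- \<i>) \<Longrightarrow> Re z = 0 \<and> \<bar>Im z\<bar> \<le> 1"
  by (auto simp: in_segment abs_le_iff)

lemma closed_segment_top: "z \<in> closed_segment \<i> (of_nat k) \<Longrightarrow> Re z = (1 - Im z) * real k \<and> 0 \<le> Im z"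
  by (auto simp: in_segment)

lemma closed_segment_bottom: "z \<in> closed_segment (- \<i>) (of_nat k) \<Longrightarrow> Re z = (1 + Im z) * real k \<and> Im z \<le> 0"
  by (auto simp: in_segment)

lemma closed_segment_axis: "z \<in> closed_segment (of_nat k) (of_nat (Suc k)) \<Longrightarrow> Im z = 0 \<and> real k \<le> Re z \<and> Re z \<le> real k + 1"
  by (auto simp: in_segment algebra_simps)

text \<open>The four types of segments in the drawing, which reduces crossings to a finite case
  analysis. \<open>kind_pos\<close> keeps axis points away from 0, where the segment between the
  dominating vertices meets the axis.\<close>

datatype edge_kind = Poles | Top nat | Bottom nat | Axis nat

fun kind_seg :: "edge_kind \<Rightarrow> complex set" where
  "kind_seg Poles = closed_segment \<i> (- \<i>)"
| "kind_seg (Top k) = closed_segment \<i> (of_nat k)"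
| "kind_seg (Bottom k) = closed_segment (- \<i>) (of_nat k)"
| "kind_seg (Axis k) = closed_segment (of_nat k) (of_nat (Suc k))"

fun kind_ends :: "edge_kind \<Rightarrow> complex set" where
  "kind_ends Poles = {\<i>, - \<i>}"
| "kind_ends (Top k) = {\<i>, of_nat k}"
| "kind_ends (Bottom k) = {- \<i>, of_nat k}"
| "kind_ends (Axis k) = {of_nat k, of_nat (Suc k)}"

fun kind_pos :: "edge_kind \<Rightarrow> bool" where
  "kind_pos Poles = True"
| "kind_pos (Top k) = (k > 0)"
| "kind_pos (Bottom k) = (k > 0)"
| "kind_pos (Axis k) = (k > 0)"

lemma eq_i: "Re z = 0 \<Longrightarrow> Im z = 1 \<Longrightarrow> z = \<i>" "Re z = 0 \<Longrightarrow> Im z = - 1 \<Longrightarrow> z = - \<i>"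
  "Re z = real k \<Longrightarrow> Im z = 0 \<Longrightarrow> z = of_nat k"
  by (simp_all add: complex_eq_iff)

lemma kind_seg_props:
  "z \<in> kind_seg Poles \<Longrightarrow> Re z = 0 \<and> \<bar>Im z\<bar> \<le> 1"
  "z \<in> kind_seg (Top k) \<Longrightarrow> Re z = (1 - Im z) * real k \<and> 0 \<le> Im z"
  "z \<in> kind_seg (Bottom k) \<Longrightarrow> Re z = (1 + Im z) * real k \<and> Im z \<le> 0"
  "z \<in> kind_seg (Axis k) \<Longrightarrow> Im z = 0 \<and> real k \<le> Re z \<and> Re z \<le> real k + 1"
  using closed_segment_poles closed_segment_top closed_segment_bottom closed_segment_axis by auto

text \<open>Segments from the same dominating vertex have different slopes and meet only there. One
  from above and one from below meet only on the axis. A point on the axis that lies on such a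
  segment is an integer, hence an end of the axis segments through it.\<close>

lemma kind_cross_sym:
  assumes "kind_pos a" "kind_pos b" "a \<noteq> b" "z \<in> kind_seg a" "z \<in> kind_seg b"
  shows "z \<in> kind_ends a \<inter> kind_ends b"
proof -
  have PT: "z \<in> kind_ends Poles \<inter> kind_ends (Top k)" if "k > 0" "z \<in> kind_seg Poles" "z \<in> kind_seg (Top k)" for k z
    using kind_seg_props(1)[OF that(2)] kind_seg_props(2)[OF that(3)] that(1) by (auto intro: eq_i)
  have PB: "z \<in> kind_ends Poles \<inter> kind_ends (Bottom k)" if "k > 0" "z \<in> kind_seg Poles" "z \<in> kind_seg (Bottom k)" for k z
    using kind_seg_props(1)[OF that(2)] kind_seg_props(3)[OF that(3)] that(1) by (auto intro: eq_i)
  have PA: False if "k > 0" "z \<in> kind_seg Poles" "z \<in> kind_seg (Axis k)" for k z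
    using kind_seg_props(1)[OF that(2)] kind_seg_props(4)[OF that(3)] that(1) by auto
  have TT: "z \<in> kind_ends (Top k) \<inter> kind_ends (Top l)" if "k \<noteq> l" "z \<in> kind_seg (Top k)" "z \<in> kind_seg (Top l)" for k l z
  proof -
    have "(1 - Im z) * (real k - real l) = 0"
      using kind_seg_props(2)[OF that(2)] kind_seg_props(2)[OF that(3)] by (simp add: algebra_simps)
    then have "Im z = 1" using that(1) by simp
    then show ?thesis using kind_seg_props(2)[OF that(2)] by (auto intro: eq_i)
  qed
  have BB: "z \<in> kind_ends (Bottom k) \<inter> kind_ends (Bottom l)" if "k \<noteq> l" "z \<in> kind_seg (Bottom k)" "z \<in> kind_seg (Bottom l)" for k l z
  proof -
    have "(1 + Im z) * (real k - real l) = 0"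
      using kind_seg_props(3)[OF that(2)] kind_seg_props(3)[OF that(3)] by (simp add: algebra_simps)
    then have "Im z = - 1" using that(1) by simp
    then show ?thesis using kind_seg_props(3)[OF that(2)] by (auto intro: eq_i)
  qed
  have TB: "z \<in> kind_ends (Top k) \<inter> kind_ends (Bottom l)" if "z \<in> kind_seg (Top k)" "z \<in> kind_seg (Bottom l)" for k l z
  proof -
    have "Im z = 0" using kind_seg_props(2)[OF that(1)] kind_seg_props(3)[OF that(2)] by simp
    then show ?thesis using kind_seg_props(2)[OF that(1)] kind_seg_props(3)[OF that(2)] by (auto intro: eq_i)
  qed
  have axis: "z = of_nat k \<or> z = of_nat (Suc k)" "l = k \<or> l = Suc k"
    if "z \<in> kind_seg (Axis k)" "Re z = real l" for k l z
  proof -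
    have "real k \<le> real l" "real l \<le> real (Suc k)" using kind_seg_props(4)[OF that(1)] that(2) by auto
    then have "k \<le> l" "l \<le> Suc k" by simp_all
    then show "l = k \<or> l = Suc k" by auto
    then show "z = of_nat k \<or> z = of_nat (Suc k)"
      using eq_i(3)[of z l] that kind_seg_props(4)[OF that(1)] by auto
  qed
  have TA: "z \<in> kind_ends (Top k) \<inter> kind_ends (Axis l)" if "z \<in> kind_seg (Top k)" "z \<in> kind_seg (Axis l)" for k l z
    using kind_seg_props(2)[OF that(1)] kind_seg_props(4)[OF that(2)] axis[OF that(2), of k] eq_i(3)[of z k] by auto
  have BA: "z \<in> kind_ends (Bottom k) \<inter> kind_ends (Axis l)" if "z \<in> kind_seg (Bottom k)" "z \<in> kind_seg (Axis l)" for k l z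
    using kind_seg_props(3)[OF that(1)] kind_seg_props(4)[OF that(2)] axis[OF that(2), of k] eq_i(3)[of z k] by auto
  have AA: "z \<in> kind_ends (Axis k) \<inter> kind_ends (Axis l)" if kl: "k < l" "z \<in> kind_seg (Axis k)" "z \<in> kind_seg (Axis l)" for k l z
  proof -
    have "real l \<le> real k + 1" using kind_seg_props(4)[OF kl(2)] kind_seg_props(4)[OF kl(3)] by simp
    then have l: "l = Suc k" using kl(1) by simp
    then have "Re z = real l" using kind_seg_props(4)[OF kl(2)] kind_seg_props(4)[OF kl(3)] by simp
    then have "z = of_nat l" using eq_i(3) kind_seg_props(4)[OF kl(2)] by blast
    then show ?thesis using l by simp
  qed
  show ?thesis
  proof (cases a)
    case Poles
    note a = Poles
    show ?thesis
    proof (cases b)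
      case (Top l) then show ?thesis using PT[of l z] assms a by simp
    next
      case (Bottom l) then show ?thesis using PB[of l z] assms a by simp
    next
      case (Axis l) then show ?thesis using PA[of l z] assms a by simp
    qed (use assms a in simp)
  next
    case (Top k)
    note a = Top
    show ?thesis
    proof (cases b)
      case Poles then show ?thesis using PT[of k z] assms a by auto
    next
      case (Top l) then show ?thesis using TT[of k l z] assms a by auto
    next
      case (Bottom l) then show ?thesis using TB[of z k l] assms a by auto
    next
      case (Axis l) then show ?thesis using TA[of z k l] assms a by auto
    qed
  next
    case (Bottom k)
    note a = Bottom
    show ?thesis
    proof (cases b)
      case Poles then show ?thesis using PB[of k z] assms a by auto
    next
      case (Top l) then show ?thesis using TB[of z l k] assms a by auto
    next
      case (Bottom l) then show ?thesis using BB[of k l z] assms a by auto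
    next
      case (Axis l) then show ?thesis using BA[of z k l] assms a by auto
    qed
  next
    case (Axis k)
    show ?thesis
    proof (cases b)
      case Poles then show ?thesis using assms PA Axis by auto
    next
      case (Top l) then show ?thesis using assms TA Axis by blast
    next
      case (Bottom l) then show ?thesis using assms BA Axis by blast
    next
      case b: (Axis l)
      then have "k < l \<or> l < k" using assms(3) Axis by auto
      then show ?thesis using AA[of k l z] AA[of l k z] assms(4,5) Axis b by blast
    qed
  qed
qed

definition drawn :: "nat list \<Rightarrow> (nat + nat \<times> nat) set \<Rightarrow> edge_kind \<Rightarrow> nat + nat \<times> nat \<Rightarrow> nat + nat \<times> nat \<Rightarrow> bool" where
  "drawn ls e k u v \<longleftrightarrow> e = {u, v} \<and> u \<in> verts (JP ls) \<and> v \<in> verts (JP ls) \<and> kind_pos k \<and>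
    place ls u \<noteq> place ls v \<and> kind_seg k = closed_segment (place ls u) (place ls v) \<and> kind_ends k = place ls ` e"

lemma edge_kind_ex:
  assumes "e \<in> edges (JP ls)"
  shows "\<exists>k u v. drawn ls e k u v"
proof -
  consider "e = {Inl 0, Inl 1}"
    | i j where "e = {Inr (i, j), Inr (i, Suc j)}" "i < length ls" "Suc j < ls ! i"
    | w where "e = {Inl 0, Inr w}" "w \<in> slots ls"
    | w where "e = {Inl 1, Inr w}" "w \<in> slots ls"
    using assms unfolding edges_JP by auto
  then show ?thesis
  proof cases
    case 1
    have "place ls (Inl 0) = \<i>" "place ls (Inl 1) = - \<i>" "\<i> \<noteq> - \<i>"
      by (simp_all add: place_def complex_eq_iff)
    then have "drawn ls e Poles (Inl 0) (Inl 1)" using 1 by (simp add: drawn_def verts_JP)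
    then show ?thesis by blast
  next
    case (2 i j)
    have "pos ls (i, Suc j) = Suc (pos ls (i, j))" by (simp add: pos_def)
    then have "drawn ls e (Axis (pos ls (i, j))) (Inr (i, j)) (Inr (i, Suc j))" using 2
      by (auto simp: drawn_def place_def verts_JP slots_def pos_def)
    then show ?thesis by blast
  next
    case (3 w)
    then have "drawn ls e (Top (pos ls w)) (Inl 0) (Inr w)"
      by (auto simp: drawn_def place_def verts_JP pos_def complex_eq_iff)
    then show ?thesis by blast
  next
    case (4 w)
    then have "drawn ls e (Bottom (pos ls w)) (Inl 1) (Inr w)"
      by (auto simp: drawn_def place_def verts_JP pos_def complex_eq_iff)
    then show ?thesis by blast
  qed
qed

lemma place_inj: "inj_on (place ls) (verts (JP ls))"
proof (rule inj_onI)
  fix z z' assume "z \<in> verts (JP ls)" "z' \<in> verts (JP ls)" "place ls z = place ls z'"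
  then show "z = z'"
    unfolding verts_JP by (auto simp: place_def complex_eq_iff inj_on_eq_iff[OF pos_inj])
qed

text \<open>An inner vertex is an end of its own segment from the top, so any other segment through
  it crosses that one and the crossing lemma applies.\<close>

lemma place_kind_seg:
  assumes "kind_pos k" "w \<in> verts (JP ls)" "place ls w \<in> kind_seg k"
  shows "place ls w \<in> kind_ends k"
proof -
  have p: "pos ls q > 0" for q by (simp add: pos_def)
  consider "w = Inl 0" | "w = Inl 1" | q where "w = Inr q" using assms(2) by (auto simp: verts_JP)
  then show ?thesis
  proof cases
    case 1
    then show ?thesis using kind_seg_props[of "place ls w"] assms(1,3) by (cases k) (auto simp: place_def)
  next
    case 2
    then show ?thesis using kind_seg_props[of "place ls w"] assms(1,3) by (cases k) (auto simp: place_def)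
  next
    case (3 q)
    then have z: "place ls w \<in> kind_seg (Top (pos ls q))" "place ls w \<in> kind_seg (Bottom (pos ls q))"
      "place ls w \<noteq> \<i>" "place ls w \<noteq> - \<i>"
      by (auto simp: place_def complex_eq_iff)
    show ?thesis
    proof (cases "k = Top (pos ls q)")
      case True
      then show ?thesis using 3 by (simp add: place_def)
    next
      case False
      then show ?thesis using kind_cross_sym[of k "Top (pos ls q)"] assms(1,3) p z by auto
    qed
  qed
qed

lemma planar_JP: "planar (JP ls)"
proof -
  obtain K U W where K0: "\<And>e. e \<in> edges (JP ls) \<Longrightarrow> drawn ls e (K e) (U e) (W e)"
    using edge_kind_ex[of _ ls] by metis
  note K = K0[unfolded drawn_def]
  define \<gamma> where "\<gamma> e = linepath (place ls (U e)) (place ls (W e))" for e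
  have img: "path_image (\<gamma> e) = kind_seg (K e)" if "e \<in> edges (JP ls)" for e
    using K[OF that] by (simp add: \<gamma>_def)
  have inv: "x \<in> verts (JP ls) \<Longrightarrow> e \<in> edges (JP ls) \<Longrightarrow> place ls x \<in> kind_ends (K e) \<Longrightarrow> x \<in> e" for x e
  proof -
    assume *: "x \<in> verts (JP ls)" "e \<in> edges (JP ls)" "place ls x \<in> kind_ends (K e)"
    then obtain y where y: "y \<in> e" "place ls x = place ls y" using K[OF *(2)] by auto
    then have "y \<in> verts (JP ls)" using K[OF *(2)] by (metis insertE singletonD)
    then show "x \<in> e" using inj_onD[OF place_inj y(2) *(1)] y(1) by simp
  qed
  show ?thesis
    unfolding planar_def
  proof (rule exI[of _ "place ls"], rule exI[of _ \<gamma>], intro conjI ballI impI)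
    show "inj_on (place ls) (verts (JP ls))" by (rule place_inj)
  next
    fix e assume e: "e \<in> edges (JP ls)"
    show "\<exists>u v. e = {u, v} \<and> arc (\<gamma> e) \<and> pathstart (\<gamma> e) = place ls u \<and> pathfinish (\<gamma> e) = place ls v"
      using K[OF e] by (intro exI[of _ "U e"] exI[of _ "W e"]) (auto simp: \<gamma>_def arc_linepath)
  next
    fix e w assume e: "e \<in> edges (JP ls)" and w: "w \<in> verts (JP ls)" "place ls w \<in> path_image (\<gamma> e)"
    then have "place ls w \<in> kind_ends (K e)" using place_kind_seg[of "K e" w ls] img[OF e] K[OF e] by simp
    then show "w \<in> e" using inv[OF w(1) e] by simp
  next
    fix e e' assume e: "e \<in> edges (JP ls)" "e' \<in> edges (JP ls)" "e \<noteq> e'"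
    \<comment> \<open>The ends of the segment determine the edge because the placement is
      injective.\<close>
    have "kind_ends (K e) \<noteq> kind_ends (K e')"
    proof
      assume "kind_ends (K e) = kind_ends (K e')"
      then have "place ls ` e = place ls ` e'" using K[OF e(1)] K[OF e(2)] by simp
      moreover have "e \<subseteq> verts (JP ls)" "e' \<subseteq> verts (JP ls)" using K[OF e(1)] K[OF e(2)] by (metis empty_subsetI insert_subset)+
      ultimately show False using e(3) inj_on_image_eq_iff[OF place_inj[of ls]] by blast
    qed
    then have ne: "K e \<noteq> K e'" by auto
    show "path_image (\<gamma> e) \<inter> path_image (\<gamma> e') \<subseteq> place ls ` (e \<inter> e')"
    proof
      fix z assume "z \<in> path_image (\<gamma> e) \<inter> path_image (\<gamma> e')"
      then have z: "z \<in> kind_ends (K e) \<inter> kind_ends (K e')"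
        using kind_cross_sym[OF _ _ ne] K[OF e(1)] K[OF e(2)] img e by auto
      then obtain x where x: "x \<in> e" "z = place ls x" using K[OF e(1)] by auto
      moreover have "x \<in> verts (JP ls)" using K[OF e(1)] x(1) by (metis insertE singletonD)
      ultimately have "x \<in> e'" using inv[of x e'] z e by auto
      then show "z \<in> place ls ` (e \<inter> e')" using x by blast
    qed
  qed
qed

section \<open>Weights of paths\<close>

text \<open>The root in \<open>(0, 1)\<close> of the characteristic equation \<open>q\<^sup>2 - r q + 1 = 0\<close> of the recurrence along a path.\<close>

definition decay :: "real \<Rightarrow> real" where
  "decay r = (r - sqrt (r\<^sup>2 - 4)) / 2"

text \<open>Solution of \<open>r * x i = 2 + x (i - 1) + x (i + 1)\<close> with \<open>x 0 = x (a + 1) = 0\<close>: the entries of a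
  Perron vector of the join along an inner path on \<open>a\<close> vertices, if the two dominating vertices
  have entry 1.\<close>

definition profile :: "real \<Rightarrow> nat \<Rightarrow> nat \<Rightarrow> real" where
  "profile r a i = 2 / (r - 2) * (1 - (decay r ^ i + decay r ^ (a + 1 - i)) / (1 + decay r ^ (a + 1)))"

definition weight :: "real \<Rightarrow> nat \<Rightarrow> real" where
  "weight r a = (\<Sum>j<a. profile r a (Suc j))"

text \<open>The loss caused by the two ends of the path, in units of \<open>2 / (r - 2)\<close>, the
  entry far from the ends; see \<open>weight_eq\<close>.\<close>

definition deficit :: "real \<Rightarrow> nat \<Rightarrow> real" where
  "deficit r a = 2 * (decay r - decay r ^ (a + 1)) / ((1 - decay r) * (1 + decay r ^ (a + 1)))"

lemma decay:
  assumes "r > 2"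
  shows "0 < decay r" "decay r < 1" "decay r * r = 1 + (decay r)\<^sup>2" "decay r \<le> 1 / (r - 1)"
proof -
  have r2: "r\<^sup>2 > 4" using assms power_strict_mono[of 2 r 2] by simp
  define s where "s = sqrt (r\<^sup>2 - 4)"
  have s: "s\<^sup>2 = r\<^sup>2 - 4" "s > 0" using r2 by (simp_all add: s_def)
  have d: "decay r = (r - s) / 2" by (simp add: decay_def s_def)
  have "s < r" using s assms by (intro power2_less_imp_less[of s r]) auto
  then show 1: "0 < decay r" by (simp add: d)
  have "r - 2 < s"
  proof (rule power2_less_imp_less)
    have "(r - 2)\<^sup>2 = r\<^sup>2 - 4 * r + 4" by (simp add: power2_eq_square algebra_simps)
    then show "(r - 2)\<^sup>2 < s\<^sup>2" using assms s(1) by simp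
  qed (use s in simp)
  then show 2: "decay r < 1" by (simp add: d)
  show 3: "decay r * r = 1 + (decay r)\<^sup>2"
    using s(1) by (simp add: d power2_eq_square field_simps)
  have "decay r * (r - 1) = 1 - decay r * (1 - decay r)"
    using 3 by (simp add: power2_eq_square algebra_simps)
  also have "\<dots> \<le> 1" using 1 2 by simp
  finally show "decay r \<le> 1 / (r - 1)" using assms by (simp add: field_simps)
qed

context
  fixes r :: real
  assumes r: "r > 2"
begin

lemmas q = decay[OF r]

lemma profile_0 [simp]: "profile r a 0 = 0"
proof -
  have "1 + decay r ^ (a + 1) > 0" using q(1) by (simp add: add_pos_pos)
  then show ?thesis by (simp add: profile_def)
qed

lemma profile_end [simp]: "profile r a (Suc a) = 0"
proof -
  have "1 + decay r ^ Suc a > 0" using q(1) by (simp add: add_pos_pos)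
  then show ?thesis by (simp add: profile_def add.commute)
qed

lemma profile_rec:
  assumes "1 \<le> i" "i \<le> a"
  shows "r * profile r a i = 2 + profile r a (i - 1) + profile r a (i + 1)"
proof -
  let ?q = "decay r" and ?c = "2 / (r - 2)" and ?D = "1 + decay r ^ (a + 1)"
  have D: "?D > 0" using q(1) by (simp add: add_pos_pos)
  have c: "r * ?c = 2 + 2 * ?c" using r by (simp add: field_simps)
  have step: "r * ?q ^ Suc k = ?q ^ k + ?q ^ Suc (Suc k)" for k
  proof -
    have "r * ?q ^ Suc k = ?q ^ k * (?q * r)" by simp
    also have "\<dots> = ?q ^ k + ?q ^ Suc (Suc k)" unfolding q(3) by (simp add: power2_eq_square algebra_simps)
    finally show ?thesis .
  qed
  obtain k where k: "i = Suc k" using assms by (cases i) auto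
  define l where "l = a - i"
  have l: "a + 1 - i = Suc l" "a + 1 - (i - 1) = Suc (Suc l)" "a + 1 - (i + 1) = l"
    using assms by (auto simp: l_def)
  have "r * profile r a i = r * ?c - ?c * (r * (?q ^ i + ?q ^ (a + 1 - i)) / ?D)"
    by (simp add: profile_def algebra_simps)
  also have "r * (?q ^ i + ?q ^ (a + 1 - i)) = (?q ^ (i - 1) + ?q ^ (a + 1 - (i - 1))) + (?q ^ (i + 1) + ?q ^ (a + 1 - (i + 1)))"
  proof -
    have "r * ?q ^ i = ?q ^ (i - 1) + ?q ^ (i + 1)" using step[of k] k by simp
    moreover have "r * ?q ^ (a + 1 - i) = ?q ^ (a + 1 - (i - 1)) + ?q ^ (a + 1 - (i + 1))"
      using step[of l] unfolding l by simp
    ultimately show ?thesis by (simp only: distrib_left)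
  qed
  also have "r * ?c - ?c * (\<dots> / ?D) = 2 + profile r a (i - 1) + profile r a (i + 1)"
    unfolding c profile_def by (simp add: add_divide_distrib algebra_simps)
  finally show ?thesis .
qed

lemma weight_eq: "weight r a = 2 / (r - 2) * (real a - deficit r a)"
proof -
  let ?q = "decay r" and ?c = "2 / (r - 2)" and ?D = "1 + decay r ^ (a + 1)"
  have D: "?D > 0" using q(1) by (simp add: add_pos_pos)
  have geo: "(\<Sum>j<a. ?q ^ Suc j) = (?q - ?q ^ (a + 1)) / (1 - ?q)"
  proof -
    have "(\<Sum>j<a. ?q ^ Suc j) = ?q * (\<Sum>j<a. ?q ^ j)" by (simp add: sum_distrib_left)
    also have "(\<Sum>j<a. ?q ^ j) = (1 - ?q ^ a) / (1 - ?q)" using q(2) by (simp add: sum_gp_strict)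
    finally show ?thesis by (simp add: algebra_simps)
  qed
  have "(\<Sum>j<a. ?q ^ (a + 1 - Suc j)) = (\<Sum>j<a. ?q ^ Suc (a - Suc j))"
    by (intro sum.cong refl arg_cong[of _ _ "power ?q"]) simp
  also have "\<dots> = (\<Sum>j<a. ?q ^ Suc j)" by (rule sum.nat_diff_reindex)
  finally have geo2: "(\<Sum>j<a. ?q ^ (a + 1 - Suc j)) = (?q - ?q ^ (a + 1)) / (1 - ?q)" using geo by simp
  have "weight r a = ?c * (real a - ((\<Sum>j<a. ?q ^ Suc j) + (\<Sum>j<a. ?q ^ (a + 1 - Suc j))) / ?D)"
    unfolding weight_def profile_def
    by (simp only: sum_distrib_left[symmetric] sum_subtractf sum_divide_distrib[symmetric] sum.distrib) simp
  also have "\<dots> = ?c * (real a - deficit r a)"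
  proof -
    have "(X / Y + X / Y) / Z = 2 * X / (Y * Z)" for X Y Z :: real by simp
    then show ?thesis unfolding geo geo2 deficit_def by simp
  qed
  finally show ?thesis .
qed

text \<open>The deficit decreases in \<open>decay r ^ (a + 1)\<close>, which lies between 0 and
  \<open>(decay r)\<^sup>2\<close>. The lower bound is the value at \<open>a = 1\<close>, the upper
  one the limit for long paths. They differ by a factor near 1, so the total deficit essentially
  counts paths.\<close>

lemma deficit_bounds:
  assumes "a \<ge> 1"
  shows "2 * decay r / (1 + (decay r)\<^sup>2) \<le> deficit r a" "deficit r a \<le> 2 * decay r / (1 - decay r)"
proof -
  let ?q = "decay r"
  define Q where "Q = ?q ^ (a + 1)"
  have Q: "0 < Q" "Q \<le> ?q\<^sup>2" using q(1,2) assms power_decreasing[of 2 "a + 1" ?q] by (simp_all add: Q_def)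
  have e: "deficit r a = (2 / (1 - ?q)) * ((?q - Q) / (1 + Q))" by (simp add: deficit_def Q_def)
  have "(?q - ?q\<^sup>2) / (1 + ?q\<^sup>2) \<le> (?q - Q) / (1 + Q)"
  proof (rule frac_le)
    have "?q\<^sup>2 \<le> ?q" using q(1,2) by (simp add: power2_eq_square mult_left_le)
    then show "0 \<le> ?q - Q" using Q by simp
  qed (use Q in auto)
  then have "(2 / (1 - ?q)) * ((?q - ?q\<^sup>2) / (1 + ?q\<^sup>2)) \<le> deficit r a"
    unfolding e using q(2) by (intro mult_left_mono) auto
  moreover have "(2 / (1 - ?q)) * ((?q - ?q\<^sup>2) / (1 + ?q\<^sup>2)) = 2 * ?q / (1 + ?q\<^sup>2)"
  proof -
    have "?q - ?q\<^sup>2 = ?q * (1 - ?q)" by (simp add: power2_eq_square algebra_simps)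
    then show ?thesis using q(2) by simp
  qed
  ultimately show "2 * ?q / (1 + ?q\<^sup>2) \<le> deficit r a" by simp
  have "(?q - Q) / (1 + Q) \<le> ?q" using Q q(1) by (simp add: field_simps)
  then have "deficit r a \<le> (2 / (1 - ?q)) * ?q" unfolding e using q(2) by (intro mult_left_mono) auto
  then show "deficit r a \<le> 2 * ?q / (1 - ?q)" by simp
qed

text \<open>Equivalent to strict concavity of the deficit. Its increment at a path with
  \<open>X = decay r ^ (a + 1)\<close> is a constant over \<open>1 / X + (1 + q) + q * X\<close>,
  and this denominator grows as \<open>X\<close> shrinks in (0, 1).\<close>

lemma weight_convex:
  assumes "1 \<le> b" "b \<le> a"
  shows "weight r a + weight r b < weight r (a + 1) + weight r (b - 1)"
proof -
  let ?q = "decay r"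
  define A B where "A = ?q ^ (a + 1)" and "B = ?q ^ b"
  have A: "0 < A" using q(1) by (simp add: A_def)
  have AB: "A < B" unfolding A_def B_def using q(1,2) assms by (intro power_strict_decreasing) auto
  have B1: "B < 1" unfolding B_def using q(1,2) assms power_strict_decreasing[of 0 b ?q] by simp
  have B: "0 < B" using A AB by simp
  have dA: "deficit r a = (2 / (1 - ?q)) * ((1 + ?q) / (1 + A) - 1)"
    and dA': "deficit r (a + 1) = (2 / (1 - ?q)) * ((1 + ?q) / (1 + ?q * A) - 1)"
    and dB: "deficit r b = (2 / (1 - ?q)) * ((1 + ?q) / (1 + ?q * B) - 1)"
    and dB': "deficit r (b - 1) = (2 / (1 - ?q)) * ((1 + ?q) / (1 + B) - 1)"
  proof -
    have *: "2 * (?q - X) / ((1 - ?q) * (1 + X)) = (2 / (1 - ?q)) * ((1 + ?q) / (1 + X) - 1)" if "0 < X" for X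
    proof -
      have "(1 + ?q) / (1 + X) - 1 = (?q - X) / (1 + X)" using that by (simp add: field_simps)
      then show ?thesis by simp
    qed
    have qA: "0 < ?q * A" "0 < ?q * B" using q(1) A B by auto
    show "deficit r a = (2 / (1 - ?q)) * ((1 + ?q) / (1 + A) - 1)"
      using *[OF A] by (simp add: deficit_def A_def)
    show "deficit r (a + 1) = (2 / (1 - ?q)) * ((1 + ?q) / (1 + ?q * A) - 1)"
      using *[OF qA(1)] by (simp add: deficit_def A_def)
    show "deficit r b = (2 / (1 - ?q)) * ((1 + ?q) / (1 + ?q * B) - 1)"
      using *[OF qA(2)] by (simp add: deficit_def B_def)
    show "deficit r (b - 1) = (2 / (1 - ?q)) * ((1 + ?q) / (1 + B) - 1)"
      using *[OF B] assms by (simp add: deficit_def B_def)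
  qed
  have h: "1 / (1 + ?q * X) - 1 / (1 + X) = (1 - ?q) / (1 / X + (1 + ?q) + ?q * X)" if "0 < X" for X
  proof -
    have "1 + ?q * X > 0" "1 + X > 0" using q(1) that by (auto simp: add_pos_pos)
    then have "1 / (1 + ?q * X) - 1 / (1 + X) = (1 - ?q) * X / ((1 + ?q * X) * (1 + X))"
      by (simp add: field_simps)
    also have "(1 + ?q * X) * (1 + X) = X * (1 / X + (1 + ?q) + ?q * X)"
      using that by (simp add: field_simps)
    finally show ?thesis using that by simp
  qed
  have "1 / B + ?q * B < 1 / A + ?q * A"
  proof -
    have "?q * A < 1 * 1" using q(1,2) A AB B1 by (intro mult_strict_mono) auto
    then have "(?q * A) * B < 1 * 1" using q(1) A B B1 by (intro mult_strict_mono) auto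
    then have "?q * (B - A) < (B - A) / (A * B)"
      using A B AB by (simp add: pos_less_divide_eq mult.assoc)
    moreover have "(B - A) / (A * B) = 1 / A - 1 / B" using A B by (simp add: field_simps)
    ultimately show ?thesis by (simp add: algebra_simps)
  qed
  then have "(1 - ?q) / (1 / A + (1 + ?q) + ?q * A) < (1 - ?q) / (1 / B + (1 + ?q) + ?q * B)"
    using q(1,2) A B by (intro divide_strict_left_mono mult_pos_pos add_pos_pos) (auto simp: add_pos_pos)
  then have "1 / (1 + ?q * A) - 1 / (1 + A) < 1 / (1 + ?q * B) - 1 / (1 + B)" using h A B by simp
  then have "(2 / (1 - ?q) * (1 + ?q)) * (1 / (1 + ?q * A) - 1 / (1 + A))
      < (2 / (1 - ?q) * (1 + ?q)) * (1 / (1 + ?q * B) - 1 / (1 + B))"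
    using q(1,2) by (intro mult_strict_left_mono) auto
  then have "deficit r (a + 1) - deficit r a < deficit r b - deficit r (b - 1)"
  proof -
    have gen: "C * (y / X - 1) = (C * y) * (1 / X) - C" for C y X :: real by (simp add: algebra_simps)
    assume "(2 / (1 - ?q) * (1 + ?q)) * (1 / (1 + ?q * A) - 1 / (1 + A))
      < (2 / (1 - ?q) * (1 + ?q)) * (1 / (1 + ?q * B) - 1 / (1 + B))"
    then show ?thesis
      unfolding dA dA' dB dB' gen unfolding right_diff_distrib[of "2 / (1 - ?q) * (1 + ?q)"] by linarith
  qed
  then have "real a - deficit r a + (real b - deficit r b) < real (a + 1) - deficit r (a + 1) + (real (b - 1) - deficit r (b - 1))"
    using assms by (simp add: of_nat_diff)
  then have "2 / (r - 2) * (real a - deficit r a + (real b - deficit r b)) < 2 / (r - 2) * (real (a + 1) - deficit r (a + 1) + (real (b - 1) - deficit r (b - 1)))"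
    using r by (intro mult_strict_left_mono) auto
  then show ?thesis unfolding weight_eq by (simp add: distrib_left)
qed

lemma weight_shift:
  assumes "1 \<le> j" "j \<le> b" "b \<le> a"
  shows "weight r a + weight r b < weight r (a + j) + weight r (b - j)"
  using assms(1,2)
proof (induction j rule: dec_induct)
  case base
  then show ?case using weight_convex[of b a] assms by simp
next
  case (step j)
  have "weight r (a + j) + weight r (b - j) < weight r (a + j + 1) + weight r (b - j - 1)"
    using weight_convex[of "b - j" "a + j"] step assms by auto
  then show ?case using step by simp
qed

text \<open>Satisfies the eigenvalue equation for \<open>r\<close> at every inner vertex, whatever
  the lengths. Only the two dominating vertices can fail, both by the amount 1 + total weight -
  \<open>r\<close>.\<close>

definition test_vector :: "nat list \<Rightarrow> nat + nat \<times> nat \<Rightarrow> real" where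
  "test_vector ls z = (case z of Inl _ \<Rightarrow> 1 | Inr (i, j) \<Rightarrow> profile r (ls ! i) (Suc j))"

lemma sum_slots: "(\<Sum>w\<in>slots ls. f w) = (\<Sum>i<length ls. \<Sum>j<ls ! i. f (i, j))"
  unfolding slots_Sigma by (subst sum.Sigma) auto

lemma finite_verts_JP: "finite (verts (JP ls))"
  using simple_JP by (simp add: simple_graph_def)

lemma sum_verts_JP: "(\<Sum>v\<in>verts (JP ls). f v) = f (Inl 0) + f (Inl 1) + (\<Sum>w\<in>slots ls. f (Inr w))"
proof -
  have "(\<Sum>v\<in>verts (JP ls). f v) = (\<Sum>v\<in>{Inl 0, Inl 1}. f v) + (\<Sum>v\<in>Inr ` slots ls. f v)"
    unfolding verts_JP by (rule sum.union_disjoint) (auto simp: finite_slots)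
  then show ?thesis by (simp add: sum.reindex)
qed

lemma adj_matrix_adj: "adj_matrix G u v = (if adj G u v then 1 else 0)"
  by (simp add: adj_matrix_def adj_def)

lemma mv_JP_pole:
  assumes "a < 2"
  shows "mv (JP ls) x (Inl a) = x (Inl (1 - a)) + (\<Sum>w\<in>slots ls. x (Inr w))"
  using assms unfolding mv_def sum_verts_JP by (auto simp: adj_matrix_adj less_2_cases_iff)

lemma mv_test_pole:
  assumes "a < 2"
  shows "mv (JP ls) (test_vector ls) (Inl a) = 1 + (\<Sum>i<length ls. weight r (ls ! i))"
  unfolding mv_JP_pole[OF assms] by (simp add: test_vector_def sum_slots weight_def)

lemma mv_test_slot:
  assumes "w \<in> slots ls"
  shows "mv (JP ls) (test_vector ls) (Inr w) = r * test_vector ls (Inr w)"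
proof -
  obtain i j where w: "w = (i, j)" "i < length ls" "j < ls ! i" using assms by (auto simp: slots_def)
  let ?f = "profile r (ls ! i)"
  have "mv (JP ls) (test_vector ls) (Inr w) = 2 +
      (\<Sum>i'<length ls. \<Sum>j'<ls ! i'. (if adj (JP ls) (Inr (i, j)) (Inr (i', j')) then 1 else 0) * profile r (ls ! i') (Suc j'))"
    using assms unfolding mv_def sum_verts_JP by (simp add: adj_matrix_adj w test_vector_def sum_slots)
  also have "(\<Sum>i'<length ls. \<Sum>j'<ls ! i'. (if adj (JP ls) (Inr (i, j)) (Inr (i', j')) then 1 else 0) * profile r (ls ! i') (Suc j'))
      = (\<Sum>i'<length ls. if i' = i then (\<Sum>j'<ls ! i. (if j' = Suc j then ?f (Suc j') else 0) + (if j = Suc j' then ?f (Suc j') else 0)) else 0)"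
    using w by (intro sum.cong refl) (auto intro!: sum.cong)
  also have "\<dots> = (\<Sum>j'<ls ! i. (if j' = Suc j then ?f (Suc j') else 0)) + (\<Sum>j'<ls ! i. if j = Suc j' then ?f (Suc j') else 0)"
    using w by (simp add: sum.distrib)
  also have "(\<Sum>j'<ls ! i. (if j' = Suc j then ?f (Suc j') else 0)) = ?f (Suc (Suc j))"
    using w by (cases "Suc j < ls ! i") (auto simp: not_less le_Suc_eq dest: order_antisym)
  also have "(\<Sum>j'<ls ! i. if j = Suc j' then ?f (Suc j') else 0) = ?f j"
    using w by (cases j) auto
  finally have "mv (JP ls) (test_vector ls) (Inr w) = r * ?f (Suc j)"
    using profile_rec[of "Suc j" "ls ! i"] w by simp
  moreover have "test_vector ls (Inr w) = ?f (Suc j)" by (simp add: test_vector_def w)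
  ultimately show ?thesis by simp
qed

lemma ip_test:
  "ip (JP ls) x (mv (JP ls) (test_vector ls)) = r * ip (JP ls) x (test_vector ls) +
    (x (Inl 0) + x (Inl 1)) * (1 + (\<Sum>i<length ls. weight r (ls ! i)) - r)"
  unfolding ip_def sum_verts_JP
  by (simp add: mv_test_pole mv_test_slot) (simp add: test_vector_def algebra_simps sum_distrib_left sum.distrib)

lemma spectral_radius_JP_gt:
  assumes "1 + (\<Sum>i<length ls. weight r (ls ! i)) > r"
  shows "spectral_radius (JP ls) > r"
proof -
  have V: "finite (verts (JP ls))" "verts (JP ls) \<noteq> {}" using finite_verts_JP by (auto simp: verts_JP)
  have pos: "ip (JP ls) (test_vector ls) (test_vector ls) > 0"
    by (rule ip_self_pos[of _ "Inl 0"]) (auto simp: finite_slots verts_JP test_vector_def)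
  have "r * ip (JP ls) (test_vector ls) (test_vector ls) < ip (JP ls) (test_vector ls) (mv (JP ls) (test_vector ls))"
    unfolding ip_test using assms by (simp add: test_vector_def)
  also have "\<dots> \<le> spectral_radius (JP ls) * ip (JP ls) (test_vector ls) (test_vector ls)"
    by (rule spectral_radius_rayleigh(1)[OF V])
  finally show ?thesis using pos by simp
qed

text \<open>Pairing a Perron vector with the test vector and using symmetry leaves the defect at the
  dominating vertices times the sum of their Perron entries, which must vanish.\<close>

lemma spectral_radius_JP_eq:
  assumes "spectral_radius (JP ls) = r"
  shows "1 + (\<Sum>i<length ls. weight r (ls ! i)) = r"
proof -
  let ?G = "JP ls"
  have V: "finite (verts ?G)" "verts ?G \<noteq> {}" using finite_verts_JP by (auto simp: verts_JP)
  obtain x where x: "\<And>v. x v \<ge> 0" "\<exists>v\<in>verts ?G. x v > 0" "\<And>u. u \<in> verts ?G \<Longrightarrow> mv ?G x u = r * x u"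
    using perron_vector[OF V] assms by metis
  have "ip ?G (mv ?G x) (test_vector ls) = r * ip ?G x (test_vector ls)"
    using x(3) by (simp add: ip_def sum_distrib_left mult_ac)
  then have "(x (Inl 0) + x (Inl 1)) * (1 + (\<Sum>i<length ls. weight r (ls ! i)) - r) = 0"
    using mv_sym[of ?G x "test_vector ls"] ip_test[of ls x] by simp
  \<comment> \<open>If both entries were 0, the equation at one of them would make all inner entries
    0 too.\<close>
  moreover have "x (Inl 0) + x (Inl 1) \<noteq> 0"
  proof
    assume "x (Inl 0) + x (Inl 1) = 0"
    then have 0: "x (Inl 0) = 0" "x (Inl 1) = 0" using x(1)[of "Inl 0"] x(1)[of "Inl 1"] by linarith+
    have "mv ?G x (Inl 0) = r * x (Inl 0)" by (rule x(3)) (simp add: verts_JP)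
    then have "(\<Sum>w\<in>slots ls. x (Inr w)) = 0" using mv_JP_pole[of 0 ls x] 0 by simp
    then have "\<forall>w\<in>slots ls. x (Inr w) = 0" using x(1) by (subst (asm) sum_nonneg_eq_0_iff) (auto simp: finite_slots)
    then show False using x(2) 0 by (auto simp: verts_JP)
  qed
  ultimately show ?thesis by simp
qed

end

text \<open>Both weights are taken at the same \<open>r\<close>, the spectral radius of the first
  join. There the first total weight is exactly \<open>r - 1\<close>, so the second exceeds
  it.\<close>

lemma spectral_radius_JP_less:
  assumes "spectral_radius (JP ls) = r" "r > 2"
    and "(\<Sum>i<length ls. weight r (ls ! i)) < (\<Sum>i<length ms. weight r (ms ! i))"
  shows "spectral_radius (JP ms) > r"
  using spectral_radius_JP_gt[OF assms(2), of ms] spectral_radius_JP_eq[OF assms(2,1)] assms(3) by simp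

text \<open>For single vertices the weight is \<open>2 / r\<close>, and \<open>N\<close> of them
  total \<open>r\<close> when \<open>r\<^sup>2 = 2 * N\<close>; the edge of \<open>K2\<close>
  supplies the surplus 1.\<close>

lemma spectral_radius_JP_singletons:
  assumes "N \<ge> 3"
  shows "spectral_radius (JP (replicate N 1)) > sqrt (2 * real N)"
proof -
  let ?r = "sqrt (2 * real N)"
  have r: "?r > 2" using assms real_less_rsqrt[of 2 "2 * real N"] by simp
  note q = decay[OF r]
  have "profile ?r 1 1 * ?r = 2"
    using profile_rec[OF r, of 1 1] profile_0[OF r, of 1] profile_end[OF r, of 1] by (simp add: mult.commute numeral_2_eq_2)
  then have "weight ?r 1 * ?r = 2" by (simp add: weight_def)
  then have "weight ?r 1 = 2 / ?r" using assms by (subst eq_divide_eq) simp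
  moreover have "real N * (2 / ?r) = ?r" using real_div_sqrt[of "2 * real N"] by (simp add: mult.commute)
  ultimately show ?thesis
    using spectral_radius_JP_gt[OF r, of "replicate N 1"] by simp
qed

section \<open>Optimal path lengths\<close>

abbreviation tot :: "(nat \<Rightarrow> 'b::comm_monoid_add) \<Rightarrow> nat list \<Rightarrow> 'b" where
  "tot g ls \<equiv> \<Sum>i<length ls. g (ls ! i)"

lemma tot_update2:
  assumes "i < length ls" "j < length ls" "i \<noteq> j"
  shows "tot g (ls[i := x, j := y]) + (g (ls ! i) + g (ls ! j)) = tot g ls + (g x + g y)"
proof -
  let ?I = "{..<length ls} - {i} - {j}"
  have split: "(\<Sum>s<length ls. h s) = h i + (h j + (\<Sum>s\<in>?I. h s))" for h :: "nat \<Rightarrow> 'a"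
    using assms by (subst sum.remove[of _ i], simp, simp) (subst sum.remove[of _ j], auto)
  have "(\<Sum>s\<in>?I. g (ls[i := x, j := y] ! s)) = (\<Sum>s\<in>?I. g (ls ! s))"
    by (intro sum.cong) auto
  then show ?thesis
    using split[of "\<lambda>s. g (ls[i := x, j := y] ! s)"] split[of "\<lambda>s. g (ls ! s)"] assms
    by (simp add: ac_simps)
qed

lemma tot_id: "tot id ls = sum_list ls"
  by (simp add: sum_list_sum_nth lessThan_atLeast0)

text \<open>The last length may be anything from 1 to \<open>k\<close>; the value \<open>k\<close>
  is the divisible case, where \<open>H_P_lengths\<close> appends no remainder.\<close>

lemma H_P_lengths_eqI:
  assumes "length ls \<ge> 2" "ls ! 0 = n1" "\<And>i. 1 \<le> i \<Longrightarrow> i < length ls - 1 \<Longrightarrow> ls ! i = k"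
    and "1 \<le> last ls" "last ls \<le> k" "sum_list ls = n - 2"
  shows "ls = H_P_lengths n n1 k"
proof -
  define c b where "c = length ls - 2" and "b = last ls"
  have ls: "ls = n1 # replicate c k @ [b]"
  proof (rule nth_equalityI)
    show "length ls = length (n1 # replicate c k @ [b])" using assms(1) by (simp add: c_def)
    fix i assume i: "i < length ls"
    consider "i = 0" | "1 \<le> i" "i < length ls - 1" | "i = length ls - 1" "1 \<le> i" using i assms(1) by linarith
    then show "ls ! i = (n1 # replicate c k @ [b]) ! i"
    proof cases
      case 1 then show ?thesis using assms(2) by simp
    next
      case 2
      then have "i - 1 < c" by (simp add: c_def)
      then show ?thesis using assms(3)[OF 2] 2 by (cases i) (auto simp: nth_append)
    next
      case 3
      then have i: "i = Suc c" using assms(1) by (simp add: c_def)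
      have "ls \<noteq> []" using assms(1) by auto
      then have "ls ! i = b" using 3(1) by (simp add: b_def last_conv_nth)
      then show ?thesis using i by (simp add: nth_append)
    qed
  qed
  then have m: "n - 2 - n1 = c * k + b" using assms(6) by (simp add: sum_list_replicate)
  have b: "1 \<le> b" "b \<le> k" using assms by (simp_all add: b_def)
  show ?thesis
  proof (cases "b = k")
    case True
    then have "n - 2 - n1 = Suc c * k" using m by simp
    moreover have "replicate c k @ [k] = replicate (Suc c) k" by (simp add: replicate_append_same)
    ultimately show ?thesis using b True ls by (simp add: H_P_lengths_def Let_def)
  next
    case False
    then have "b < k" using b by simp
    then have "(c * k + b) div k = c" "(c * k + b) mod k = b" by simp_all
    then have "(c * k + b) div k = c" "\<not> k dvd c * k + b" using b by (simp_all add: dvd_eq_mod_eq_0)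
    then show ?thesis using ls m by (simp add: H_P_lengths_def Let_def)
  qed
qed

lemma H_P_lengths_props:
  assumes "k \<ge> 1" "n1 \<le> n - 2"
  shows "sum_list (H_P_lengths n n1 k) = n - 2" "H_P_lengths n n1 k ! 0 = n1"
    "H_P_lengths n n1 k \<noteq> []"
    "\<And>i. 1 \<le> i \<Longrightarrow> i < length (H_P_lengths n n1 k) \<Longrightarrow> H_P_lengths n n1 k ! i \<le> k"
    "real (length (H_P_lengths n n1 k)) \<le> 2 + real (n - 2) / real k"
proof -
  let ?m = "n - 2 - n1"
  have dm: "?m div k * k + ?m mod k = ?m" by simp
  have rest: "?m - ?m div k * k = ?m mod k" by (rule minus_div_mult_eq_mod)
  have "n1 + ?m = n - 2" using assms(2) by simp
  then have "n1 + (?m div k * k + ?m mod k) = n - 2" by (simp only: dm)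
  moreover have "?m mod k = 0 \<longleftrightarrow> k dvd ?m" by (simp only: dvd_eq_mod_eq_0)
  ultimately show "sum_list (H_P_lengths n n1 k) = n - 2"
    unfolding H_P_lengths_def Let_def rest by (cases "k dvd ?m") (simp_all add: sum_list_replicate)
  show "H_P_lengths n n1 k ! 0 = n1" "H_P_lengths n n1 k \<noteq> []"
    by (auto simp: H_P_lengths_def Let_def)
  show "H_P_lengths n n1 k ! i \<le> k" if "1 \<le> i" "i < length (H_P_lengths n n1 k)" for i
  proof -
    have "?m - ?m div k * k = ?m mod k" using minus_div_mult_eq_mod .
    then have "?m - ?m div k * k \<le> k" using assms(1) by (simp add: less_imp_le)
    then show ?thesis using that by (cases i) (auto simp: H_P_lengths_def Let_def nth_append nth_Cons' split: if_splits)
  qed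
  have "length (H_P_lengths n n1 k) \<le> 2 + ?m div k" by (simp add: H_P_lengths_def Let_def)
  moreover have "real (?m div k) \<le> real ?m / real k" by (rule of_nat_div_le_of_nat)
  moreover have "real ?m / real k \<le> real (n - 2) / real k" by (intro divide_right_mono) auto
  ultimately show "real (length (H_P_lengths n n1 k)) \<le> 2 + real (n - 2) / real k" by linarith
qed

text \<open>\<open>valid\<close> abstracts the absence of the forbidden tree and \<open>r\<close> is
  the spectral radius of the extremal graph. Lengths are sorted, so moving vertices from a later to
  an earlier entry raises the weight.\<close>

locale optimal_lengths =
  fixes r :: real and ls :: "nat list" and N :: nat and valid :: "nat list \<Rightarrow> bool"
  assumes r2: "r \<ge> sqrt (2 * real N)" and N: "real N \<ge> 4 * 10 ^ 16"
    and pos: "i < length ls \<Longrightarrow> 1 \<le> ls ! i" and desc: "\<lbrakk>i \<le> j; j < length ls\<rbrakk> \<Longrightarrow> ls ! j \<le> ls ! i"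
    and sum_ls: "sum_list ls = N"
    and max: "\<lbrakk>valid ms; sum_list ms = N\<rbrakk> \<Longrightarrow> tot (weight r) ms \<le> tot (weight r) ls"
begin

lemma r_large: "r \<ge> 28 * 10 ^ 7"
proof -
  have "sqrt ((28 * 10 ^ 7)\<^sup>2) \<le> sqrt (2 * real N)" using N by (intro real_sqrt_le_mono) simp
  then show ?thesis using r2 by simp
qed

lemma rgt: "r > 2" using r_large by simp

abbreviation "q \<equiv> decay r"

lemma q_bounds: "0 < q" "q < 1" "q \<le> 1 / 10 ^ 6" "q * (r - 1) \<le> 1"
proof -
  note d = decay[OF rgt]
  show "0 < q" "q < 1" using d by auto
  show 1: "q * (r - 1) \<le> 1" using d(4) rgt by (simp add: field_simps)
  have "q * (10 ^ 6) \<le> q * (r - 1)" using r_large d(1) by (intro mult_left_mono) auto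
  then show "q \<le> 1 / 10 ^ 6" using 1 by simp
qed

lemma no_better:
  assumes "valid (ls[i := a, j := b])" "i < length ls" "j < length ls" "i \<noteq> j" "a + b = ls ! i + ls ! j"
  shows "weight r a + weight r b \<le> weight r (ls ! i) + weight r (ls ! j)"
proof -
  have "tot id (ls[i := a, j := b]) = tot id ls" using tot_update2[OF assms(2-4), of id a b] assms(5) by simp
  then have "sum_list (ls[i := a, j := b]) = N" unfolding tot_id using sum_ls by simp
  then have "tot (weight r) (ls[i := a, j := b]) \<le> tot (weight r) ls" using max assms(1) by blast
  then show ?thesis using tot_update2[OF assms(2-4), of "weight r" a b] by simp
qed

lemma no_shift:
  assumes "valid (ls[i := ls ! i + s, j := ls ! j - s])" "j < length ls" "i < j" "1 \<le> s" "s \<le> ls ! j"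
  shows False
  using no_better[OF assms(1)] weight_shift[OF rgt assms(4,5) desc[of i j]] assms by simp

text \<open>At equal total length the optimal list has the smaller total deficit, and each path
  costs between \<open>2 * q / (1 + q\<^sup>2)\<close> and \<open>2 * q / (1 - q)\<close>. So it has
  hardly more parts than any valid list.\<close>

lemma length_compare:
  assumes "valid ms" "sum_list ms = N"
  shows "real (length ls) * (1 - q) \<le> real (length ms) * (1 + q\<^sup>2)"
proof -
  have W: "tot (weight r) xs = 2 / (r - 2) * (real (sum_list xs) - tot (deficit r) xs)" for xs
  proof -
    have "tot (weight r) xs = 2 / (r - 2) * (tot real xs - tot (deficit r) xs)"
      unfolding weight_eq[OF rgt] by (simp only: sum_distrib_left[symmetric] sum_subtractf)
    moreover have "tot real xs = real (sum_list xs)" by (simp add: sum_list_sum_nth lessThan_atLeast0)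
    ultimately show ?thesis by simp
  qed
  have "2 / (r - 2) * (real N - tot (deficit r) ms) \<le> 2 / (r - 2) * (real N - tot (deficit r) ls)"
    using max[OF assms] W assms(2) sum_ls by simp
  moreover have "0 < 2 / (r - 2)" using rgt by simp
  ultimately have "real N - tot (deficit r) ms \<le> real N - tot (deficit r) ls"
    by (simp only: mult_le_cancel_left_pos)
  then have "tot (deficit r) ls \<le> tot (deficit r) ms" by simp
  moreover have "real (length ls) * (2 * q / (1 + q\<^sup>2)) \<le> tot (deficit r) ls"
    using sum_mono[of "{..<length ls}" "\<lambda>_. 2 * q / (1 + q\<^sup>2)"] deficit_bounds(1)[OF rgt] pos by simp
  moreover have "tot (deficit r) ms \<le> real (length ms) * (2 * q / (1 - q))"
  proof -
    have "deficit r a \<le> 2 * q / (1 - q)" for a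
      using deficit_bounds(2)[OF rgt, of a] q_bounds by (cases "a = 0") (auto simp: deficit_def)
    then show ?thesis using sum_mono[of "{..<length ms}" _ "\<lambda>_. 2 * q / (1 - q)"] by simp
  qed
  ultimately have "real (length ls) * (2 * q / (1 + q\<^sup>2)) \<le> real (length ms) * (2 * q / (1 - q))" by linarith
  then have "(real (length ls) * (2 * q / (1 + q\<^sup>2))) * ((1 - q) * (1 + q\<^sup>2)) \<le> (real (length ms) * (2 * q / (1 - q))) * ((1 - q) * (1 + q\<^sup>2))"
    using q_bounds by (intro mult_right_mono) auto
  moreover have "(real (length ls) * (2 * q / (1 + q\<^sup>2))) * ((1 - q) * (1 + q\<^sup>2)) = 2 * q * (real (length ls) * (1 - q))"
  proof -
    have "1 + q\<^sup>2 \<noteq> 0" by (smt (verit) zero_le_power2)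
    then show ?thesis by simp
  qed
  moreover have "(real (length ms) * (2 * q / (1 - q))) * ((1 - q) * (1 + q\<^sup>2)) = 2 * q * (real (length ms) * (1 + q\<^sup>2))"
    using q_bounds by simp
  ultimately have "2 * q * (real (length ls) * (1 - q)) \<le> 2 * q * (real (length ms) * (1 + q\<^sup>2))" by simp
  then show ?thesis using q_bounds by simp
qed

text \<open>\<open>L\<close> bounds the sum of the three largest parts. If the third one were below
  \<open>k\<close>, all but two parts would be, and too many parts would be necessary. Once it is
  \<open>k\<close>, shifts push the second down to \<open>k\<close>, fill up the first, and fill the
  others from the last part.\<close>

lemma three_largest:
  fixes L :: nat
  defines "k \<equiv> L div 3"
  assumes L: "L \<ge> 3" and NL: "real N \<ge> 10.2 * 2 ^ L" and k2: "real N \<ge> 625 / 32 * (real k)\<^sup>2"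
    and part: "\<And>i. i < length ls \<Longrightarrow> ls ! i \<le> L + 1"
    and three: "\<And>a b c. \<lbrakk>a < length ls; b < length ls; c < length ls; a \<noteq> b; b \<noteq> c; a \<noteq> c\<rbrakk> \<Longrightarrow> ls ! a + ls ! b + ls ! c \<le> L"
    and valid: "\<And>ms I. (\<And>I. \<lbrakk>I \<subseteq> {..<length ms}; card I \<le> 3\<rbrakk> \<Longrightarrow> (\<Sum>i\<in>I. ms ! i) \<le> L) \<Longrightarrow> valid ms"
  shows "ls = H_P_lengths (N + 2) (L - 2 * k) k"
proof -
  have k: "1 \<le> k" "3 * k \<le> L" "L \<le> 3 * k + 2" using L by (auto simp: k_def)
  have LN: "3 * (L + 1) < N"
  proof -
    have "L + 1 \<le> 2 ^ L" using less_exp[of L] by linarith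
    then have "real (L + 1) \<le> 2 ^ L" by (metis of_nat_le_iff of_nat_numeral of_nat_power)
    then have "3 * real (L + 1) < real N" using NL by simp
    then show ?thesis by linarith
  qed
  have valid': "valid ms" if len: "\<And>i. 1 \<le> i \<Longrightarrow> i < length ms \<Longrightarrow> ms ! i \<le> k" and hd: "ms \<noteq> [] \<Longrightarrow> ms ! 0 \<le> L - 2 * k" for ms
  proof (rule valid)
    fix I assume I: "I \<subseteq> {..<length ms}" "card I \<le> 3"
    have finI: "finite I" using I(1) finite_subset by blast
    show "(\<Sum>i\<in>I. ms ! i) \<le> L"
    proof (cases "0 \<in> I")
      case True
      have "(\<Sum>i\<in>I. ms ! i) = ms ! 0 + (\<Sum>i\<in>I - {0}. ms ! i)" using finI True by (rule sum.remove)
      also have "(\<Sum>i\<in>I - {0}. ms ! i) \<le> card (I - {0}) * k"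
        using sum_bounded_above[of "I - {0}" "\<lambda>i. ms ! i" k] len I(1) by (auto simp: Suc_le_eq)
      also have "card (I - {0}) * k \<le> 2 * k" using I(2) True finI by (intro mult_right_mono) auto
      finally show ?thesis using hd k I(1) True by force
    next
      case False
      then have "(\<Sum>i\<in>I. ms ! i) \<le> card I * k"
        using sum_bounded_above[of I "\<lambda>i. ms ! i" k] len I(1) by (metis (no_types, lifting) One_nat_def Suc_leI gr0I lessThan_iff of_nat_id subsetD)
      also have "\<dots> \<le> 3 * k" using I(2) by simp
      finally show ?thesis using k by simp
    qed
  qed
  \<comment> \<open>Three parts of at most \<open>L + 1\<close> vertices cannot reach
    \<open>N\<close>. Four parts keep the last index apart from 0, 1 and 2.\<close>
  have len: "length ls \<ge> 4"
  proof (rule ccontr)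
    assume "\<not> ?thesis"
    then have "length ls * (L + 1) \<le> 3 * (L + 1)" by (intro mult_right_mono) auto
    moreover have "sum_list ls \<le> length ls * (L + 1)"
      using sum_bounded_above[of "{..<length ls}" "\<lambda>i. ls ! i" "L + 1"] part
      by (simp add: sum_list_sum_nth lessThan_atLeast0)
    ultimately show False using LN sum_ls by linarith
  qed
  let ?H = "H_P_lengths (N + 2) (L - 2 * k) k"
  have n1: "L - 2 * k \<le> N + 2 - 2" using LN by simp
  note H = H_P_lengths_props[OF k(1) n1]
  have HV: "valid ?H" by (rule valid') (use H in auto)
  have "ls \<noteq> []" using len by auto
  then have top: "ls ! 0 + ls ! 1 + ls ! 2 \<le> L" using three[of 0 1 2] len by simp
  have d: "ls ! 1 \<le> ls ! 0" "ls ! 2 \<le> ls ! 1" using desc[of 0 1] desc[of 1 2] len by auto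
  have k2le: "ls ! 2 \<le> k" using top d k(3) by linarith
  have third: "ls ! 2 = k"
  proof (rule ccontr)
    assume "ls ! 2 \<noteq> k"
    then have small: "ls ! 2 \<le> k - 1" using k2le by simp
    have "ls ! i \<le> (k - 1) + ((if i = 0 then ls ! 0 else 0) + (if i = 1 then ls ! 1 else 0))" if "i < length ls" for i
    proof (cases "i < 2")
      case True then show ?thesis by (auto simp: less_2_cases_iff)
    next
      case False then show ?thesis using desc[of 2 i] that small by simp
    qed
    then have "sum_list ls \<le> (\<Sum>i<length ls. (k - 1) + ((if i = 0 then ls ! 0 else 0) + (if i = 1 then ls ! 1 else 0)))"
      unfolding tot_id[symmetric] by (intro sum_mono) simp
    also have "\<dots> = length ls * (k - 1) + (ls ! 0 + ls ! 1)"
    proof -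
      have "0 < length ls" "Suc 0 < length ls" using len by auto
      then show ?thesis by (simp add: sum.distrib)
    qed
    finally have "N \<le> length ls * (k - 1) + L" using top sum_ls by linarith
    then have "real N \<le> real (length ls * (k - 1) + L)" by (simp only: of_nat_le_iff)
    then have 1: "real N - real L \<le> real (length ls) * (real k - 1)"
      using k(1) by (simp add: of_nat_diff)
    have HL: "real (length ?H) \<le> 2 + real N / real k" using H(5) by simp
    have "real (length ls) * (1 - q) \<le> real (length ?H) * (1 + q\<^sup>2)"
      using length_compare[OF HV] H(1) by simp
    also have "\<dots> \<le> (2 + real N / real k) * (1 + q\<^sup>2)" using HL by (intro mult_right_mono) auto
    finally have 2: "real (length ls) * (1 - q) \<le> (2 + real N / real k) * (1 + q\<^sup>2)" .
    define K n where "K = real k" and "n = real N"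
    have K: "1 \<le> K" using k(1) by (simp add: K_def)
    have "(n - real L) * (1 - q) \<le> real (length ls) * (K - 1) * (1 - q)"
      using 1 q_bounds by (intro mult_right_mono) (auto simp: K_def n_def)
    also have "\<dots> = (real (length ls) * (1 - q)) * (K - 1)" by simp
    also have "\<dots> \<le> ((2 + n / K) * (1 + q\<^sup>2)) * (K - 1)"
      using 2 K by (intro mult_right_mono) (auto simp: K_def n_def)
    finally have "K * ((n - real L) * (1 - q)) \<le> K * (((2 + n / K) * (1 + q\<^sup>2)) * (K - 1))"
      using K by (intro mult_left_mono) auto
    also have "\<dots> = (2 * K + n) * (1 + q\<^sup>2) * (K - 1)" using K by (simp add: field_simps)
    finally have main: "K * ((n - real L) * (1 - q)) \<le> (2 * K + n) * (1 + q\<^sup>2) * (K - 1)" .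
    \<comment> \<open>2 * 625 / 32 is 6.25^2, so \<open>r\<close> is at least
      \<open>6.25 * K\<close> and \<open>q * K\<close> at most 1/6.\<close>
    have qK: "q * K \<le> 17 / 100"
    proof -
      have "sqrt ((625 / 100 * K)\<^sup>2) \<le> sqrt (2 * n)"
        using k2 by (intro real_sqrt_le_mono) (simp add: K_def n_def power_mult_distrib power2_eq_square)
      then have "625 / 100 * K \<le> r" using r2 K by (simp add: n_def)
      then have "6 * K \<le> r - 1" using r_large by simp
      then have "q * (6 * K) \<le> q * (r - 1)" using q_bounds by (intro mult_left_mono) auto
      then show ?thesis using q_bounds(4) by simp
    qed
    have q2K: "q\<^sup>2 * K \<le> 1 / 10 ^ 6"
    proof -
      have "q * (q * K) \<le> 1 / 10 ^ 6 * 1" using q_bounds qK K by (intro mult_mono) auto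
      then show ?thesis by (simp add: power2_eq_square mult.assoc)
    qed
    have n0: "0 \<le> n" by (simp add: n_def)
    have "(2 * K + n) * (1 + q\<^sup>2) * (K - 1) \<le> (2 * K + n) * (K - 1 + 1 / 10 ^ 6)"
    proof -
      have "(1 + q\<^sup>2) * (K - 1) = K - 1 + q\<^sup>2 * K - q\<^sup>2" by (simp add: algebra_simps)
      then have "(1 + q\<^sup>2) * (K - 1) \<le> K - 1 + 1 / 10 ^ 6" using q2K zero_le_power2[of q] by linarith
      then have "(2 * K + n) * ((1 + q\<^sup>2) * (K - 1)) \<le> (2 * K + n) * (K - 1 + 1 / 10 ^ 6)"
        using K n0 by (intro mult_left_mono) auto
      then show ?thesis by (simp add: mult.assoc)
    qed
    moreover have "K * ((n - real L) * (1 - q)) \<ge> K * n - K * real L - 17 / 100 * n"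
    proof -
      have "q * K * n \<le> 17 / 100 * n" using qK n0 by (rule mult_right_mono)
      moreover have "0 \<le> q * K * real L" using q_bounds K by auto
      ultimately show ?thesis by (simp add: algebra_simps)
    qed
    ultimately have "K * n - K * real L - 17 / 100 * n \<le> (2 * K + n) * (K - 1 + 1 / 10 ^ 6)" using main by linarith
    \<comment> \<open>The terms \<open>K * n\<close> cancel. The right side is at most
      \<open>7 * K * K\<close> because \<open>L\<close> is at most \<open>3 * K + 2\<close>, while
      the left side is at least \<open>16 * K * K\<close>.\<close>
    then have "82 / 100 * n \<le> K * real L + 2 * (K * K)" using K n0 by (simp add: algebra_simps)
    moreover have "K * real L \<le> K * (3 * K + 2)" using k(3) K by (intro mult_left_mono) (auto simp: K_def)
    moreover have "K \<le> K * K" using K by simp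
    moreover have "n \<ge> 625 / 32 * (K * K)" using k2 by (simp add: K_def n_def power2_eq_square)
    moreover have "1 \<le> K * K" using K by (smt (verit) \<open>K \<le> K * K\<close>)
    ultimately show False by (simp add: algebra_simps)
  qed
  have small: "ls ! i \<le> k" if "2 \<le> i" "i < length ls" for i using desc[OF that] third by simp
  \<comment> \<open>The excess over \<open>k\<close> goes to the first part, which stays within
    \<open>L - 2 * k\<close> since the third part is already \<open>k\<close>.\<close>
  have second: "ls ! 1 = k"
  proof (rule ccontr)
    assume "ls ! 1 \<noteq> k"
    then have gt: "ls ! 1 > k" using d third by simp
    let ?s = "ls ! 1 - k"
    have "valid (ls[0 := ls ! 0 + ?s, 1 := ls ! 1 - ?s])"
    proof (rule valid')
      fix i assume i: "1 \<le> i" "i < length (ls[0 := ls ! 0 + ?s, 1 := ls ! 1 - ?s])"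
      then show "ls[0 := ls ! 0 + ?s, 1 := ls ! 1 - ?s] ! i \<le> k"
        using small[of i] gt by (cases "i = 1") (auto simp: nth_list_update)
    next
      show "ls[0 := ls ! 0 + ?s, 1 := ls ! 1 - ?s] ! 0 \<le> L - 2 * k"
        using top third gt \<open>ls \<noteq> []\<close> by simp
    qed
    moreover have "1 \<le> ?s" "?s \<le> ls ! 1" using gt by linarith+
    ultimately show False using len by (intro no_shift[of 0 ?s 1]) auto
  qed
  have others: "ls ! i \<le> k" if "1 \<le> i" "i < length ls" for i
    using small[of i] second that by (cases "i = 1") auto
  let ?m = "length ls - 1"
  have m: "?m < length ls" "0 < ?m" "1 \<le> ls ! ?m" using len pos[of ?m] by auto
  \<comment> \<open>The missing vertex is taken from the last part, which may thereby become empty;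
    \<open>valid\<close> and \<open>weight\<close> are defined for length 0.\<close>
  have first: "ls ! 0 = L - 2 * k"
  proof (rule ccontr)
    assume "ls ! 0 \<noteq> L - 2 * k"
    then have lt: "ls ! 0 + 1 \<le> L - 2 * k" using top second third by simp
    have "valid (ls[0 := ls ! 0 + 1, ?m := ls ! ?m - 1])"
    proof (rule valid')
      fix i assume i: "1 \<le> i" "i < length (ls[0 := ls ! 0 + 1, ?m := ls ! ?m - 1])"
      then show "ls[0 := ls ! 0 + 1, ?m := ls ! ?m - 1] ! i \<le> k"
        using others[of i] by (auto simp: nth_list_update)
    next
      show "ls[0 := ls ! 0 + 1, ?m := ls ! ?m - 1] ! 0 \<le> L - 2 * k"
        using lt m \<open>ls \<noteq> []\<close> by simp
    qed
    then show False using no_shift[of 0 1 ?m] m by simp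
  qed
  have rest: "ls ! i = k" if i: "1 \<le> i" "i < ?m" for i
  proof (rule ccontr)
    assume "ls ! i \<noteq> k"
    moreover have "i < length ls" using i by linarith
    ultimately have lt: "ls ! i + 1 \<le> k" using others[of i] i by simp
    have "valid (ls[i := ls ! i + 1, ?m := ls ! ?m - 1])"
    proof (rule valid')
      fix j assume j: "1 \<le> j" "j < length (ls[i := ls ! i + 1, ?m := ls ! ?m - 1])"
      then show "ls[i := ls ! i + 1, ?m := ls ! ?m - 1] ! j \<le> k"
        using others[of j] lt i by (auto simp: nth_list_update)
    next
      show "ls[i := ls ! i + 1, ?m := ls ! ?m - 1] ! 0 \<le> L - 2 * k"
        using first i m by (auto simp: nth_list_update)
    qed
    then show False using no_shift[of i 1 ?m] m i by simp
  qed
  show ?thesis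
  proof (rule H_P_lengths_eqI)
    show "1 \<le> last ls" "last ls \<le> k" using last_conv_nth[OF \<open>ls \<noteq> []\<close>] m others[of ?m] by auto
  qed (use len first rest sum_ls in auto)
qed

text \<open>A leg has \<open>p\<close> vertices, so a part of length \<open>a\<close> holds
  \<open>a div p\<close> of them. The quotient sum \<open>t - 1\<close> would forbid pairing short
  parts into another leg; nearly all short parts would be below \<open>k / 2\<close>, hence almost
  twice as many as in \<open>?H\<close>. With quotient sum at most \<open>t - 2\<close>, convexity
  collects all legs in the first part.\<close>

lemma div_parts:
  fixes p t :: nat
  defines "k \<equiv> p - 1"
  assumes p: "p \<ge> 2" and t: "t \<ge> 5" and NL: "real N \<ge> 10.2 * 2 ^ (t * p - 2)"
    and div: "tot (\<lambda>a. a div p) ls \<le> t - 1"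
    and small: "\<And>i j. \<lbrakk>tot (\<lambda>a. a div p) ls = t - 1; i < length ls; j < length ls; i \<noteq> j; ls ! i < p; ls ! j < p\<rbrakk>
      \<Longrightarrow> ls ! i + ls ! j < k"
    and valid: "\<And>ms. tot (\<lambda>a. a div p) ms \<le> t - 2 \<Longrightarrow> valid ms"
  shows "ls = H_P_lengths (N + 2) ((t - 1) * p - 1) k"
proof -
  let ?n1 = "(t - 1) * p - 1" and ?D = "tot (\<lambda>a. a div p)"
  have k: "1 \<le> k" "k < p" "p = Suc k" using p by (auto simp: k_def)
  have big: "7 * (t * p) < N"
  proof -
    have "5 * 2 \<le> t * p" using p t by (intro mult_mono) auto
    define m where "m = t * p - 4"
    have m: "t * p = m + 4" "m \<ge> 6" using \<open>5 * 2 \<le> t * p\<close> by (simp_all add: m_def)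
    have "real m \<le> 2 ^ m" by (rule of_nat_less_two_power[THEN less_imp_le])
    moreover have "(2::real) ^ (t * p - 2) = 4 * 2 ^ m" using m by (simp add: power_add)
    ultimately have "real N \<ge> 40 * real m" using NL by linarith
    then have "7 * real (t * p) < real N" using m by simp
    then show ?thesis by (metis of_nat_less_iff of_nat_mult of_nat_numeral)
  qed
  have n1: "?n1 = p * (t - 2) + k" "?n1 div p = t - 2" "?n1 \<le> N + 2 - 2"
  proof -
    obtain c where "t = Suc (Suc c)" using t le_Suc_ex[of 2 t] by auto
    then show 1: "?n1 = p * (t - 2) + k" using k by (simp add: algebra_simps)
    have "(p * (t - 2) + k) div p = t - 2 + k div p" using p by simp
    then show "?n1 div p = t - 2" unfolding 1 using k(2) by simp
    have "?n1 \<le> t * p" by (simp add: diff_mult_distrib)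
    then show "?n1 \<le> N + 2 - 2" using big by simp
  qed
  let ?H = "H_P_lengths (N + 2) ?n1 k"
  note H = H_P_lengths_props[OF k(1) n1(3)]
  have valid': "valid ms" if ms: "ms \<noteq> []" "\<And>i. 1 \<le> i \<Longrightarrow> i < length ms \<Longrightarrow> ms ! i < p" "ms ! 0 div p \<le> t - 2" for ms
  proof (rule valid)
    have "?D ms = ms ! 0 div p + (\<Sum>i\<in>{..<length ms} - {0}. ms ! i div p)"
      using ms(1) by (intro sum.remove) auto
    also have "(\<Sum>i\<in>{..<length ms} - {0}. ms ! i div p) = 0"
      using ms(2) by (intro sum.neutral) (auto simp: Suc_le_eq)
    finally show "?D ms \<le> t - 2" using ms(3) by simp
  qed
  have HV: "valid ?H"
  proof (rule valid')
    fix i assume "1 \<le> i" "i < length ?H"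
    then show "?H ! i < p" using H(4)[of i] k by simp
  qed (use H(2,3) n1(2) in auto)
  have Dlt: "?D ls \<le> t - 2"
  proof (rule ccontr)
    assume "\<not> ?D ls \<le> t - 2"
    then have D: "?D ls = t - 1" using div by simp
    \<comment> \<open>Two short parts of length at least \<open>k / 2\<close> would violate
      \<open>small\<close>, so at most one index \<open>s\<close> is exceptional.\<close>
    obtain s where s: "\<And>i. i < length ls \<Longrightarrow> ls ! i < p \<Longrightarrow> i \<noteq> s \<Longrightarrow> 2 * ls ! i \<le> k - 1"
    proof (cases "\<exists>s<length ls. ls ! s < p \<and> k \<le> 2 * ls ! s")
      case True
      then obtain s where s: "s < length ls" "ls ! s < p" "k \<le> 2 * ls ! s" by blast
      have "2 * ls ! i \<le> k - 1" if "i < length ls" "ls ! i < p" "i \<noteq> s" for i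
        using small[OF D that(1) s(1) that(3) that(2) s(2)] s(3) by linarith
      then show ?thesis using that by blast
    next
      case False
      then have "2 * ls ! i \<le> k - 1" if "i < length ls" "ls ! i < p" for i using that by (metis Suc_diff_1 k(1) less_Suc_eq_le not_le Suc_le_eq One_nat_def)
      then show ?thesis using that by blast
    qed
    \<comment> \<open>A part of length at least \<open>p\<close> is below
      \<open>2 * p * (ls ! i div p)\<close>; short ones are bounded by \<open>s\<close>. Doubling
      avoids fractions.\<close>
    have "2 * ls ! i \<le> 4 * p * (ls ! i div p) + (k - 1) + (if i = s then 2 * p else 0)" if "i < length ls" for i
    proof (cases "ls ! i < p")
      case True
      then show ?thesis using s[OF that True] by auto
    next
      case False
      then have "p * 1 \<le> p * (ls ! i div p)" using p by (intro mult_left_mono) (auto simp: div_greater_zero_iff Suc_le_eq)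
      moreover have "ls ! i = p * (ls ! i div p) + ls ! i mod p" by simp
      moreover have "ls ! i mod p < p" using p by simp
      ultimately show ?thesis by linarith
    qed
    then have "(\<Sum>i<length ls. 2 * ls ! i) \<le> (\<Sum>i<length ls. 4 * p * (ls ! i div p) + (k - 1) + (if i = s then 2 * p else 0))"
      by (intro sum_mono) simp
    also have "\<dots> \<le> 4 * p * ?D ls + length ls * (k - 1) + 2 * p"
      by (simp add: sum.distrib sum_distrib_left)
    finally have "2 * N \<le> 4 * p * (t - 1) + length ls * (k - 1) + 2 * p"
      using sum_ls D by (simp add: sum_distrib_left[symmetric] tot_id[symmetric])
    moreover have "p * (t - 1) + p = t * p" using t by (cases t) auto
    ultimately have "2 * N \<le> 4 * (t * p) + length ls * (k - 1)" by linarith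
    then have "real (2 * N) \<le> real (4 * (t * p) + length ls * (k - 1))" by (rule of_nat_mono)
    then have 1: "2 * real N - 4 * real (t * p) \<le> real (length ls) * (real k - 1)"
      using k(1) by (simp add: of_nat_diff)
    have "real (length ls) * (1 - q) \<le> real (length ?H) * (1 + q\<^sup>2)"
      using length_compare[OF HV] H(1) by simp
    also have "\<dots> \<le> (2 + real N / real k) * (1 + q\<^sup>2)" using H(5) by (intro mult_right_mono) auto
    finally have 2: "real (length ls) * (1 - q) \<le> (2 + real N / real k) * (1 + q\<^sup>2)" .
    define K n T where "K = real k" and "n = real N" and "T = real (t * p)"
    have K: "1 \<le> K" using k(1) by (simp add: K_def)
    have KT: "K \<le> T" "7 * T < n" "0 \<le> T"
    proof -
      have "k \<le> t * p" using k t by (metis One_nat_def less_imp_le mult_le_mono mult_1 Suc_leI order_trans zero_less_numeral less_le_trans numeral_One one_le_numeral)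
      then show "K \<le> T" unfolding K_def T_def by (simp only: of_nat_le_iff)
      have "real (7 * (t * p)) < real N" using big by (simp only: of_nat_less_iff)
      then show "7 * T < n" by (simp add: T_def n_def)
      show "0 \<le> T" by (simp add: T_def)
    qed
    have "(2 * n - 4 * T) * (1 - q) \<le> real (length ls) * (K - 1) * (1 - q)"
      using 1 q_bounds by (intro mult_right_mono) (auto simp: K_def n_def T_def)
    also have "\<dots> = (real (length ls) * (1 - q)) * (K - 1)" by simp
    also have "\<dots> \<le> ((2 + n / K) * (1 + q\<^sup>2)) * (K - 1)"
      using 2 K by (intro mult_right_mono) (auto simp: K_def n_def)
    also have "\<dots> \<le> ((2 + n / K) * (1 + q\<^sup>2)) * K"
      using KT K by (intro mult_left_mono mult_nonneg_nonneg add_nonneg_nonneg) auto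
    also have "\<dots> = (2 * K + n) * (1 + q\<^sup>2)" using K by (simp add: field_simps)
    also have "\<dots> \<le> (2 * K + n) * (1 + 1 / 10 ^ 6)"
    proof (rule mult_left_mono)
      have "q * q \<le> 1 / 10 ^ 6 * 1" using q_bounds by (intro mult_mono) auto
      then show "1 + q\<^sup>2 \<le> 1 + 1 / 10 ^ 6" by (simp add: power2_eq_square)
    qed (use K KT in auto)
    also have "\<dots> \<le> (2 * T + n) * (1 + 1 / 10 ^ 6)" using KT by (intro mult_right_mono) auto
    finally have "(2 * n - 4 * T) * (1 - q) \<le> (2 * T + n) * (1 + 1 / 10 ^ 6)" .
    moreover have "(2 * n - 4 * T) * (1 - 1 / 10 ^ 6) \<le> (2 * n - 4 * T) * (1 - q)"
      using q_bounds KT by (intro mult_left_mono) auto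
    \<comment> \<open>This says about \<open>n \<le> 6 * T\<close>, against
      \<open>7 * T < n\<close>.\<close>
    ultimately have "(2 * n - 4 * T) * (1 - 1 / 10 ^ 6) \<le> (2 * T + n) * (1 + 1 / 10 ^ 6)" by linarith
    then show False using KT by (simp add: algebra_simps)
  qed
  have len: "length ls \<ge> 2"
  proof (rule ccontr)
    assume "\<not> ?thesis"
    then have "length ls = 0 \<or> length ls = 1" by linarith
    then have N0: "N = 0 \<or> (length ls = 1 \<and> N = ls ! 0)"
      using sum_ls by (auto simp: tot_id[symmetric])
    then have "N div p \<le> t - 2" using Dlt by auto
    then have "N < p * (t - 2) + p" using p by (metis add.commute div_less_iff_less_mult dividend_less_times_div le_imp_less_Suc less_le_trans mult.commute mult_Suc zero_less_numeral gr0I not_numeral_le_zero less_eq_Suc_le)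
    moreover have "p * (t - 2) + p \<le> t * p" using t by (cases t) (auto simp: diff_mult_distrib2)
    ultimately show False using big by linarith
  qed
  let ?m = "length ls - 1"
  have m: "?m < length ls" "0 < ?m" "1 \<le> ls ! ?m" using len pos[of ?m] by auto
  have nonempty: "ls \<noteq> []" using len by auto
  have step: "?D (ls[i := a, j := b]) \<le> t - 2"
    if "i < length ls" "j < length ls" "i \<noteq> j" "a div p + b div p \<le> ls ! i div p + ls ! j div p" for i j a b
    using tot_update2[OF that(1-3), of "\<lambda>a. a div p" a b] that(4) Dlt by linarith
  have second: "ls ! 1 < p"
  proof (rule ccontr)
    assume neg: "\<not> ls ! 1 < p"
    define a b where "a = ls ! 0" and "b = ls ! 1"
    have ab: "p \<le> b" "b \<le> a" using neg desc[of 0 1] len by (auto simp: a_def b_def)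
    have dm: "a = p * (a div p) + a mod p" "b = p * (b div p) + b mod p" "a mod p < p" "b mod p < p" using p by auto
    have bp: "p * 1 \<le> p * (b div p)" using ab p by (intro mult_left_mono) (auto simp: div_greater_zero_iff Suc_le_eq)
    \<comment> \<open>All full blocks of \<open>b\<close> move to \<open>a\<close>. If the
      remainders together reach \<open>k\<close>, the remainder of \<open>a\<close> is filled up to
      exactly \<open>k\<close>; otherwise all of \<open>b\<close> moves. In both cases the sum of
      the quotients does not grow.\<close>
    define s where "s = (if a mod p + b mod p \<ge> k then p * (b div p) + (k - a mod p) else b)"
    have s: "1 \<le> s" "s \<le> b" "(a + s) div p + (b - s) div p \<le> a div p + b div p"
    proof -
      have am: "a mod p \<le> k" using dm(3) k by simp
      have "1 \<le> p * (b div p)" "1 \<le> b" using bp p ab by linarith+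
      then show "1 \<le> s" unfolding s_def by (metis trans_le_add1)
      have "p * (b div p) + (k - a mod p) \<le> b" if "k \<le> a mod p + b mod p"
        using dm(2) am that by linarith
      then show "s \<le> b" by (simp add: s_def)
      show "(a + s) div p + (b - s) div p \<le> a div p + b div p"
      proof (cases "a mod p + b mod p \<ge> k")
        case True
        then have "s = p * (b div p) + (k - a mod p)" by (simp add: s_def)
        then have 1: "a + s = p * (a div p + b div p) + k" "b - s = b mod p - (k - a mod p)"
          unfolding distrib_left using dm(1,2) am by linarith+
        have "(p * (a div p + b div p) + k) div p = a div p + b div p + k div p" using p by simp
        then have "(a + s) div p = a div p + b div p" unfolding 1(1) using k(2) by simp
        moreover have "(b - s) div p = 0" unfolding 1(2) using dm(4) by simp
        ultimately show ?thesis by simp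
      next
        case False
        then have "s = b" by (simp add: s_def)
        then have 1: "a + s = p * (a div p + b div p) + (a mod p + b mod p)" "b - s = 0"
          unfolding distrib_left using dm(1,2) by linarith+
        have "(p * (a div p + b div p) + (a mod p + b mod p)) div p = a div p + b div p + (a mod p + b mod p) div p"
          using p by simp
        moreover have "a mod p + b mod p < p" using False k(2) by linarith
        ultimately have "(a + s) div p = a div p + b div p" unfolding 1(1) by simp
        then show ?thesis using 1(2) by simp
      qed
    qed
    have "valid (ls[0 := ls ! 0 + s, 1 := ls ! 1 - s])"
      using s(3) len by (intro valid step) (auto simp: a_def b_def)
    then show False using no_shift[of 0 s 1] s len by (simp add: b_def)
  qed
  have others: "ls ! i < p" if "1 \<le> i" "i < length ls" for i
    using desc[OF that] second by simp
  have others': "ls ! i \<le> k" if "1 \<le> i" "i < length ls" for i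
    using others[OF that] k by simp
  have mp: "ls ! ?m < p" using others[of ?m] m by simp
  have full: "ls ! 0 mod p = k"
  proof (rule ccontr)
    assume ne: "ls ! 0 mod p \<noteq> k"
    have "ls ! 0 mod p < p" using p by simp
    then have "Suc (ls ! 0 mod p) \<noteq> p" using ne k by simp
    then have "(ls ! 0 + 1) div p = ls ! 0 div p" by (simp add: div_Suc mod_Suc)
    moreover have "(ls ! ?m - 1) div p = 0" using mp by simp
    ultimately have "valid (ls[0 := ls ! 0 + 1, ?m := ls ! ?m - 1])"
      using m by (intro valid step) auto
    then show False using no_shift[of 0 1 ?m] m by simp
  qed
  have D0: "?D ls = ls ! 0 div p"
  proof -
    have "?D ls = ls ! 0 div p + (\<Sum>i\<in>{..<length ls} - {0}. ls ! i div p)"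
      using len by (intro sum.remove) auto
    also have "(\<Sum>i\<in>{..<length ls} - {0}. ls ! i div p) = 0"
      using others by (intro sum.neutral) (auto simp: Suc_le_eq)
    finally show ?thesis by simp
  qed
  \<comment> \<open>Otherwise the first part can absorb the last one completely: that part is
    shorter than \<open>p\<close>, so the quotient rises by at most 1.\<close>
  have quot: "ls ! 0 div p = t - 2"
  proof (rule ccontr)
    assume "ls ! 0 div p \<noteq> t - 2"
    then have lt: "ls ! 0 div p + 1 \<le> t - 2" using D0 Dlt by simp
    have "(ls ! 0 + ls ! ?m) div p \<le> (ls ! 0 + p) div p" using mp by (intro div_le_mono) simp
    then have "(ls ! 0 + ls ! ?m) div p \<le> t - 2" using lt p by simp
    then have "valid (ls[0 := ls ! 0 + ls ! ?m, ?m := ls ! ?m - ls ! ?m])"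
      using others m len p nonempty by (intro valid') (auto simp: nth_list_update)
    then show False using no_shift[of 0 "ls ! ?m" ?m] m by simp
  qed
  have first: "ls ! 0 = ?n1"
    using full quot n1(1) mult_div_mod_eq[of p "ls ! 0"] by simp
  have rest: "ls ! i = k" if i: "1 \<le> i" "i < ?m" for i
  proof (rule ccontr)
    assume "ls ! i \<noteq> k"
    moreover have "i < length ls" using i by linarith
    ultimately have lt: "ls ! i + 1 < p" using others'[of i] i k by simp
    then have "valid (ls[i := ls ! i + 1, ?m := ls ! ?m - 1])"
      using m i mp by (intro valid step) auto
    then show False using no_shift[of i 1 ?m] m i by simp
  qed
  show ?thesis
  proof (rule H_P_lengths_eqI)
    show "1 \<le> last ls" "last ls \<le> k" using last_conv_nth[OF nonempty] m others'[of ?m] by auto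
  qed (use len first rest sum_ls in auto)
qed

end

section \<open>Starlike trees\<close>

text \<open>The starlike tree as a centre and lists of legs, for an edge relation instead of a
  graph. That the centre avoids the legs is contained in \<open>gpath E (c # p i)\<close>.\<close>

definition has_spider :: "('a \<Rightarrow> 'a \<Rightarrow> bool) \<Rightarrow> nat \<Rightarrow> nat \<Rightarrow> bool" where
  "has_spider E t l \<longleftrightarrow> (\<exists>c p. (\<forall>i<t. length (p i) = l - 1 \<and> gpath E (c # p i)) \<and>
     (\<forall>i<t. \<forall>j<t. i \<noteq> j \<longrightarrow> set (p i) \<inter> set (p j) = {}))"

lemma has_spiderI:
  assumes "\<And>i. i < t \<Longrightarrow> length (p i) = l - 1 \<and> gpath E (c # p i)"
    and "\<And>i j. \<lbrakk>i < t; j < t; i \<noteq> j\<rbrakk> \<Longrightarrow> set (p i) \<inter> set (p j) = {}"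
  shows "has_spider E t l"
  unfolding has_spider_def using assms by (intro exI[of _ c] exI[of _ p]) blast

lemma has_spiderE:
  assumes "has_spider E t l"
  obtains c p where "\<And>i. i < t \<Longrightarrow> length (p i) = l - 1" "\<And>i. i < t \<Longrightarrow> gpath E (c # p i)"
    "\<And>i j. \<lbrakk>i < t; j < t; i \<noteq> j\<rbrakk> \<Longrightarrow> set (p i) \<inter> set (p j) = {}"
  using assms unfolding has_spider_def by blast

lemma gpath_nth:
  "gpath E p \<longleftrightarrow> p \<noteq> [] \<and> distinct p \<and> (\<forall>j. Suc j < length p \<longrightarrow> E (p ! j) (p ! Suc j))"
  unfolding gpath_def successively_conv_nth by auto

lemma gpath_map:
  assumes "gpath E p" "inj_on g (set p)" "\<And>x y. \<lbrakk>x \<in> set p; y \<in> set p; E x y\<rbrakk> \<Longrightarrow> E' (g x) (g y)"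
  shows "gpath E' (map g p)"
  using assms unfolding gpath_nth by (auto simp: distinct_map)

lemma has_spider_map:
  assumes "has_spider E t l"
    and "\<And>c p. (\<And>i. i < t \<Longrightarrow> length (p i) = l - 1 \<and> gpath E (c # p i)) \<Longrightarrow>
      \<exists>g. inj_on g (insert c (\<Union>i<t. set (p i))) \<and>
        (\<forall>x\<in>insert c (\<Union>i<t. set (p i)). \<forall>y\<in>insert c (\<Union>i<t. set (p i)). E x y \<longrightarrow> E' (g x) (g y))"
  shows "has_spider E' t l"
proof -
  obtain c p where p: "\<And>i. i < t \<Longrightarrow> length (p i) = l - 1" "\<And>i. i < t \<Longrightarrow> gpath E (c # p i)"
    "\<And>i j. \<lbrakk>i < t; j < t; i \<noteq> j\<rbrakk> \<Longrightarrow> set (p i) \<inter> set (p j) = {}"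
    using has_spiderE[OF assms(1)] by metis
  let ?X = "insert c (\<Union>i<t. set (p i))"
  obtain g where g: "inj_on g ?X" "\<forall>x\<in>?X. \<forall>y\<in>?X. E x y \<longrightarrow> E' (g x) (g y)"
    using assms(2)[of p c] p(1,2) by blast
  show ?thesis
  proof (rule has_spiderI[of t "\<lambda>i. map g (p i)" l E' "g c"])
    fix i assume i: "i < t"
    have sub: "set (c # p i) \<subseteq> ?X" using i by auto
    have "gpath E' (map g (c # p i))"
    proof (rule gpath_map[OF p(2)[OF i] inj_on_subset[OF g(1) sub]])
      fix x y assume "x \<in> set (c # p i)" "y \<in> set (c # p i)" "E x y"
      then show "E' (g x) (g y)" using g(2)[rule_format, OF subsetD[OF sub] subsetD[OF sub]] by blast
    qed
    then show "length (map g (p i)) = l - 1 \<and> gpath E' (g c # map g (p i))" using p(1)[OF i] by simp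
  next
    fix i j assume ij: "i < t" "j < t" "i \<noteq> j"
    have "set (p i) \<subseteq> ?X" "set (p j) \<subseteq> ?X" using ij by auto
    then show "set (map g (p i)) \<inter> set (map g (p j)) = {}"
      using p(3)[OF ij] inj_on_image_Int[OF g(1), of "set (p i)" "set (p j)"] by simp
  qed
qed

lemma contains_starlike_has_spider:
  assumes "contains_subgraph G (starlike t l)" "l \<ge> 2"
  shows "has_spider (adj G) t l"
proof -
  let ?k = "l - 1"
  obtain \<phi> where \<phi>: "inj_on \<phi> (verts (starlike t l))" "\<forall>e\<in>edges (starlike t l). \<phi> ` e \<in> edges G"
    using assms(1) unfolding contains_subgraph_def by blast
  have V: "verts (starlike t l) = {0..t * ?k}" by (simp add: starlike_def verts_def)
  have e1: "adj G (\<phi> 0) (\<phi> (i * ?k + 1))" if "i < t" for i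
  proof -
    have "{0, i * ?k + 1} \<in> edges (starlike t l)" using that assms(2) by (auto simp: starlike_def edges_def)
    then show ?thesis using \<phi>(2) by (fastforce simp: adj_def)
  qed
  have e2: "adj G (\<phi> (i * ?k + j)) (\<phi> (i * ?k + j + 1))" if "i < t" "1 \<le> j" "j < ?k" for i j
  proof -
    have "{i * ?k + j, i * ?k + j + 1} \<in> edges (starlike t l)"
      unfolding starlike_def edges_def snd_conv using that by blast
    then show ?thesis using \<phi>(2) by (fastforce simp: adj_def)
  qed
  have bound: "i * ?k + j < t * ?k" if "i < t" "j < ?k" for i j
  proof -
    have "Suc i * ?k \<le> t * ?k" using that by (intro mult_right_mono) auto
    then show ?thesis using that by simp
  qed
  have uniq: "i = i'" if "i * ?k + j = i' * ?k + j'" "j < ?k" "j' < ?k" for i j i' j'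
  proof -
    have "(i * ?k + j) div ?k = i" "(i' * ?k + j') div ?k = i'" using that(2,3) by simp_all
    then show ?thesis using that(1) by simp
  qed
  define p where "p i = map (\<lambda>j. \<phi> (i * ?k + j + 1)) [0..<?k]" for i
  show ?thesis
  proof (rule has_spiderI[of t p l _ "\<phi> 0"])
    fix i assume i: "i < t"
    have inj: "inj_on \<phi> {0..t * ?k}" using \<phi>(1) V by simp
    have mem: "i * ?k + j + 1 \<in> {0..t * ?k}" if "j < ?k" for j using bound[OF i that] by simp
    have not0: "\<phi> 0 \<noteq> \<phi> (i * ?k + j + 1)" if "j < ?k" for j
      using inj_onD[OF inj, of 0 "i * ?k + j + 1"] mem[OF that] by auto
    have "inj_on (\<lambda>j. \<phi> (i * ?k + j + 1)) {0..<?k}"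
    proof (rule inj_onI)
      fix a b assume ab: "a \<in> {0..<?k}" "b \<in> {0..<?k}" "\<phi> (i * ?k + a + 1) = \<phi> (i * ?k + b + 1)"
      then have "i * ?k + a + 1 = i * ?k + b + 1" using inj_onD[OF inj ab(3)] mem[of a] mem[of b] by auto
      then show "a = b" by simp
    qed
    then have "distinct (p i)" by (simp add: p_def distinct_map)
    moreover have "\<phi> 0 \<notin> set (p i)"
    proof
      assume "\<phi> 0 \<in> set (p i)"
      then obtain j where "j < ?k" "\<phi> 0 = \<phi> (i * ?k + j + 1)" by (auto simp: p_def)
      then show False using not0 by blast
    qed
    ultimately have d: "distinct (\<phi> 0 # p i)" by simp
    have "adj G ((\<phi> 0 # p i) ! j) ((\<phi> 0 # p i) ! Suc j)" if "Suc j < length (\<phi> 0 # p i)" for j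
      using that e1[OF i] e2[OF i, of j] by (cases j) (auto simp: p_def)
    then show "length (p i) = l - 1 \<and> gpath (adj G) (\<phi> 0 # p i)"
      using d unfolding gpath_nth by (simp add: p_def)
  next
    fix i j assume ij: "i < t" "j < t" "i \<noteq> j"
    have inj: "inj_on \<phi> {0..t * ?k}" using \<phi>(1) V by simp
    show "set (p i) \<inter> set (p j) = {}"
    proof (rule ccontr)
      assume "set (p i) \<inter> set (p j) \<noteq> {}"
      then obtain a b where ab: "a < ?k" "b < ?k" "\<phi> (i * ?k + a + 1) = \<phi> (j * ?k + b + 1)"
        by (auto simp: p_def)
      then have "i * ?k + a + 1 = j * ?k + b + 1"
        using inj_onD[OF inj ab(3)] bound[OF ij(1) ab(1)] bound[OF ij(2) ab(2)] by (simp add: Suc_le_eq)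
      then show False using uniq[of i a j b] ab ij by simp
    qed
  qed
qed

lemma has_spider_contains_starlike:
  assumes "has_spider (adj G) t l" "simple_graph G" "l \<ge> 2" "t \<ge> 1"
  shows "contains_subgraph G (starlike t l)"
proof -
  let ?k = "l - 1"
  have k: "?k \<ge> 1" using assms(3) by simp
  obtain c p where p: "\<And>i. i < t \<Longrightarrow> length (p i) = ?k" "\<And>i. i < t \<Longrightarrow> gpath (adj G) (c # p i)"
    "\<And>i j. \<lbrakk>i < t; j < t; i \<noteq> j\<rbrakk> \<Longrightarrow> set (p i) \<inter> set (p j) = {}"
    using has_spiderE[OF assms(1)] by metis
  \<comment> \<open>Vertex \<open>x > 0\<close> of the tree sits at position
    \<open>(x - 1) mod (l - 1)\<close> of leg \<open>(x - 1) div (l - 1)\<close>, inverting the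
    numbering of \<open>starlike\<close>.\<close>
  define \<phi> where "\<phi> x = (if x = 0 then c else p ((x - 1) div ?k) ! ((x - 1) mod ?k))" for x
  have \<phi>1: "\<phi> (i * ?k + j + 1) = p i ! j" if "j < ?k" for i j
    using that by (simp add: \<phi>_def)
  have dec: "\<exists>i j. i < t \<and> j < ?k \<and> x = i * ?k + j + 1" if "x \<in> {0..t * ?k}" "x \<noteq> 0" for x
  proof -
    have "(x - 1) div ?k < t" using that k by (auto simp: div_less_iff_less_mult)
    moreover have "(x - 1) mod ?k < ?k" using k by simp
    moreover have "x = (x - 1) div ?k * ?k + (x - 1) mod ?k + 1"
      using div_mult_mod_eq[of "x - 1" ?k] that(2) by linarith
    ultimately show ?thesis by blast
  qed
  have V: "verts (starlike t l) = {0..t * ?k}" by (simp add: starlike_def verts_def)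
  have adjp: "adj G ((c # p i) ! j) ((c # p i) ! Suc j)" if "i < t" "j < ?k" for i j
    using p(1)[OF that(1)] p(2)[OF that(1)] that(2) unfolding gpath_nth by auto
  have notc: "p i ! j \<noteq> c" if "i < t" "j < ?k" for i j
    using p(1)[OF that(1)] p(2)[OF that(1)] that(2) by (auto simp: gpath_def)
  have inV: "p i ! j \<in> verts G" if "i < t" "j < ?k" for i j
    using adjp[OF that] adj_in_verts(2)[OF assms(2)] by simp
  have cV: "c \<in> verts G" using adjp[of 0 0] adj_in_verts(1)[OF assms(2)] k assms(4) by fastforce
  have inj: "inj_on \<phi> {0..t * ?k}"
  proof (rule inj_onI)
    fix x y assume xy: "x \<in> {0..t * ?k}" "y \<in> {0..t * ?k}" "\<phi> x = \<phi> y"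
    show "x = y"
    proof (cases "x = 0 \<or> y = 0")
      case True
      have "\<phi> z \<noteq> c" if z: "z \<in> {0..t * ?k}" "z \<noteq> 0" for z
      proof -
        obtain i j where "i < t" "j < ?k" "z = i * ?k + j + 1" using dec[OF z] by blast
        then show ?thesis using \<phi>1[of j i] notc[of i j] by simp
      qed
      then show ?thesis using True xy by (metis \<phi>_def)
    next
      case False
      have "x \<noteq> 0" "y \<noteq> 0" using False by simp_all
      obtain i j where ij: "i < t" "j < ?k" "x = i * ?k + j + 1" using dec[OF xy(1) \<open>x \<noteq> 0\<close>] by blast
      obtain i' j' where ij': "i' < t" "j' < ?k" "y = i' * ?k + j' + 1" using dec[OF xy(2) \<open>y \<noteq> 0\<close>] by blast
      have eq: "p i ! j = p i' ! j'" using xy(3) \<phi>1 ij ij' by simp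
      have "p i ! j \<in> set (p i)" "p i' ! j' \<in> set (p i')" using p(1) ij ij' by auto
      then have "i = i'" using p(3)[OF ij(1) ij'(1)] eq by auto
      moreover have "distinct (p i)" using p(2)[OF ij(1)] by (simp add: gpath_def)
      ultimately have "j = j'" using eq p(1)[OF ij(1)] ij ij' by (simp add: nth_eq_iff_index_eq)
      then show ?thesis using ij ij' \<open>i = i'\<close> by simp
    qed
  qed
  have "\<phi> ` {0..t * ?k} \<subseteq> verts G"
  proof
    fix z assume "z \<in> \<phi> ` {0..t * ?k}"
    then obtain x where x: "x \<in> {0..t * ?k}" "z = \<phi> x" by blast
    show "z \<in> verts G"
    proof (cases "x = 0")
      case True then show ?thesis using x cV by (simp add: \<phi>_def)
    next
      case False
      obtain i j where "i < t" "j < ?k" "x = i * ?k + j + 1" using dec[OF x(1) False] by blast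
      then show ?thesis using x inV \<phi>1 by simp
    qed
  qed
  moreover have "\<phi> ` e \<in> edges G" if e: "e \<in> edges (starlike t l)" for e
  proof -
    consider i where "i < t" "e = {0, i * ?k + 1}" | i j where "i < t" "1 \<le> j" "j < ?k" "e = {i * ?k + j, i * ?k + j + 1}"
      using e unfolding starlike_def edges_def snd_conv by blast
    then show ?thesis
    proof cases
      case (1 i)
      have "\<phi> 0 = c" "\<phi> (i * ?k + 1) = p i ! 0" using \<phi>1[of 0 i] k by (auto simp: \<phi>_def)
      then show ?thesis using adjp[of i 0] 1 k by (simp add: adj_def)
    next
      case (2 i j)
      have "\<phi> (i * ?k + j) = p i ! (j - 1)" using \<phi>1[of "j - 1" i] 2 by simp
      moreover have "\<phi> (i * ?k + j + 1) = p i ! j" using \<phi>1[of j i] 2 by simp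
      ultimately show ?thesis using adjp[of i j] 2 by (cases j) (auto simp: adj_def)
    qed
  qed
  ultimately show ?thesis unfolding contains_subgraph_def V using inj by blast
qed

lemma gpath_take: "gpath E p \<Longrightarrow> 1 \<le> m \<Longrightarrow> gpath E (take m p)"
  unfolding gpath_nth by auto

lemma has_spider_1:
  assumes "l \<ge> 2"
  shows "has_spider E 1 l \<longleftrightarrow> (\<exists>s. gpath E s \<and> length s = l)"
proof
  assume "has_spider E 1 l"
  then obtain c p where "length (p (0::nat)) = l - 1" "gpath E (c # p 0)" by (elim has_spiderE) auto
  then show "\<exists>s. gpath E s \<and> length s = l" using assms by (intro exI[of _ "c # p 0"]) auto
next
  assume "\<exists>s. gpath E s \<and> length s = l"
  then obtain s where s: "gpath E s" "length s = l" by blast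
  then obtain c q where "s = c # q" using assms by (cases s) auto
  then show "has_spider E 1 l" using s by (intro has_spiderI[of 1 "\<lambda>_. q" l E c]) auto
qed

text \<open>Reversing one leg joins both legs and the centre to a path; conversely a path of odd
  length is split at its middle vertex.\<close>

lemma has_spider_2:
  assumes "l \<ge> 2" "symp E"
  shows "has_spider E 2 l \<longleftrightarrow> (\<exists>s. gpath E s \<and> length s = 2 * l - 1)"
proof
  assume "has_spider E 2 l"
  then obtain c p where p: "\<And>i::nat. i < 2 \<Longrightarrow> length (p i) = l - 1" "\<And>i. i < 2 \<Longrightarrow> gpath E (c # p i)"
    "\<And>i j. \<lbrakk>i < 2; j < 2; i \<noteq> j\<rbrakk> \<Longrightarrow> set (p i) \<inter> set (p j) = {}"
    by (elim has_spiderE) blast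
  have "p 1 \<noteq> []" using p(1)[of 1] assms(1) by auto
  have gp1: "gpath E (p 1)" "E c (hd (p 1))" using p(2)[of 1] \<open>p 1 \<noteq> []\<close> by (auto simp: gpath_def successively_Cons)
  have "gpath E (rev (c # p 0))" using p(2)[of 0] by (intro gpath_rev[OF assms(2)]) auto
  moreover have "set (rev (c # p 0)) \<inter> set (p 1) = {}" using p(3)[of 0 1] p(2)[of 1] by (auto simp: gpath_def)
  ultimately have "gpath E (rev (c # p 0) @ p 1)" using gp1 by (intro gpath_append) auto
  moreover have "length (rev (c # p 0) @ p 1) = 2 * l - 1" using p(1)[of 0] p(1)[of 1] assms(1) by simp
  ultimately show "\<exists>s. gpath E s \<and> length s = 2 * l - 1" by blast
next
  assume "\<exists>s. gpath E s \<and> length s = 2 * l - 1"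
  then obtain s where s: "gpath E s" "length s = 2 * l - 1" by blast
  define xs ys c where "xs = take (l - 1) s" and "ys = drop l s" and "c = s ! (l - 1)"
  have dec: "s = xs @ c # ys"
    using s(2) assms(1) id_take_nth_drop[of "l - 1" s] by (simp add: xs_def ys_def c_def)
  have len: "length xs = l - 1" "length ys = l - 1" using s(2) assms(1) by (auto simp: xs_def ys_def)
  have gp: "gpath E (rev (xs @ [c]))" "gpath E (c # ys)"
  proof -
    have "gpath E (xs @ [c]) \<and> gpath E (c # ys)" using gpath_split[of E xs c ys] s(1) unfolding dec[symmetric] by simp
    then show "gpath E (rev (xs @ [c]))" "gpath E (c # ys)" using gpath_rev[OF assms(2)] by blast+
  qed
  have "distinct (xs @ c # ys)" using s(1) unfolding dec[symmetric] by (simp add: gpath_def)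
  then have dj: "set xs \<inter> set ys = {}" by auto
  show "has_spider E 2 l"
  proof (rule has_spiderI[of 2 "\<lambda>i. if i = 0 then rev xs else ys" l E c])
    fix i j :: nat assume "i < 2" "j < 2" "i \<noteq> j"
    then show "set (if i = 0 then rev xs else ys) \<inter> set (if j = 0 then rev xs else ys) = {}"
      using dj by (auto simp: less_2_cases_iff)
  qed (use gp len in auto)
qed

section \<open>Fans: the join with a linear forest given by vertex lists\<close>

definition consec :: "'a list \<Rightarrow> 'a \<Rightarrow> 'a \<Rightarrow> bool" where
  "consec p a b \<longleftrightarrow> (\<exists>j. Suc j < length p \<and> a = p ! j \<and> b = p ! Suc j)"

text \<open>Determines \<open>E\<close> completely from the two dominating vertices and the inner
  paths, so that trees in it can be written down as lists.\<close>

definition fan :: "('a \<Rightarrow> 'a \<Rightarrow> bool) \<Rightarrow> 'a \<Rightarrow> 'a \<Rightarrow> 'a list list \<Rightarrow> bool" where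
  "fan E u v ps \<longleftrightarrow> distinct (u # v # concat ps) \<and>
    (\<forall>a b. E a b \<longleftrightarrow> a \<in> set (u # v # concat ps) \<and> b \<in> set (u # v # concat ps) \<and> a \<noteq> b \<and>
      (a \<in> {u, v} \<or> b \<in> {u, v} \<or> (\<exists>p\<in>set ps. consec p a b \<or> consec p b a)))"

lemma consec_set: "consec p a b \<Longrightarrow> a \<in> set p \<and> b \<in> set p"
  by (auto simp: consec_def)

lemma concat_disjoint:
  assumes "distinct (concat ps)" "i < length ps" "j < length ps" "i \<noteq> j"
  shows "set (ps ! i) \<inter> set (ps ! j) = {}"
proof -
  have *: "set (ps ! i) \<inter> set (ps ! j) = {}" if "i < j" "j < length ps" for i j
  proof -
    have "ps = take j ps @ ps ! j # drop (Suc j) ps" using that by (simp add: id_take_nth_drop)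
    then have "concat ps = concat (take j ps) @ ps ! j @ concat (drop (Suc j) ps)"
      by (metis concat.simps(2) concat_append)
    then have "distinct (concat (take j ps) @ ps ! j @ concat (drop (Suc j) ps))" using assms(1) by metis
    then have "set (concat (take j ps)) \<inter> set (ps ! j) = {}" by auto
    moreover have "ps ! i \<in> set (take j ps)" using nth_mem[of i "take j ps"] that by simp
    ultimately show ?thesis by auto
  qed
  show ?thesis
  proof (cases "i < j")
    case True then show ?thesis using *[OF True assms(3)] by simp
  next
    case False
    then have "j < i" using assms(4) by simp
    then show ?thesis using *[OF _ assms(2)] by blast
  qed
qed

locale fan_graph =
  fixes E :: "'a \<Rightarrow> 'a \<Rightarrow> bool" and u v :: 'a and ps :: "'a list list"
  assumes fan: "fan E u v ps"
begin

lemma dist: "distinct (u # v # concat ps)"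
  using fan by (simp add: fan_def)

lemma E_iff: "E a b \<longleftrightarrow> a \<in> set (u # v # concat ps) \<and> b \<in> set (u # v # concat ps) \<and> a \<noteq> b \<and>
      (a \<in> {u, v} \<or> b \<in> {u, v} \<or> (\<exists>p\<in>set ps. consec p a b \<or> consec p b a))"
  using fan unfolding fan_def by blast

lemma symE: "symp E"
  by (rule sympI) (subst (asm) E_iff, subst E_iff, blast)

lemma part_disjoint: "\<lbrakk>i < length ps; j < length ps; i \<noteq> j\<rbrakk> \<Longrightarrow> set (ps ! i) \<inter> set (ps ! j) = {}"
  using concat_disjoint[of ps i j] dist by simp

lemma part_props:
  assumes "i < length ps"
  shows "set (ps ! i) \<subseteq> set (concat ps)" "distinct (ps ! i)" "u \<notin> set (ps ! i)" "v \<notin> set (ps ! i)"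
proof -
  show 1: "set (ps ! i) \<subseteq> set (concat ps)" using nth_mem[OF assms] by auto
  show "distinct (ps ! i)" using dist assms by (simp add: distinct_concat_iff)
  show "u \<notin> set (ps ! i)" "v \<notin> set (ps ! i)" using 1 dist by auto
qed

lemma pole_adj: "\<lbrakk>c \<in> {u, v}; b \<in> set (concat ps)\<rbrakk> \<Longrightarrow> E c b" "E u v"
  using dist by (auto simp: E_iff)

lemma inner_adj:
  assumes "E a b" "a \<notin> {u, v}" "b \<notin> {u, v}"
  obtains i where "i < length ps" "consec (ps ! i) a b \<or> consec (ps ! i) b a"
  using assms E_iff[of a b] by (metis in_set_conv_nth)

lemma part_gpath:
  assumes "i < length ps" "ps ! i \<noteq> []"
  shows "gpath E (ps ! i)"
  unfolding gpath_nth
proof (intro conjI allI impI)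
  fix j assume j: "Suc j < length (ps ! i)"
  then have m: "ps ! i ! j \<in> set (ps ! i)" "ps ! i ! Suc j \<in> set (ps ! i)" by auto
  have ne: "ps ! i ! j \<noteq> ps ! i ! Suc j" using j part_props(2)[OF assms(1)] by (simp add: nth_eq_iff_index_eq)
  have "consec (ps ! i) (ps ! i ! j) (ps ! i ! Suc j)" using j by (auto simp: consec_def)
  moreover have "ps ! i \<in> set ps" using assms(1) by simp
  ultimately show "E (ps ! i ! j) (ps ! i ! Suc j)"
    unfolding E_iff using m ne part_props(1)[OF assms(1)] by auto
qed (use assms part_props in auto)

text \<open>Away from \<open>u\<close> and \<open>v\<close> all edges stay within one part. The
  index set with at most one element also covers the empty list.\<close>

lemma inner_path_in_part:
  assumes "successively E s" "set s \<inter> {u, v} = {}" "set s \<subseteq> set (concat ps)"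
  shows "\<exists>I. I \<subseteq> {..<length ps} \<and> card I \<le> 1 \<and> set s \<subseteq> (\<Union>i\<in>I. set (ps ! i))"
proof (cases s)
  case Nil
  then show ?thesis by (intro exI[of _ "{}"]) auto
next
  case (Cons a s')
  then have "a \<in> set (concat ps)" using assms(3) by simp
  then obtain p where "p \<in> set ps" "a \<in> set p" by auto
  then obtain i where i: "i < length ps" "a \<in> set (ps ! i)" by (metis in_set_conv_nth)
  have "set (a # s'') \<subseteq> set (ps ! i)"
    if "successively E (a # s'')" "set (a # s'') \<inter> {u, v} = {}" "a \<in> set (ps ! i)" for s'' a
    using that
  proof (induction s'' arbitrary: a)
    case (Cons b s'')
    have E: "E a b" "a \<notin> {u, v}" "b \<notin> {u, v}" using Cons.prems by auto
    obtain j where j: "j < length ps" "consec (ps ! j) a b \<or> consec (ps ! j) b a" using inner_adj[OF E] .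
    then have ab: "a \<in> set (ps ! j)" "b \<in> set (ps ! j)" using consec_set[of "ps ! j"] by blast+
    then have "j = i" using part_disjoint[OF j(1) i(1)] Cons.prems(3) by blast
    then show ?case using Cons.IH[of b] Cons.prems ab by auto
  qed simp
  then have "set s \<subseteq> set (ps ! i)" using assms(1,2) i(2) Cons by blast
  then show ?thesis using i(1) by (intro exI[of _ "{i}"]) auto
qed

text \<open>Deleting \<open>u\<close> and \<open>v\<close> cuts the path into at most three pieces,
  each inside a single part.\<close>

lemma gpath_length_le:
  assumes s: "gpath E s" and len2: "length s \<ge> 2"
  shows "\<exists>I. I \<subseteq> {..<length ps} \<and> card I \<le> 3 \<and> length s \<le> 2 + (\<Sum>i\<in>I. length (ps ! i))"
proof -
  have cut: "\<exists>xs ys. set r - {w} = set xs \<union> set ys \<and> set xs \<inter> set ys = {} \<and> w \<notin> set xs \<and> w \<notin> set ys \<and>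
      distinct xs \<and> distinct ys \<and> successively E xs \<and> successively E ys"
    if "distinct r" "successively E r" for r w
  proof (cases "w \<in> set r")
    case True
    then obtain xs ys where "r = xs @ w # ys" by (meson split_list)
    then show ?thesis using that by (intro exI[of _ xs] exI[of _ ys]) (auto simp: successively_append_iff successively_Cons)
  next
    case False
    then show ?thesis using that by (intro exI[of _ r] exI[of _ "[]"]) auto
  qed
  have sd: "distinct s" "successively E s" using s by (auto simp: gpath_def)
  have "set s \<subseteq> set (u # v # concat ps)"
  proof
    fix x assume "x \<in> set s"
    then obtain j where j: "j < length s" "x = s ! j" by (auto simp: in_set_conv_nth)
    have nx: "Suc i < length s \<Longrightarrow> E (s ! i) (s ! Suc i)" for i using s unfolding gpath_nth by blast
    show "x \<in> set (u # v # concat ps)"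
    proof (cases "Suc j < length s")
      case True then show ?thesis using nx[of j] E_iff[of "s ! j" "s ! Suc j"] j by blast
    next
      case False
      then obtain i where "j = Suc i" using j len2 by (cases j) auto
      then show ?thesis using nx[of i] E_iff[of "s ! i" "s ! j"] j by blast
    qed
  qed
  obtain xs ys where c1: "set s - {u} = set xs \<union> set ys" "set xs \<inter> set ys = {}" "u \<notin> set xs" "u \<notin> set ys"
      "distinct xs" "distinct ys" "successively E xs" "successively E ys"
    using cut[OF sd, of u] by blast
  have "\<exists>a b c. set s - {u, v} = set a \<union> set b \<union> set c \<and> successively E a \<and> successively E b \<and> successively E c"
  proof (cases "v \<in> set xs")
    case True
    obtain a b where "set xs - {v} = set a \<union> set b" "successively E a" "successively E b"
      using cut[OF c1(5,7), of v] by blast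
    moreover have "v \<notin> set ys" using True c1(2) by blast
    ultimately have "set s - {u, v} = set a \<union> set b \<union> set ys" using c1(1) by blast
    then show ?thesis using \<open>successively E a\<close> \<open>successively E b\<close> c1(8) by blast
  next
    case False
    obtain a b where "set ys - {v} = set a \<union> set b" "successively E a" "successively E b"
      using cut[OF c1(6,8), of v] by blast
    then have "set s - {u, v} = set a \<union> set b \<union> set xs" using c1(1) False by blast
    then show ?thesis using \<open>successively E a\<close> \<open>successively E b\<close> c1(7) by blast
  qed
  then obtain a b c where abc: "set s - {u, v} = set a \<union> set b \<union> set c" "successively E a" "successively E b" "successively E c"
    by blast
  have sub: "set a \<inter> {u, v} = {}" "set b \<inter> {u, v} = {}" "set c \<inter> {u, v} = {}"
      "set a \<subseteq> set (concat ps)" "set b \<subseteq> set (concat ps)" "set c \<subseteq> set (concat ps)"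
    using abc(1) \<open>set s \<subseteq> set (u # v # concat ps)\<close> by auto
  obtain I1 I2 I3 where I: "I1 \<subseteq> {..<length ps}" "card I1 \<le> 1" "set a \<subseteq> (\<Union>i\<in>I1. set (ps ! i))"
    "I2 \<subseteq> {..<length ps}" "card I2 \<le> 1" "set b \<subseteq> (\<Union>i\<in>I2. set (ps ! i))"
    "I3 \<subseteq> {..<length ps}" "card I3 \<le> 1" "set c \<subseteq> (\<Union>i\<in>I3. set (ps ! i))"
    using inner_path_in_part[OF abc(2) sub(1,4)] inner_path_in_part[OF abc(3) sub(2,5)] inner_path_in_part[OF abc(4) sub(3,6)]
    by blast
  let ?I = "I1 \<union> I2 \<union> I3"
  have fin: "finite ?I" using I(1,4,7) finite_subset by blast
  have "card ?I \<le> 3" using card_Un_le[of "I1 \<union> I2" I3] card_Un_le[of I1 I2] I(2,5,8) by linarith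
  moreover have "length s \<le> 2 + (\<Sum>i\<in>?I. length (ps ! i))"
  proof -
    have "length s = card (set s)" using sd by (simp add: distinct_card)
    also have "\<dots> \<le> card ({u, v} \<union> (\<Union>i\<in>?I. set (ps ! i)))"
    proof (rule card_mono)
      show "finite ({u, v} \<union> (\<Union>i\<in>?I. set (ps ! i)))" using fin by simp
      show "set s \<subseteq> {u, v} \<union> (\<Union>i\<in>?I. set (ps ! i))" 
      proof -
        let ?U = "\<Union>i\<in>?I. set (ps ! i)"
        have "set a \<subseteq> ?U" by (rule order_trans[OF I(3)]) (rule UN_mono, auto)
        moreover have "set b \<subseteq> ?U" by (rule order_trans[OF I(6)]) (rule UN_mono, auto)
        moreover have "set c \<subseteq> ?U" by (rule order_trans[OF I(9)]) (rule UN_mono, auto)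
        ultimately have "set s - {u, v} \<subseteq> ?U" unfolding abc(1) by simp
        then show ?thesis by (simp only: Diff_subset_conv)
      qed
    qed
    also have "\<dots> \<le> card {u, v} + card (\<Union>i\<in>?I. set (ps ! i))" by (rule card_Un_le)
    also have "card {u, v} \<le> 2" by (rule order_trans[OF card_insert_le_m1]) auto
    also have "card (\<Union>i\<in>?I. set (ps ! i)) \<le> (\<Sum>i\<in>?I. card (set (ps ! i)))" using fin by (rule card_UN_le)
    also have "\<dots> \<le> (\<Sum>i\<in>?I. length (ps ! i))" by (intro sum_mono card_length)
    finally show ?thesis by simp
  qed
  ultimately show ?thesis using I(1,4,7) by (intro exI[of _ ?I]) auto
qed

lemma pole_gpath:
  assumes "i < length ps"
  shows "gpath E (ps ! i @ [u])"
proof (cases "ps ! i = []")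
  case True then show ?thesis by (simp add: gpath_def)
next
  case False
  then have "last (ps ! i) \<in> set (concat ps)" using part_props(1)[OF assms] last_in_set by blast
  then have "E (last (ps ! i)) u" using pole_adj(1)[of u "last (ps ! i)"] by (auto intro: sympD[OF symE])
  then show ?thesis using part_gpath[OF assms False] part_props(3)[OF assms]
    by (intro gpath_append) (auto simp: gpath_def)
qed

lemma three_parts_gpath:
  assumes "i < length ps" "j < length ps" "k < length ps" "i \<noteq> j" "j \<noteq> k" "i \<noteq> k" "ps ! j \<noteq> []" "ps ! k \<noteq> []"
  shows "gpath E ((ps ! i @ [u]) @ (ps ! j @ [v]) @ ps ! k)"
proof -
  have hdj: "hd (ps ! j) \<in> set (concat ps)" "last (ps ! j) \<in> set (concat ps)" "hd (ps ! k) \<in> set (concat ps)"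
    using part_props(1)[OF assms(2)] part_props(1)[OF assms(3)] assms(7,8) hd_in_set last_in_set by blast+
  have "E (last (ps ! j)) v" using pole_adj(1)[of v "last (ps ! j)"] hdj(2) by (auto intro: sympD[OF symE])
  then have 1: "gpath E (ps ! j @ [v])"
    using part_gpath[OF assms(2,7)] part_props(4)[OF assms(2)] by (intro gpath_append) (auto simp: gpath_def)
  have 2: "gpath E ((ps ! j @ [v]) @ ps ! k)"
  proof (rule gpath_append[OF 1 part_gpath[OF assms(3,8)]])
    show "E (last (ps ! j @ [v])) (hd (ps ! k))" using pole_adj(1)[of v] hdj(3) by simp
    show "set (ps ! j @ [v]) \<inter> set (ps ! k) = {}"
      using part_props(4)[OF assms(3)] part_disjoint[OF assms(2,3,5)] by auto
  qed
  show ?thesis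
  proof (rule gpath_append)
    show "gpath E (ps ! i @ [u])" by (rule pole_gpath[OF assms(1)])
    show "gpath E ((ps ! j @ [v]) @ ps ! k)" by (rule 2)
    show "E (last (ps ! i @ [u])) (hd ((ps ! j @ [v]) @ ps ! k))" using pole_adj(1)[of u] hdj assms(7) by (simp add: hd_append)
    have "u \<noteq> v" using dist by simp
    then show "set (ps ! i @ [u]) \<inter> set ((ps ! j @ [v]) @ ps ! k) = {}"
      using part_disjoint[OF assms(1,2,4)] part_disjoint[OF assms(1,3,6)] part_props(3,4)[OF assms(1)]
        part_props(3)[OF assms(2)] part_props(3)[OF assms(3)] by auto
  qed
qed

lemma inner_degree:
  assumes "c \<notin> {u, v}" "\<And>b. b \<in> B \<Longrightarrow> E c b"
  shows "card B \<le> 4"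
proof (cases "\<exists>b. E c b")
  case False
  then have "B = {}" using assms(2) by blast
  then show ?thesis by simp
next
  case True
  then have "c \<in> set (concat ps)" using assms(1) E_iff[of c] by auto
  then obtain p where "p \<in> set ps" "c \<in> set p" by auto
  then obtain i j where ij: "i < length ps" "j < length (ps ! i)" "c = ps ! i ! j" by (metis in_set_conv_nth)
  \<comment> \<open>At the ends of the part the index \<open>j - 1\<close> returns \<open>c\<close>
    itself and \<open>Suc j\<close> an unspecified element; both only enlarge the set.\<close>
  have "B \<subseteq> {u, v, ps ! i ! (j - 1), ps ! i ! Suc j}"
  proof
    fix b assume "b \<in> B"
    then have E: "E c b" using assms(2) by blast
    show "b \<in> {u, v, ps ! i ! (j - 1), ps ! i ! Suc j}"
    proof (cases "b \<in> {u, v}")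
      case False
      obtain i' where i': "i' < length ps" "consec (ps ! i') c b \<or> consec (ps ! i') b c" using inner_adj[OF E assms(1) False] .
      then have "c \<in> set (ps ! i')" using consec_set[of "ps ! i'"] by blast
      moreover have "c \<in> set (ps ! i)" using ij by simp
      ultimately have "i' = i" using part_disjoint[OF i'(1) ij(1)] by blast
      then obtain a where a: "Suc a < length (ps ! i)" "(c = ps ! i ! a \<and> b = ps ! i ! Suc a) \<or> (b = ps ! i ! a \<and> c = ps ! i ! Suc a)"
        using i'(2) unfolding consec_def by blast
      have d: "distinct (ps ! i)" by (rule part_props(2)[OF ij(1)])
      from a(2) show ?thesis
      proof
        assume "c = ps ! i ! a \<and> b = ps ! i ! Suc a"
        moreover then have "a = j" using d ij a(1) by (simp add: nth_eq_iff_index_eq)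
        ultimately show ?thesis by simp
      next
        assume "b = ps ! i ! a \<and> c = ps ! i ! Suc a"
        moreover then have "Suc a = j" using d ij a(1) by (simp add: nth_eq_iff_index_eq)
        ultimately show ?thesis by auto
      qed
    qed auto
  qed
  then have "card B \<le> card {u, v, ps ! i ! (j - 1), ps ! i ! Suc j}" by (intro card_mono) auto
  also have "\<dots> \<le> 4" using card_length[of "[u, v, ps ! i ! (j - 1), ps ! i ! Suc j]"] by simp
  finally show ?thesis .
qed

text \<open>Five legs force the centre to be \<open>u\<close> or \<open>v\<close>. The other
  dominating vertex lies on at most one leg, and each remaining leg stays inside one part, where
  disjoint legs of \<open>l - 1\<close> vertices are counted by the quotient.\<close>

lemma spider_div_bound:
  assumes sp: "has_spider E t l" and l: "l \<ge> 3" and t: "t \<ge> 5"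
  shows "t - 1 \<le> (\<Sum>i<length ps. length (ps ! i) div (l - 1))"
proof -
  let ?k = "l - 1"
  obtain c p where p: "\<And>i. i < t \<Longrightarrow> length (p i) = ?k" "\<And>i. i < t \<Longrightarrow> gpath E (c # p i)"
    "\<And>i j. \<lbrakk>i < t; j < t; i \<noteq> j\<rbrakk> \<Longrightarrow> set (p i) \<inter> set (p j) = {}"
    using has_spiderE[OF sp] by metis
  have ne: "p i \<noteq> []" if "i < t" for i using p(1)[OF that] l by auto
  have "c \<in> {u, v}"
  proof (rule ccontr)
    assume c: "c \<notin> {u, v}"
    have "inj_on (\<lambda>i. hd (p i)) {..<t}"
    proof (rule inj_onI)
      fix i j assume ij: "i \<in> {..<t}" "j \<in> {..<t}" "hd (p i) = hd (p j)"
      then have "hd (p i) \<in> set (p i) \<inter> set (p j)" using ne by (metis IntI hd_in_set lessThan_iff)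
      then show "i = j" using p(3) ij by blast
    qed
    then have "card ((\<lambda>i. hd (p i)) ` {..<t}) = t" by (simp add: card_image)
    moreover have "card ((\<lambda>i. hd (p i)) ` {..<t}) \<le> 4"
      using p(2) ne by (intro inner_degree[OF c]) (auto simp: gpath_def successively_Cons)
    ultimately show False using t by simp
  qed
  define w where "w = (if c = u then v else u)"
  have cw: "{c, w} = {u, v}" using \<open>c \<in> {u, v}\<close> by (auto simp: w_def)
  define Q where "Q = {i. i < t \<and> w \<notin> set (p i)}"
  have "{..<t} - Q \<subseteq> {i. i < t \<and> w \<in> set (p i)}" by (auto simp: Q_def)
  moreover have "card {i. i < t \<and> w \<in> set (p i)} \<le> Suc 0"
    using p(3) by (subst card_le_Suc0_iff_eq) auto
  moreover have "finite {i. i < t \<and> w \<in> set (p i)}" by simp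
  ultimately have "card ({..<t} - Q) \<le> 1" using card_mono[of "{i. i < t \<and> w \<in> set (p i)}" "{..<t} - Q"] by simp
  moreover have Q: "Q \<subseteq> {..<t}" "finite Q" by (auto simp: Q_def)
  ultimately have cQ: "t - 1 \<le> card Q" using card_Diff_subset[of Q "{..<t}"] by simp
  have "\<exists>i. i < length ps \<and> set (p a) \<subseteq> set (ps ! i)" if a: "a \<in> Q" for a
  proof -
    have at: "a < t" "w \<notin> set (p a)" using a by (auto simp: Q_def)
    have d: "c \<notin> set (p a)" "successively E (p a)" "successively E (c # p a)"
      using p(2)[OF at(1)] by (auto simp: gpath_def successively_Cons)
    have disj: "set (p a) \<inter> {u, v} = {}" unfolding cw[symmetric] using d(1) at(2) by simp
    have "set (p a) \<subseteq> set (u # v # concat ps)"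
    proof
      fix x assume "x \<in> set (p a)"
      then obtain j where j: "j < length (p a)" "x = p a ! j" by (auto simp: in_set_conv_nth)
      then have "E ((c # p a) ! j) ((c # p a) ! Suc j)" using p(2)[OF at(1)] unfolding gpath_nth by auto
      then show "x \<in> set (u # v # concat ps)" using E_iff[of _ x] j by auto
    qed
    then have "set (p a) \<subseteq> set (concat ps)" using disj by auto
    then obtain I where I: "I \<subseteq> {..<length ps}" "card I \<le> 1" "set (p a) \<subseteq> (\<Union>i\<in>I. set (ps ! i))"
      using inner_path_in_part[OF d(2) disj] by blast
    obtain x where "x \<in> set (p a)" using ne[OF at(1)] by (meson list.set_sel(1))
    then obtain i where i: "i \<in> I" using I(3) by blast
    have "finite I" using I(1) finite_subset by blast
    then have "I = {i}" using I(2) i card_le_Suc0_iff_eq[of I] by auto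
    then show ?thesis using I by auto
  qed
  then obtain h where h: "\<And>a. a \<in> Q \<Longrightarrow> h a < length ps \<and> set (p a) \<subseteq> set (ps ! h a)" by metis
  have "card Q = (\<Sum>a\<in>Q. 1)" by simp
  also have "\<dots> = (\<Sum>i<length ps. \<Sum>a\<in>{a\<in>Q. h a = i}. 1)"
    using h Q(2) by (intro sum.group[symmetric]) auto
  also have "\<dots> = (\<Sum>i<length ps. card {a\<in>Q. h a = i})" by simp
  also have "\<dots> \<le> (\<Sum>i<length ps. length (ps ! i) div ?k)"
  proof (rule sum_mono)
    fix i assume "i \<in> {..<length ps}"
    let ?F = "{a\<in>Q. h a = i}"
    have "card ?F * ?k = (\<Sum>a\<in>?F. card (set (p a)))"
    proof -
      have "card (set (p a)) = ?k" if "a \<in> Q" for a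
        using that p(1,2)[of a] distinct_card[of "p a"] by (auto simp: Q_def gpath_def)
      then show ?thesis by simp
    qed
    also have "\<dots> = card (\<Union>a\<in>?F. set (p a))"
      using Q p(3) by (subst card_UN_disjoint) auto
    also have "\<dots> \<le> card (set (ps ! i))" using h by (intro card_mono) auto
    also have "\<dots> \<le> length (ps ! i)" by (rule card_length)
    finally show "card ?F \<le> length (ps ! i) div ?k" using l by (simp add: less_eq_div_iff_mult_less_eq)
  qed
  finally show ?thesis using cQ by simp
qed

end

section \<open>Fans and the graphs \<open>JP\<close>\<close>

definition slot_lists :: "nat list \<Rightarrow> (nat + nat \<times> nat) list list" where
  "slot_lists ls = map (\<lambda>i. map (\<lambda>j. Inr (i, j)) [0..<ls ! i]) [0..<length ls]"

lemma length_slot_lists: "length (slot_lists ls) = length ls" "i < length ls \<Longrightarrow> length (slot_lists ls ! i) = ls ! i"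
  by (simp_all add: slot_lists_def)

lemma set_slot_lists: "set (concat (slot_lists ls)) = Inr ` slots ls"
  by (auto simp: slot_lists_def slots_def)

lemma distinct_concatI:
  assumes "\<And>i. i < length ps \<Longrightarrow> distinct (ps ! i)"
    and "\<And>i j. \<lbrakk>i < length ps; j < length ps; i \<noteq> j\<rbrakk> \<Longrightarrow> set (ps ! i) \<inter> set (ps ! j) = {}"
  shows "distinct (concat ps)"
  using assms
proof (induction ps)
  case (Cons p ps)
  have "distinct (concat ps)"
    by (rule Cons.IH) (use Cons.prems(1)[of "Suc _"] Cons.prems(2)[of "Suc _" "Suc _"] in auto)
  moreover have "set p \<inter> set q = {}" if q: "q \<in> set ps" for q
  proof -
    obtain i where "i < length ps" "q = ps ! i" using q by (metis in_set_conv_nth)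
    then show ?thesis using Cons.prems(2)[of 0 "Suc i"] by simp
  qed
  ultimately show ?case using Cons.prems(1)[of 0] by auto
qed simp

lemma fan_JP: "fan (adj (JP ls)) (Inl 0) (Inl 1) (slot_lists ls)"
proof -
  have d: "distinct (concat (slot_lists ls))"
    by (rule distinct_concatI) (auto simp: slot_lists_def distinct_map inj_on_def)
  have cons: "(\<exists>p\<in>set (slot_lists ls). consec p a b) \<longleftrightarrow>
      (\<exists>i j. i < length ls \<and> Suc j < ls ! i \<and> a = Inr (i, j) \<and> b = Inr (i, Suc j))" for a b
  proof
    assume "\<exists>p\<in>set (slot_lists ls). consec p a b"
    then obtain i where i: "i < length ls" "consec (map (\<lambda>j. Inr (i, j)) [0..<ls ! i]) a b"
      by (auto simp: slot_lists_def)
    then show "\<exists>i j. i < length ls \<and> Suc j < ls ! i \<and> a = Inr (i, j) \<and> b = Inr (i, Suc j)"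
      by (auto simp: consec_def)
  next
    assume "\<exists>i j. i < length ls \<and> Suc j < ls ! i \<and> a = Inr (i, j) \<and> b = Inr (i, Suc j)"
    then obtain i j where ij: "i < length ls" "Suc j < ls ! i" "a = Inr (i, j)" "b = Inr (i, Suc j)" by blast
    have "consec (map (\<lambda>j. Inr (i, j)) [0..<ls ! i]) a b"
      unfolding consec_def using ij by (intro exI[of _ j]) auto
    then show "\<exists>p\<in>set (slot_lists ls). consec p a b" using ij(1) by (auto simp: slot_lists_def)
  qed
  have A: "adj (JP ls) a b \<longleftrightarrow> a \<in> {Inl 0, Inl 1} \<union> Inr ` slots ls \<and> b \<in> {Inl 0, Inl 1} \<union> Inr ` slots ls \<and> a \<noteq> b \<and>
      (a \<in> {Inl 0, Inl 1} \<or> b \<in> {Inl 0, Inl 1} \<or> (\<exists>p\<in>set (slot_lists ls). consec p a b) \<or> (\<exists>p\<in>set (slot_lists ls). consec p b a))" for a b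
    unfolding cons by (cases a; cases b) (auto simp: slots_def)
  have S: "set (Inl 0 # Inl 1 # concat (slot_lists ls)) = {Inl 0, Inl 1} \<union> Inr ` slots ls"
    using set_slot_lists[of ls] by simp
  have "distinct (Inl 0 # Inl 1 # concat (slot_lists ls))"
    using d set_slot_lists[of ls] by (simp only: distinct.simps list.set) auto
  then show ?thesis
    unfolding fan_def S bex_disj_distrib using A by blast
qed

definition fan_map :: "'a \<Rightarrow> 'a \<Rightarrow> 'a list list \<Rightarrow> nat + nat \<times> nat \<Rightarrow> 'a" where
  "fan_map u v ps z = (case z of Inl a \<Rightarrow> (if a = 0 then u else v) | Inr (i, j) \<Rightarrow> ps ! i ! j)"

context fan_graph
begin

lemma fan_map_bij: "bij_betw (fan_map u v ps) (verts (JP (map length ps))) (set (u # v # concat ps))"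
proof -
  let ?W = "slots (map length ps)"
  have W: "(i, j) \<in> ?W \<longleftrightarrow> i < length ps \<and> j < length (ps ! i)" for i j by (auto simp: slots_def)
  have mem: "ps ! i ! j \<in> set (concat ps)" if "(i, j) \<in> ?W" for i j
    using that W[of i j] part_props(1)[of i] nth_mem[of j "ps ! i"] by blast
  have uv: "u \<noteq> v" "u \<notin> set (concat ps)" "v \<notin> set (concat ps)" using dist by auto
  have inj: "ps ! i ! j = ps ! i' ! j' \<longleftrightarrow> i = i' \<and> j = j'" if "(i, j) \<in> ?W" "(i', j') \<in> ?W" for i j i' j'
  proof
    assume eq: "ps ! i ! j = ps ! i' ! j'"
    have ij: "i < length ps" "j < length (ps ! i)" "i' < length ps" "j' < length (ps ! i')" using that W by auto
    have "i = i'" using part_disjoint[OF ij(1,3)] nth_mem[OF ij(2)] nth_mem[OF ij(4)] eq by auto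
    then show "i = i' \<and> j = j'" using eq ij part_props(2)[OF ij(1)] by (auto simp: nth_eq_iff_index_eq)
  qed simp
  show ?thesis
    unfolding bij_betw_def
  proof
    show "inj_on (fan_map u v ps) (verts (JP (map length ps)))"
      unfolding verts_JP
    proof (rule inj_onI)
      fix z z' assume z: "z \<in> {Inl 0, Inl 1} \<union> Inr ` ?W" "z' \<in> {Inl 0, Inl 1} \<union> Inr ` ?W"
        "fan_map u v ps z = fan_map u v ps z'"
      have m: "ps ! i ! j \<noteq> u" "ps ! i ! j \<noteq> v" if "(i, j) \<in> ?W" for i j using mem[OF that] uv by metis+
      show "z = z'" using z uv(1) m inj by (fastforce simp: fan_map_def split: if_splits)
    qed
    show "fan_map u v ps ` verts (JP (map length ps)) = set (u # v # concat ps)"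
    proof
      show "fan_map u v ps ` verts (JP (map length ps)) \<subseteq> set (u # v # concat ps)"
        unfolding verts_JP using mem by (fastforce simp: fan_map_def)
      show "set (u # v # concat ps) \<subseteq> fan_map u v ps ` verts (JP (map length ps))"
      proof
        fix x assume "x \<in> set (u # v # concat ps)"
        then consider "x = u" | "x = v" | p where "p \<in> set ps" "x \<in> set p" by auto
        then show "x \<in> fan_map u v ps ` verts (JP (map length ps))"
        proof cases
          case 1 then show ?thesis by (intro image_eqI[of _ _ "Inl 0"]) (auto simp: fan_map_def verts_JP)
        next
          case 2 then show ?thesis by (intro image_eqI[of _ _ "Inl 1"]) (auto simp: fan_map_def verts_JP)
        next
          case (3 p)
          then obtain i j where "i < length ps" "j < length (ps ! i)" "x = ps ! i ! j" by (metis in_set_conv_nth)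
          then show ?thesis by (intro image_eqI[of _ _ "Inr (i, j)"]) (auto simp: fan_map_def verts_JP W)
        qed
      qed
    qed
  qed
qed

lemma fan_map_adj:
  assumes "z \<in> verts (JP (map length ps))" "z' \<in> verts (JP (map length ps))"
  shows "adj (JP (map length ps)) z z' \<longleftrightarrow> E (fan_map u v ps z) (fan_map u v ps z')"
proof -
  let ?W = "slots (map length ps)"
  have W: "(i, j) \<in> ?W \<longleftrightarrow> i < length ps \<and> j < length (ps ! i)" for i j by (auto simp: slots_def)
  have mem: "ps ! i ! j \<in> set (concat ps)" if "(i, j) \<in> ?W" for i j
    using that W[of i j] part_props(1)[of i] nth_mem[of j "ps ! i"] by blast
  have uv: "u \<noteq> v" "u \<notin> set (concat ps)" "v \<notin> set (concat ps)" using dist by auto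
  have irr: "\<not> E a a" for a using E_iff[of a a] by simp
  have pole: "E c b" "E b c" if "c \<in> {u, v}" "b \<in> set (concat ps)" for c b
    using pole_adj(1)[OF that] sympD[OF symE] by blast+
  have vu: "E u v" "E v u" using pole_adj(2) sympD[OF symE] by blast+
  have inner: "adj (JP (map length ps)) (Inr (i, j)) (Inr (i', j')) \<longleftrightarrow> E (ps ! i ! j) (ps ! i' ! j')"
    if ij: "(i, j) \<in> ?W" "(i', j') \<in> ?W" for i j i' j'
  proof
    have ij': "i < length ps" "j < length (ps ! i)" "i' < length ps" "j' < length (ps ! i')" using ij W by auto
    {
      assume a: "adj (JP (map length ps)) (Inr (i, j)) (Inr (i', j'))"
      then have ii: "i = i'" "j' = Suc j \<or> j = Suc j'" by auto
      have "ps ! i \<noteq> []" using ij'(2) by (metis less_nat_zero_code list.size(3))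
      then have gp: "gpath E (ps ! i)" by (rule part_gpath[OF ij'(1)])
      then show "E (ps ! i ! j) (ps ! i' ! j')"
        using ii ij' sympD[OF symE] unfolding gpath_nth by auto
    next
      assume e: "E (ps ! i ! j) (ps ! i' ! j')"
      have n: "ps ! i ! j \<notin> {u, v}" "ps ! i' ! j' \<notin> {u, v}" using mem[OF ij(1)] mem[OF ij(2)] uv by auto
      obtain k where k: "k < length ps" "consec (ps ! k) (ps ! i ! j) (ps ! i' ! j') \<or> consec (ps ! k) (ps ! i' ! j') (ps ! i ! j)"
        using inner_adj[OF e n] .
      then have "ps ! i ! j \<in> set (ps ! k)" "ps ! i' ! j' \<in> set (ps ! k)" using consec_set[of "ps ! k"] by blast+
      then have ki: "k = i" "k = i'"
        using part_disjoint[OF k(1) ij'(1)] part_disjoint[OF k(1) ij'(3)] nth_mem[OF ij'(2)] nth_mem[OF ij'(4)] by blast+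
      have d: "distinct (ps ! i)" by (rule part_props(2)[OF ij'(1)])
      have "j' = Suc j \<or> j = Suc j'"
        using k(2) ki d ij' unfolding consec_def by (auto simp: nth_eq_iff_index_eq)
      then show "adj (JP (map length ps)) (Inr (i, j)) (Inr (i', j'))" using ki ij' by auto
    }
  qed
  have "z = Inl 0 \<or> z = Inl 1 \<or> (\<exists>i j. z = Inr (i, j) \<and> (i, j) \<in> ?W)"
    "z' = Inl 0 \<or> z' = Inl 1 \<or> (\<exists>i j. z' = Inr (i, j) \<and> (i, j) \<in> ?W)"
    using assms by (auto simp: verts_JP)
  then show ?thesis
    by (elim disjE exE conjE) (simp_all add: fan_map_def inner irr vu pole[OF _ mem] del: adj_JP(4))
qed

lemma fan_iso:
  assumes "E = adj G" "verts G = set (u # v # concat ps)"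
  shows "graph_iso G (JP (map length ps))"
proof -
  let ?f = "fan_map u v ps" and ?H = "JP (map length ps)"
  let ?g = "inv_into (verts ?H) ?f"
  have f: "bij_betw ?f (verts ?H) (verts G)" using fan_map_bij assms(2) by simp
  have g: "bij_betw ?g (verts G) (verts ?H)" by (rule bij_betw_inv_into[OF f])
  have gx: "?g x \<in> verts ?H" "?f (?g x) = x" if "x \<in> verts G" for x
    using bij_betwE[OF g] bij_betw_inv_into_right[OF f that] that by auto
  show ?thesis
    unfolding graph_iso_def
    using g fan_map_adj[OF gx(1) gx(1)] gx(2) assms(1)
    by (intro exI[of _ ?g]) (simp add: adj_def)
qed

lemma fan_quadratic_form:
  assumes V: "V = set (u # v # concat ps)"
  shows "ip (JP (map length ps)) (x \<circ> fan_map u v ps) (x \<circ> fan_map u v ps) = (\<Sum>a\<in>V. x a * x a)"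
    and "ip (JP (map length ps)) (x \<circ> fan_map u v ps) (mv (JP (map length ps)) (x \<circ> fan_map u v ps))
      = (\<Sum>a\<in>V. \<Sum>b\<in>V. of_bool (E a b) * x a * x b)"
    and "z \<in> verts (JP (map length ps)) \<Longrightarrow>
      mv (JP (map length ps)) (x \<circ> fan_map u v ps) z = (\<Sum>b\<in>V. of_bool (E (fan_map u v ps z) b) * x b)"
proof -
  let ?f = "fan_map u v ps" and ?H = "JP (map length ps)"
  have f: "bij_betw ?f (verts ?H) V" using fan_map_bij V by simp
  show "ip ?H (x \<circ> ?f) (x \<circ> ?f) = (\<Sum>a\<in>V. x a * x a)"
    unfolding ip_def using sum.reindex_bij_betw[OF f, of "\<lambda>a. x a * x a"] by simp
  show mv: "mv ?H (x \<circ> ?f) z = (\<Sum>b\<in>V. of_bool (E (?f z) b) * x b)" if z: "z \<in> verts ?H" for z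
  proof -
    have "mv ?H (x \<circ> ?f) z = (\<Sum>w\<in>verts ?H. of_bool (E (?f z) (?f w)) * x (?f w))"
      unfolding mv_def using fan_map_adj[OF z] by (intro sum.cong refl) (simp add: adj_matrix_def adj_def[symmetric])
    also have "\<dots> = (\<Sum>b\<in>V. of_bool (E (?f z) b) * x b)"
      using sum.reindex_bij_betw[OF f, of "\<lambda>b. of_bool (E (?f z) b) * x b"] by simp
    finally show ?thesis .
  qed
  have "ip ?H (x \<circ> ?f) (mv ?H (x \<circ> ?f)) = (\<Sum>z\<in>verts ?H. x (?f z) * (\<Sum>b\<in>V. of_bool (E (?f z) b) * x b))"
    unfolding ip_def using mv by simp
  also have "\<dots> = (\<Sum>a\<in>V. x a * (\<Sum>b\<in>V. of_bool (E a b) * x b))"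
    using sum.reindex_bij_betw[OF f, of "\<lambda>a. x a * (\<Sum>b\<in>V. of_bool (E a b) * x b)"] by simp
  finally show "ip ?H (x \<circ> ?f) (mv ?H (x \<circ> ?f)) = (\<Sum>a\<in>V. \<Sum>b\<in>V. of_bool (E a b) * x a * x b)"
    by (simp add: sum_distrib_left mult_ac)
qed

end

section \<open>Starlike trees in fans\<close>

definition chunks :: "nat \<Rightarrow> 'a list \<Rightarrow> 'a list list" where
  "chunks k q = map (\<lambda>i. take k (drop (i * k) q)) [0..<length q div k]"

lemma chunks_props:
  assumes "k \<ge> 1" "c \<in> set (chunks k q)"
  shows "length c = k" "set c \<subseteq> set q" "distinct q \<Longrightarrow> distinct c" "successively E q \<Longrightarrow> successively E c"
proof -
  obtain i where i: "i < length q div k" "c = take k (drop (i * k) q)" using assms(2) by (auto simp: chunks_def)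
  have "Suc i * k \<le> length q div k * k" using i(1) by (intro mult_right_mono) auto
  also have "\<dots> \<le> length q" by simp
  finally show "length c = k" using i(2) by simp
  show "set c \<subseteq> set q" unfolding i(2) by (meson order_trans set_drop_subset set_take_subset)
  show "distinct q \<Longrightarrow> distinct c" using i(2) by simp
  show "successively E q \<Longrightarrow> successively E c" unfolding i(2) successively_conv_nth by auto
qed

lemma concat_chunks_distinct:
  assumes "distinct q" "k \<ge> 1"
  shows "distinct (concat (chunks k q))"
proof (rule distinct_concatI)
  fix i assume "i < length (chunks k q)"
  then show "distinct (chunks k q ! i)" using chunks_props(3)[OF assms(2)] assms(1) nth_mem by blast
next
  fix i j assume ij: "i < length (chunks k q)" "j < length (chunks k q)" "i \<noteq> j"
  have *: "set (take k (drop (i * k) q)) \<inter> set (take k (drop (j * k) q)) = {}" if "i < j" for i j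
  proof -
    have "set (take k (drop (i * k) q)) \<subseteq> set (take (j * k) q)"
    proof -
      have "Suc i * k \<le> j * k" using that by (intro mult_right_mono) auto
      then have "take k (drop (i * k) q) = drop (i * k) (take (Suc i * k) q)" by (simp add: take_drop add.commute)
      moreover have "set (take (Suc i * k) q) \<subseteq> set (take (j * k) q)" using \<open>Suc i * k \<le> j * k\<close> by (rule set_take_subset_set_take)
      ultimately show ?thesis by (metis order_trans set_drop_subset)
    qed
    moreover have "set (take (j * k) q) \<inter> set (drop (j * k) q) = {}" by (rule set_take_disj_set_drop_if_distinct[OF assms(1)]) simp
    ultimately show ?thesis by (meson disjoint_iff in_set_takeD subsetD)
  qed
  have "chunks k q ! i = take k (drop (i * k) q)" "chunks k q ! j = take k (drop (j * k) q)"
    using ij(1,2) by (simp_all add: chunks_def)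
  then show "set (chunks k q ! i) \<inter> set (chunks k q ! j) = {}"
    using *[of i j] *[of j i] ij(3) by (metis Int_commute linorder_neqE_nat)
qed

text \<open>Legs are cut off the paths \<open>qs\<close>; \<open>extra\<close> contributes further legs that are already of the right
  length.\<close>

lemma has_spider_chunks:
  assumes k: "k \<ge> 1" and d: "distinct (concat qs)" and de: "distinct (concat extra)"
    and sep: "\<And>q c. \<lbrakk>q \<in> set qs; k \<le> length q; c \<in> set extra\<rbrakk> \<Longrightarrow> set q \<inter> set c = {}"
    and suc: "\<And>q. q \<in> set qs \<Longrightarrow> successively E q"
    and ex: "\<And>c. c \<in> set extra \<Longrightarrow> length c = k \<and> successively E c"
    and center: "\<And>b. b \<in> set (concat qs) \<union> set (concat extra) \<Longrightarrow> E w b \<and> b \<noteq> w"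
    and t: "t \<le> (\<Sum>i<length qs. length (qs ! i) div k) + length extra"
  shows "has_spider E t (Suc k)"
proof -
  define L where "L = concat (map (chunks k) qs) @ extra"
  have "length (concat (map (chunks k) qs)) = (\<Sum>i<length qs. length (qs ! i) div k)"
    by (simp add: length_concat sum_list_sum_nth lessThan_atLeast0 chunks_def)
  then have len: "t \<le> length L" using t by (simp add: L_def)
  \<comment> \<open>Only parts of length at least \<open>k\<close> yield chunks, so the legs in
    \<open>extra\<close> may run through shorter parts.\<close>
  have chunk_len: "k \<le> length q" if "c \<in> set (chunks k q)" for c q
    using chunks_props(1)[OF k that] chunks_props(2)[OF k that] that
    by (auto simp: chunks_def) (metis div_less less_nat_zero_code not_le)
  have "distinct (concat (concat (map (chunks k) qs)))"
    using d
  proof (induction qs)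
    case (Cons q qs)
    have "set (concat (chunks k q)) \<subseteq> set q" using chunks_props(2)[OF k] by fastforce
    moreover have "set (concat (concat (map (chunks k) qs))) \<subseteq> set (concat qs)" using chunks_props(2)[OF k] by fastforce
    ultimately show ?case using Cons concat_chunks_distinct[of q k] k by auto
  qed simp
  moreover have "set (concat (concat (map (chunks k) qs))) \<inter> set (concat extra) = {}"
  proof (rule ccontr)
    assume "\<not> ?thesis"
    then obtain x q c e where x: "q \<in> set qs" "c \<in> set (chunks k q)" "x \<in> set c" "e \<in> set extra" "x \<in> set e" by auto
    then have "x \<in> set q" using chunks_props(2)[OF k x(2)] by blast
    then show False using sep[OF x(1) chunk_len[OF x(2)] x(4)] x(5) by blast
  qed
  ultimately have dL: "distinct (concat L)" using de by (simp add: L_def)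
  have sub: "set (concat L) \<subseteq> set (concat qs) \<union> set (concat extra)"
    using chunks_props(2)[OF k] by (fastforce simp: L_def)
  have leg: "length c = k \<and> successively E c" if cL: "c \<in> set L" for c
  proof (cases "c \<in> set extra")
    case True then show ?thesis by (rule ex)
  next
    case False
    then obtain q where q: "q \<in> set qs" "c \<in> set (chunks k q)" using cL by (auto simp: L_def)
    then show ?thesis using chunks_props(1)[OF k q(2)] chunks_props(4)[OF k q(2) suc[OF q(1)]] by simp
  qed
  show ?thesis
  proof (rule has_spiderI[of t "\<lambda>i. L ! i" "Suc k" E w])
    fix i assume i: "i < t"
    then have m: "L ! i \<in> set L" using len by simp
    have ne: "L ! i \<noteq> []" using leg[OF m] k by auto
    have s: "set (L ! i) \<subseteq> set (concat L)" using m by auto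
    have "E w (hd (L ! i))" "w \<notin> set (L ! i)" using center s sub hd_in_set[OF ne] by blast+
    moreover have "distinct (L ! i)" using dL m by (simp add: distinct_concat_iff)
    ultimately show "length (L ! i) = Suc k - 1 \<and> gpath E (w # L ! i)"
      using leg[OF m] by (auto simp: gpath_def successively_Cons)
  next
    fix i j assume "i < t" "j < t" "i \<noteq> j"
    then show "set (L ! i) \<inter> set (L ! j) = {}" using concat_disjoint[OF dL, of i j] len by simp
  qed
qed

context fan_graph
begin

lemma has_spider_of_parts:
  assumes "k \<ge> 1" "t \<le> (\<Sum>i<length ps. length (ps ! i) div k)"
  shows "has_spider E t (Suc k)"
proof (rule has_spider_chunks[of k ps "[]" E u t])
  show "successively E q" if "q \<in> set ps" for q
    using that part_gpath by (metis gpath_def in_set_conv_nth successively.simps(1))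
  show "E u b \<and> b \<noteq> u" if "b \<in> set (concat ps) \<union> set (concat [])" for b
    using that pole_adj(1)[of u b] dist by auto
qed (use assms dist in auto)

text \<open>With centre \<open>u\<close>, the vertex \<open>v\<close> is free to link the two short
  parts into one further leg, of at least \<open>k\<close> vertices before it is truncated.\<close>

lemma has_spider_of_parts_and_pair:
  assumes k: "k \<ge> 1" and t: "t \<le> Suc (\<Sum>i<length ps. length (ps ! i) div k)"
    and ij: "i < length ps" "j < length ps" "i \<noteq> j" "length (ps ! i) < k" "length (ps ! j) < k"
    and long: "k - 1 \<le> length (ps ! i) + length (ps ! j)" and ne: "ps ! i \<noteq> []" "ps ! j \<noteq> []"
  shows "has_spider E t (Suc k)"
proof -
  define c where "c = take k (ps ! i @ [v] @ ps ! j)"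
  have hl: "last (ps ! i) \<in> set (concat ps)" "hd (ps ! j) \<in> set (concat ps)"
    using part_props(1)[OF ij(1)] part_props(1)[OF ij(2)] ne hd_in_set last_in_set by blast+
  have gi: "gpath E (ps ! i)" "gpath E (ps ! j)" using part_gpath ij(1,2) ne by auto
  have 1: "gpath E ([v] @ ps ! j)"
    using pole_adj(1)[of v] hl part_props(4)[OF ij(2)] by (intro gpath_append gi) (auto simp: gpath_def)
  have "E (last (ps ! i)) v" using pole_adj(1)[of v "last (ps ! i)"] hl by (auto intro: sympD[OF symE])
  then have "gpath E (ps ! i @ [v] @ ps ! j)"
    using part_props(4)[OF ij(1)] part_disjoint[OF ij(1-3)] by (intro gpath_append gi 1) auto
  then have c: "gpath E c" unfolding c_def using k by (intro gpath_take)
  have lc: "length c = k" using long k by (simp add: c_def)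
  have sc: "set c \<subseteq> set (ps ! i) \<union> {v} \<union> set (ps ! j)"
    unfolding c_def by (rule order_trans[OF set_take_subset]) auto
  show ?thesis
  proof (rule has_spider_chunks[of k ps "[c]" E u t])
    show "successively E q" if "q \<in> set ps" for q
      using that part_gpath by (metis gpath_def in_set_conv_nth successively.simps(1))
    show "E u b \<and> b \<noteq> u" if b: "b \<in> set (concat ps) \<union> set (concat [c])" for b
    proof -
      have "b \<in> insert v (set (concat ps))" using b sc part_props(1)[OF ij(1)] part_props(1)[OF ij(2)] by auto
      then show ?thesis using pole_adj dist by auto
    qed
    show "set q \<inter> set c' = {}" if q: "q \<in> set ps" "k \<le> length q" "c' \<in> set [c]" for q c'
    proof -
      obtain m where m: "m < length ps" "q = ps ! m" using q(1) by (metis in_set_conv_nth)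
      then have "m \<noteq> i" "m \<noteq> j" using q(2) ij(4,5) by auto
      then have "set q \<inter> set (ps ! i) = {}" "set q \<inter> set (ps ! j) = {}" "v \<notin> set q"
        using part_disjoint[OF m(1) ij(1)] part_disjoint[OF m(1) ij(2)] part_props(4)[OF m(1)] m(2) by auto
      then show ?thesis using sc q(3) by auto
    qed
  qed (use assms dist c lc in \<open>auto simp: gpath_def\<close>)
qed

end

text \<open>A longest path is a whole component: its interior vertices already have two neighbours,
  its ends have no neighbour elsewhere by maximality, and a chord between the ends would close a
  cycle. Removing longest paths first also sorts the lengths in descending order.\<close>

lemma linear_forest:
  assumes "finite W" "symp H" "\<And>a b. H a b \<Longrightarrow> a \<in> W \<and> b \<in> W" "irreflp H"
    and deg: "\<And>a B. \<lbrakk>\<And>b. b \<in> B \<Longrightarrow> H a b; finite B\<rbrakk> \<Longrightarrow> card B \<le> 2"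
    and acyclic: "\<And>c. \<lbrakk>gpath H c; length c \<ge> 3; H (last c) (hd c)\<rbrakk> \<Longrightarrow> False"
  shows "\<exists>ps. distinct (concat ps) \<and> set (concat ps) = W \<and> [] \<notin> set ps \<and>
    (\<forall>i j. i \<le> j \<longrightarrow> j < length ps \<longrightarrow> length (ps ! j) \<le> length (ps ! i)) \<and>
    (\<forall>a b. H a b \<longleftrightarrow> (\<exists>p\<in>set ps. consec p a b \<or> consec p b a))"
  using assms
proof (induction "card W" arbitrary: W H rule: less_induct)
  case less
  note symH = sympD[OF less.prems(2)]
  have irr: "\<not> H a a" for a using less.prems(4) by (simp add: irreflp_def)
  show ?case
  proof (cases "W = {}")
    case True
    then show ?thesis using less.prems(3) by (intro exI[of _ "[]"]) auto
  next
    case False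
    define P where "P = {p. gpath H p \<and> set p \<subseteq> W}"
    obtain w where "w \<in> W" using False by blast
    then have "[w] \<in> P" by (simp add: P_def gpath_def)
    moreover have bound: "length p \<le> card W" if "p \<in> P" for p
      using that card_mono[OF less.prems(1), of "set p"] distinct_card[of p] by (auto simp: P_def gpath_def)
    ultimately have "\<exists>p. p \<in> P \<and> (\<forall>q. q \<in> P \<longrightarrow> length q \<le> length p)"
      by (intro ex_has_greatest_nat[of "\<lambda>p. p \<in> P" "[w]" length "Suc (card W)"]) (auto simp: le_imp_less_Suc)
    then obtain p where p: "p \<in> P" "\<And>q. q \<in> P \<Longrightarrow> length q \<le> length p" by blast
    have gp: "gpath H p" "set p \<subseteq> W" "p \<noteq> []" "distinct p" using p(1) by (auto simp: P_def gpath_def)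
    have step: "H (p ! i) (p ! Suc i)" if "Suc i < length p" for i using gp(1) that unfolding gpath_nth by blast
    have nth_ne: "p ! i \<noteq> p ! j" if "i < length p" "j < length p" "i \<noteq> j" for i j
      using that gp(4) by (simp add: nth_eq_iff_index_eq)
    have interior: "b = p ! (i - 1) \<or> b = p ! Suc i" if i: "0 < i" "Suc i < length p" "H (p ! i) b" for i b
    proof (rule ccontr)
      assume n: "\<not> (b = p ! (i - 1) \<or> b = p ! Suc i)"
      have "H (p ! i) (p ! (i - 1))" using step[of "i - 1"] i symH by simp
      then have "card {b, p ! (i - 1), p ! Suc i} \<le> 2" using step[OF i(2)] i(3) by (intro less.prems(5)[of _ "p ! i"]) auto
      moreover have "p ! (i - 1) \<noteq> p ! Suc i" using nth_ne[of "i - 1" "Suc i"] i by auto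
      ultimately show False using n by auto
    qed
    have closed: "consec p a b \<or> consec p b a" if ab: "a \<in> set p" "H a b" for a b
    proof -
      have bW: "b \<in> W" using less.prems(3)[OF ab(2)] by blast
      obtain j where j: "j < length p" "a = p ! j" using ab(1) by (auto simp: in_set_conv_nth)
      have inner: "consec p (p ! i) b \<or> consec p b (p ! i)" if i: "0 < i" "Suc i < length p" "H (p ! i) b" for i b
      proof -
        have "Suc (i - 1) < length p" "p ! Suc (i - 1) = p ! i" using i by auto
        note prev = this
        from interior[OF i] show ?thesis
        proof
          assume "b = p ! (i - 1)"
          then have "consec p b (p ! i)" unfolding consec_def using prev by (intro exI[of _ "i - 1"]) simp
          then show ?thesis ..
        next
          assume "b = p ! Suc i"
          then have "consec p (p ! i) b" unfolding consec_def using i(2) by (intro exI[of _ i]) simp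
          then show ?thesis ..
        qed
      qed
      show ?thesis
      proof (cases "0 < j \<and> Suc j < length p")
        case True then show ?thesis using inner[of j b] ab j by blast
      next
        case False
        then have ends: "j = 0 \<or> j = length p - 1" using j by auto
        have bp: "b \<in> set p"
        proof (rule ccontr)
          assume nb: "b \<notin> set p"
          have gb: "gpath H [b]" by (simp add: gpath_def)
          from ends have "\<exists>q. gpath H q \<and> set q = insert b (set p) \<and> length q = Suc (length p)"
          proof
            assume "j = 0"
            then have "hd p = a" using j gp(3) by (simp add: hd_conv_nth)
            then show ?thesis using gpath_append[OF gb gp(1)] nb symH[OF ab(2)] by (intro exI[of _ "[b] @ p"]) auto
          next
            assume "j = length p - 1"
            then have "last p = a" using j gp(3) by (simp add: last_conv_nth)
            then show ?thesis using gpath_append[OF gp(1) gb] nb ab(2) by (intro exI[of _ "p @ [b]"]) auto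
          qed
          then obtain q where q: "gpath H q" "set q = insert b (set p)" "length q = Suc (length p)" by blast
          then have "q \<in> P" using gp(2) bW by (simp add: P_def)
          then show False using p(2)[of q] q(3) by simp
        qed
        then obtain i where i: "i < length p" "b = p ! i" by (auto simp: in_set_conv_nth)
        have ij: "i \<noteq> j" using ab(2) irr i j by metis
        show ?thesis
        proof (cases "0 < i \<and> Suc i < length p")
          case True
          then have "consec p b a \<or> consec p a b" using inner[of i a] symH[OF ab(2)] i by blast
          then show ?thesis by blast
        next
          case False
          then have e2: "i = 0 \<or> i = length p - 1" using i by auto
          show ?thesis
          proof (cases "length p \<ge> 3")
            case True
            have "H (last p) (hd p)"
              using ends e2 ij ab(2) symH i j gp(3) by (auto simp: hd_conv_nth last_conv_nth)
            then show ?thesis using less.prems(6)[OF gp(1) True] by blast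
          next
            case False
            then have "(i = 0 \<and> j = Suc 0) \<or> (j = 0 \<and> i = Suc 0)" "length p = 2" using i j ij by linarith+
            then show ?thesis unfolding consec_def using i j by auto
          qed
        qed
      qed
    qed
    let ?W = "W - set p"
    define H' where "H' a b \<longleftrightarrow> H a b \<and> a \<in> ?W \<and> b \<in> ?W" for a b
    have H'H: "H' a b \<Longrightarrow> H a b" for a b by (simp add: H'_def)
    have "?W \<subset> W" using gp(2,3) by (cases p) auto
    then have "card ?W < card W" using less.prems(1) by (intro psubset_card_mono)
    then have "\<exists>ps. distinct (concat ps) \<and> set (concat ps) = ?W \<and> [] \<notin> set ps \<and>
      (\<forall>i j. i \<le> j \<longrightarrow> j < length ps \<longrightarrow> length (ps ! j) \<le> length (ps ! i)) \<and>
      (\<forall>a b. H' a b \<longleftrightarrow> (\<exists>p\<in>set ps. consec p a b \<or> consec p b a))"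
    proof (rule less.hyps)
      show "symp H'" using symH by (auto intro!: sympI simp: H'_def)
      show "irreflp H'" using irr by (auto intro!: irreflpI simp: H'_def)
      show "card B \<le> 2" if "\<And>b. b \<in> B \<Longrightarrow> H' a b" "finite B" for a B using less.prems(5)[of B a] that H'H by blast
      show False if "gpath H' c" "length c \<ge> 3" "H' (last c) (hd c)" for c
        using less.prems(6)[of c] that H'H unfolding gpath_nth by blast
    qed (use less.prems(1) in \<open>auto simp: H'_def\<close>)
    then obtain ps where ps0: "distinct (concat ps)" "set (concat ps) = ?W" "[] \<notin> set ps"
      "\<forall>i j. i \<le> j \<longrightarrow> j < length ps \<longrightarrow> length (ps ! j) \<le> length (ps ! i)"
      "\<forall>a b. H' a b \<longleftrightarrow> (\<exists>p\<in>set ps. consec p a b \<or> consec p b a)"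
      by (elim exE conjE) (rule that)
    note ps = ps0(1-3) ps0(4)[rule_format] ps0(5)[rule_format]
    have len: "length q \<le> length p" if q: "q \<in> set ps" for q
    proof -
      have "q \<noteq> []" "distinct q" "set q \<subseteq> W" using ps(1-3) q by (auto simp: distinct_concat_iff)
      moreover have "H (q ! i) (q ! Suc i)" if "Suc i < length q" for i
      proof -
        have "consec q (q ! i) (q ! Suc i)" using that by (auto simp: consec_def)
        then show ?thesis using ps(5) q H'H by blast
      qed
      ultimately have "q \<in> P" unfolding P_def gpath_nth by blast
      then show ?thesis by (rule p(2))
    qed
    have "H a b \<longleftrightarrow> (\<exists>q\<in>set (p # ps). consec q a b \<or> consec q b a)" for a b
    proof
      assume H: "H a b"
      show "\<exists>q\<in>set (p # ps). consec q a b \<or> consec q b a"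
      proof (cases "a \<in> set p \<or> b \<in> set p")
        case True then show ?thesis using closed[of a b] closed[of b a] H symH[OF H] by auto
      next
        case False
        then have "H' a b" using H less.prems(3)[OF H] by (simp add: H'_def)
        then show ?thesis using ps(5) by auto
      qed
    next
      assume "\<exists>q\<in>set (p # ps). consec q a b \<or> consec q b a"
      then consider "consec p a b" | "consec p b a" | "H' a b" using ps(5) by auto
      then show "H a b" using step symH H'H by cases (auto simp: consec_def)
    qed
    moreover have "length ((p # ps) ! j) \<le> length ((p # ps) ! i)" if "i \<le> j" "j < length (p # ps)" for i j
      using that ps(4)[of "i - 1" "j - 1"] len[of "ps ! (j - 1)"] by (cases i; cases j) auto
    ultimately show ?thesis
      using ps(1-3) gp(2-4) by (intro exI[of _ "p # ps"]) auto
  qed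
qed

lemma card_legs_le:
  assumes "\<And>i. i < t \<Longrightarrow> length (p i) = k"
  shows "card (insert c (\<Union>i<t. set (p i))) \<le> t * k + 1"
proof -
  have "card (\<Union>i<t. set (p i)) \<le> (\<Sum>i<t. card (set (p i)))" by (rule card_UN_le) simp
  also have "\<dots> \<le> (\<Sum>i<t. k)"
  proof (rule sum_mono)
    fix i assume "i \<in> {..<t}"
    then show "card (set (p i)) \<le> k" using card_length[of "p i"] assms[of i] by simp
  qed
  finally have "card (\<Union>i<t. set (p i)) \<le> t * k" by simp
  then show ?thesis using card_insert_le_m1[of "t * k + 1" "\<Union>i<t. set (p i)" c] by simp
qed

text \<open>A tree edge \<open>u v\<close> is subdivided by an unused common neighbour, and the leg is cut at its free end.\<close>

lemma has_spider_reroute: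
  assumes sp: "has_spider (\<lambda>x y. E x y \<or> (x = u \<and> y = v) \<or> (x = v \<and> y = u)) t l" and sym: "symp E"
    and fresh: "\<And>X. finite X \<Longrightarrow> card X \<le> t * (l - 1) + 1 \<Longrightarrow> \<exists>z. z \<notin> X \<and> E u z \<and> E v z"
  shows "has_spider E t l"
proof -
  let ?E = "\<lambda>x y. E x y \<or> (x = u \<and> y = v) \<or> (x = v \<and> y = u)"
  obtain c p where p0: "\<forall>i<t. length (p i) = l - 1 \<and> gpath ?E (c # p i)"
    "\<forall>i<t. \<forall>j<t. i \<noteq> j \<longrightarrow> set (p i) \<inter> set (p j) = {}"
    using sp unfolding has_spider_def by (elim exE conjE) (rule that)
  have p: "length (p i) = l - 1" "gpath ?E (c # p i)" if "i < t" for i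
    using p0(1) that by simp_all
  have p3: "set (p i) \<inter> set (p j) = {}" if "i < t" "j < t" "i \<noteq> j" for i j
    using p0(2) that by simp
  have good: "gpath E q" if "gpath ?E q" "\<not> (u \<in> set q \<and> v \<in> set q)" for q
    using that unfolding gpath_nth by (metis Suc_lessD nth_mem)
  show ?thesis
  proof (cases "\<forall>i<t. gpath E (c # p i)")
    case True
    then show ?thesis using p(1) p3 by (intro has_spiderI[of t p l E c]) auto
  next
    case False
    then obtain i where i: "i < t" "\<not> gpath E (c # p i)" by blast
    have bad: "u \<in> set (c # p i)" "v \<in> set (c # p i)" using good[OF p(2)[OF i(1)]] i(2) by blast+
    obtain j where j: "Suc j < length (c # p i)" "\<not> E ((c # p i) ! j) ((c # p i) ! Suc j)"
      using i(2) p(2)[OF i(1)] unfolding gpath_nth by blast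
    define a b where "a = (c # p i) ! j" and "b = (c # p i) ! Suc j"
    have "?E a b" using p(2)[OF i(1)] j(1) unfolding gpath_nth a_def b_def by blast
    then have ab: "(a = u \<and> b = v) \<or> (a = v \<and> b = u)" using j(2) by (auto simp: a_def b_def)
    define xs ys where "xs = take j (c # p i)" and "ys = drop (Suc (Suc j)) (c # p i)"
    have dec: "c # p i = xs @ a # b # ys"
      unfolding xs_def ys_def a_def b_def Cons_nth_drop_Suc[OF j(1)]
      by (rule id_take_nth_drop) (use j(1) in simp)
    have d: "distinct (xs @ a # b # ys)" using p(2)[OF i(1)] unfolding dec by (simp add: gpath_def)
    have "gpath ?E (xs @ [a])" "gpath ?E (b # ys)"
      using gpath_split[of ?E xs a "b # ys"] gpath_split[of ?E "xs @ [a]" b ys] p(2)[OF i(1)] unfolding dec by auto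
    then have gp: "gpath E (xs @ [a])" "gpath E (b # ys)" using good ab d by auto
    let ?X = "insert c (\<Union>i<t. set (p i))"
    have "card ?X \<le> t * (l - 1) + 1" using p(1) by (rule card_legs_le)
    then obtain z where z: "z \<notin> ?X" "E u z" "E v z" using fresh[of ?X] by auto
    have zn: "z \<notin> set (xs @ a # b # ys)" using z(1) i(1) unfolding dec[symmetric] by auto
    have "gpath E ((xs @ [a]) @ [z] @ (b # ys))"
    proof (rule gpath_append[OF gp(1) gpath_append[OF _ gp(2)]])
      show "gpath E [z]" by (simp add: gpath_def)
      show "E (last [z]) (hd (b # ys))" using z ab sympD[OF sym] by auto
      show "E (last (xs @ [a])) (hd ([z] @ b # ys))" using z ab by auto
    qed (use zn d in auto)
    moreover have hdc: "hd (xs @ [a]) = c" using dec by (cases xs) auto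
    moreover define w where "w = tl (xs @ [a, z] @ b # ys)"
    ultimately have w: "gpath E (c # w)" by (cases xs) auto
    have lw: "length w = Suc (length (p i))" using arg_cong[OF dec, of length] by (simp add: w_def)
    have sw: "set w \<subseteq> insert z (set (p i))"
    proof -
      have "set (c # w) \<subseteq> insert z (set (c # p i))" unfolding dec using hdc by (cases xs) (auto simp: w_def)
      then show ?thesis using w by (auto simp: gpath_def)
    qed
    let ?w = "take (l - 1) w"
    have "gpath E (take (Suc (l - 1)) (c # w))" by (intro gpath_take w) simp
    then have gw: "gpath E (c # ?w)" by simp
    define p' where "p' = p(i := ?w)"
    show ?thesis
    proof (rule has_spiderI[of t p' l E c])
      fix k assume k: "k < t"
      show "length (p' k) = l - 1 \<and> gpath E (c # p' k)"
      proof (cases "k = i")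
        case True then show ?thesis using gw lw p(1)[OF i(1)] by (simp add: p'_def)
      next
        case False
        \<comment> \<open>Leg \<open>i\<close> together with the centre contains both
          \<open>u\<close> and \<open>v\<close>; at most one of them is the centre, so no other leg
          can contain both.\<close>
        have "\<not> (u \<in> set (c # p k) \<and> v \<in> set (c # p k))"
        proof
          assume uv: "u \<in> set (c # p k) \<and> v \<in> set (c # p k)"
          have "u \<noteq> v" using ab d by auto
          then have "u \<in> set (p k) \<inter> set (p i) \<or> v \<in> set (p k) \<inter> set (p i)"
            using uv bad p(2)[OF i(1)] p(2)[OF k] by (auto simp: gpath_def)
          then show False using p3[OF k i(1) False] by blast
        qed
        then show ?thesis using good[OF p(2)[OF k]] p(1)[OF k] False by (simp add: p'_def)
      qed
    next
      fix k m assume km: "k < t" "m < t" "k \<noteq> m"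
      have zk: "z \<notin> set (p k)" if "k < t" for k using z(1) that by auto
      have "set ?w \<subseteq> insert z (set (p i))" using sw set_take_subset[of "l - 1" w] by blast
      then show "set (p' k) \<inter> set (p' m) = {}"
        using p3[OF km] p3[of i m] p3[of k i] i(1) km zk[OF km(1)] zk[OF km(2)] unfolding p'_def by auto
    qed
  qed
qed

context eigen_graph
begin

lemma has_spider_E':
  assumes sp: "has_spider (E' v) t l" and v: "v \<in> V" "v \<noteq> u" and t: "t \<ge> 1"
    and big: "2 * (t * (l - 1) + 1) < card (A v)"
  shows "has_spider E t l"
proof (rule has_spider_reroute)
  let ?n = "t * (l - 1) + 1"
  define m where "m = ?n"
  have big': "2 * m < card (A v)" using big by (simp only: m_def)
  show "symp E" by (rule sym)
  show "\<exists>z. z \<notin> X \<and> E u z \<and> E v z" if "finite X" "card X \<le> ?n" for X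
  proof -
    have "\<not> A v \<subseteq> X" 
    proof
      assume "A v \<subseteq> X"
      then have "card (A v) \<le> card X" by (rule card_mono[OF that(1)])
      moreover have "card X \<le> m" using that(2) by (simp only: m_def)
      ultimately show False using big' by linarith
    qed
    then show ?thesis by (auto simp: A_def nbr_def)
  qed
  show "has_spider (\<lambda>x y. E x y \<or> (x = u \<and> y = v) \<or> (x = v \<and> y = u)) t l"
  proof (rule has_spider_map[OF sp])
    fix c p assume p: "\<And>i. i < t \<Longrightarrow> length (p i) = l - 1 \<and> gpath (E' v) (c # p i)"
    let ?X = "insert c (\<Union>i<t. set (p i))"
    have finX: "finite ?X" by simp
    have cX: "card ?X \<le> ?n" using p by (intro card_legs_le) simp
    have "card (?X \<inter> R v) \<le> card (A v - ?X)"
    proof -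
      have "card (?X \<inter> R v) \<le> card ?X" using finX by (intro card_mono) auto
      moreover have "card (A v) - card ?X \<le> card (A v - ?X)" using finX by (rule diff_card_le_card_Diff)
      moreover have "card ?X \<le> m" using cX by (simp only: m_def)
      ultimately show ?thesis using big' by linarith
    qed
    then obtain h where h: "inj_on h (?X \<inter> R v)" "h ` (?X \<inter> R v) \<subseteq> A v - ?X"
      using card_le_inj[of "?X \<inter> R v" "A v - ?X"] finX finite_R by auto
    define g where "g x = (if x \<in> ?X \<inter> R v then h x else x)" for x
    have disj: "A v \<inter> R v = {}" "u \<notin> A v" "v \<notin> A v" "u \<notin> R v" "v \<notin> R v"
      using irrE by (auto simp: R_def A_def nbr_def)
    have Aadj: "E u b" "E v b" "E b u" "E b v" if "b \<in> A v" for b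
      using that symE' by (auto simp: A_def nbr_def)
    have gA: "g x \<in> A v" if "x \<in> ?X" "x \<in> A v \<union> R v" for x using that h(2) disj(1) by (auto simp: g_def)
    have gid: "g x = x" if "x \<notin> R v" for x using that by (simp add: g_def)
    have "inj_on g ?X"
    proof (rule inj_onI)
      fix x y assume xy: "x \<in> ?X" "y \<in> ?X" "g x = g y"
      show "x = y"
      proof (cases "x \<in> R v"; cases "y \<in> R v")
        assume "x \<in> R v" "y \<in> R v"
        then show ?thesis using xy inj_onD[OF h(1), of x y] by (simp add: g_def)
      next
        assume *: "x \<in> R v" "y \<notin> R v"
        then have "h x \<in> A v - ?X" using h(2) xy(1) by blast
        then show ?thesis using xy * by (auto simp: g_def)
      next
        assume *: "x \<notin> R v" "y \<in> R v"
        then have "h y \<in> A v - ?X" using h(2) xy(2) by blast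
        then show ?thesis using xy * by (auto simp: g_def)
      next
        assume "x \<notin> R v" "y \<notin> R v" then show ?thesis using xy(3) gid by simp
      qed
    qed
    moreover have "E (g x) (g y) \<or> (g x = u \<and> g y = v) \<or> (g x = v \<and> g y = u)"
      if xy: "x \<in> ?X" "y \<in> ?X" "E' v x y" for x y
    proof -
      have V: "x \<in> {u, v} \<union> A v \<union> R v" "y \<in> {u, v} \<union> A v \<union> R v" using xy(3) by (auto simp: E'_def R_def)
      consider "x \<in> {u, v}" "y \<in> {u, v}" | "x \<in> {u, v}" "y \<in> A v \<union> R v" | "y \<in> {u, v}" "x \<in> A v \<union> R v"
        | "x \<in> A v" "y \<in> A v" "E x y"
        using xy(3) V unfolding E'_def by blast
      then show ?thesis
      proof cases
        case 1
        then show ?thesis using xy(3) gid disj by (auto simp: E'_def)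
      next
        case 2
        then show ?thesis using gA[OF xy(2)] Aadj[of "g y"] gid[of x] disj by auto
      next
        case 3
        then show ?thesis using gA[OF xy(1)] Aadj[of "g x"] gid[of y] disj by auto
      next
        case 4
        then have "x \<notin> R v" "y \<notin> R v" using disj(1) by blast+
        then show ?thesis using 4 gid by simp
      qed
    qed
    ultimately show "\<exists>g. inj_on g ?X \<and> (\<forall>x\<in>?X. \<forall>y\<in>?X. E' v x y \<longrightarrow> E (g x) (g y) \<or> (g x = u \<and> g y = v) \<or> (g x = v \<and> g y = u))"
      by blast
  qed
qed

end

section \<open>The extremal graphs\<close>

context fan_graph
begin

lemma has_spider_JP:
  assumes "has_spider (adj (JP (map length ps))) t l" "t \<ge> 1" "l \<ge> 2"
  shows "has_spider E t l"
proof (rule has_spider_map[OF assms(1)])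
  let ?H = "JP (map length ps)"
  fix c p assume p: "\<And>i. i < t \<Longrightarrow> length (p i) = l - 1 \<and> gpath (adj ?H) (c # p i)"
  have inV: "set (c # p i) \<subseteq> verts ?H" if i: "i < t" for i
  proof
    fix x assume "x \<in> set (c # p i)"
    then obtain j where j: "j < length (c # p i)" "x = (c # p i) ! j" by (metis in_set_conv_nth)
    have st: "adj ?H ((c # p i) ! m) ((c # p i) ! Suc m)" if "Suc m < length (c # p i)" for m
      using p[OF i] that unfolding gpath_nth by blast
    show "x \<in> verts ?H"
    proof (cases "Suc j < length (c # p i)")
      case True then show ?thesis using adj_in_verts(1)[OF simple_JP st[OF True]] j by simp
    next
      case False
      then obtain m where "j = Suc m" using j p[OF i] assms(3) by (cases j) auto
      then show ?thesis using adj_in_verts(2)[OF simple_JP st[of m]] j by simp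
    qed
  qed
  then have sub: "insert c (\<Union>i<t. set (p i)) \<subseteq> verts ?H" using assms(2) inV[of 0] by auto
  have "inj_on (fan_map u v ps) (insert c (\<Union>i<t. set (p i)))"
    using fan_map_bij sub by (meson bij_betw_imp_inj_on inj_on_subset)
  moreover have "E (fan_map u v ps x) (fan_map u v ps y)"
    if "x \<in> insert c (\<Union>i<t. set (p i))" "y \<in> insert c (\<Union>i<t. set (p i))" "adj ?H x y" for x y
    using fan_map_adj[of x y] that sub by blast
  ultimately show "\<exists>g. inj_on g (insert c (\<Union>i<t. set (p i))) \<and>
      (\<forall>x\<in>insert c (\<Union>i<t. set (p i)). \<forall>y\<in>insert c (\<Union>i<t. set (p i)). adj ?H x y \<longrightarrow> E (g x) (g y))"
    by blast
qed

end

lemma JP_class: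
  assumes "sum_list ms = n - 2" "n \<ge> 2" "l \<ge> 2" "\<not> has_spider (adj (JP ms)) t l"
  shows "planar_F_free_class n (starlike t l) (JP ms)"
  using assms contains_starlike_has_spider[of "JP ms" t l] simple_JP[of ms] planar_JP[of ms] card_JP[of ms]
  by (auto simp: planar_F_free_class_def F_free_def)

lemma JP_no_long_path:
  assumes "\<And>I. \<lbrakk>I \<subseteq> {..<length ms}; card I \<le> 3\<rbrakk> \<Longrightarrow> (\<Sum>i\<in>I. ms ! i) \<le> L"
  shows "\<not> (\<exists>s. gpath (adj (JP ms)) s \<and> length s = L + 3)"
proof
  assume "\<exists>s. gpath (adj (JP ms)) s \<and> length s = L + 3"
  then obtain s where s: "gpath (adj (JP ms)) s" "length s = L + 3" by blast
  interpret fan_graph "adj (JP ms)" "Inl 0" "Inl 1" "slot_lists ms" by unfold_locales (rule fan_JP)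
  obtain I where I: "I \<subseteq> {..<length ms}" "card I \<le> 3" "length s \<le> 2 + (\<Sum>i\<in>I. length (slot_lists ms ! i))"
    using gpath_length_le[OF s(1)] s(2) by (auto simp: length_slot_lists)
  have "(\<Sum>i\<in>I. length (slot_lists ms ! i)) = (\<Sum>i\<in>I. ms ! i)"
    using I(1) by (intro sum.cong refl) (auto simp: length_slot_lists)
  then show False using assms[OF I(1,2)] I(3) s(2) by simp
qed

lemma JP_no_spider:
  assumes "t \<ge> 5" "l \<ge> 3" "tot (\<lambda>a. a div (l - 1)) ms \<le> t - 2"
  shows "\<not> has_spider (adj (JP ms)) t l"
proof
  assume sp: "has_spider (adj (JP ms)) t l"
  interpret fan_graph "adj (JP ms)" "Inl 0" "Inl 1" "slot_lists ms" by unfold_locales (rule fan_JP)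
  have "t - 1 \<le> (\<Sum>i<length ms. length (slot_lists ms ! i) div (l - 1))"
    using spider_div_bound[OF sp assms(2,1)] by (simp add: length_slot_lists)
  then show False using assms by (simp add: length_slot_lists)
qed

lemma extremal_is_fan:
  fixes G :: "'a ugraph"
  assumes G: "planar_F_free_class n (starlike t l) G" and max: "spectral_radius G = spex_planar n (starlike t l)"
    and tl: "t \<ge> 1" "l \<ge> 2" and nb: "real n \<ge> 44 * 10 ^ 15" "6 * (t * (l - 1) + 1) < n"
    and single: "\<not> has_spider (adj (JP (replicate (n - 2) 1))) t l"
  obtains u v ps where "fan (adj G) u v ps" "verts G = set (u # v # concat ps)" "[] \<notin> set ps"
    "\<And>i j. \<lbrakk>i \<le> j; j < length ps\<rbrakk> \<Longrightarrow> length (ps ! j) \<le> length (ps ! i)"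
    "spectral_radius G > sqrt (2 * real (n - 2))"
proof -
  let ?V = "verts G" and ?E = "adj G" and ?r = "spectral_radius G"
  have Gp: "simple_graph G" "card ?V = n" "planar G" "F_free G (starlike t l)"
    using G by (auto simp: planar_F_free_class_def)
  have fin: "finite ?V" using Gp(1) by (simp add: simple_graph_def)
  have n0: "n \<ge> 5"
  proof -
    have "5 \<le> real n" using nb(1) by simp
    then show ?thesis by linarith
  qed
  have ne: "?V \<noteq> {}" using Gp(2) n0 by auto
  have nosp: "\<not> has_spider ?E t l"
    using has_spider_contains_starlike[OF _ Gp(1) tl(2,1)] Gp(4) by (auto simp: F_free_def)
  \<comment> \<open>Comparison with isolated inner vertices gives the lower bound on the spectral
    radius from which everything starts.\<close>
  have "planar_F_free_class n (starlike t l) (JP (replicate (n - 2) 1))"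
    using n0 tl single by (intro JP_class) (auto simp: sum_list_replicate)
  then have "spectral_radius (JP (replicate (n - 2) 1)) \<le> ?r"
    using spectral_radius_le_spex[of n "starlike t l"] n0 max by simp
  then have rgt: "?r > sqrt (2 * real (n - 2))"
    using spectral_radius_JP_singletons[of "n - 2"] n0 by linarith
  have rpos: "?r > 0" using rgt real_sqrt_ge_zero[of "2 * real (n - 2)"] by linarith
  have "(sqrt (2 * real (n - 2)))\<^sup>2 \<le> ?r\<^sup>2" using rgt by (intro power_mono) auto
  then have r2: "?r\<^sup>2 \<ge> 2 * real n - 4" using n0 by (simp add: of_nat_diff)
  obtain x0 where x0: "\<And>a. x0 a \<ge> 0" "\<exists>a\<in>?V. x0 a > 0" "\<And>a. a \<in> ?V \<Longrightarrow> mv G x0 a = ?r * x0 a"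
    using perron_vector[OF fin ne] by blast
  define M where "M = Max (x0 ` ?V)"
  have M: "M \<in> x0 ` ?V" "\<And>a. a \<in> ?V \<Longrightarrow> x0 a \<le> M" using fin ne by (auto simp: M_def)
  then obtain u where u: "u \<in> ?V" "x0 u = M" by auto
  have Mpos: "M > 0" using x0(2) M(2) by (meson less_le_trans)
  define x where "x a = x0 a / M" for a
  have sumN: "(\<Sum>b\<in>?V. of_bool (?E a b) * f b) = (\<Sum>b\<in>nbr ?E ?V a. f b)" for f :: "'a \<Rightarrow> real" and a
    unfolding nbr_def using fin by (subst sum.inter_filter) (auto intro!: sum.cong simp: of_bool_def)
  have mvE: "mv G f a = (\<Sum>b\<in>?V. of_bool (?E a b) * f b)" for f a
    by (simp add: mv_def adj_matrix_def adj_def of_bool_def)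
  have eig: "(\<Sum>b\<in>nbr ?E ?V a. x b) = ?r * x a" if "a \<in> ?V" for a
    using x0(3)[OF that] unfolding mvE sumN by (simp add: x_def sum_divide_distrib[symmetric])
  interpret eigen_graph ?V ?E x ?r "real n" u
  proof
    show "finite ?V" "real n = card ?V" "u \<in> ?V" "x u = 1" "?r > 0" "2 * real n - 4 \<le> ?r\<^sup>2" "44 * 10 ^ 15 \<le> real n"
      using fin Gp(2) u Mpos rpos r2 nb(1) by (auto simp: x_def)
    show "symp ?E" by (auto intro: sympI adj_sym)
    show "irreflp ?E" using adj_in_verts(3)[OF Gp(1)] by (auto intro: irreflpI)
    show "\<not> bip_minor 3 ?V ?E" by (rule planar_no_K33_minor[OF Gp(1,3)])
    show "0 \<le> x a" "x a \<le> 1" if "a \<in> ?V" for a using x0(1)[of a] M(2)[OF that] Mpos by (auto simp: x_def)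
    show "(\<Sum>b\<in>nbr ?E ?V a. x b) = ?r * x a" if "a \<in> ?V" for a by (rule eig[OF that])
  qed
  obtain v where v: "v \<in> ?V" "v \<noteq> u" "x v \<ge> 95 / 100" "card (R v) \<le> real n / 20"
    using second_vertex by blast
  have VAR: "?V = {u, v} \<union> A v \<union> R v" using v u N_sub by (auto simp: R_def A_def)
  have disj: "u \<notin> A v" "v \<notin> A v" "A v \<inter> R v = {}" "u \<notin> R v" "v \<notin> R v"
    using irrE by (auto simp: R_def A_def nbr_def)
  have Aadj: "?E u b" "?E v b" "?E b u" "?E b v" if "b \<in> A v" for b
    using that symE' by (auto simp: A_def nbr_def)
  have cA: "2 * (t * (l - 1) + 1) < card (A v)"
  proof -
    define m where "m = t * (l - 1) + 1"
    have "card ?V \<le> card ({u, v} \<union> A v) + card (R v)" by (subst VAR) (rule card_Un_le)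
    also have "card ({u, v} \<union> A v) \<le> card {u, v} + card (A v)" by (rule card_Un_le)
    also have "card {u, v} \<le> 2" using v(2) by simp
    finally have "real n \<le> 2 + real (card (A v)) + real (card (R v))" using Gp(2) by simp
    then have "95 / 100 * real n \<le> 2 + real (card (A v))" using v(4) by simp
    moreover have "6 * real m < real n" using nb(2) unfolding m_def[symmetric] by simp
    moreover have "1 \<le> m" by (simp add: m_def)
    ultimately have "2 * real m < real (card (A v))" using nb(1) by simp
    then show ?thesis unfolding m_def[symmetric] by linarith
  qed
  \<comment> \<open>Only edges inside \<open>A v\<close> are kept, exactly those that
    \<open>E' v\<close> retains off \<open>u\<close> and \<open>v\<close>; vertices of
    \<open>R v\<close> become paths of length one in the decomposition.\<close>
  define H where "H a b \<longleftrightarrow> ?E a b \<and> a \<in> A v \<and> b \<in> A v" for a b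
  have "\<exists>ps. distinct (concat ps) \<and> set (concat ps) = A v \<union> R v \<and> [] \<notin> set ps \<and>
    (\<forall>i j. i \<le> j \<longrightarrow> j < length ps \<longrightarrow> length (ps ! j) \<le> length (ps ! i)) \<and>
    (\<forall>a b. H a b \<longleftrightarrow> (\<exists>p\<in>set ps. consec p a b \<or> consec p b a))"
  proof (rule linear_forest)
    show "finite (A v \<union> R v)" using finite_R by simp
    show "symp H" using symE' by (auto intro!: sympI simp: H_def)
    show "irreflp H" using irrE by (auto intro!: irreflpI simp: H_def)
    show "a \<in> A v \<union> R v \<and> b \<in> A v \<union> R v" if "H a b" for a b using that by (simp add: H_def)
    show "card B \<le> 2" if B: "\<And>b. b \<in> B \<Longrightarrow> H a b" "finite B" for a B
    proof (cases "B = {}")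
      case False
      then have a: "a \<in> A v" using B(1) by (auto simp: H_def)
      then have "a \<in> ?V" "a \<noteq> u" "a \<noteq> v" using finite_R(4)[of v] disj by auto
      then have "card (N u \<inter> N v \<inter> N a) \<le> 2" using common_nbrs_le_2[of u v a] u v by auto
      moreover have "B \<subseteq> N u \<inter> N v \<inter> N a"
        using B(1) finite_R(4)[of v] by (fastforce simp: H_def A_def nbr_def)
      ultimately show ?thesis using card_mono[of "N u \<inter> N v \<inter> N a" B] finN by auto
    qed simp
    show False if c: "gpath H c" "length c \<ge> 3" "H (last c) (hd c)" for c
    proof -
      have HE: "gpath ?E c" using c(1) unfolding gpath_nth by (auto simp: H_def)
      have cA': "set c \<subseteq> A v"
      proof
        fix y assume "y \<in> set c"
        then obtain j where j: "j < length c" "y = c ! j" by (metis in_set_conv_nth)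
        show "y \<in> A v"
        proof (cases "Suc j < length c")
          case True then show ?thesis using c(1) j unfolding gpath_nth by (auto simp: H_def)
        next
          case False
          then have "y = last c" using j by (cases c rule: rev_cases) (auto simp: nth_append)
          then show ?thesis using c(3) by (simp add: H_def)
        qed
      qed
      \<comment> \<open>A longer cycle could be cut into \<open>t\<close> legs around
        \<open>u\<close>. So some vertex of \<open>A v\<close> is off the cycle, and the wheel
        obstruction applies.\<close>
      have "length c < t * (l - 1)"
      proof (rule ccontr)
        assume "\<not> ?thesis"
        then have "t \<le> length c div (l - 1)" using tl(2) by (simp add: less_eq_div_iff_mult_less_eq)
        then have "has_spider ?E t (Suc (l - 1))"
          using HE tl(2) cA' Aadj disj by (intro has_spider_chunks[of "l - 1" "[c]" "[]" ?E u t]) (auto simp: gpath_def)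
        then show False using nosp tl(2) by simp
      qed
      moreover have "card (set c) \<le> length c" by (rule card_length)
      moreover define m where "m = t * (l - 1)"
      ultimately have "card (set c) < card (A v)" using cA[folded m_def] by simp
      then have "\<not> A v \<subseteq> set c" using card_mono[of "set c" "A v"] by auto
      then obtain z where z: "z \<in> A v" "z \<notin> set c" by blast
      have "?E (last c) (hd c)" using c(3) by (simp add: H_def)
      then show False
        using planar_no_wheel_pair[OF Gp(1,3) v(2)[symmetric] HE c(2) _ z(2)] Aadj cA' z(1) by blast
    qed
  qed
  then obtain ps where ps0: "distinct (concat ps)" "set (concat ps) = A v \<union> R v" "[] \<notin> set ps"
    "\<forall>i j. i \<le> j \<longrightarrow> j < length ps \<longrightarrow> length (ps ! j) \<le> length (ps ! i)"
    "\<forall>a b. H a b \<longleftrightarrow> (\<exists>p\<in>set ps. consec p a b \<or> consec p b a)"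
    by (elim exE conjE) (rule that)
  have Vps: "?V = set (u # v # concat ps)" using VAR ps0(2) by simp
  have fanE': "fan (E' v) u v ps"
    unfolding fan_def
  proof (intro conjI allI)
    show "distinct (u # v # concat ps)" using ps0(1,2) disj v(2) by auto
    fix a b
    have "(\<exists>p\<in>set ps. consec p a b \<or> consec p b a) \<longleftrightarrow> ?E a b \<and> a \<in> A v \<and> b \<in> A v"
      using ps0(5) H_def by metis
    then show "E' v a b \<longleftrightarrow> a \<in> set (u # v # concat ps) \<and> b \<in> set (u # v # concat ps) \<and> a \<noteq> b \<and>
      (a \<in> {u, v} \<or> b \<in> {u, v} \<or> (\<exists>p\<in>set ps. consec p a b \<or> consec p b a))"
      unfolding E'_def Vps[symmetric] by blast
  qed
  interpret F: fan_graph "E' v" u v ps by unfold_locales (rule fanE')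
  let ?J = "JP (map length ps)" and ?y = "x \<circ> fan_map u v ps"
  have "\<not> has_spider (adj ?J) t l"
    using F.has_spider_JP[OF _ tl] has_spider_E'[OF _ v(1,2) tl(1) cA] nosp by blast
  moreover have "sum_list (map length ps) = n - 2"
  proof -
    have "sum_list (map length ps) + 2 = card (verts ?J)" by (simp add: card_JP)
    also have "\<dots> = n" using bij_betw_same_card[OF F.fan_map_bij] Vps Gp(2) by simp
    finally show ?thesis by simp
  qed
  ultimately have "planar_F_free_class n (starlike t l) ?J" using n0 tl by (intro JP_class) auto
  then have rJ: "spectral_radius ?J \<le> ?r" using spectral_radius_le_spex n0 max by (metis gr0I not_numeral_le_zero)
  have Jfin: "finite (verts ?J)" "verts ?J \<noteq> {}" using simple_JP[of "map length ps"] by (auto simp: simple_graph_def verts_JP)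
  note fq = F.fan_quadratic_form[OF Vps, where x = x]
  have Q: "(\<Sum>a\<in>?V. \<Sum>b\<in>?V. of_bool (?E a b) * x a * x b) = ?r * (\<Sum>a\<in>?V. x a * x a)"
  proof -
    have "(\<Sum>a\<in>?V. \<Sum>b\<in>?V. of_bool (?E a b) * x a * x b) = (\<Sum>a\<in>?V. x a * (\<Sum>b\<in>?V. of_bool (?E a b) * x b))"
      by (simp add: sum_distrib_left mult_ac)
    also have "\<dots> = (\<Sum>a\<in>?V. x a * (?r * x a))" using eig sumN by simp
    finally show ?thesis by (simp add: sum_distrib_left mult_ac)
  qed
  have xx: "0 \<le> (\<Sum>a\<in>?V. x a * x a)" by (rule sum_nonneg) simp
  have gain: "?r * (\<Sum>a\<in>?V. x a * x a) + (\<Sum>r\<in>R v. x r) / 2 + (if ?E u v then 0 else 9 / 10) \<le> ip ?J ?y (mv ?J ?y)"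
    using join_gain[OF v] unfolding Q fq(2) .
  have "ip ?J ?y (mv ?J ?y) \<le> spectral_radius ?J * ip ?J ?y ?y" by (rule spectral_radius_rayleigh(1)[OF Jfin])
  also have "\<dots> \<le> ?r * (\<Sum>a\<in>?V. x a * x a)" unfolding fq(1) using rJ xx by (rule mult_right_mono)
  finally have up: "ip ?J ?y (mv ?J ?y) \<le> ?r * (\<Sum>a\<in>?V. x a * x a)" .
  have Rn: "0 \<le> (\<Sum>r\<in>R v. x r)" using x0 finite_R(2)[of v] by (intro sum_nonneg) (auto simp: x_def Mpos less_imp_le)
  have uv: "?E u v"
  proof (rule ccontr)
    assume "\<not> ?E u v" then show False using gain up Rn by simp
  qed
  have R0: "(\<Sum>r\<in>R v. x r) = 0" using gain up Rn uv by simp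
  \<comment> \<open>No gain is left, so the entries on \<open>R v\<close> are 0 and
    \<open>x\<close>, transported to the modified graph, attains the maximum of the Rayleigh
    quotient there. As an eigenvector it violates the equation at a vertex of \<open>R v\<close>,
    which is adjacent to \<open>u\<close> of entry 1.\<close>
  have Rempty: "R v = {}"
  proof (rule ccontr)
    assume "R v \<noteq> {}"
    then obtain r where r: "r \<in> R v" by blast
    then have rV: "r \<in> ?V" using finite_R(2) by blast
    have "x a \<ge> 0" if "a \<in> R v" for a using x0 finite_R(2) that by blast
    then have "\<forall>a\<in>R v. x a = 0"
      using R0 sum_nonneg_eq_0_iff[of "R v" x, OF finite_R(1)] by blast
    then have xr: "x r = 0" using r by blast
    obtain z where z: "z \<in> verts ?J" "fan_map u v ps z = r"
      using F.fan_map_bij rV Vps by (metis bij_betw_imp_surj_on imageE)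
    have "ip ?J ?y (mv ?J ?y) \<ge> spectral_radius ?J * ip ?J ?y ?y"
    proof -
      have "spectral_radius ?J * ip ?J ?y ?y \<le> ?r * (\<Sum>a\<in>?V. x a * x a)" unfolding fq(1) using rJ xx by (rule mult_right_mono)
      also have "\<dots> \<le> ip ?J ?y (mv ?J ?y)" using gain R0 uv by simp
      finally show ?thesis .
    qed
    then have "mv ?J ?y z = spectral_radius ?J * ?y z" using spectral_radius_eigen[OF Jfin _ z(1)] by blast
    then have 0: "(\<Sum>b\<in>?V. of_bool (E' v r b) * x b) = 0" using fq(3)[OF z(1)] z(2) xr by simp
    have "of_bool (E' v r u) * x u \<le> (\<Sum>b\<in>?V. of_bool (E' v r b) * x b)"
      using fin u(1) x0(1) Mpos by (intro member_le_sum) (auto simp: x_def less_imp_le)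
    moreover have "E' v r u" using r rV u(1) disj by (auto simp: E'_def)
    ultimately show False using 0 u(2) Mpos by (simp add: x_def)
  qed
  have "E' v a b \<longleftrightarrow> ?E a b" for a b
  proof
    assume e: "E' v a b"
    then have ab: "a \<in> {u, v} \<union> A v" "b \<in> {u, v} \<union> A v" "a \<noteq> b" using VAR Rempty by (auto simp: E'_def)
    then show "?E a b" using e Aadj uv symE'[OF uv] unfolding E'_def by auto
  next
    assume e: "?E a b"
    then have "a \<in> ?V" "b \<in> ?V" "a \<noteq> b" using adj_in_verts[OF Gp(1)] by blast+
    then show "E' v a b" using e VAR Rempty by (auto simp: E'_def)
  qed
  then have "E' v = ?E" by (intro ext) blast
  then have "fan ?E u v ps" using fanE' by simp
  then show ?thesis using that[of u v ps] Vps ps0(3,4) rgt by blast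
qed

text \<open>A valid list of larger total weight would give a join in the class whose spectral radius
  exceeds \<open>spex_planar\<close>.\<close>

lemma extremal_lengths:
  fixes G :: "'a ugraph"
  assumes G: "planar_F_free_class n (starlike t l) G" and max: "spectral_radius G = spex_planar n (starlike t l)"
    and tl: "t \<ge> 1" "l \<ge> 2" and n: "real n \<ge> 44 * 10 ^ 15" "6 * (t * (l - 1) + 1) < n"
    and single: "\<not> has_spider (adj (JP (replicate (n - 2) 1))) t l"
  obtains u v ps where "fan_graph (adj G) u v ps" "[] \<notin> set ps" "graph_iso G (JP (map length ps))"
    "optimal_lengths (spectral_radius G) (map length ps) (n - 2) (\<lambda>ms. \<not> has_spider (adj (JP ms)) t l)"
    "\<not> has_spider (adj G) t l"
proof -
  obtain u v ps where ps: "fan (adj G) u v ps" "verts G = set (u # v # concat ps)" "[] \<notin> set ps"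
    "\<And>i j. \<lbrakk>i \<le> j; j < length ps\<rbrakk> \<Longrightarrow> length (ps ! j) \<le> length (ps ! i)"
    "spectral_radius G > sqrt (2 * real (n - 2))"
    using extremal_is_fan[OF assms] by metis
  interpret fan_graph "adj G" u v ps by unfold_locales (rule ps(1))
  let ?ls = "map length ps"
  have iso: "graph_iso G (JP ?ls)" by (rule fan_iso[OF refl ps(2)])
  have n0: "n \<ge> 5"
  proof -
    have "5 \<le> real n" using n(1) by simp
    then show ?thesis by linarith
  qed
  have cV: "card (verts G) = n" "simple_graph G" "F_free G (starlike t l)" using G by (auto simp: planar_F_free_class_def)
  have sum: "sum_list ?ls = n - 2"
  proof -
    have "sum_list ?ls + 2 = card (verts (JP ?ls))" by (simp add: card_JP)
    also have "\<dots> = n" using bij_betw_same_card[OF fan_map_bij] ps(2) cV by simp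
    finally show ?thesis by simp
  qed
  have r: "spectral_radius (JP ?ls) = spectral_radius G" using spectral_radius_iso[OF iso] by simp
  have "optimal_lengths (spectral_radius G) ?ls (n - 2) (\<lambda>ms. \<not> has_spider (adj (JP ms)) t l)"
  proof
    show "sqrt (2 * real (n - 2)) \<le> spectral_radius G" using ps(5) by simp
    show "4 * 10 ^ 16 \<le> real (n - 2)" using n(1) n0 by (simp add: of_nat_diff)
    show "1 \<le> ?ls ! i" if "i < length ?ls" for i
    proof -
      have "i < length ps" using that by simp
      then have "ps ! i \<in> set ps" by simp
      then have "ps ! i \<noteq> []" using ps(3) by metis
      then show ?thesis using that by (simp add: Suc_le_eq)
    qed
    show "?ls ! j \<le> ?ls ! i" if "i \<le> j" "j < length ?ls" for i j using ps(4)[OF that(1)] that by simp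
    show "sum_list ?ls = n - 2" by (rule sum)
    show "tot (weight (spectral_radius G)) ms \<le> tot (weight (spectral_radius G)) ?ls"
      if ms: "\<not> has_spider (adj (JP ms)) t l" "sum_list ms = n - 2" for ms
    proof (rule ccontr)
      assume "\<not> ?thesis"
      moreover have "spectral_radius G > 2"
      proof -
        have "sqrt (2\<^sup>2) \<le> sqrt (2 * real (n - 2))" using n0 by (intro real_sqrt_le_mono) (simp add: of_nat_diff)
        then show ?thesis using ps(5) by simp
      qed
      ultimately have "spectral_radius (JP ms) > spectral_radius G"
        using spectral_radius_JP_less[OF r] by (simp add: not_le)
      moreover have "planar_F_free_class n (starlike t l) (JP ms)" using ms n0 tl by (intro JP_class) auto
      then have "spectral_radius (JP ms) \<le> spex_planar n (starlike t l)"
        using n0 by (intro spectral_radius_le_spex) auto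
      ultimately show False using max by simp
    qed
  qed
  moreover have "\<not> has_spider (adj G) t l"
    using has_spider_contains_starlike[OF _ cV(2) tl(2,1)] cV(3) by (auto simp: F_free_def)
  ultimately show ?thesis using that[of u v ps] fan_graph_axioms ps(3) iso by blast
qed

text \<open>Common treatment of \<open>t = 1\<close> and \<open>t = 2\<close>, where the tree is a
  path on \<open>L + 3\<close> vertices: one more than two dominating vertices and three parts of
  total length \<open>L\<close> can carry. \<open>paths\<close> is required separately for the
  vertex types of \<open>G\<close> and of \<open>JP\<close>.\<close>

lemma path_case:
  fixes G :: "'a ugraph" and L :: nat
  defines "k \<equiv> L div 3"
  assumes tl: "t \<ge> 1" "l \<ge> 2" and L: "L \<ge> 3" and size: "t * (l - 1) \<le> 2 * L + 2"
    and paths: "\<And>E :: 'a \<Rightarrow> 'a \<Rightarrow> bool. symp E \<Longrightarrow> has_spider E t l \<longleftrightarrow> (\<exists>s. gpath E s \<and> length s = L + 3)"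
      "\<And>E :: nat + nat \<times> nat \<Rightarrow> nat + nat \<times> nat \<Rightarrow> bool. symp E \<Longrightarrow> has_spider E t l \<longleftrightarrow> (\<exists>s. gpath E s \<and> length s = L + 3)"
    and n: "real n \<ge> 44 * 10 ^ 15" "real n \<ge> 10.2 * 2 ^ L + 2" "real n \<ge> 625 / 32 * (real k)\<^sup>2 + 2"
  shows "planar_F_free_class n (starlike t l) (JP (H_P_lengths n (L - 2 * k) k))"
    and "planar_F_free_class n (starlike t l) G \<Longrightarrow> spectral_radius G = spex_planar n (starlike t l) \<Longrightarrow>
      graph_iso G (JP (H_P_lengths n (L - 2 * k) k))"
proof -
  have n5: "n \<ge> 5"
  proof -
    have "5 \<le> real n" using n(1) by simp
    then show ?thesis by linarith
  qed
  have k: "1 \<le> k" "3 * k \<le> L" using L by (auto simp: k_def)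
  have valid: "\<not> has_spider (adj (JP ms)) t l"
    if "\<And>I. \<lbrakk>I \<subseteq> {..<length ms}; card I \<le> 3\<rbrakk> \<Longrightarrow> (\<Sum>i\<in>I. ms ! i) \<le> L" for ms
  proof -
    have "symp (adj (JP ms))" by (auto intro: sympI adj_sym)
    then show ?thesis using paths(2)[of "adj (JP ms)"] JP_no_long_path[OF that] by blast
  qed
  have Ln: "10 * (L + 1) \<le> n"
  proof -
    have "L + 1 \<le> 2 ^ L" using less_exp[of L] by linarith
    then have "real (L + 1) \<le> 2 ^ L" by (metis of_nat_le_iff of_nat_numeral of_nat_power)
    moreover define P :: real where "P = 2 ^ L"
    ultimately have "real L + 1 \<le> P" "10.2 * P + 2 \<le> real n" using n(2) by simp_all
    then have "10 * (real L + 1) \<le> real n" by (simp add: field_simps)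
    then have "real (10 * (L + 1)) \<le> real n" by simp
    then show ?thesis by (simp only: of_nat_le_iff)
  qed
  have size': "6 * (t * (l - 1) + 1) < n"
  proof -
    define m where "m = t * (l - 1)"
    have L3: "10 * (L + 1) \<le> n" "m \<le> 2 * L + 2" using Ln size by (simp_all add: m_def)
    have "20 * (L + 1) < n"
    proof -
      have "2 * (L + 1) \<le> 2 ^ L"
        using L by (induction L rule: dec_induct) auto
      then have "2 * real (L + 1) \<le> 2 ^ L" by (metis of_nat_le_iff of_nat_mult of_nat_numeral of_nat_power)
      moreover define P :: real where "P = 2 ^ L"
      ultimately have "2 * (real L + 1) \<le> P" "10.2 * P + 2 \<le> real n" using n(2) by simp_all
      then have "20 * (real L + 1) < real n" by (simp add: field_simps)
      then have "real (20 * (L + 1)) < real n" by simp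
      then show ?thesis by (simp only: of_nat_less_iff)
    qed
    then show ?thesis unfolding m_def[symmetric] using L3 L by simp
  qed
  have bounded: "(\<Sum>i\<in>I. ms ! i) \<le> L"
    if ms: "\<And>i. 1 \<le> i \<Longrightarrow> i < length ms \<Longrightarrow> ms ! i \<le> k" "ms \<noteq> []" "ms ! 0 \<le> L - 2 * k"
      and I: "I \<subseteq> {..<length ms}" "card I \<le> 3" for ms I
  proof -
    have finI: "finite I" using I(1) finite_subset by blast
    show ?thesis
    proof (cases "0 \<in> I")
      case True
      have "(\<Sum>i\<in>I. ms ! i) = ms ! 0 + (\<Sum>i\<in>I - {0}. ms ! i)" using finI True by (rule sum.remove)
      also have "(\<Sum>i\<in>I - {0}. ms ! i) \<le> (\<Sum>i\<in>I - {0}. k)" using ms(1) I(1) by (intro sum_mono) (auto simp: Suc_le_eq)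
      also have "(\<Sum>i\<in>I - {0}. k) = card (I - {0}) * k" by simp
      also have "\<dots> \<le> 2 * k" using I(2) True finI by (intro mult_right_mono) (simp_all add: card_Diff_singleton)
      finally show ?thesis using ms(3) k by linarith
    next
      case False
      have "(\<Sum>i\<in>I. ms ! i) \<le> (\<Sum>i\<in>I. k)"
      proof (rule sum_mono)
        fix i assume "i \<in> I"
        then have "1 \<le> i" "i < length ms" using False I(1) by (auto simp: Suc_le_eq intro: gr0I)
        then show "ms ! i \<le> k" by (rule ms(1))
      qed
      also have "\<dots> \<le> 3 * k" using I(2) by simp
      finally show ?thesis using k by linarith
    qed
  qed
  let ?H = "H_P_lengths n (L - 2 * k) k"
  have n1: "L - 2 * k \<le> n - 2" using Ln by simp
  note H = H_P_lengths_props[OF k(1) n1]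
  show "planar_F_free_class n (starlike t l) (JP ?H)"
    by (rule JP_class[OF H(1) _ tl(2) valid]) (use n5 bounded[OF H(4,3)] H(2) in auto)
  assume G: "planar_F_free_class n (starlike t l) G" "spectral_radius G = spex_planar n (starlike t l)"
  have single: "\<not> has_spider (adj (JP (replicate (n - 2) 1))) t l"
  proof (rule valid)
    fix I assume I: "I \<subseteq> {..<length (replicate (n - 2) (1::nat))}" "card I \<le> 3"
    have "(\<Sum>i\<in>I. replicate (n - 2) (1::nat) ! i) = card I" using I(1) by (simp add: subset_iff)
    then show "(\<Sum>i\<in>I. replicate (n - 2) 1 ! i) \<le> L" using I(2) L by simp
  qed
  obtain u v ps where fg: "fan_graph (adj G) u v ps" and ps: "[] \<notin> set ps" "graph_iso G (JP (map length ps))"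
    and opt: "optimal_lengths (spectral_radius G) (map length ps) (n - 2) (\<lambda>ms. \<not> has_spider (adj (JP ms)) t l)"
    and nosp: "\<not> has_spider (adj G) t l"
    using extremal_lengths[OF G tl n(1) size' single] by metis
  interpret fan_graph "adj G" u v ps by (rule fg)
  interpret optimal_lengths "spectral_radius G" "map length ps" "n - 2" "\<lambda>ms. \<not> has_spider (adj (JP ms)) t l" by (rule opt)
  have short: "length s \<le> L + 2" if "gpath (adj G) s" for s
  proof (rule ccontr)
    assume "\<not> length s \<le> L + 2"
    then have "gpath (adj G) (take (L + 3) s) \<and> length (take (L + 3) s) = L + 3" using gpath_take[OF that] by simp
    then show False using paths(1)[OF symE] nosp by blast
  qed
  have nonempty: "ps ! i \<noteq> []" if "i < length ps" for i using ps(1) nth_mem[OF that] by metis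
  have "map length ps = H_P_lengths (n - 2 + 2) (L - 2 * k) k"
    unfolding k_def
  proof (rule three_largest)
    show "10.2 * 2 ^ L \<le> real (n - 2)" using n(2) n5 by (simp add: of_nat_diff)
    show "625 / 32 * (real (L div 3))\<^sup>2 \<le> real (n - 2)" using n(3) n5 by (simp add: of_nat_diff k_def)
    show "map length ps ! i \<le> L + 1" if "i < length (map length ps)" for i
      using short[OF pole_gpath[of i]] that by simp
    show "map length ps ! a + map length ps ! b + map length ps ! c \<le> L"
      if "a < length (map length ps)" "b < length (map length ps)" "c < length (map length ps)" "a \<noteq> b" "b \<noteq> c" "a \<noteq> c" for a b c
      using short[OF three_parts_gpath[of a b c]] that nonempty by simp
  qed (use L valid in auto)
  moreover have "n - 2 + 2 = n" using n5 by simp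
  ultimately show "graph_iso G (JP ?H)" using ps(2) by (simp only:)
qed

text \<open>With \<open>p = l - 1\<close> the first length is \<open>p * (t - 2) + (p - 1)\<close>:
  room for \<open>t - 2\<close> legs and a remainder one vertex short of another leg, which is also
  the length of the other paths.\<close>

lemma spider_case:
  fixes G :: "'a ugraph"
  assumes t: "t \<ge> 5" and l: "l \<ge> 3"
    and n: "real n \<ge> 44 * 10 ^ 15" "real n \<ge> 10.2 * 2 ^ (t * (l - 1) - 2) + 2"
  shows "planar_F_free_class n (starlike t l) (JP (H_P_lengths n (t * l - t - l) (l - 2)))"
    and "planar_F_free_class n (starlike t l) G \<Longrightarrow> spectral_radius G = spex_planar n (starlike t l) \<Longrightarrow>
      graph_iso G (JP (H_P_lengths n (t * l - t - l) (l - 2)))"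
proof -
  define p where "p = l - 1"
  have p: "2 \<le> p" "l = Suc p" "l - 2 = p - 1" using l by (auto simp: p_def)
  have tl: "t \<ge> 1" "l \<ge> 2" using t l by auto
  have n5: "n \<ge> 5"
  proof -
    have "5 \<le> real n" using n(1) by simp
    then show ?thesis by linarith
  qed
  have n1eq: "t * l - t - l = (t - 1) * p - 1"
    unfolding p(2) by (simp add: diff_mult_distrib)
  obtain c where c: "t = Suc (Suc c)" using t le_Suc_ex[of 2 t] by auto
  have n1: "(t - 1) * p - 1 = p * (t - 2) + (p - 1)" "((t - 1) * p - 1) div p = t - 2"
  proof -
    show 1: "(t - 1) * p - 1 = p * (t - 2) + (p - 1)" using p(1) by (simp add: c algebra_simps)
    show "((t - 1) * p - 1) div p = t - 2"
      unfolding 1 using p(1) by (intro div_nat_eqI) (simp_all add: c algebra_simps)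
  qed
  have size: "6 * (t * p + 1) < n"
  proof -
    define T where "T = t * p"
    have "5 * 2 \<le> t * p" using p t by (intro mult_mono) auto
    then have T: "10 \<le> T" by (simp add: T_def)
    define m where "m = T - 4"
    have m: "T = m + 4" "6 \<le> m" using T by (simp_all add: m_def)
    have "real m \<le> 2 ^ m" by (rule of_nat_less_two_power[THEN less_imp_le])
    moreover have "(2::real) ^ (T - 2) = 4 * 2 ^ m" using m by (simp add: power_add)
    moreover have "real n \<ge> 10.2 * 2 ^ (T - 2) + 2" using n(2) by (simp add: T_def p_def)
    ultimately have "real n \<ge> 40 * real m" by linarith
    then have "real (6 * (T + 1)) < real n" using m by simp
    then show ?thesis unfolding T_def[symmetric] by (simp only: of_nat_less_iff)
  qed
  have size': "6 * (t * (l - 1) + 1) < n" using size by (simp add: p_def)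
  have valid: "\<not> has_spider (adj (JP ms)) t l" if "tot (\<lambda>a. a div p) ms \<le> t - 2" for ms
    using JP_no_spider[OF t l] that by (simp add: p_def)
  let ?H = "H_P_lengths n ((t - 1) * p - 1) (p - 1)"
  have k1: "1 \<le> p - 1" using p(1) by simp
  have n1le: "(t - 1) * p - 1 \<le> n - 2"
  proof -
    define a b where "a = (t - 1) * p" and "b = t * p"
    have "a \<le> b" unfolding a_def b_def by (intro mult_right_mono) auto
    then show ?thesis using size unfolding a_def[symmetric] b_def[symmetric] by simp
  qed
  note H = H_P_lengths_props[OF k1 n1le]
  have "tot (\<lambda>a. a div p) ?H \<le> t - 2"
  proof -
    have "tot (\<lambda>a. a div p) ?H = ?H ! 0 div p + (\<Sum>i\<in>{..<length ?H} - {0}. ?H ! i div p)"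
      using H(3) by (intro sum.remove) auto
    also have "(\<Sum>i\<in>{..<length ?H} - {0}. ?H ! i div p) = 0"
    proof (rule sum.neutral, rule ballI)
      fix i assume "i \<in> {..<length ?H} - {0}"
      then have "?H ! i \<le> p - 1" using H(4)[of i] by (auto simp: Suc_le_eq)
      then show "?H ! i div p = 0" using p(1) by simp
    qed
    finally show ?thesis using H(2) n1(2) by simp
  qed
  then have "planar_F_free_class n (starlike t l) (JP ?H)"
    using n5 by (intro JP_class H(1) tl(2) valid) auto
  then show "planar_F_free_class n (starlike t l) (JP (H_P_lengths n (t * l - t - l) (l - 2)))"
    by (simp only: n1eq p(3))
  assume G: "planar_F_free_class n (starlike t l) G" "spectral_radius G = spex_planar n (starlike t l)"
  have single: "\<not> has_spider (adj (JP (replicate (n - 2) 1))) t l"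
    by (rule valid) (use p(1) in simp)
  obtain u v ps where fg: "fan_graph (adj G) u v ps" and ps: "[] \<notin> set ps" "graph_iso G (JP (map length ps))"
    and opt: "optimal_lengths (spectral_radius G) (map length ps) (n - 2) (\<lambda>ms. \<not> has_spider (adj (JP ms)) t l)"
    and nosp: "\<not> has_spider (adj G) t l"
    using extremal_lengths[OF G tl n(1) size' single] by metis
  interpret fan_graph "adj G" u v ps by (rule fg)
  interpret optimal_lengths "spectral_radius G" "map length ps" "n - 2" "\<lambda>ms. \<not> has_spider (adj (JP ms)) t l" by (rule opt)
  have nonempty: "ps ! i \<noteq> []" if "i < length ps" for i using ps(1) nth_mem[OF that] by metis
  have totps: "tot (\<lambda>a. a div p) (map length ps) = (\<Sum>i<length ps. length (ps ! i) div p)" by simp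
  have "map length ps = H_P_lengths (n - 2 + 2) ((t - 1) * p - 1) (p - 1)"
  proof (rule div_parts)
    show "10.2 * 2 ^ (t * p - 2) \<le> real (n - 2)" using n(2) n5 by (simp add: of_nat_diff p_def)
    show "tot (\<lambda>a. a div p) (map length ps) \<le> t - 1"
    proof (rule ccontr)
      assume "\<not> ?thesis"
      then have "t \<le> (\<Sum>i<length ps. length (ps ! i) div p)" unfolding totps by linarith
      then have "has_spider (adj G) t (Suc p)" using p(1) by (intro has_spider_of_parts) auto
      then show False using nosp p(2) by simp
    qed
    show "map length ps ! i + map length ps ! j < p - 1"
      if D: "tot (\<lambda>a. a div p) (map length ps) = t - 1" and ij: "i < length (map length ps)" "j < length (map length ps)" "i \<noteq> j"
        "map length ps ! i < p" "map length ps ! j < p" for i j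
    proof (rule ccontr)
      assume "\<not> ?thesis"
      then have "has_spider (adj G) t (Suc p)"
        using has_spider_of_parts_and_pair[of p t i j] D[unfolded totps] ij p(1) t nonempty by simp
      then show False using nosp p(2) by simp
    qed
  qed (use p t valid in auto)
  moreover have "n - 2 + 2 = n" using n5 by simp
  ultimately show "graph_iso G (JP (H_P_lengths n (t * l - t - l) (l - 2)))"
    using ps(2) by (simp only: n1eq p(3))
qed

theorem theorem3:
  fixes t l n :: nat
  defines "n0 \<equiv> max (2.67 * 9 ^ 17) (10.2 * 2 ^ ((t - 1) * (l - 1) + l - 3) + 2 :: real)"
  shows
   "(t = 1 \<and> l \<ge> 6 \<and> real n \<ge> n0 \<and>
       real n \<ge> 625 / 32 * (real ((l - 3) div 3))\<^sup>2 + 2 \<longrightarrow>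
      (let X = join K2 (H_P n (l - 3 - 2 * ((l - 3) div 3)) ((l - 3) div 3)) in
        planar_F_free_class n (starlike t l) X \<and>
        (\<forall>G :: 'a ugraph. planar_F_free_class n (starlike t l) G \<and>
            spectral_radius G = spex_planar n (starlike t l) \<longrightarrow> graph_iso G X)))
  \<and> (t = 2 \<and> l \<ge> 4 \<and> real n \<ge> n0 \<and>
       real n \<ge> 625 / 32 * (real ((2 * l - 4) div 3))\<^sup>2 + 2 \<longrightarrow>
      (let X = join K2 (H_P n (2 * l - 4 - 2 * ((2 * l - 4) div 3)) ((2 * l - 4) div 3)) in
        planar_F_free_class n (starlike t l) X \<and>
        (\<forall>G :: 'a ugraph. planar_F_free_class n (starlike t l) G \<and>
            spectral_radius G = spex_planar n (starlike t l) \<longrightarrow> graph_iso G X)))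
  \<and> (t \<ge> 5 \<and> l \<ge> 3 \<and> real n \<ge> n0 \<and>
       real n \<ge> 625 / 32 * (real ((l - 3) div 2))\<^sup>2 + 2 \<longrightarrow>
      (let X = join K2 (H_P n (t * l - t - l) (l - 2)) in
        planar_F_free_class n (starlike t l) X \<and>
        (\<forall>G :: 'a ugraph. planar_F_free_class n (starlike t l) G \<and>
            spectral_radius G = spex_planar n (starlike t l) \<longrightarrow> graph_iso G X)))"
proof (intro conjI impI)
  \<comment> \<open>2.67 * 9^17 is about 4.45 * 10^16. The exponent in \<open>n0\<close> equals
    \<open>L\<close> in the two path cases and \<open>t * (l - 1) - 2\<close> in the third.\<close>
  have "44 * 10 ^ 15 \<le> (2.67 * 9 ^ 17 :: real)" by simp
  then have n0: "n0 \<ge> 44 * 10 ^ 15" "n0 \<ge> 10.2 * 2 ^ ((t - 1) * (l - 1) + l - 3) + 2"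
    unfolding n0_def by linarith+
  have JP: "join K2 (H_P n a b) = JP (H_P_lengths n a b)" for a b by (simp add: JP_def H_P_def)
  {
    assume *: "t = 1 \<and> l \<ge> 6 \<and> real n \<ge> n0 \<and> real n \<ge> 625 / 32 * (real ((l - 3) div 3))\<^sup>2 + 2"
    define L where "L = l - 3"
    have L: "L \<ge> 3" "l = L + 3" "l \<ge> 2" using * unfolding L_def by linarith+
    have e: "(t - 1) * (l - 1) + l - 3 = L" using * by (simp add: L_def)
    have tl: "t \<ge> 1" "t * (l - 1) \<le> 2 * L + 2" unfolding L(2) using * by simp_all
    have big: "real n \<ge> 44 * 10 ^ 15" "real n \<ge> 10.2 * 2 ^ L + 2" "real n \<ge> 625 / 32 * (real (L div 3))\<^sup>2 + 2"
      using * n0[unfolded e] unfolding L_def[symmetric] by linarith+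
    have t1: "t = 1" using * by blast
    have paths: "has_spider E t l \<longleftrightarrow> (\<exists>s. gpath E s \<and> length s = L + 3)" for E :: "'a \<Rightarrow> 'a \<Rightarrow> bool"
      unfolding t1 L(2)[symmetric] by (rule has_spider_1[OF L(3)])
    have paths': "has_spider E t l \<longleftrightarrow> (\<exists>s. gpath E s \<and> length s = L + 3)"
      for E :: "nat + nat \<times> nat \<Rightarrow> nat + nat \<times> nat \<Rightarrow> bool"
      unfolding t1 L(2)[symmetric] by (rule has_spider_1[OF L(3)])
    note extremal = path_case[OF tl(1) L(3) L(1) tl(2) paths paths' big]
    show "let X = join K2 (H_P n (l - 3 - 2 * ((l - 3) div 3)) ((l - 3) div 3)) in
        planar_F_free_class n (starlike t l) X \<and>
        (\<forall>G :: 'a ugraph. planar_F_free_class n (starlike t l) G \<and>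
            spectral_radius G = spex_planar n (starlike t l) \<longrightarrow> graph_iso G X)"
      unfolding Let_def JP L_def[symmetric] by (intro conjI allI impI; (elim conjE)?; rule extremal)
  next
    assume *: "t = 2 \<and> l \<ge> 4 \<and> real n \<ge> n0 \<and> real n \<ge> 625 / 32 * (real ((2 * l - 4) div 3))\<^sup>2 + 2"
    define L where "L = 2 * l - 4"
    have L: "L \<ge> 3" "2 * l - 1 = L + 3" "l \<ge> 2" using * unfolding L_def by linarith+
    have e: "(t - 1) * (l - 1) + l - 3 = L" using * by (simp add: L_def)
    have t2: "t = 2" using * by blast
    have tl: "t \<ge> 1" "t * (l - 1) \<le> 2 * L + 2" unfolding t2 using L by simp_all
    have big: "real n \<ge> 44 * 10 ^ 15" "real n \<ge> 10.2 * 2 ^ L + 2" "real n \<ge> 625 / 32 * (real (L div 3))\<^sup>2 + 2"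
      using * n0[unfolded e] unfolding L_def[symmetric] by linarith+
    have paths: "has_spider E t l \<longleftrightarrow> (\<exists>s. gpath E s \<and> length s = L + 3)" if "symp E" for E :: "'a \<Rightarrow> 'a \<Rightarrow> bool"
      unfolding t2 L(2)[symmetric] by (rule has_spider_2[OF L(3) that])
    have paths': "has_spider E t l \<longleftrightarrow> (\<exists>s. gpath E s \<and> length s = L + 3)"
      if "symp E" for E :: "nat + nat \<times> nat \<Rightarrow> nat + nat \<times> nat \<Rightarrow> bool"
      unfolding t2 L(2)[symmetric] by (rule has_spider_2[OF L(3) that])
    note extremal = path_case[OF tl(1) L(3) L(1) tl(2) paths paths' big]
    show "let X = join K2 (H_P n (2 * l - 4 - 2 * ((2 * l - 4) div 3)) ((2 * l - 4) div 3)) in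
        planar_F_free_class n (starlike t l) X \<and>
        (\<forall>G :: 'a ugraph. planar_F_free_class n (starlike t l) G \<and>
            spectral_radius G = spex_planar n (starlike t l) \<longrightarrow> graph_iso G X)"
      unfolding Let_def JP L_def[symmetric] by (intro conjI allI impI; (elim conjE)?; rule extremal)
  next
    assume *: "t \<ge> 5 \<and> l \<ge> 3 \<and> real n \<ge> n0 \<and> real n \<ge> 625 / 32 * (real ((l - 3) div 2))\<^sup>2 + 2"
    have tl: "t \<ge> 5" "l \<ge> 3" using * by simp_all
    have e: "(t - 1) * (l - 1) + l - 3 = t * (l - 1) - 2"
    proof -
      obtain a where a: "t = Suc a" using tl(1) by (cases t) auto
      obtain b where b: "l = b + 3" using tl(2) by (metis add.commute le_Suc_ex)
      show ?thesis unfolding a b by simp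
    qed
    have big: "real n \<ge> 44 * 10 ^ 15" "real n \<ge> 10.2 * 2 ^ (t * (l - 1) - 2) + 2"
      using * n0[unfolded e] by linarith+
    note extremal = spider_case[OF tl big]
    show "let X = join K2 (H_P n (t * l - t - l) (l - 2)) in
        planar_F_free_class n (starlike t l) X \<and>
        (\<forall>G :: 'a ugraph. planar_F_free_class n (starlike t l) G \<and>
            spectral_radius G = spex_planar n (starlike t l) \<longrightarrow> graph_iso G X)"
      unfolding Let_def JP by (intro conjI allI impI; (elim conjE)?; rule extremal)
  }
qed

end
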